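(* Let $\pi:A\to M$ be an affine bundle of rank $n$. (i) If $n>0$, there is a one-to-one correspondence between affine Jacobi brackets $\{\cdot,\cdot\}_{(\Lambda_A,E_A)}$ on $A$ and homogeneous Poisson brackets $\{\cdot,\cdot\}_{\bar\Lambda_{\hat A}}$ on the vector bundle $\hat A=(A^+)^*$, uniquely determined by the equation $$\{a,b\}_{(\Lambda_A,E_A)}=\big(\{\bar a,\bar b\}_{\bar\Lambda_{\hat A}}\big)_{|A}$$ for all affine functions $a,b:A\to\mathbb{R}$. The Jacobi structure $(\Lambda_A,E_A)$ on $A$ is the restriction to $A$ of the Jacobi structure $(\bar\Lambda_{\hat A}-\Delta_{\hat A}\wedge E_{\hat A},\,E_{\hat A})$ on $\hat A$, where $\Delta_{\hat A}$ is the Liouville vector field of $\hat A$ and $E_{\hat A}$ is the hamiltonian vector field of the linear function $\iota_{\tilde 1}:\hat A\to\mathbb{R}$ with respect to $\bar\Lambda_{\hat A}$. (ii) If $n=0$, there is a one-to-one correspondence between affine Jacobi brackets $\{\cdot,\cdot\}_{(\Lambda_A,E_A)}$ on $A$ and linear (homogeneous) Poisson tensors $\bar\Lambda_{\hat A-\{O\}}$ on $\hat A-\{O\}=M\times(\mathbb{R}-\{0\})$, uniquely determined by the equation $$\bar\Lambda_{\hat A-\{O\}}(d(tf),d(tg))=t\,\{f,g\}_{(\Lambda,E)}\quad\text{on } M\times(\mathbb{R}-\{0\}),$$ for all $f,g\in C^\infty(M,\mathbb{R})$, where $t$ is the usual coordinate on $\mathbb{R}$ and $(\Lambda,E)$ is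 the Jacobi structure on $M$ induced by $(\Lambda_A,E_A)$. The linear Poisson tensor is given by $$\bar\Lambda_{\hat A-\{O\}}=\frac1t\Lambda+\frac{\partial}{\partial t}\wedge E.$$
   Context: Everything is smooth. A Jacobi structure on a manifold $N$ is a pair $(\Lambda,E)$ of a bivector field and a vector field such that the Jacobi bracket $\{f,g\}_{(\Lambda,E)}=\Lambda(df,dg)+fE(g)-gE(f)$ on $C^\infty(N,\mathbb{R})$ satisfies the Jacobi identity. For a Poisson tensor $\bar\Lambda$, $\{f,g\}_{\bar\Lambda}=\bar\Lambda(df,dg)$ and the hamiltonian vector field of $f$ is $g\mapsto\bar\Lambda(df,dg)$. An affine bundle $\pi:A\to M$ is a locally trivial bundle whose fibres $A_p$ are affine spaces modelled on the fibres of a vector bundle, with affine transition maps. A function $A\to\mathbb{R}$ is affine if it is smooth and affine on every fibre. A Jacobi structure (bracket) on $A$ is affine if the Jacobi bracket of two affine functions is an affine function. $A^+=\bigcup_{p\in M}\mathrm{Aff}(A_p,\mathbb{R})\to M$ is the vector bundle of fibrewise affine functions and $\tilde 1\in\Gamma(A^+)$ is the section given by the constant function $1$. Put $\hat A=(A^+)^*$. For a section $X$ of a vector bundle $V$, $\iota_X:V^*\to\mathbb{R}$ is the fibrewise linear function $\psi\mapsto\psi(X)$. $A$ is identified (via evaluation) with the affine subbundle $\{\iota_{\tilde 1}=1\}$ of $\hat A$. Each affine function $a:A\to\mathbb{R}$ corresponds to the fibrewise linear function $\bar a:\hat A\to\mathbb{R}$, $\bar a(\psi_p)=\psi_p(a_{|A_p})$;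 one has $\bar a_{|A}=a$. The Liouville vector field $\Delta_V$ of a vector bundle $V$ is $\sum_\alpha y^\alpha\partial/\partial y^\alpha$ in fibred linear coordinates. A Poisson structure $\bar\Lambda$ on a vector bundle $V$ is homogeneous (linear) if $\mathcal{L}_{\Delta_V}\bar\Lambda=-\bar\Lambda$, equivalently if the bracket of fibrewise linear functions is fibrewise linear. If $n=0$, then $A$ is identified with $M$, $A^+=M\times\mathbb{R}$, $\hat A=M\times\mathbb{R}$ with zero section $O$, and an affine Jacobi structure on $A$ is just a Jacobi structure $(\Lambda,E)$ on $M$. A $k$-vector $\bar P$ on $M\times(\mathbb{R}-\{0\})$ is called homogeneous (or linear) if for all $f_1,\dots,f_k\in C^\infty(M,\mathbb{R})$ there is $h\in C^\infty(M,\mathbb{R})$ with $\bar P(d(tf_1),\dots,d(tf_k))=th$. *)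

theory Defs
  imports "HOL-Analysis.Analysis"
begin

section \<open>Model spaces\<close>

text \<open>Unlike \<^class>\<open>euclidean_space\<close>, this class admits the zero space (see the instance for
  \<^typ>\<open>unit\<close> below), so that bases of dimension 0 and bundles of rank 0 are covered.\<close>

class fin_dim_inner = real_inner +
  assumes finite_spanning_set:
    "\<exists>B :: 'a set. finite B \<and> (\<forall>x. \<exists>c. x = (\<Sum>b\<in>B. c b *\<^sub>R b))"

lemma fin_dim_inner_iff_span:
  "finite B \<Longrightarrow> (\<forall>x. \<exists>c. x = (\<Sum>b\<in>B. c b *\<^sub>R b)) \<longleftrightarrow> span B = (UNIV :: 'a::real_vector set)"
  by (auto simp: span_finite)

instance euclidean_space \<subseteq> fin_dim_inner
  by standard (use finite_Basis span_Basis fin_dim_inner_iff_span in blast)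

instance prod :: (fin_dim_inner, fin_dim_inner) fin_dim_inner
proof
  obtain B :: "'a set" where B: "finite B" "span B = UNIV"
    using finite_spanning_set fin_dim_inner_iff_span by metis
  obtain C :: "'b set" where C: "finite C" "span C = UNIV"
    using finite_spanning_set fin_dim_inner_iff_span by metis
  let ?i = "\<lambda>x::'a. (x, 0::'b)" and ?j = "\<lambda>y::'b. (0::'a, y)"
  have i: "linear ?i" and j: "linear ?j"
    by (auto intro!: linearI)
  have "z \<in> span (?i ` B \<union> ?j ` C)" for z :: "'a \<times> 'b"
  proof -
    have "?i (fst z) \<in> span (?i ` B)"
      using B(2) linear_span_image[OF i, of B] by auto
    moreover have "?j (snd z) \<in> span (?j ` C)"
      using C(2) linear_span_image[OF j, of C] by auto
    ultimately have "?i (fst z) + ?j (snd z) \<in> span (?i ` B \<union> ?j ` C)"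
      by (meson Un_upper1 Un_upper2 span_add span_mono subsetD)
    then show ?thesis by simp
  qed
  with B(1) C(1) have "finite (?i ` B \<union> ?j ` C) \<and> span (?i ` B \<union> ?j ` C) = UNIV"
    by auto
  then show "\<exists>D :: ('a \<times> 'b) set. finite D \<and> (\<forall>x. \<exists>c. x = (\<Sum>b\<in>D. c b *\<^sub>R b))"
    using fin_dim_inner_iff_span by metis
qed

instantiation unit :: real_inner
begin
definition "0 = ()"
definition plus_unit :: "unit \<Rightarrow> unit \<Rightarrow> unit" where "plus_unit x y = ()"
definition minus_unit :: "unit \<Rightarrow> unit \<Rightarrow> unit" where "minus_unit x y = ()"
definition uminus_unit :: "unit \<Rightarrow> unit" where "uminus_unit x = ()"
definition scaleR_unit :: "real \<Rightarrow> unit \<Rightarrow> unit" where "scaleR_unit c x = ()"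
definition inner_unit :: "unit \<Rightarrow> unit \<Rightarrow> real" where "inner_unit x y = 0"
definition norm_unit :: "unit \<Rightarrow> real" where "norm_unit x = 0"
definition sgn_unit :: "unit \<Rightarrow> unit" where "sgn_unit x = ()"
definition dist_unit :: "unit \<Rightarrow> unit \<Rightarrow> real" where "dist_unit x y = 0"
definition uniformity_unit :: "(unit \<times> unit) filter"
  where "uniformity_unit = (INF e\<in>{0<..}. principal {(x, y). dist x y < e})"
definition open_unit :: "unit set \<Rightarrow> bool"
  where "open_unit U = (\<forall>x\<in>U. eventually (\<lambda>(x', y). x' = x \<longrightarrow> y \<in> U) uniformity)"
instance
  by standard
    (simp_all add: inner_unit_def norm_unit_def dist_unit_def uniformity_unit_def open_unit_def)
end

instance unit :: fin_dim_inner
  by standard (intro exI[of _ "{}"], auto simp: zero_unit_def)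


section \<open>Smooth manifolds\<close>

text \<open>Only meant for open \<open>S\<close>; on finite-dimensional spaces
  this is the usual notion of a \<open>C\<^sup>\<infinity>\<close> map.\<close>

fun Ck_on :: "nat \<Rightarrow> ('e::real_normed_vector \<Rightarrow> 'g::real_normed_vector) \<Rightarrow> 'e set \<Rightarrow> bool" where
  "Ck_on 0 f S \<longleftrightarrow> continuous_on S f"
| "Ck_on (Suc k) f S \<longleftrightarrow> (\<forall>x\<in>S. f differentiable at x) \<and>
     (\<forall>v. Ck_on k (\<lambda>x. frechet_derivative f (at x) v) S)"

definition smooth_on :: "('e::real_normed_vector \<Rightarrow> 'g::real_normed_vector) \<Rightarrow> 'e set \<Rightarrow> bool" where
  "smooth_on f S \<longleftrightarrow> (\<forall>k. Ck_on k f S)"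

text \<open>A manifold is given by an atlas alone: its point set is the union of the chart
  domains, and its topology is the one that makes all charts homeomorphisms.\<close>

type_synonym ('n, 'e) atlas = "('n set \<times> ('n \<Rightarrow> 'e)) set"

definition point_set :: "('n, 'e) atlas \<Rightarrow> 'n set" where
  "point_set \<A> = (\<Union>(U, \<phi>)\<in>\<A>. U)"

definition smooth_atlas :: "('n, 'e::real_normed_vector) atlas \<Rightarrow> bool" where
  "smooth_atlas \<A> \<longleftrightarrow>
     (\<forall>(U, \<phi>)\<in>\<A>. inj_on \<phi> U \<and> open (\<phi> ` U)) \<and>
     (\<forall>(U, \<phi>)\<in>\<A>. \<forall>(V, \<psi>)\<in>\<A>.
        open (\<phi> ` (U \<inter> V)) \<and> smooth_on (\<psi> \<circ> inv_into U \<phi>) (\<phi> ` (U \<inter> V)))"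

definition atlas_topology :: "('n, 'e::real_normed_vector) atlas \<Rightarrow> 'n topology" where
  "atlas_topology \<A> =
     topology (\<lambda>W. W \<subseteq> point_set \<A> \<and> (\<forall>(U, \<phi>)\<in>\<A>. open (\<phi> ` (U \<inter> W))))"

definition smooth_manifold :: "('n, 'e::real_normed_vector) atlas \<Rightarrow> bool" where
  "smooth_manifold \<A> \<longleftrightarrow> smooth_atlas \<A> \<and>
     Hausdorff_space (atlas_topology \<A>) \<and> second_countable (atlas_topology \<A>)"

text \<open>Values outside the point set are unconstrained; tangent vectors ignore them,
  because a derivation at \<open>p\<close> annihilates every function vanishing on the point set.\<close>

definition Cinf :: "('n, 'e::real_normed_vector) atlas \<Rightarrow> ('n \<Rightarrow> real) set" where
  "Cinf \<A> = {f. \<forall>(U, \<phi>)\<in>\<A>. smooth_on (f \<circ> inv_into U \<phi>) (\<phi> ` U)}"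

definition smooth_map ::
  "('n, 'e::real_normed_vector) atlas \<Rightarrow> ('k, 'g::real_normed_vector) atlas \<Rightarrow> ('n \<Rightarrow> 'k) \<Rightarrow> bool" where
  "smooth_map \<A> \<B> F \<longleftrightarrow> F ` point_set \<A> \<subseteq> point_set \<B> \<and>
     (\<forall>(U, \<phi>)\<in>\<A>. \<forall>(V, \<psi>)\<in>\<B>. open (\<phi> ` (U \<inter> F -` V)) \<and>
        smooth_on (\<psi> \<circ> F \<circ> inv_into U \<phi>) (\<phi> ` (U \<inter> F -` V)))"

definition diffeomorphism ::
  "('n, 'e::real_normed_vector) atlas \<Rightarrow> ('k, 'g::real_normed_vector) atlas \<Rightarrow> ('n \<Rightarrow> 'k) \<Rightarrow> bool" where
  "diffeomorphism \<A> \<B> F \<longleftrightarrow> bij_betw F (point_set \<A>) (point_set \<B>) \<and>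
     smooth_map \<A> \<B> F \<and> smooth_map \<B> \<A> (inv_into (point_set \<A>) F)"

definition open_submanifold :: "('n, 'e) atlas \<Rightarrow> 'n set \<Rightarrow> ('n, 'e) atlas" where
  "open_submanifold \<A> W = (\<lambda>(U, \<phi>). (U \<inter> W, \<phi>)) ` \<A>"

definition prod_atlas :: "('n, 'e) atlas \<Rightarrow> ('k, 'g) atlas \<Rightarrow> ('n \<times> 'k, 'e \<times> 'g) atlas" where
  "prod_atlas \<A> \<B> = {(U \<times> V, map_prod \<phi> \<psi>) | U \<phi> V \<psi>. (U, \<phi>) \<in> \<A> \<and> (V, \<psi>) \<in> \<B>}"

definition nonzero_reals :: "(real, real) atlas" where
  "nonzero_reals = {(- {0}, id)}"


section \<open>Tensor fields\<close>

text \<open>Tangent vectors are derivations at a point. They, and vector and bivector fields,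
  are set to 0 on non-smooth functions and outside the point set, so that equality of
  fields is equality of HOL functions.\<close>

definition tangent_space :: "('n, 'e::real_normed_vector) atlas \<Rightarrow> 'n \<Rightarrow> (('n \<Rightarrow> real) \<Rightarrow> real) set" where
  "tangent_space \<A> p = {v.
     (\<forall>f\<in>Cinf \<A>. \<forall>g\<in>Cinf \<A>. v (\<lambda>q. f q + g q) = v f + v g \<and>
        v (\<lambda>q. f q * g q) = v f * g p + f p * v g) \<and>
     (\<forall>c. \<forall>f\<in>Cinf \<A>. v (\<lambda>q. c * f q) = c * v f) \<and>
     (\<forall>f. f \<notin> Cinf \<A> \<longrightarrow> v f = 0)}"

text \<open>The second exterior power of the tangent space: finite sums of decomposable
  bivectors \<open>u \<and> v\<close>, paired with \<open>(df, dg)\<close> by \<open>(u \<and> v)(df, dg) = u(f) v(g) - u(g) v(f)\<close>.\<close>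

definition bivector_space ::
  "('n, 'e::real_normed_vector) atlas \<Rightarrow> 'n \<Rightarrow> (('n \<Rightarrow> real) \<Rightarrow> ('n \<Rightarrow> real) \<Rightarrow> real) set" where
  "bivector_space \<A> p = {(\<lambda>f g. \<Sum>i<k. u i f * v i g - u i g * v i f) | (k::nat) u v.
     \<forall>i<k. u i \<in> tangent_space \<A> p \<and> v i \<in> tangent_space \<A> p}"

type_synonym 'n vfield = "'n \<Rightarrow> ('n \<Rightarrow> real) \<Rightarrow> real"
type_synonym 'n bifield = "'n \<Rightarrow> ('n \<Rightarrow> real) \<Rightarrow> ('n \<Rightarrow> real) \<Rightarrow> real"

definition vector_field :: "('n, 'e::real_normed_vector) atlas \<Rightarrow> 'n vfield \<Rightarrow> bool" where
  "vector_field \<A> X \<longleftrightarrow>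
     (\<forall>p\<in>point_set \<A>. X p \<in> tangent_space \<A> p) \<and> (\<forall>p. p \<notin> point_set \<A> \<longrightarrow> X p = (\<lambda>_. 0)) \<and>
     (\<forall>f\<in>Cinf \<A>. (\<lambda>p. X p f) \<in> Cinf \<A>)"

text \<open>For a bivector field \<open>P\<close>, \<open>P p f g\<close> is the value of \<open>P(df, dg)\<close> at \<open>p\<close>.\<close>

definition bivector_field :: "('n, 'e::real_normed_vector) atlas \<Rightarrow> 'n bifield \<Rightarrow> bool" where
  "bivector_field \<A> P \<longleftrightarrow>
     (\<forall>p\<in>point_set \<A>. P p \<in> bivector_space \<A> p) \<and> (\<forall>p. p \<notin> point_set \<A> \<longrightarrow> P p = (\<lambda>_ _. 0)) \<and>
     (\<forall>f\<in>Cinf \<A>. \<forall>g\<in>Cinf \<A>. (\<lambda>p. P p f g) \<in> Cinf \<A>)"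

definition wedge :: "'n vfield \<Rightarrow> 'n vfield \<Rightarrow> 'n bifield" where
  "wedge X Y = (\<lambda>p f g. X p f * Y p g - X p g * Y p f)"

definition lie_derivative :: "'n vfield \<Rightarrow> 'n bifield \<Rightarrow> 'n bifield" where
  "lie_derivative X P = (\<lambda>p f g.
     X p (\<lambda>q. P q f g) - P p (\<lambda>q. X q f) g - P p f (\<lambda>q. X q g))"

definition hamiltonian :: "'n bifield \<Rightarrow> ('n \<Rightarrow> real) \<Rightarrow> 'n vfield" where
  "hamiltonian P f = (\<lambda>p g. P p f g)"

definition jacobi_bracket :: "'n bifield \<Rightarrow> 'n vfield \<Rightarrow> ('n \<Rightarrow> real) \<Rightarrow> ('n \<Rightarrow> real) \<Rightarrow> 'n \<Rightarrow> real" where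
  "jacobi_bracket \<Lambda> E f g = (\<lambda>p. \<Lambda> p f g + f p * E p g - g p * E p f)"

definition poisson_bracket :: "'n bifield \<Rightarrow> ('n \<Rightarrow> real) \<Rightarrow> ('n \<Rightarrow> real) \<Rightarrow> 'n \<Rightarrow> real" where
  "poisson_bracket P f g = (\<lambda>p. P p f g)"

definition jacobi_identity ::
  "('n, 'e::real_normed_vector) atlas \<Rightarrow> (('n \<Rightarrow> real) \<Rightarrow> ('n \<Rightarrow> real) \<Rightarrow> 'n \<Rightarrow> real) \<Rightarrow> bool" where
  "jacobi_identity \<A> br \<longleftrightarrow> (\<forall>f\<in>Cinf \<A>. \<forall>g\<in>Cinf \<A>. \<forall>h\<in>Cinf \<A>. \<forall>p\<in>point_set \<A>.
     br f (br g h) p + br g (br h f) p + br h (br f g) p = 0)"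

definition jacobi_structure ::
  "('n, 'e::real_normed_vector) atlas \<Rightarrow> 'n bifield \<Rightarrow> 'n vfield \<Rightarrow> bool" where
  "jacobi_structure \<A> \<Lambda> E \<longleftrightarrow> bivector_field \<A> \<Lambda> \<and> vector_field \<A> E \<and>
     jacobi_identity \<A> (jacobi_bracket \<Lambda> E)"

definition poisson_structure :: "('n, 'e::real_normed_vector) atlas \<Rightarrow> 'n bifield \<Rightarrow> bool" where
  "poisson_structure \<A> P \<longleftrightarrow> bivector_field \<A> P \<and> jacobi_identity \<A> (poisson_bracket P)"

text \<open>Push-forward along a map that is injective on the point set \<open>N\<close>.\<close>

definition push_vfield :: "'n set \<Rightarrow> ('n \<Rightarrow> 'k) \<Rightarrow> 'n vfield \<Rightarrow> 'k vfield" where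
  "push_vfield N F X = (\<lambda>q f. if q \<in> F ` N then X (inv_into N F q) (f \<circ> F) else 0)"

definition push_bifield :: "'n set \<Rightarrow> ('n \<Rightarrow> 'k) \<Rightarrow> 'n bifield \<Rightarrow> 'k bifield" where
  "push_bifield N F P = (\<lambda>q f g. if q \<in> F ` N then P (inv_into N F q) (f \<circ> F) (g \<circ> F) else 0)"

text \<open>\<open>(\<Lambda>\<^sub>0, E\<^sub>0)\<close> on the submanifold embedded by \<open>F\<close> is the restriction of
  \<open>(\<Lambda>, E)\<close>: the embedding carries one to the other at every point of the submanifold.\<close>

definition jacobi_restriction ::
  "('n, 'e::real_normed_vector) atlas \<Rightarrow> ('k, 'g::real_normed_vector) atlas \<Rightarrow> ('n \<Rightarrow> 'k) \<Rightarrow>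
   'n bifield \<Rightarrow> 'n vfield \<Rightarrow> 'k bifield \<Rightarrow> 'k vfield \<Rightarrow> bool" where
  "jacobi_restriction \<A> \<B> F \<Lambda>\<^sub>0 E\<^sub>0 \<Lambda> E \<longleftrightarrow> (\<forall>p\<in>point_set \<A>. \<forall>f\<in>Cinf \<B>. \<forall>g\<in>Cinf \<B>.
     \<Lambda>\<^sub>0 p (f \<circ> F) (g \<circ> F) = \<Lambda> (F p) f g \<and> E\<^sub>0 p (f \<circ> F) = E (F p) f)"


section \<open>Vector bundles\<close>

text \<open>A bundle carries a set of local trivialisations \<open>(U, y)\<close>, where \<open>y\<close> maps the part
  over \<open>U\<close> to the typical fibre; together with the charts of the base they generate the
  atlas of the total space.\<close>

definition bundle_atlas ::
  "('m, 'e) atlas \<Rightarrow> 'v set \<Rightarrow> ('v \<Rightarrow> 'm) \<Rightarrow> ('m set \<times> ('v \<Rightarrow> 'f)) set \<Rightarrow> ('v, 'e \<times> 'f) atlas" where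
  "bundle_atlas \<M> T \<pi> Y = {({v \<in> T. \<pi> v \<in> W \<inter> U}, \<lambda>v. (\<phi> (\<pi> v), y v)) | W \<phi> U y.
     (W, \<phi>) \<in> \<M> \<and> (U, y) \<in> Y}"

record ('m, 'e, 'v, 'f) vbundle =
  vbase :: "('m, 'e) atlas"
  vtotal :: "'v set"
  vproj :: "'v \<Rightarrow> 'm"
  vadd :: "'v \<Rightarrow> 'v \<Rightarrow> 'v"
  vscale :: "real \<Rightarrow> 'v \<Rightarrow> 'v"
  vtriv :: "('m set \<times> ('v \<Rightarrow> 'f)) set"

definition vfibre :: "('m, 'e, 'v, 'f) vbundle \<Rightarrow> 'm \<Rightarrow> 'v set" where
  "vfibre V p = {v \<in> vtotal V. vproj V v = p}"

definition vatlas :: "('m, 'e, 'v, 'f) vbundle \<Rightarrow> ('v, 'e \<times> 'f) atlas" where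
  "vatlas V = bundle_atlas (vbase V) (vtotal V) (vproj V) (vtriv V)"

text \<open>The vector space axioms on the fibres follow from the existence of the
  trivialisations, which are bijective and compatible with the fibre operations.\<close>

definition vector_bundle :: "('m, 'e::fin_dim_inner, 'v, 'f::fin_dim_inner) vbundle \<Rightarrow> bool" where
  "vector_bundle V \<longleftrightarrow>
     smooth_manifold (vbase V) \<and>
     vproj V ` vtotal V \<subseteq> point_set (vbase V) \<and>
     (\<forall>p\<in>point_set (vbase V). \<forall>u\<in>vfibre V p.
        (\<forall>v\<in>vfibre V p. vadd V u v \<in> vfibre V p) \<and> (\<forall>c. vscale V c u \<in> vfibre V p)) \<and>
     (\<Union>(U, \<eta>)\<in>vtriv V. U) = point_set (vbase V) \<and>
     (\<forall>(U, \<eta>)\<in>vtriv V. openin (atlas_topology (vbase V)) U \<and>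
        (\<forall>p\<in>U. bij_betw \<eta> (vfibre V p) UNIV \<and>
           (\<forall>u\<in>vfibre V p. (\<forall>v\<in>vfibre V p. \<eta> (vadd V u v) = \<eta> u + \<eta> v) \<and>
              (\<forall>c. \<eta> (vscale V c u) = c *\<^sub>R \<eta> u)))) \<and>
     smooth_atlas (vatlas V)"

definition zero_section :: "('m, 'e, 'v, 'f) vbundle \<Rightarrow> 'v set" where
  "zero_section V = {v \<in> vtotal V. vscale V 0 v = v}"

definition linear_form :: "('m, 'e, 'v, 'f) vbundle \<Rightarrow> 'm \<Rightarrow> ('v \<Rightarrow> real) \<Rightarrow> bool" where
  "linear_form V p l \<longleftrightarrow> (\<forall>u\<in>vfibre V p. (\<forall>v\<in>vfibre V p. l (vadd V u v) = l u + l v) \<and>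
     (\<forall>c. l (vscale V c u) = c * l u))"

text \<open>An element of the dual bundle over \<open>p\<close> is a pair \<open>(p, \<psi>)\<close> with \<open>\<psi>\<close> a linear form on
  the fibre over \<open>p\<close>, extended by 0. The typical fibre is identified with its dual through
  the inner product.\<close>

definition dual_bundle ::
  "('m, 'e, 'v, 'f::real_inner) vbundle \<Rightarrow> ('m, 'e, 'm \<times> ('v \<Rightarrow> real), 'f) vbundle" where
  "dual_bundle V = \<lparr>
     vbase = vbase V,
     vtotal = {(p, \<psi>). p \<in> point_set (vbase V) \<and> linear_form V p \<psi> \<and>
       (\<forall>v. v \<notin> vfibre V p \<longrightarrow> \<psi> v = 0)},
     vproj = fst,
     vadd = (\<lambda>(p, \<psi>) (q, \<theta>). (p, \<lambda>v. \<psi> v + \<theta> v)),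
     vscale = (\<lambda>c (p, \<psi>). (p, \<lambda>v. c * \<psi> v)),
     vtriv = {(U, \<lambda>(p, \<psi>). THE z. \<forall>v\<in>vfibre V p. \<psi> v = z \<bullet> \<eta> v) | U \<eta>. (U, \<eta>) \<in> vtriv V} \<rparr>"

definition iota :: "('m \<Rightarrow> 'v) \<Rightarrow> 'm \<times> ('v \<Rightarrow> real) \<Rightarrow> real" where
  "iota X = (\<lambda>(p, \<psi>). \<psi> (X p))"

text \<open>In a bundle chart with coordinates \<open>(x, y)\<close>, the derivative in direction \<open>(0, y)\<close> is
  \<open>\<Sum>\<^sub>\<alpha> y\<^sup>\<alpha> \<partial>/\<partial>y\<^sup>\<alpha>\<close>; it does not depend on the chosen chart.\<close>

definition liouville :: "('m, 'e::real_normed_vector, 'v, 'f::real_normed_vector) vbundle \<Rightarrow> 'v vfield" where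
  "liouville V = (\<lambda>v f. if v \<in> point_set (vatlas V) \<and> f \<in> Cinf (vatlas V) then
     (let (D, \<kappa>) = (SOME c. c \<in> vatlas V \<and> v \<in> fst c)
      in frechet_derivative (f \<circ> inv_into D \<kappa>) (at (\<kappa> v)) (0, snd (\<kappa> v))) else 0)"

definition homogeneous_poisson ::
  "('m, 'e::real_normed_vector, 'v, 'f::real_normed_vector) vbundle \<Rightarrow> 'v bifield \<Rightarrow> bool" where
  "homogeneous_poisson V P \<longleftrightarrow> poisson_structure (vatlas V) P \<and>
     lie_derivative (liouville V) P = (\<lambda>v f g. - P v f g)"


section \<open>Affine bundles\<close>

record ('m, 'e, 'a, 'v, 'f) abundle =
  amodel :: "('m, 'e, 'v, 'f) vbundle"
  atotal :: "'a set"
  aproj :: "'a \<Rightarrow> 'm"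
  atrans :: "'a \<Rightarrow> 'v \<Rightarrow> 'a"
  atriv :: "('m set \<times> ('a \<Rightarrow> 'f)) set"

definition abase :: "('m, 'e, 'a, 'v, 'f) abundle \<Rightarrow> ('m, 'e) atlas" where
  "abase A = vbase (amodel A)"

definition afibre :: "('m, 'e, 'a, 'v, 'f) abundle \<Rightarrow> 'm \<Rightarrow> 'a set" where
  "afibre A p = {x \<in> atotal A. aproj A x = p}"

definition aatlas :: "('m, 'e, 'a, 'v, 'f) abundle \<Rightarrow> ('a, 'e \<times> 'f) atlas" where
  "aatlas A = bundle_atlas (abase A) (atotal A) (aproj A) (atriv A)"

text \<open>Every trivialisation of an affine bundle is fibrewise affine over a trivialisation \<open>\<eta>\<close>
  of the model bundle, where adjoining \<open>\<eta>\<close> to the trivialisations of the model bundle yields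
  a vector bundle again. That the translations form a free and transitive action of the
  fibres of the model bundle, and that the transition maps are affine, follows.\<close>

definition affine_bundle :: "('m, 'e::fin_dim_inner, 'a, 'v, 'f::fin_dim_inner) abundle \<Rightarrow> bool" where
  "affine_bundle A \<longleftrightarrow>
     vector_bundle (amodel A) \<and>
     aproj A ` atotal A \<subseteq> point_set (abase A) \<and>
     (\<forall>p\<in>point_set (abase A). \<forall>x\<in>afibre A p. \<forall>v\<in>vfibre (amodel A) p. atrans A x v \<in> afibre A p) \<and>
     (\<Union>(U, y)\<in>atriv A. U) = point_set (abase A) \<and>
     (\<forall>(U, y)\<in>atriv A. openin (atlas_topology (abase A)) U \<and>
        (\<forall>p\<in>U. bij_betw y (afibre A p) UNIV) \<and>
        (\<exists>\<eta>. vector_bundle ((amodel A)\<lparr>vtriv := insert (U, \<eta>) (vtriv (amodel A))\<rparr>) \<and>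
           (\<forall>p\<in>U. \<forall>x\<in>afibre A p. \<forall>v\<in>vfibre (amodel A) p. y (atrans A x v) = y x + \<eta> v))) \<and>
     smooth_atlas (aatlas A)"

definition bundle_rank :: "('m, 'e, 'a, 'v, 'f::fin_dim_inner) abundle \<Rightarrow> nat" where
  "bundle_rank A = dim (UNIV :: 'f set)"

definition affine_on_fibre :: "('m, 'e, 'a, 'v, 'f) abundle \<Rightarrow> 'm \<Rightarrow> ('a \<Rightarrow> real) \<Rightarrow> bool" where
  "affine_on_fibre A p a \<longleftrightarrow> (\<exists>l. linear_form (amodel A) p l \<and>
     (\<forall>x\<in>afibre A p. \<forall>v\<in>vfibre (amodel A) p. a (atrans A x v) = a x + l v))"

definition affine_functions ::
  "('m, 'e::real_normed_vector, 'a, 'v, 'f::real_normed_vector) abundle \<Rightarrow> ('a \<Rightarrow> real) set" where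
  "affine_functions A =
     {a \<in> Cinf (aatlas A). \<forall>p\<in>point_set (abase A). affine_on_fibre A p a}"

definition affine_jacobi ::
  "('m, 'e::real_normed_vector, 'a, 'v, 'f::real_normed_vector) abundle \<Rightarrow>
   'a bifield \<Rightarrow> 'a vfield \<Rightarrow> bool" where
  "affine_jacobi A \<Lambda> E \<longleftrightarrow> jacobi_structure (aatlas A) \<Lambda> E \<and>
     (\<forall>a\<in>affine_functions A. \<forall>b\<in>affine_functions A. jacobi_bracket \<Lambda> E a b \<in> affine_functions A)"

text \<open>The bundle \<open>A\<^sup>+\<close>. Elements over \<open>p\<close> are pairs \<open>(p, a)\<close> with \<open>a\<close> an affine function on
  the fibre over \<open>p\<close>, extended by 0. In a trivialisation \<open>y\<close> of \<open>A\<close>, the coordinates of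
  \<open>x \<mapsto> w \<bullet> y x + d\<close> are \<open>(w, d)\<close>.\<close>

definition aff_bundle ::
  "('m, 'e, 'a, 'v, 'f::real_inner) abundle \<Rightarrow> ('m, 'e, 'm \<times> ('a \<Rightarrow> real), 'f \<times> real) vbundle" where
  "aff_bundle A = \<lparr>
     vbase = abase A,
     vtotal = {(p, a). p \<in> point_set (abase A) \<and> affine_on_fibre A p a \<and>
       (\<forall>x. x \<notin> afibre A p \<longrightarrow> a x = 0)},
     vproj = fst,
     vadd = (\<lambda>(p, a) (q, b). (p, \<lambda>x. a x + b x)),
     vscale = (\<lambda>c (p, a). (p, \<lambda>x. c * a x)),
     vtriv = {(U, \<lambda>(p, a). THE wd. \<forall>x\<in>afibre A p. a x = fst wd \<bullet> y x + snd wd) | U y.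
       (U, y) \<in> atriv A} \<rparr>"

definition hat ::
  "('m, 'e, 'a, 'v, 'f::real_inner) abundle \<Rightarrow>
   ('m, 'e, 'm \<times> ('m \<times> ('a \<Rightarrow> real) \<Rightarrow> real), 'f \<times> real) vbundle" where
  "hat A = dual_bundle (aff_bundle A)"

definition fibre_section :: "('m, 'e, 'a, 'v, 'f) abundle \<Rightarrow> ('a \<Rightarrow> real) \<Rightarrow> 'm \<Rightarrow> 'm \<times> ('a \<Rightarrow> real)" where
  "fibre_section A a = (\<lambda>p. (p, \<lambda>x. if x \<in> afibre A p then a x else 0))"

definition one_section :: "('m, 'e, 'a, 'v, 'f) abundle \<Rightarrow> 'm \<Rightarrow> 'm \<times> ('a \<Rightarrow> real)" where
  "one_section A = fibre_section A (\<lambda>_. 1)"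

definition bar ::
  "('m, 'e, 'a, 'v, 'f) abundle \<Rightarrow> ('a \<Rightarrow> real) \<Rightarrow> 'm \<times> ('m \<times> ('a \<Rightarrow> real) \<Rightarrow> real) \<Rightarrow> real" where
  "bar A a = iota (fibre_section A a)"

text \<open>The embedding of \<open>A\<close> as the affine subbundle \<open>iota (one_section A) = 1\<close>.\<close>

definition evaluation ::
  "('m, 'e, 'a, 'v, 'f::real_inner) abundle \<Rightarrow> 'a \<Rightarrow> 'm \<times> ('m \<times> ('a \<Rightarrow> real) \<Rightarrow> real)" where
  "evaluation A x = (aproj A x,
     \<lambda>s. if s \<in> vfibre (aff_bundle A) (aproj A x) then snd s x else 0)"


section \<open>The cylinder over a manifold without its zero section\<close>

definition cylinder :: "('m, 'e) atlas \<Rightarrow> ('m \<times> real, 'e \<times> real) atlas" where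
  "cylinder \<M> = prod_atlas \<M> nonzero_reals"

definition t_times :: "('m \<Rightarrow> real) \<Rightarrow> 'm \<times> real \<Rightarrow> real" where
  "t_times f = (\<lambda>(x, t). t * f x)"

definition linear_poisson :: "('m, 'e::real_normed_vector) atlas \<Rightarrow> ('m \<times> real) bifield \<Rightarrow> bool" where
  "linear_poisson \<M> P \<longleftrightarrow> poisson_structure (cylinder \<M>) P \<and>
     (\<forall>f\<in>Cinf \<M>. \<forall>g\<in>Cinf \<M>. \<exists>h\<in>Cinf \<M>. \<forall>z\<in>point_set (cylinder \<M>).
        P z (t_times f) (t_times g) = t_times h z)"

definition d_dt :: "('m, 'e::real_normed_vector) atlas \<Rightarrow> ('m \<times> real) vfield" where
  "d_dt \<M> = (\<lambda>(x, t) F. if (x, t) \<in> point_set (cylinder \<M>) \<and> F \<in> Cinf (cylinder \<M>)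
     then deriv (\<lambda>s. F (x, s)) t else 0)"

definition lift_vfield :: "('m, 'e::real_normed_vector) atlas \<Rightarrow> 'm vfield \<Rightarrow> ('m \<times> real) vfield" where
  "lift_vfield \<M> X = (\<lambda>(x, t) F. if (x, t) \<in> point_set (cylinder \<M>) \<and> F \<in> Cinf (cylinder \<M>)
     then X x (\<lambda>y. F (y, t)) else 0)"

definition lift_bifield :: "('m, 'e::real_normed_vector) atlas \<Rightarrow> 'm bifield \<Rightarrow> ('m \<times> real) bifield" where
  "lift_bifield \<M> P = (\<lambda>(x, t) F G. if (x, t) \<in> point_set (cylinder \<M>) \<and>
       F \<in> Cinf (cylinder \<M>) \<and> G \<in> Cinf (cylinder \<M>)
     then P x (\<lambda>y. F (y, t)) (\<lambda>y. G (y, t)) else 0)"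

definition poissonization ::
  "('m, 'e::real_normed_vector) atlas \<Rightarrow> 'm bifield \<Rightarrow> 'm vfield \<Rightarrow> ('m \<times> real) bifield" where
  "poissonization \<M> \<Lambda> E = (\<lambda>z F G. (1 / snd z) * lift_bifield \<M> \<Lambda> z F G
     + wedge (d_dt \<M>) (lift_vfield \<M> E) z F G)"

text \<open>For rank 0, the identification of \<open>M \<times> (\<real> - {0})\<close> with the complement of the zero
  section: \<open>(p, t)\<close> goes to \<open>t\<close> times the evaluation at the only point of \<open>A\<close> over \<open>p\<close>.\<close>

definition cylinder_map ::
  "('m, 'e, 'a, 'v, 'f::real_inner) abundle \<Rightarrow> 'm \<times> real \<Rightarrow> 'm \<times> ('m \<times> ('a \<Rightarrow> real) \<Rightarrow> real)" where
  "cylinder_map A = (\<lambda>(p, t). vscale (hat A) t (evaluation A (inv_into (atotal A) (aproj A) p)))"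

end

theory Submission
  imports Defs
begin

text \<open>A Jacobi bracket is a first-order operator in each argument, so it is determined at a point by its
  values on functions spanning the 1-jets there, and its Jacobiator, which is again of first order in
  each argument, only has to be checked on such functions. On \<open>A\<close> the affine functions span all
  1-jets; on \<open>hat A\<close> off the zero section the fibrewise linear functions span all differentials, and
  the zero section is handled by continuity. This gives both uniqueness statements.

  In the direction from \<open>hat A\<close> to \<open>A\<close>, functions on \<open>A\<close> are extended to be homogeneous of degree 0
  near \<open>A\<close>, and \<open>\<Lambda>(df, dg)\<close>, \<open>E(f)\<close> are the brackets of the extensions with each other and with
  \<open>\<tau> = \<iota>(1)\<close>. Conversely, for rank \<open>n > 0\<close> the operator \<open>f \<mapsto> {f a, b} - f {a, b}\<close> on basic functions has the
  form \<open>a \<cdot> X\<^sub>b f\<close> where \<open>a \<cdot> X\<^sub>b f\<close> is affine for every affine \<open>a\<close>; since the fibres have positive dimension,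
  \<open>X\<^sub>b f\<close> is basic. The bivector at \<open>z\<close> then has the value \<open>bar {a, b} z + X\<^sub>b f - X\<^sub>a g\<close> on functions with
  the differentials of \<open>bar a + f\<close> and \<open>bar b + g\<close>; that this depends on the differentials only is the
  main point. For \<open>n = 0\<close> the correspondence is the Poissonization of a Jacobi structure.\<close>

section \<open>Finite-dimensional inner product spaces\<close>

text \<open>Near \<open>A\<close> a linear function \<open>bar A a\<close> is \<open>\<tau>\<close>
  F with F homogeneous of degree 0, and on \<open>\<tau>\<close> = 1 the Leibniz rule gives
  {\<open>\<tau>\<close> F, \<open>\<tau>\<close> G} = {F, G} + F {\<open>\<tau>\<close>, G} - G
  {\<open>\<tau>\<close>, F}. This is why a homogeneous Poisson bracket turns into a Jacobi bracket,
  with \<open>E\<close> the hamiltonian field of \<open>\<tau>\<close>. In the other direction the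
  obstacle is the zero section. There the differentials of linear functions vanish on all vectors
  tangent to the zero section, so brackets of linear functions do not define a bivector at these
  points, and the bivector that they define elsewhere might have a pole. In rank 0 the pole is real,
  as the term \<open>\<Lambda>\<close>/t shows: every function is then affine, and a X f being
  affine says nothing about X f. In positive rank it bounds the degree of X f along the fibres.
  Adding basic functions f to \<open>bar A a\<close> yields every differential at every point of
  \<open>hat A\<close>, the zero section included; the price is that one differential has many
  representations.\<close>

lemma finite_orthonormal_basis_exists:
  "\<exists>B::'a::fin_dim_inner set. finite B \<and> (\<forall>b\<in>B. \<forall>c\<in>B. b \<bullet> c = (if b = c then 1 else 0)) \<and>
     (\<forall>x. x = (\<Sum>b\<in>B. (x \<bullet> b) *\<^sub>R b))"
proof -
  let ?on = "\<lambda>B::'a set. finite B \<and> (\<forall>b\<in>B. \<forall>c\<in>B. b \<bullet> c = (if b = c then 1 else 0))"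
  have expand: "x = (\<Sum>b\<in>B. (x \<bullet> b) *\<^sub>R b)" if "?on B" "x \<in> span B" for B and x :: 'a
    using that(2)
  proof (induction rule: span_induct_alt)
    case base
    then show ?case by simp
  next
    case (step c y z)
    have "(\<Sum>b\<in>B. (y \<bullet> b) *\<^sub>R b) = (\<Sum>b\<in>B. if b = y then y else 0)"
      using that(1) step(1) by (intro sum.cong) auto
    also have "\<dots> = y" using that(1) step(1) by simp
    finally have "(\<Sum>b\<in>B. (y \<bullet> b) *\<^sub>R b) = y" .
    then show ?case
      using step(2) by (simp add: inner_add_left scaleR_add_left sum.distrib flip: scaleR_scaleR scaleR_sum_right)
  qed
  \<comment> \<open>Gram-Schmidt: a vector outside \<open>span B\<close> contributes its normalised
    difference from the projection onto \<open>span B\<close>.\<close>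
  have ex: "\<exists>B. ?on B \<and> span S \<subseteq> span B" if "finite S" for S :: "'a set"
    using that
  proof (induction S rule: finite_induct)
    case empty
    then show ?case by (intro exI[of _ "{}"]) auto
  next
    case (insert x S)
    then obtain B where B: "?on B" "span S \<subseteq> span B" by blast
    show ?case
    proof (cases "x \<in> span B")
      case True
      then have "span (insert x S) \<subseteq> span B"
        using B(2) by (meson insert_subset span_minimal span_superset subset_trans subspace_span)
      then show ?thesis using B by blast
    next
      case False
      define y where "y = x - (\<Sum>b\<in>B. (x \<bullet> b) *\<^sub>R b)"
      define e where "e = (1 / norm y) *\<^sub>R y"
      have s: "(\<Sum>b\<in>B. (x \<bullet> b) *\<^sub>R b) \<in> span B"
        by (intro span_sum span_scale span_base)
      have y0: "y \<noteq> 0"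
        using False s by (auto simp: y_def)
      have orth: "y \<bullet> b = 0" if "b \<in> B" for b
      proof -
        have "(\<Sum>c\<in>B. (x \<bullet> c) * (c \<bullet> b)) = (\<Sum>c\<in>B. if c = b then x \<bullet> b else 0)"
          using B(1) that by (intro sum.cong) auto
        then show ?thesis
          using B(1) that by (simp add: y_def inner_diff_left inner_sum_left)
      qed
      have ee: "e \<bullet> e = 1"
        using y0 by (simp add: e_def dot_square_norm power2_eq_square)
      have eb: "e \<bullet> b = 0" "b \<bullet> e = 0" if "b \<in> B" for b
        using orth[OF that] by (auto simp: e_def inner_commute)
      have on: "?on (insert e B)"
        using B(1) ee eb by (auto split: if_splits)
      have "x = norm y *\<^sub>R e + (\<Sum>b\<in>B. (x \<bullet> b) *\<^sub>R b)"
        using y0 by (simp add: e_def y_def)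
      moreover have "norm y *\<^sub>R e + (\<Sum>b\<in>B. (x \<bullet> b) *\<^sub>R b) \<in> span (insert e B)"
        by (intro span_add span_scale span_base insertI1 span_sum insertI2)
      ultimately have x: "x \<in> span (insert e B)" by simp
      have "insert x S \<subseteq> span (insert e B)"
        using x B(2) by (metis insert_subset span_mono span_superset subset_insertI subset_trans)
      then have "span (insert x S) \<subseteq> span (insert e B)"
        by (rule span_minimal) simp
      with on show ?thesis by blast
    qed
  qed
  obtain S :: "'a set" where S: "finite S" "span S = UNIV"
    using finite_spanning_set fin_dim_inner_iff_span by metis
  with ex[OF S(1)] obtain B where B: "?on B" "span B = UNIV" by auto
  with expand[OF B(1)] show ?thesis by (intro exI[of _ B]) auto
qed

text \<open>It takes the place of \<open>Basis\<close>. For the zero space it is empty and sums over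
  it are 0, so rank 0 and dimension 0 need no separate treatment in coordinate formulas.\<close>

definition onb :: "'a::fin_dim_inner set" where
  "onb = (SOME B. finite B \<and> (\<forall>b\<in>B. \<forall>c\<in>B. b \<bullet> c = (if b = c then 1 else 0)) \<and>
     (\<forall>x. x = (\<Sum>b\<in>B. (x \<bullet> b) *\<^sub>R b)))"

lemma finite_onb [simp]: "finite (onb :: 'a::fin_dim_inner set)"
  and onb_inner: "b \<in> onb \<Longrightarrow> c \<in> onb \<Longrightarrow> b \<bullet> (c::'a) = (if b = c then 1 else 0)"
  and onb_expand: "(\<Sum>b\<in>onb. (x \<bullet> b) *\<^sub>R b) = (x::'a)"
  using someI_ex[OF finite_orthonormal_basis_exists[where 'a='a]] unfolding onb_def[symmetric]
  by metis+

lemma linear_onb: "linear f \<Longrightarrow> f x = (\<Sum>b\<in>onb. (x \<bullet> b) *\<^sub>R f b)" for x :: "'a::fin_dim_inner"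
  by (metis (no_types, lifting) linear_sum linear_cmul onb_expand sum.cong)

lemma linear_riesz: "linear l \<Longrightarrow> \<exists>z. \<forall>x. l x = z \<bullet> x" for l :: "'a::fin_dim_inner \<Rightarrow> real"
  by (intro exI[of _ "\<Sum>b\<in>onb. l b *\<^sub>R b"] allI, subst linear_onb[of l], assumption)
     (simp add: inner_sum_left, simp add: inner_commute mult.commute)

text \<open>Towards Heine-Borel: a box in one more coordinate is the Minkowski sum of a segment and
  a box, and sums of compact sets are compact.\<close>

lemma compact_coordinate_box:
  "compact ((\<lambda>c. \<Sum>b\<in>onb. c b *\<^sub>R b) ` {c. \<forall>b\<in>onb. \<bar>c b\<bar> \<le> R})" for R :: real
proof -
  have "compact ((\<lambda>c. \<Sum>b\<in>B. c b *\<^sub>R b) ` {c. \<forall>b\<in>B. \<bar>c b\<bar> \<le> R})"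
    if "finite B" for B :: "'a set"
    using that
  proof (induction B rule: finite_induct)
    case empty
    then show ?case by (simp add: image_constant_conv)
  next
    case (insert x B)
    let ?S = "(\<lambda>t. t *\<^sub>R x) ` {-R..R}" and ?T = "(\<lambda>c. \<Sum>b\<in>B. c b *\<^sub>R b) ` {c. \<forall>b\<in>B. \<bar>c b\<bar> \<le> R}"
    have "compact ?S"
      by (intro compact_continuous_image continuous_intros compact_Icc)
    then have "compact {s + t |s t. s \<in> ?S \<and> t \<in> ?T}"
      using insert.IH by (rule compact_sums)
    also have "{s + t |s t. s \<in> ?S \<and> t \<in> ?T} =
        (\<lambda>c. \<Sum>b\<in>insert x B. c b *\<^sub>R b) ` {c. \<forall>b\<in>insert x B. \<bar>c b\<bar> \<le> R}"
    proof (intro equalityI subsetI)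
      fix z assume "z \<in> {s + t |s t. s \<in> ?S \<and> t \<in> ?T}"
      then obtain r c where "-R \<le> r \<and> r \<le> R" "\<forall>b\<in>B. \<bar>c b\<bar> \<le> R" "z = r *\<^sub>R x + (\<Sum>b\<in>B. c b *\<^sub>R b)"
        by clarsimp
      then have "\<bar>r\<bar> \<le> R" "\<forall>b\<in>B. \<bar>c b\<bar> \<le> R" "z = r *\<^sub>R x + (\<Sum>b\<in>B. c b *\<^sub>R b)"
        by auto
      moreover have "(\<Sum>b\<in>B. (c(x := r)) b *\<^sub>R b) = (\<Sum>b\<in>B. c b *\<^sub>R b)"
        using insert by (intro sum.cong) auto
      ultimately show "z \<in> (\<lambda>c. \<Sum>b\<in>insert x B. c b *\<^sub>R b) ` {c. \<forall>b\<in>insert x B. \<bar>c b\<bar> \<le> R}"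
        using insert by (intro image_eqI[of _ _ "c(x := r)"]) auto
    next
      fix z assume "z \<in> (\<lambda>c. \<Sum>b\<in>insert x B. c b *\<^sub>R b) ` {c. \<forall>b\<in>insert x B. \<bar>c b\<bar> \<le> R}"
      then obtain c where c: "\<forall>b\<in>insert x B. \<bar>c b\<bar> \<le> R" "z = c x *\<^sub>R x + (\<Sum>b\<in>B. c b *\<^sub>R b)"
        using insert by auto
      then have "c x *\<^sub>R x \<in> ?S" by (intro imageI) auto
      moreover from c have "(\<Sum>b\<in>B. c b *\<^sub>R b) \<in> ?T" by auto
      ultimately show "z \<in> {s + t |s t. s \<in> ?S \<and> t \<in> ?T}" using c(2) by blast
    qed
    finally show ?case .
  qed
  then show ?thesis by simp
qed

lemma onb_norm: "b \<in> onb \<Longrightarrow> norm b = 1"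
  using onb_inner[of b b] by (simp add: norm_eq_sqrt_inner)

text \<open>Closed balls become compact; they serve as supports of bump functions and as compact
  neighbourhoods inside charts. A bounded sequence has bounded coordinates by Cauchy-Schwarz, so it
  stays in a compact box.\<close>

instance fin_dim_inner \<subseteq> heine_borel
proof
  fix f :: "nat \<Rightarrow> 'a"
  assume "bounded (range f)"
  then obtain R where R: "\<And>n. norm (f n) \<le> R"
    unfolding bounded_iff by auto
  let ?K = "(\<lambda>c. \<Sum>b\<in>(onb::'a set). c b *\<^sub>R b) ` {c. \<forall>b\<in>onb. \<bar>c b\<bar> \<le> R}"
  have "seq_compact ?K"
    using compact_coordinate_box compact_eq_seq_compact_metric by blast
  moreover have "f n \<in> ?K" for n
  proof (rule image_eqI)
    show "f n = (\<Sum>b\<in>onb. (f n \<bullet> b) *\<^sub>R b)" by (simp add: onb_expand)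
    show "(\<lambda>b. f n \<bullet> b) \<in> {c. \<forall>b\<in>onb. \<bar>c b\<bar> \<le> R}"
    proof clarify
      fix b :: 'a assume "b \<in> onb"
      then have "\<bar>f n \<bullet> b\<bar> \<le> norm (f n)"
        using Cauchy_Schwarz_ineq2[of "f n" b] by (simp add: onb_norm)
      with R[of n] show "\<bar>f n \<bullet> b\<bar> \<le> R" by linarith
    qed
  qed
  ultimately show "\<exists>l r. strict_mono (r::nat\<Rightarrow>nat) \<and> ((f \<circ> r) \<longlongrightarrow> l) sequentially"
    unfolding seq_compact_def by blast
qed

instance fin_dim_inner \<subseteq> banach ..

section \<open>Smooth maps\<close>

lemma Ck_on_subset: "Ck_on k f S \<Longrightarrow> T \<subseteq> S \<Longrightarrow> Ck_on k f T"
  by (induction k arbitrary: f) (auto intro: continuous_on_subset)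

lemma Ck_on_imp_continuous: "Ck_on k f S \<Longrightarrow> continuous_on S f"
  by (cases k) (auto intro!: continuous_at_imp_continuous_on differentiable_imp_continuous_within)

lemma Ck_on_Suc_imp: "Ck_on (Suc k) f S \<Longrightarrow> Ck_on k f S"
proof (induction k arbitrary: f)
  case 0
  then show ?case using Ck_on_imp_continuous[of "Suc 0" f S] by simp
qed auto

lemma Ck_on_cong: "Ck_on k f S \<Longrightarrow> open S \<Longrightarrow> (\<And>x. x \<in> S \<Longrightarrow> f x = g x) \<Longrightarrow> Ck_on k g S"
proof (induction k arbitrary: f g)
  case 0
  then show ?case by (auto cong: continuous_on_cong)
next
  case (Suc k)
  have d: "(g has_derivative f') (at x)" if "x \<in> S" "(f has_derivative f') (at x)" for x f'
    using that Suc.prems by (intro has_derivative_transform_within_open[of f f' x UNIV S g]) auto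
  show ?case
  proof (simp, intro conjI ballI allI)
    fix x assume "x \<in> S"
    then show "g differentiable at x"
      using Suc.prems(1) d[of x] unfolding Ck_on.simps differentiable_def by blast
  next
    fix v
    show "Ck_on k (\<lambda>x. frechet_derivative g (at x) v) S"
    proof (rule Suc.IH[of "\<lambda>x. frechet_derivative f (at x) v"])
      fix x assume "x \<in> S"
      then show "frechet_derivative f (at x) v = frechet_derivative g (at x) v"
        using d[of x] Suc.prems(1) by (metis Ck_on.simps(2) frechet_derivative_at frechet_derivative_works)
    qed (use Suc.prems in auto)
  qed
qed

text \<open>Lets an explicit formula \<open>D\<close> replace \<open>frechet_derivative\<close>,
  which is defined by choice. The rules for addition, bilinear products and composition are
  inductions through this rule.\<close>

lemma Ck_on_SucI:
  assumes "open S" "\<And>x. x \<in> S \<Longrightarrow> (f has_derivative D x) (at x)" "\<And>v. Ck_on k (\<lambda>x. D x v) S"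
  shows "Ck_on (Suc k) f S"
proof (simp, intro conjI ballI allI)
  show "f differentiable at x" if "x \<in> S" for x
    using assms(2)[OF that] differentiable_def by blast
  show "Ck_on k (\<lambda>x. frechet_derivative f (at x) v) S" for v
    using assms(3)[of v] assms(1)
    by (rule Ck_on_cong) (use assms(2) frechet_derivative_at in metis)
qed

lemma Ck_on_SucD:
  assumes "Ck_on (Suc k) f S" "x \<in> S"
  shows "(f has_derivative frechet_derivative f (at x)) (at x)"
  using assms by (auto simp: frechet_derivative_works)

lemma Ck_on_const: "open S \<Longrightarrow> Ck_on k (\<lambda>x. c) S"
proof (induction k arbitrary: c)
  case (Suc k)
  show ?case by (rule Ck_on_SucI[of _ _ "\<lambda>x v. 0"]) (auto simp: Suc)
qed auto

lemma Ck_on_bounded_linear: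
  assumes "bounded_linear L" "open S" "Ck_on k f S"
  shows "Ck_on k (\<lambda>x. L (f x)) S"
  using assms(3)
proof (induction k arbitrary: f)
  case 0
  then show ?case using assms(1) by (auto intro: bounded_linear.continuous_on)
next
  case (Suc k)
  show ?case
    by (rule Ck_on_SucI[OF assms(2), of _ "\<lambda>x v. L (frechet_derivative f (at x) v)"])
      (use Suc assms(1) Ck_on_SucD[OF Suc.prems] in \<open>auto intro: bounded_linear.has_derivative\<close>)
qed

lemma Ck_on_id: "open S \<Longrightarrow> Ck_on k (\<lambda>x. x) S"
proof (cases k)
  case (Suc j)
  assume "open S"
  then show ?thesis unfolding Suc
    by (intro Ck_on_SucI[of _ _ "\<lambda>x v. v"]) (auto intro: Ck_on_const)
qed auto

lemma Ck_on_add: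
  assumes "open S" "Ck_on k f S" "Ck_on k g S"
  shows "Ck_on k (\<lambda>x. f x + g x) S"
  using assms(2,3)
proof (induction k arbitrary: f g)
  case 0
  then show ?case by (auto intro: continuous_on_add)
next
  case (Suc k)
  show ?case
    by (rule Ck_on_SucI[OF assms(1),
        of _ "\<lambda>x v. frechet_derivative f (at x) v + frechet_derivative g (at x) v"])
      (use Suc Ck_on_SucD[OF Suc.prems(1)] Ck_on_SucD[OF Suc.prems(2)] in \<open>auto intro: has_derivative_add\<close>)
qed

lemma Ck_on_sum:
  assumes "open S" "\<And>i. i \<in> I \<Longrightarrow> Ck_on k (f i) S"
  shows "Ck_on k (\<lambda>x. \<Sum>i\<in>I. f i x) S"
  using assms(2)
  by (induction I rule: infinite_finite_induct) (auto intro!: Ck_on_add assms(1) Ck_on_const)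

lemma Ck_on_bilinear:
  assumes "bounded_bilinear p" "open S" "Ck_on k f S" "Ck_on k g S"
  shows "Ck_on k (\<lambda>x. p (f x) (g x)) S"
  using assms(3,4)
proof (induction k arbitrary: f g)
  case 0
  then show ?case using assms(1) by (auto intro: bounded_bilinear.continuous_on)
next
  case (Suc k)
  show ?case
    by (rule Ck_on_SucI[OF assms(2), of _ "\<lambda>x v. p (f x) (frechet_derivative g (at x) v) +
        p (frechet_derivative f (at x) v) (g x)"])
      (use Suc assms(2) Ck_on_SucD[OF Suc.prems(1)] Ck_on_SucD[OF Suc.prems(2)]
        Ck_on_Suc_imp[OF Suc.prems(1)] Ck_on_Suc_imp[OF Suc.prems(2)]
        in \<open>auto intro!: Ck_on_add bounded_bilinear.FDERIV[OF assms(1)]\<close>)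
qed

text \<open>\<open>Ck_on\<close> controls the derivative of g in fixed directions only, while the
  chain rule feeds in a direction that depends on x. Expanding that direction in \<open>onb\<close>
  separates the two dependences, which is where finite dimension of the middle space enters.\<close>

lemma Ck_on_compose:
  fixes f :: "'a::real_normed_vector \<Rightarrow> 'b::fin_dim_inner" and g :: "'b \<Rightarrow> 'c::real_normed_vector"
  assumes "open S" "open T" "f ` S \<subseteq> T" "Ck_on k f S" "Ck_on k g T"
  shows "Ck_on k (\<lambda>x. g (f x)) S"
  using assms(4,5)
proof (induction k arbitrary: g)
  case 0
  then show ?case using assms(3) by (auto intro: continuous_on_compose2)
next
  case (Suc k)
  have Dg: "(g has_derivative frechet_derivative g (at (f x))) (at (f x))" if "x \<in> S" for x
    using Ck_on_SucD[OF Suc.prems(2)] that assms(3) by auto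
  show ?case
  proof (rule Ck_on_SucI[OF assms(1), of _
        "\<lambda>x v. \<Sum>b\<in>onb. (frechet_derivative f (at x) v \<bullet> b) *\<^sub>R frechet_derivative g (at (f x)) b"])
    fix x assume x: "x \<in> S"
    have "((\<lambda>x. g (f x)) has_derivative
        (\<lambda>v. frechet_derivative g (at (f x)) (frechet_derivative f (at x) v))) (at x)"
      using has_derivative_compose[OF Ck_on_SucD[OF Suc.prems(1) x] Dg[OF x]] .
    then show "((\<lambda>x. g (f x)) has_derivative (\<lambda>v. \<Sum>b\<in>onb.
        (frechet_derivative f (at x) v \<bullet> b) *\<^sub>R frechet_derivative g (at (f x)) b)) (at x)"
      by (rule has_derivative_eq_rhs) (rule ext, rule linear_onb[OF has_derivative_linear[OF Dg[OF x]]])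
  next
    fix v
    show "Ck_on k (\<lambda>x. \<Sum>b\<in>onb. (frechet_derivative f (at x) v \<bullet> b) *\<^sub>R
        frechet_derivative g (at (f x)) b) S"
    proof (intro Ck_on_sum assms(1) Ck_on_bilinear[OF bounded_bilinear_scaleR])
      fix b :: 'b
      show "Ck_on k (\<lambda>x. frechet_derivative f (at x) v \<bullet> b) S"
        using Suc.prems(1) by (intro Ck_on_bounded_linear[OF bounded_linear_inner_left assms(1)]) auto
      show "Ck_on k (\<lambda>x. frechet_derivative g (at (f x)) b) S"
        using Suc.prems Ck_on_Suc_imp[OF Suc.prems(1)] by (intro Suc.IH) auto
    qed
  qed
qed

lemma Ck_on_local:
  assumes "\<And>x. x \<in> S \<Longrightarrow> \<exists>T. open T \<and> x \<in> T \<and> Ck_on k f T"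
  shows "Ck_on k f S"
  using assms
proof (induction k arbitrary: f)
  case 0
  have "isCont f x" if "x \<in> S" for x
  proof -
    obtain T where "open T" "x \<in> T" "Ck_on 0 f T" using 0[of x] \<open>x \<in> S\<close> by auto
    then show ?thesis by (simp add: continuous_on_eq_continuous_at)
  qed
  then show ?case
    by (simp add: continuous_at_imp_continuous_on)
next
  case (Suc k)
  have "\<exists>T. open T \<and> x \<in> T \<and> Ck_on k (\<lambda>x. frechet_derivative f (at x) v) T" if "x \<in> S" for x v
    using Suc.prems[OF that] by auto
  then have "Ck_on k (\<lambda>x. frechet_derivative f (at x) v) S" for v
    by (intro Suc.IH) auto
  moreover have "f differentiable at x" if "x \<in> S" for x
    using Suc.prems[OF that] by auto
  ultimately show ?case by simp
qed

lemma smooth_on_subset: "smooth_on f S \<Longrightarrow> T \<subseteq> S \<Longrightarrow> smooth_on f T"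
  unfolding smooth_on_def using Ck_on_subset by blast

lemma smooth_on_cong: "smooth_on f S \<Longrightarrow> open S \<Longrightarrow> (\<And>x. x \<in> S \<Longrightarrow> f x = g x) \<Longrightarrow> smooth_on g S"
  unfolding smooth_on_def using Ck_on_cong by blast

lemma smooth_on_const [intro]: "open S \<Longrightarrow> smooth_on (\<lambda>x. c) S"
  unfolding smooth_on_def using Ck_on_const by blast

lemma smooth_on_id [intro]: "open S \<Longrightarrow> smooth_on (\<lambda>x. x) S"
  unfolding smooth_on_def using Ck_on_id by blast

lemma smooth_on_bounded_linear:
  "bounded_linear L \<Longrightarrow> open S \<Longrightarrow> smooth_on f S \<Longrightarrow> smooth_on (\<lambda>x. L (f x)) S"
  unfolding smooth_on_def using Ck_on_bounded_linear by blast

lemma smooth_on_bilinear: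
  "bounded_bilinear p \<Longrightarrow> open S \<Longrightarrow> smooth_on f S \<Longrightarrow> smooth_on g S \<Longrightarrow> smooth_on (\<lambda>x. p (f x) (g x)) S"
  unfolding smooth_on_def using Ck_on_bilinear by blast

lemmas smooth_on_mult = smooth_on_bilinear[OF bounded_bilinear_mult]
lemmas smooth_on_scaleR = smooth_on_bilinear[OF bounded_bilinear_scaleR]
lemmas smooth_on_inner = smooth_on_bilinear[OF bounded_bilinear_inner]

lemma smooth_on_add: "open S \<Longrightarrow> smooth_on f S \<Longrightarrow> smooth_on g S \<Longrightarrow> smooth_on (\<lambda>x. f x + g x) S"
  unfolding smooth_on_def using Ck_on_add by blast

lemma smooth_on_minus: "open S \<Longrightarrow> smooth_on f S \<Longrightarrow> smooth_on (\<lambda>x. - f x) S"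
  by (rule smooth_on_bounded_linear[OF bounded_linear_minus[OF bounded_linear_ident]])

lemma smooth_on_diff: "open S \<Longrightarrow> smooth_on f S \<Longrightarrow> smooth_on g S \<Longrightarrow> smooth_on (\<lambda>x. f x - g x) S"
  using smooth_on_add[of S f "\<lambda>x. - g x"] smooth_on_minus[of S g] by simp

lemma smooth_on_sum:
  "open S \<Longrightarrow> (\<And>i. i \<in> I \<Longrightarrow> smooth_on (f i) S) \<Longrightarrow> smooth_on (\<lambda>x. \<Sum>i\<in>I. f i x) S"
  unfolding smooth_on_def by (rule allI, rule Ck_on_sum) auto

lemma smooth_on_compose:
  fixes f :: "'a::real_normed_vector \<Rightarrow> 'b::fin_dim_inner"
  shows "open S \<Longrightarrow> open T \<Longrightarrow> f ` S \<subseteq> T \<Longrightarrow> smooth_on f S \<Longrightarrow> smooth_on g T \<Longrightarrow>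
    smooth_on (\<lambda>x. g (f x)) S"
  unfolding smooth_on_def by (rule allI, rule Ck_on_compose[of S T f]) auto

lemma smooth_on_local:
  "(\<And>x. x \<in> S \<Longrightarrow> \<exists>T. open T \<and> x \<in> T \<and> smooth_on f T) \<Longrightarrow> smooth_on f S"
  unfolding smooth_on_def by (rule allI, rule Ck_on_local) blast

lemma smooth_on_fst: "open S \<Longrightarrow> smooth_on f S \<Longrightarrow> smooth_on (\<lambda>x. fst (f x)) S"
  by (rule smooth_on_bounded_linear[OF bounded_linear_fst])

lemma smooth_on_snd: "open S \<Longrightarrow> smooth_on f S \<Longrightarrow> smooth_on (\<lambda>x. snd (f x)) S"
  by (rule smooth_on_bounded_linear[OF bounded_linear_snd])

lemma smooth_on_Pair:
  assumes "open S" "smooth_on f S" "smooth_on g S"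
  shows "smooth_on (\<lambda>x. (f x, g x)) S"
proof -
  have "smooth_on (\<lambda>x. (f x, 0) + (0, g x)) S"
    by (intro smooth_on_add smooth_on_bounded_linear[of "\<lambda>y. (y, 0)"]
        smooth_on_bounded_linear[of "\<lambda>y. (0, y)"] assms
        bounded_linear_Pair bounded_linear_ident bounded_linear_zero)
  then show ?thesis by simp
qed

lemma smooth_on_imp_continuous: "smooth_on f S \<Longrightarrow> continuous_on S f"
  unfolding smooth_on_def using Ck_on_imp_continuous by blast

lemma smooth_on_has_derivative:
  "smooth_on f S \<Longrightarrow> x \<in> S \<Longrightarrow> (f has_derivative frechet_derivative f (at x)) (at x)"
  unfolding smooth_on_def using Ck_on_SucD by blast

lemma smooth_on_frechet:
  "smooth_on f S \<Longrightarrow> smooth_on (\<lambda>x. frechet_derivative f (at x) v) S"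
  unfolding smooth_on_def using Ck_on.simps(2) by blast

text \<open>The derivative of \<open>inverse\<close> is a polynomial in \<open>inverse\<close>, so
  the induction on the order closes.\<close>

lemma smooth_on_inverse: "smooth_on inverse (- {0::real})"
proof -
  have "Ck_on k inverse (- {0::real})" for k
  proof (induction k)
    case 0
    then show ?case by (auto intro!: continuous_intros)
  next
    case (Suc k)
    show ?case
    proof (rule Ck_on_SucI[of _ _ "\<lambda>x v. - (inverse x * v * inverse x)"])
      fix v :: real
      have "Ck_on k (\<lambda>x::real. inverse x * inverse x) (- {0})"
        by (rule Ck_on_bilinear[OF bounded_bilinear_mult]) (use Suc in auto)
      then have "Ck_on k (\<lambda>x::real. (- v) *\<^sub>R (inverse x * inverse x)) (- {0})"
        using Ck_on_bounded_linear[OF bounded_linear_scaleR_right[of "- v"], of "- {0}" k "\<lambda>x::real. inverse x * inverse x"]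
        by (simp add: open_Compl)
      then show "Ck_on k (\<lambda>x. - (inverse x * v * inverse x)) (- {0})"
        by (rule Ck_on_cong) auto
    qed (auto intro: has_derivative_inverse')
  qed
  then show ?thesis by (simp add: smooth_on_def)
qed

lemma smooth_on_divide:
  fixes f g :: "'a::real_normed_vector \<Rightarrow> real"
  assumes "open S" "smooth_on f S" "smooth_on g S" "\<And>x. x \<in> S \<Longrightarrow> g x \<noteq> 0"
  shows "smooth_on (\<lambda>x. f x / g x) S"
  unfolding divide_inverse
  using assms by (intro smooth_on_mult smooth_on_compose[of S "- {0}" g inverse] smooth_on_inverse) auto

lemmas smooth_intros = smooth_on_const smooth_on_id smooth_on_add smooth_on_diff smooth_on_minus
  smooth_on_mult smooth_on_scaleR smooth_on_inner smooth_on_fst smooth_on_snd smooth_on_Pair smooth_on_sum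

section \<open>Smooth cutoff functions\<close>

definition flat :: "nat \<Rightarrow> real \<Rightarrow> real" where
  "flat m t = (if t > 0 then exp (- inverse t) * inverse t ^ m else 0)"

text \<open>The family exp(-1/t) t^(-m), extended by 0, is closed under differentiation up to linear
  combinations; hence all members are smooth by one induction on the order. At t = 0 the difference
  quotient from the right is the next member of the family, which tends to 0.\<close>

lemma flat_has_derivative:
  "(flat m has_derivative (\<lambda>v. (flat (m + 2) t - m * flat (Suc m) t) * v)) (at t)"
proof -
  consider "t > 0" | "t < 0" | "t = 0" by linarith
  then have "(flat m has_real_derivative (flat (m + 2) t - m * flat (Suc m) t)) (at t)"
  proof cases
    case 1
    have "((\<lambda>t. exp (- inverse t) * inverse t ^ m) has_real_derivative
        (exp (- inverse t) * inverse t ^ (m + 2) - m * (exp (- inverse t) * inverse t ^ Suc m))) (at t)"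
      using 1 by (cases m) (auto intro!: derivative_eq_intros simp: algebra_simps power2_eq_square,
          metis Suc_pred not_gr_zero power_Suc)
    then have "(flat m has_real_derivative
        (exp (- inverse t) * inverse t ^ (m + 2) - m * (exp (- inverse t) * inverse t ^ Suc m))) (at t)"
      by (rule has_field_derivative_transform_within_open[of _ _ _ "{0<..}"]) (use 1 in \<open>auto simp: flat_def\<close>)
    then show ?thesis using 1 by (simp add: flat_def)
  next
    case 2
    have "((\<lambda>t. 0) has_real_derivative 0) (at t)" by simp
    then have "(flat m has_real_derivative 0) (at t)"
      by (rule has_field_derivative_transform_within_open[of _ _ _ "{..<0}"]) (use 2 in \<open>auto simp: flat_def\<close>)
    then show ?thesis using 2 by (simp add: flat_def)
  next
    case 3
    have lim: "((\<lambda>h. exp (- inverse h) * inverse h ^ Suc m) \<longlongrightarrow> 0) (at_right (0::real))" for m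
      by real_asymp
    have "((\<lambda>h. flat m h / h) \<longlongrightarrow> 0) (at (0::real))"
    proof (rule filterlim_split_at)
      show "((\<lambda>h. flat m h / h) \<longlongrightarrow> 0) (at_left 0)"
        by (rule Lim_transform_eventually[of "\<lambda>_. 0"])
          (auto simp: flat_def eventually_at_filter)
      show "((\<lambda>h. flat m h / h) \<longlongrightarrow> 0) (at_right 0)"
        by (rule Lim_transform_eventually[OF lim[of m]])
          (auto simp: flat_def eventually_at_filter field_simps)
    qed
    then show ?thesis
      using 3 by (simp add: DERIV_def flat_def)
  qed
  then show ?thesis
    by (simp add: has_field_derivative_def mult_commute_abs)
qed

lemma smooth_on_flat: "open S \<Longrightarrow> smooth_on (flat m) S"
proof -
  assume S: "open S"
  have "Ck_on k (flat m) S" for k m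
  proof (induction k arbitrary: m)
    case 0
    show ?case
      using flat_has_derivative[THEN has_derivative_continuous] by (auto intro!: continuous_at_imp_continuous_on)
  next
    case (Suc k)
    show ?case
    proof (rule Ck_on_SucI[OF S flat_has_derivative])
      fix v :: real
      have "Ck_on k (\<lambda>x. v * flat (m + 2) x + (- (real m * v)) * flat (Suc m) x) S"
        by (intro Ck_on_add[OF S] Ck_on_bounded_linear[OF bounded_linear_mult_right S] Suc)
      then show "Ck_on k (\<lambda>x. (flat (m + 2) x - real m * flat (Suc m) x) * v) S"
        by (rule Ck_on_cong[OF _ S]) (simp add: algebra_simps)
    qed
  qed
  then show ?thesis by (simp add: smooth_on_def)
qed

text \<open>The denominator is positive everywhere, since t or 1 - t is positive; the transition
  from 0 to 1 takes place on [0, 1].\<close>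

definition smooth_step :: "real \<Rightarrow> real" where
  "smooth_step t = flat 0 t / (flat 0 t + flat 0 (1 - t))"

lemma smooth_step_0: "t \<le> 0 \<Longrightarrow> smooth_step t = 0"
  and smooth_step_1: "1 \<le> t \<Longrightarrow> smooth_step t = 1"
  by (auto simp: smooth_step_def flat_def)

lemma smooth_on_smooth_step: "open S \<Longrightarrow> smooth_on smooth_step S"
proof -
  have "smooth_on (\<lambda>t. flat 0 (1 - t)) (UNIV::real set)"
    by (rule smooth_on_compose[where T=UNIV and f="\<lambda>t. 1 - t"]) (auto intro!: smooth_intros smooth_on_flat)
  then have "smooth_on (\<lambda>t. flat 0 t / (flat 0 t + flat 0 (1 - t))) UNIV"
    by (intro smooth_on_divide smooth_intros smooth_on_flat)
      (auto simp: flat_def add_nonneg_eq_0_iff, (smt (verit) exp_gt_zero)?)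
  then show ?thesis
    using smooth_on_subset by (auto simp: smooth_step_def[abs_def])
qed

lemma smooth_bump:
  fixes z :: "'a::fin_dim_inner"
  assumes "open S" "z \<in> S"
  obtains \<beta> :: "'a \<Rightarrow> real" and T K where "smooth_on \<beta> UNIV" "open T" "z \<in> T" "compact K" "T \<subseteq> K" "K \<subseteq> S"
    "\<And>x. x \<in> T \<Longrightarrow> \<beta> x = 1" "\<And>x. x \<notin> K \<Longrightarrow> \<beta> x = 0"
proof -
  obtain r where r: "r > 0" "cball z r \<subseteq> S"
    using assms open_contains_cball by blast
  \<comment> \<open>With d the distance to z, the argument 2 - 2 d^2 / r^2 is at least 1 for d < r/2
    and at most 0 outside the ball of radius r. Squaring the distance keeps the argument smooth at
    z.\<close>
  define \<beta> where "\<beta> x = smooth_step (2 - (2 / r\<^sup>2) * ((x - z) \<bullet> (x - z)))" for x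
  have n: "(x - z) \<bullet> (x - z) = (dist z x)\<^sup>2" for x
    by (simp add: dist_norm norm_minus_commute power2_norm_eq_inner)
  show ?thesis
  proof
    show "smooth_on \<beta> UNIV"
      unfolding \<beta>_def
      by (rule smooth_on_compose[of UNIV UNIV "\<lambda>x. 2 - (2 / r\<^sup>2) * ((x - z) \<bullet> (x - z))"])
        (simp_all del: times_divide_eq_left add: smooth_intros smooth_on_smooth_step)
    show "open (ball z (r/2))" "z \<in> ball z (r/2)" "compact (cball z r)" "cball z r \<subseteq> S"
      "ball z (r/2) \<subseteq> cball z r"
      using r by (auto simp: compact_eq_bounded_closed)
    fix x
    show "\<beta> x = 1" if "x \<in> ball z (r / 2)"
    proof -
      have "(dist z x)\<^sup>2 \<le> (r/2)\<^sup>2"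
        using that r by (intro power_mono) auto
      then have "2 * (dist z x)\<^sup>2 \<le> r\<^sup>2"
        by (simp add: power_divide) (use zero_le_power2[of "dist z x"] in linarith)
      then show ?thesis
        using r unfolding \<beta>_def n by (intro smooth_step_1) (simp add: field_simps)
    qed
    show "\<beta> x = 0" if "x \<notin> cball z r"
    proof -
      have "r\<^sup>2 \<le> (dist z x)\<^sup>2"
        using that r by (intro power_mono) auto
      then show ?thesis
        using r unfolding \<beta>_def n by (intro smooth_step_0) (simp add: field_simps power2_eq_square)
    qed
  qed
qed

text \<open>Differentiation under the integral sign. Each derivative in x brings out a factor s; the
  weight \<open>w\<close> is there to absorb it, which makes the statement inductive.\<close>

lemma Ck_on_segment_integral:
  fixes h :: "'a::fin_dim_inner \<Rightarrow> real"
  assumes "Ck_on k h (ball z r)" and w: "smooth_on w (UNIV::real set)"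
  shows "Ck_on k (\<lambda>x. integral (cbox 0 1) (\<lambda>s. w s * h (z + s *\<^sub>R (x - z)))) (ball z r)"
  using assms
proof (induction k arbitrary: h w)
  case 0
  let ?m = "\<lambda>x s. z + s *\<^sub>R (x - z)"
  have m: "?m x s \<in> ball z r" if "x \<in> ball z r" "s \<in> cbox 0 1" for x and s :: real
  proof -
    have "dist z (?m x s) = s * dist z x"
      using that by (simp add: dist_norm norm_minus_commute)
    also have "\<dots> \<le> 1 * dist z x" using that by (intro mult_right_mono) auto
    finally show ?thesis using that by simp
  qed
  have ch: "continuous_on (ball z r) h" using 0(1) by simp
  have "continuous_on (ball z r \<times> cbox 0 1) (\<lambda>p. h (?m (fst p) (snd p)))"
    by (rule continuous_on_compose2[OF ch]) (use m in \<open>auto intro!: continuous_intros\<close>)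
  moreover have "continuous_on (ball z r \<times> cbox 0 1) (\<lambda>p. w (snd p))"
    by (rule continuous_on_compose2[OF smooth_on_imp_continuous[OF 0(2)]]) (auto intro!: continuous_intros)
  ultimately have "continuous_on (ball z r \<times> cbox 0 1) (\<lambda>p. w (snd p) * h (?m (fst p) (snd p)))"
    by (rule continuous_on_mult[rotated])
  then have "continuous_on (ball z r) (\<lambda>x. integral (cbox 0 1) (\<lambda>s. w s * h (?m x s)))"
    by (intro integral_continuous_on_param) (simp add: split_def)
  then show ?case by simp
next
  case (Suc k)
  let ?m = "\<lambda>x s. z + s *\<^sub>R (x - z)"
  have m: "?m x s \<in> ball z r" if "x \<in> ball z r" "s \<in> cbox 0 1" for x and s :: real
  proof -
    have "dist z (?m x s) = s * dist z x"
      using that by (simp add: dist_norm norm_minus_commute)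
    also have "\<dots> \<le> 1 * dist z x" using that by (intro mult_right_mono) auto
    finally show ?thesis using that by simp
  qed
  let ?d = "\<lambda>b y. frechet_derivative h (at y) b"
  have cd: "continuous_on (ball z r) (?d b)" for b
    using Suc.prems(1) Ck_on_imp_continuous[of k "?d b" "ball z r"] by auto
  have cw: "continuous_on UNIV w" using Suc.prems(2) smooth_on_imp_continuous by blast
  have ch: "continuous_on (ball z r) h" using Suc.prems(1) Ck_on_imp_continuous by blast
  \<comment> \<open>The derivative in x as a bounded linear map, the form in which
    \<open>leibniz_rule\<close> expects it, assembled from the partial derivatives along
    \<open>onb\<close>.\<close>
  define fx where "fx x s = (\<Sum>b\<in>onb. (w s * s * ?d b (?m x s)) *\<^sub>R blinfun_inner_left b)" for x s
  have fx: "blinfun_apply (fx x s) v = (\<Sum>b\<in>onb. (w s * s * ?d b (?m x s)) * (v \<bullet> b))" for x s v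
    by (simp add: fx_def blinfun.sum_left blinfun.scaleR_left)
  have lin: "?d v y = (\<Sum>b\<in>onb. (v \<bullet> b) * ?d b y)" if "y \<in> ball z r" for v y
    using linear_onb[OF has_derivative_linear[OF Ck_on_SucD[OF Suc.prems(1) that]], of v] by simp
  have D: "((\<lambda>x. integral (cbox 0 1) (\<lambda>s. w s * h (?m x s))) has_derivative
      integral (cbox 0 1) (fx x)) (at x within ball z r)" if "x \<in> ball z r" for x
  proof (rule leibniz_rule)
    fix x and s :: real assume x: "x \<in> ball z r" and s: "s \<in> cbox 0 1"
    have "((\<lambda>x. h (?m x s)) has_derivative (\<lambda>v. frechet_derivative h (at (?m x s)) (s *\<^sub>R v))) (at x)"
      by (rule has_derivative_compose[of "\<lambda>x. ?m x s", OF _ Ck_on_SucD[OF Suc.prems(1) m[OF x s]]])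
        (auto intro!: derivative_eq_intros)
    then have "((\<lambda>x. w s * h (?m x s)) has_derivative (\<lambda>v. w s * ?d (s *\<^sub>R v) (?m x s))) (at x)"
      by (rule has_derivative_mult_right)
    moreover have "(\<lambda>v. w s * ?d (s *\<^sub>R v) (?m x s)) = blinfun_apply (fx x s)"
      by (rule ext, subst lin[OF m[OF x s]]) (simp add: fx sum_distrib_left mult_ac)
    ultimately show "((\<lambda>x. w s * h (?m x s)) has_derivative blinfun_apply (fx x s)) (at x within ball z r)"
      by (simp add: has_derivative_at_withinI)
  next
    fix x assume x: "x \<in> ball z r"
    have "continuous_on (cbox 0 1) (\<lambda>s. w s * h (?m x s))"
      using m[OF x]
      by (intro continuous_intros continuous_on_compose2[OF cw] continuous_on_compose2[OF ch]) auto
    then show "(\<lambda>s. w s * h (?m x s)) integrable_on cbox 0 1"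
      by (rule integrable_continuous)
  next
    show "continuous_on (ball z r \<times> cbox 0 1) (\<lambda>(x, t). fx x t)"
      unfolding fx_def split_def using m
      by (intro continuous_intros continuous_on_compose2[OF cw] continuous_on_compose2[OF cd]) auto
  qed (use that in auto)
  show ?case
  proof (rule Ck_on_SucI[OF open_ball])
    fix x assume x: "x \<in> ball z r"
    show "((\<lambda>x. integral (cbox 0 1) (\<lambda>s. w s * h (?m x s))) has_derivative
      integral (cbox 0 1) (fx x)) (at x)"
      using D[OF x] x by (simp add: at_within_open[OF _ open_ball])
  next
    fix v
    have "Ck_on k (\<lambda>x. integral (cbox 0 1) (\<lambda>s. (w s * s) * ?d v (?m x s))) (ball z r)"
      using Suc.prems by (intro Suc.IH smooth_intros) auto
    then show "Ck_on k (\<lambda>x. blinfun_apply (integral (cbox 0 1) (fx x)) v) (ball z r)"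
    proof (rule Ck_on_cong)
      fix x assume x: "x \<in> ball z r"
      have "continuous_on (cbox 0 1) (fx x)"
        unfolding fx_def using m[OF x]
        by (intro continuous_intros continuous_on_compose2[OF cw] continuous_on_compose2[OF cd]) auto
      then have "blinfun_apply (integral (cbox 0 1) (fx x)) v = integral (cbox 0 1) (\<lambda>s. blinfun_apply (fx x s) v)"
        by (intro blinfun_apply_integral integrable_continuous)
      also have "\<dots> = integral (cbox 0 1) (\<lambda>s. (w s * s) * ?d v (?m x s))"
        by (intro integral_cong, subst lin[OF m[OF x]]) (auto simp: fx sum_distrib_left mult_ac)
      finally show "integral (cbox 0 1) (\<lambda>s. (w s * s) * ?d v (?m x s)) =
          blinfun_apply (integral (cbox 0 1) (fx x)) v" by simp
    qed auto
  qed
qed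

text \<open>The fundamental theorem of calculus along the segment from z to x. Each
  \<open>g b\<close> is the mean of the partial derivative along b over the segment: smooth by the
  preceding lemma, and the partial derivative itself at z.\<close>

lemma hadamard:
  fixes f :: "'a::fin_dim_inner \<Rightarrow> real"
  assumes f: "smooth_on f (ball z r)" and r: "r > 0"
  obtains g where "\<And>b. smooth_on (g b) (ball z r)"
    "\<And>x. x \<in> ball z r \<Longrightarrow> f x = f z + (\<Sum>b\<in>onb. ((x - z) \<bullet> b) * g b x)"
    "\<And>b. g b z = frechet_derivative f (at z) b"
proof -
  let ?m = "\<lambda>x s. z + s *\<^sub>R (x - z)"
  let ?d = "\<lambda>b y. frechet_derivative f (at y) b"
  define g where "g b x = integral (cbox 0 1) (\<lambda>s. 1 * ?d b (?m x s))" for b x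
  show ?thesis
  proof
    fix b
    show "smooth_on (g b) (ball z r)"
      unfolding g_def smooth_on_def using smooth_on_frechet[OF f]
      by (auto intro!: Ck_on_segment_integral[where w="\<lambda>_. 1", simplified] simp: smooth_on_def Ck_on_const)
    show "g b z = ?d b z" by (simp add: g_def)
  next
    fix x assume x: "x \<in> ball z r"
    have m: "?m x s \<in> ball z r" if "s \<in> cbox 0 1" for s :: real
    proof -
      have "dist z (?m x s) = s * dist z x"
        using that by (simp add: dist_norm norm_minus_commute)
      also have "\<dots> \<le> 1 * dist z x" using that by (intro mult_right_mono) auto
      finally show ?thesis using x by simp
    qed
    have lin: "?d v y = (\<Sum>b\<in>onb. (v \<bullet> b) * ?d b y)" if "y \<in> ball z r" for v y
      using linear_onb[OF has_derivative_linear[OF smooth_on_has_derivative[OF f that]], of v] by simp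
    have der: "((\<lambda>s. f (?m x s)) has_vector_derivative ?d (x - z) (?m x s)) (at s within {0..1})"
      if "s \<in> {0..1}" for s
    proof -
      have ms: "?m x s \<in> ball z r" using m that by auto
      have "((\<lambda>s. f (?m x s)) has_derivative (\<lambda>t. frechet_derivative f (at (?m x s)) (t *\<^sub>R (x - z)))) (at s)"
        by (rule has_derivative_compose[of "\<lambda>s. ?m x s", OF _ smooth_on_has_derivative[OF f ms]])
          (auto intro!: derivative_eq_intros)
      moreover have "?d (t *\<^sub>R (x - z)) (?m x s) = t *\<^sub>R ?d (x - z) (?m x s)" for t
        using linear_cmul[OF has_derivative_linear[OF smooth_on_has_derivative[OF f ms]]] .
      ultimately show ?thesis
        by (simp add: has_vector_derivative_def has_derivative_at_withinI)
    qed
    have cd: "continuous_on (ball z r) (?d b)" for b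
      using smooth_on_imp_continuous[OF smooth_on_frechet[OF f]] .
    have int: "(\<lambda>s. ?d b (?m x s)) integrable_on {0..1}" for b
      using m by (intro integrable_continuous_interval continuous_intros continuous_on_compose2[OF cd]) auto
    have "((\<lambda>s. ?d (x - z) (?m x s)) has_integral f (?m x 1) - f (?m x 0)) {0..1}"
      by (rule fundamental_theorem_of_calculus) (use der in auto)
    then have "f x - f z = integral {0..1} (\<lambda>s. ?d (x - z) (?m x s))"
      by (simp add: integral_unique)
    also have "\<dots> = integral {0..1} (\<lambda>s. \<Sum>b\<in>onb. ((x - z) \<bullet> b) * ?d b (?m x s))"
      by (intro integral_cong lin m) auto
    also have "\<dots> = (\<Sum>b\<in>onb. ((x - z) \<bullet> b) * g b x)"
      using int by (subst integral_sum) (auto simp: g_def intro!: integrable_on_mult_right)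
    finally show "f x = f z + (\<Sum>b\<in>onb. ((x - z) \<bullet> b) * g b x)" by simp
  qed
qed

section \<open>Smooth functions on a manifold\<close>

definition chart_deriv ::
  "'n set \<Rightarrow> ('n \<Rightarrow> 'e::real_normed_vector) \<Rightarrow> ('n \<Rightarrow> real) \<Rightarrow> 'n \<Rightarrow> 'e \<Rightarrow> real" where
  "chart_deriv U \<phi> f q w = frechet_derivative (f \<circ> inv_into U \<phi>) (at (\<phi> q)) w"

lemma smooth_atlasD:
  assumes "smooth_atlas \<A>" "(U, \<phi>) \<in> \<A>"
  shows "inj_on \<phi> U" "open (\<phi> ` U)"
    and "(V, \<psi>) \<in> \<A> \<Longrightarrow> open (\<phi> ` (U \<inter> V))"
    and "(V, \<psi>) \<in> \<A> \<Longrightarrow> smooth_on (\<psi> \<circ> inv_into U \<phi>) (\<phi> ` (U \<inter> V))"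
  using assms unfolding smooth_atlas_def by blast+

lemma point_setI: "(U, \<phi>) \<in> \<A> \<Longrightarrow> p \<in> U \<Longrightarrow> p \<in> point_set \<A>"
  by (auto simp: point_set_def)

lemma point_setE:
  assumes "p \<in> point_set \<A>"
  obtains U \<phi> where "(U, \<phi>) \<in> \<A>" "p \<in> U"
  using assms by (auto simp: point_set_def)

text \<open>\<open>topology\<close> is meaningful only on predicates that satisfy
  \<open>istopology\<close>; closure under intersection is where injectivity of the charts
  enters.\<close>

lemma openin_atlas_topology:
  assumes "smooth_atlas \<A>"
  shows "openin (atlas_topology \<A>) W \<longleftrightarrow>
    W \<subseteq> point_set \<A> \<and> (\<forall>(U, \<phi>)\<in>\<A>. open (\<phi> ` (U \<inter> W)))"
proof -
  have "istopology (\<lambda>W. W \<subseteq> point_set \<A> \<and> (\<forall>(U, \<phi>)\<in>\<A>. open (\<phi> ` (U \<inter> W))))"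
    unfolding istopology_def
  proof (intro conjI allI impI)
    fix S T
    assume S: "S \<subseteq> point_set \<A> \<and> (\<forall>(U, \<phi>)\<in>\<A>. open (\<phi> ` (U \<inter> S)))"
      and T: "T \<subseteq> point_set \<A> \<and> (\<forall>(U, \<phi>)\<in>\<A>. open (\<phi> ` (U \<inter> T)))"
    show "S \<inter> T \<subseteq> point_set \<A>" using S by auto
    show "\<forall>(U, \<phi>)\<in>\<A>. open (\<phi> ` (U \<inter> (S \<inter> T)))"
    proof clarify
      fix U \<phi> assume U: "(U, \<phi>) \<in> \<A>"
      have "\<phi> ` (U \<inter> (S \<inter> T)) = \<phi> ` (U \<inter> S) \<inter> \<phi> ` (U \<inter> T)"
        using inj_on_image_Int[OF smooth_atlasD(1)[OF assms U], of "U \<inter> S" "U \<inter> T"]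
        by (simp add: Int_ac)
      then show "open (\<phi> ` (U \<inter> (S \<inter> T)))" using S T U by auto
    qed
  next
    fix K
    assume K: "\<forall>S\<in>K. S \<subseteq> point_set \<A> \<and> (\<forall>(U, \<phi>)\<in>\<A>. open (\<phi> ` (U \<inter> S)))"
    then show "\<Union>K \<subseteq> point_set \<A>" by auto
    show "\<forall>(U, \<phi>)\<in>\<A>. open (\<phi> ` (U \<inter> \<Union>K))"
    proof clarify
      fix U \<phi> assume U: "(U, \<phi>) \<in> \<A>"
      have "\<phi> ` (U \<inter> \<Union>K) = (\<Union>S\<in>K. \<phi> ` (U \<inter> S))" by auto
      then show "open (\<phi> ` (U \<inter> \<Union>K))" using K U by (auto intro!: open_UN)
    qed
  qed
  then show ?thesis
    unfolding atlas_topology_def by (simp add: topology_inverse')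
qed

lemma topspace_atlas_topology:
  assumes "smooth_atlas \<A>"
  shows "topspace (atlas_topology \<A>) = point_set \<A>"
proof -
  have "\<phi> ` (U \<inter> point_set \<A>) = \<phi> ` U" if "(U, \<phi>) \<in> \<A>" for U \<phi>
    using that by (auto simp: point_set_def)
  then have "openin (atlas_topology \<A>) (point_set \<A>)"
    using assms smooth_atlasD(2)[OF assms] by (auto simp: openin_atlas_topology)
  then show ?thesis
    using assms by (auto simp: openin_atlas_topology topspace_def)
qed

lemma open_chart_preimage:
  assumes "smooth_atlas \<A>" "(U, \<phi>) \<in> \<A>" "(V, \<psi>) \<in> \<A>" "open S"
  shows "open (\<psi> ` (V \<inter> {q \<in> U. \<phi> q \<in> S}))"
proof -
  note V = smooth_atlasD[OF assms(1,3)]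
  have "\<psi> ` (V \<inter> {q \<in> U. \<phi> q \<in> S}) = \<psi> ` (V \<inter> U) \<inter> (\<phi> \<circ> inv_into V \<psi>) -` S"
    using V(1) by (auto simp: inv_into_f_f)
  then show ?thesis
    using continuous_open_preimage[OF smooth_on_imp_continuous[OF V(4)[OF assms(2)]] V(3)[OF assms(2)] assms(4)]
    by simp
qed

lemma openin_chart_preimage:
  assumes "smooth_atlas \<A>" "(U, \<phi>) \<in> \<A>" "open S"
  shows "openin (atlas_topology \<A>) {q \<in> U. \<phi> q \<in> S}"
  using assms open_chart_preimage[OF assms(1,2) _ assms(3)] point_setI[OF assms(2)]
  by (auto simp: openin_atlas_topology)

lemma openin_chart_image:
  assumes "smooth_atlas \<A>" "(U, \<phi>) \<in> \<A>" "openin (atlas_topology \<A>) N"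
  shows "open (\<phi> ` (U \<inter> N))"
  using assms by (auto simp: openin_atlas_topology)

lemma openin_chart:
  assumes "smooth_atlas \<A>" "(U, \<phi>) \<in> \<A>"
  shows "openin (atlas_topology \<A>) U"
  using openin_chart_preimage[OF assms open_UNIV] by simp

text \<open>One chart and a small open set suffice here. Functions glued from local pieces are
  tested with this notion, and \<open>Cinf_iff_smooth_at\<close> turns the outcome into a statement
  on all charts.\<close>

definition smooth_at :: "('n, 'e::real_normed_vector) atlas \<Rightarrow> ('n \<Rightarrow> real) \<Rightarrow> 'n \<Rightarrow> bool" where
  "smooth_at \<A> f p \<longleftrightarrow> (\<exists>U \<phi> S. (U, \<phi>) \<in> \<A> \<and> p \<in> U \<and> open S \<and> \<phi> p \<in> S \<and> S \<subseteq> \<phi> ` U \<and>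
     smooth_on (f \<circ> inv_into U \<phi>) S)"

lemma smooth_atE:
  fixes \<A> :: "('n, 'e::fin_dim_inner) atlas"
  assumes A: "smooth_atlas \<A>" and f: "smooth_at \<A> f p" and V: "(V, \<psi>) \<in> \<A>" "p \<in> V"
  obtains T where "open T" "\<psi> p \<in> T" "T \<subseteq> \<psi> ` V" "smooth_on (f \<circ> inv_into V \<psi>) T"
proof -
  obtain U \<phi> S where U: "(U, \<phi>) \<in> \<A>" "p \<in> U" and S: "open S" "\<phi> p \<in> S" "S \<subseteq> \<phi> ` U"
    "smooth_on (f \<circ> inv_into U \<phi>) S"
    using f unfolding smooth_at_def by blast
  let ?T = "\<psi> ` (V \<inter> {q \<in> U. \<phi> q \<in> S})"
  note iV = smooth_atlasD(1)[OF A V(1)] and iU = smooth_atlasD(1)[OF A U(1)]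
  have oT: "open ?T" by (rule open_chart_preimage[OF A U(1) V(1) S(1)])
  have tr: "smooth_on (\<phi> \<circ> inv_into V \<psi>) ?T"
    by (rule smooth_on_subset[OF smooth_atlasD(4)[OF A V(1) U(1)]]) auto
  have "smooth_on (\<lambda>y. (f \<circ> inv_into U \<phi>) ((\<phi> \<circ> inv_into V \<psi>) y)) ?T"
    by (rule smooth_on_compose[OF oT S(1) _ tr S(4)]) (use iV in auto)
  then have "smooth_on (f \<circ> inv_into V \<psi>) ?T"
    by (rule smooth_on_cong[OF _ oT]) (use iV iU in auto)
  with that[OF oT] U V S show ?thesis by blast
qed

lemma Cinf_iff_smooth_at:
  fixes \<A> :: "('n, 'e::fin_dim_inner) atlas"
  assumes A: "smooth_atlas \<A>"
  shows "f \<in> Cinf \<A> \<longleftrightarrow> (\<forall>p\<in>point_set \<A>. smooth_at \<A> f p)"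
proof
  assume f: "f \<in> Cinf \<A>"
  show "\<forall>p\<in>point_set \<A>. smooth_at \<A> f p"
  proof
    fix p assume "p \<in> point_set \<A>"
    then obtain U \<phi> where U: "(U, \<phi>) \<in> \<A>" "p \<in> U" by (rule point_setE)
    then show "smooth_at \<A> f p"
      unfolding smooth_at_def using f smooth_atlasD(2)[OF A U(1)] by (force simp: Cinf_def)
  qed
next
  assume f: "\<forall>p\<in>point_set \<A>. smooth_at \<A> f p"
  have "smooth_on (f \<circ> inv_into V \<psi>) (\<psi> ` V)" if V: "(V, \<psi>) \<in> \<A>" for V \<psi>
  proof (rule smooth_on_local)
    fix y assume "y \<in> \<psi> ` V"
    then obtain p where p: "p \<in> V" "y = \<psi> p" by blast
    with f V have "smooth_at \<A> f p" using point_setI by fast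
    then show "\<exists>T. open T \<and> y \<in> T \<and> smooth_on (f \<circ> inv_into V \<psi>) T"
      using smooth_atE[OF A _ V p(1)] p(2) by metis
  qed
  then show "f \<in> Cinf \<A>" by (auto simp: Cinf_def)
qed

lemma smooth_at_cong:
  fixes \<A> :: "('n, 'e::fin_dim_inner) atlas"
  assumes A: "smooth_atlas \<A>" and "openin (atlas_topology \<A>) N" "p \<in> N" "smooth_at \<A> f p"
    "\<And>q. q \<in> N \<Longrightarrow> f q = g q"
  shows "smooth_at \<A> g p"
proof -
  have "p \<in> point_set \<A>" using assms by (auto simp: openin_atlas_topology)
  then obtain U \<phi> where U: "(U, \<phi>) \<in> \<A>" "p \<in> U" by (rule point_setE)
  obtain T where T: "open T" "\<phi> p \<in> T" "T \<subseteq> \<phi> ` U" "smooth_on (f \<circ> inv_into U \<phi>) T"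
    using smooth_atE[OF A assms(4) U] .
  let ?T = "T \<inter> \<phi> ` (U \<inter> N)"
  have o: "open ?T" using T(1) openin_chart_image[OF A U(1) assms(2)] by auto
  have "smooth_on (f \<circ> inv_into U \<phi>) ?T" using T(4) smooth_on_subset by blast
  then have "smooth_on (g \<circ> inv_into U \<phi>) ?T"
    by (rule smooth_on_cong[OF _ o]) (use assms(5) smooth_atlasD(1)[OF A U(1)] in auto)
  then show ?thesis
    unfolding smooth_at_def using o U T assms(3) by (intro exI[of _ U] exI[of _ \<phi>] exI[of _ ?T]) auto
qed

lemma Cinf_smooth_at:
  "smooth_atlas \<A> \<Longrightarrow> f \<in> Cinf \<A> \<Longrightarrow> p \<in> point_set \<A> \<Longrightarrow> smooth_at \<A> f p"
  for \<A> :: "('n, 'e::fin_dim_inner) atlas"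
  using Cinf_iff_smooth_at by blast

lemma CinfD: "f \<in> Cinf \<A> \<Longrightarrow> (U, \<phi>) \<in> \<A> \<Longrightarrow> smooth_on (f \<circ> inv_into U \<phi>) (\<phi> ` U)"
  by (auto simp: Cinf_def)

lemma CinfI: "(\<And>U \<phi>. (U, \<phi>) \<in> \<A> \<Longrightarrow> smooth_on (f \<circ> inv_into U \<phi>) (\<phi> ` U)) \<Longrightarrow> f \<in> Cinf \<A>"
  by (auto simp: Cinf_def)

lemma Cinf_cong:
  assumes "smooth_atlas \<A>" "f \<in> Cinf \<A>" "\<And>p. p \<in> point_set \<A> \<Longrightarrow> f p = g p"
  shows "g \<in> Cinf \<A>"
proof (rule CinfI)
  fix U \<phi> assume U: "(U, \<phi>) \<in> \<A>"
  show "smooth_on (g \<circ> inv_into U \<phi>) (\<phi> ` U)"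
    using CinfD[OF assms(2) U] smooth_atlasD(2)[OF assms(1) U]
    by (rule smooth_on_cong) (use assms(3) point_setI[OF U] inv_into_into[of _ \<phi> U] in auto)
qed

lemma Cinf_const: "smooth_atlas \<A> \<Longrightarrow> (\<lambda>_. c) \<in> Cinf \<A>"
  by (rule CinfI) (auto simp: o_def dest: smooth_atlasD(2))

lemma Cinf_add:
  assumes "smooth_atlas \<A>" "f \<in> Cinf \<A>" "g \<in> Cinf \<A>" shows "(\<lambda>q. f q + g q) \<in> Cinf \<A>"
  using smooth_on_add[OF smooth_atlasD(2)[OF assms(1)] CinfD[OF assms(2)] CinfD[OF assms(3)]]
  by (intro CinfI) (simp add: o_def)

lemma Cinf_mult:
  assumes "smooth_atlas \<A>" "f \<in> Cinf \<A>" "g \<in> Cinf \<A>" shows "(\<lambda>q. f q * g q) \<in> Cinf \<A>"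
  using smooth_on_mult[OF smooth_atlasD(2)[OF assms(1)] CinfD[OF assms(2)] CinfD[OF assms(3)]]
  by (intro CinfI) (simp add: o_def)

lemma Cinf_cmult: "smooth_atlas \<A> \<Longrightarrow> f \<in> Cinf \<A> \<Longrightarrow> (\<lambda>q. c * f q) \<in> Cinf \<A>"
  by (rule Cinf_mult[OF _ Cinf_const])

lemma Cinf_minus: "smooth_atlas \<A> \<Longrightarrow> f \<in> Cinf \<A> \<Longrightarrow> (\<lambda>q. - f q) \<in> Cinf \<A>"
  using Cinf_cmult[of \<A> f "- 1"] by simp

lemma Cinf_diff:
  "smooth_atlas \<A> \<Longrightarrow> f \<in> Cinf \<A> \<Longrightarrow> g \<in> Cinf \<A> \<Longrightarrow> (\<lambda>q. f q - g q) \<in> Cinf \<A>"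
  using Cinf_add[OF _ _ Cinf_minus, of \<A> f g] by simp

lemma Cinf_sum:
  "smooth_atlas \<A> \<Longrightarrow> (\<And>i. i \<in> I \<Longrightarrow> f i \<in> Cinf \<A>) \<Longrightarrow> (\<lambda>q. \<Sum>i\<in>I. f i q) \<in> Cinf \<A>"
  by (induction I rule: infinite_finite_induct) (auto intro: Cinf_const Cinf_add)

lemmas Cinf_intros = Cinf_const Cinf_add Cinf_mult Cinf_minus Cinf_diff Cinf_sum

lemma Cinf_compose:
  fixes h :: "real \<Rightarrow> real"
  assumes "smooth_atlas \<A>" "f \<in> Cinf \<A>" "open T" "f ` point_set \<A> \<subseteq> T" "smooth_on h T"
  shows "(\<lambda>q. h (f q)) \<in> Cinf \<A>"
proof (rule CinfI)
  fix U \<phi> assume U: "(U, \<phi>) \<in> \<A>"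
  have "smooth_on (\<lambda>x. h ((f \<circ> inv_into U \<phi>) x)) (\<phi> ` U)"
    by (rule smooth_on_compose[OF smooth_atlasD(2)[OF assms(1) U] assms(3) _ CinfD[OF assms(2) U] assms(5)])
      (use assms(4) point_setI[OF U] inv_into_into[of _ \<phi> U] in auto)
  then show "smooth_on ((\<lambda>q. h (f q)) \<circ> inv_into U \<phi>) (\<phi> ` U)"
    by (simp add: o_def)
qed

lemma chart_deriv_has_derivative:
  assumes "smooth_atlas \<A>" "(U, \<phi>) \<in> \<A>" "f \<in> Cinf \<A>" "q \<in> U"
  shows "((f \<circ> inv_into U \<phi>) has_derivative chart_deriv U \<phi> f q) (at (\<phi> q))"
  unfolding chart_deriv_def[abs_def]
  using smooth_on_has_derivative[OF CinfD[OF assms(3,2)]] assms(4) by blast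

lemma chart_deriv_eqI:
  assumes "((f \<circ> inv_into U \<phi>) has_derivative D) (at (\<phi> q))"
  shows "chart_deriv U \<phi> f q = D"
  using frechet_derivative_at[OF assms] by (auto simp: chart_deriv_def[abs_def])

lemma smooth_on_chart_deriv:
  assumes "smooth_atlas \<A>" "(U, \<phi>) \<in> \<A>" "f \<in> Cinf \<A>"
  shows "smooth_on ((\<lambda>q. chart_deriv U \<phi> f q w) \<circ> inv_into U \<phi>) (\<phi> ` U)"
  by (rule smooth_on_cong[OF smooth_on_frechet[OF CinfD[OF assms(3,2)], of w] smooth_atlasD(2)[OF assms(1,2)]])
    (use smooth_atlasD(1)[OF assms(1,2)] in \<open>auto simp: chart_deriv_def\<close>)

section \<open>Tangent vectors\<close>

lemma tangentD:
  assumes "v \<in> tangent_space \<A> p"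
  shows "f \<in> Cinf \<A> \<Longrightarrow> g \<in> Cinf \<A> \<Longrightarrow> v (\<lambda>q. f q + g q) = v f + v g"
    and "f \<in> Cinf \<A> \<Longrightarrow> g \<in> Cinf \<A> \<Longrightarrow> v (\<lambda>q. f q * g q) = v f * g p + f p * v g"
    and "f \<in> Cinf \<A> \<Longrightarrow> v (\<lambda>q. c * f q) = c * v f"
    and "f \<notin> Cinf \<A> \<Longrightarrow> v f = 0"
  using assms by (auto simp: tangent_space_def)

lemma tangentI:
  assumes "\<And>f g. f \<in> Cinf \<A> \<Longrightarrow> g \<in> Cinf \<A> \<Longrightarrow> v (\<lambda>q. f q + g q) = v f + v g"
    "\<And>f g. f \<in> Cinf \<A> \<Longrightarrow> g \<in> Cinf \<A> \<Longrightarrow> v (\<lambda>q. f q * g q) = v f * g p + f p * v g"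
    "\<And>c f. f \<in> Cinf \<A> \<Longrightarrow> v (\<lambda>q. c * f q) = c * v f"
    "\<And>f. f \<notin> Cinf \<A> \<Longrightarrow> v f = 0"
  shows "v \<in> tangent_space \<A> p"
  using assms by (auto simp: tangent_space_def)

lemma tangent_const: "smooth_atlas \<A> \<Longrightarrow> v \<in> tangent_space \<A> p \<Longrightarrow> v (\<lambda>_. c) = 0"
proof -
  assume A: "smooth_atlas \<A>" and v: "v \<in> tangent_space \<A> p"
  have "v (\<lambda>_. 1) = 0"
    using tangentD(2)[OF v Cinf_const[OF A, of 1] Cinf_const[OF A, of 1]] by simp
  then show ?thesis
    using tangentD(3)[OF v Cinf_const[OF A, of 1], of c] by simp
qed

lemma tangent_minus:
  "v \<in> tangent_space \<A> p \<Longrightarrow> f \<in> Cinf \<A> \<Longrightarrow> v (\<lambda>q. - f q) = - v f"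
  using tangentD(3)[of v \<A> p f "- 1"] by simp

lemma tangent_diff:
  "smooth_atlas \<A> \<Longrightarrow> v \<in> tangent_space \<A> p \<Longrightarrow> f \<in> Cinf \<A> \<Longrightarrow> g \<in> Cinf \<A> \<Longrightarrow>
    v (\<lambda>q. f q - g q) = v f - v g"
  using tangentD(1)[of v \<A> p f "\<lambda>q. - g q"] by (simp add: Cinf_minus tangent_minus)

lemma tangent_sum:
  assumes "smooth_atlas \<A>" "v \<in> tangent_space \<A> p" "\<And>i. i \<in> I \<Longrightarrow> f i \<in> Cinf \<A>"
  shows "v (\<lambda>q. \<Sum>i\<in>I. f i q) = (\<Sum>i\<in>I. v (f i))"
  using assms(3)
proof (induction I rule: infinite_finite_induct)
  case (insert i I)
  then show ?case
    using tangentD(1)[OF assms(2), of "f i" "\<lambda>q. \<Sum>i\<in>I. f i q"] by (auto intro: Cinf_sum assms(1))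
qed (auto simp: tangent_const[OF assms(1,2)])

text \<open>A function vanishing on the point set equals its product with any function that is 0 on the
  point set and 1 elsewhere.\<close>

lemma tangent_cong:
  assumes A: "smooth_atlas \<A>" and v: "v \<in> tangent_space \<A> p" and p: "p \<in> point_set \<A>"
    and f: "f \<in> Cinf \<A>" and eq: "\<And>q. q \<in> point_set \<A> \<Longrightarrow> f q = g q"
  shows "v f = v g"
proof -
  have g: "g \<in> Cinf \<A>" using Cinf_cong[OF A f] eq by blast
  define z :: "'a \<Rightarrow> real" where "z q = (if q \<in> point_set \<A> then 0 else 1)" for q
  have z: "z \<in> Cinf \<A>"
    by (rule Cinf_cong[OF A Cinf_const[OF A, of 0]]) (simp add: z_def)
  let ?h = "\<lambda>q. f q - g q"
  have h: "?h \<in> Cinf \<A>" using A f g by (rule Cinf_diff)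
  have "?h = (\<lambda>q. ?h q * z q)" using eq by (auto simp: z_def)
  then have "v ?h = v (\<lambda>q. ?h q * z q)" by (rule arg_cong)
  also have "\<dots> = 0"
    using tangentD(2)[OF v h z] eq[OF p] p by (simp add: z_def)
  finally show ?thesis using tangent_diff[OF A v f g] by simp
qed

lemma tangent_add_closed:
  "u \<in> tangent_space \<A> p \<Longrightarrow> v \<in> tangent_space \<A> p \<Longrightarrow> (\<lambda>f. u f + v f) \<in> tangent_space \<A> p"
  by (rule tangentI) (auto simp: tangentD algebra_simps)

lemma tangent_scale_closed: "v \<in> tangent_space \<A> p \<Longrightarrow> (\<lambda>f. c * v f) \<in> tangent_space \<A> p"
  by (rule tangentI) (auto simp: tangentD algebra_simps)

lemma tangent_zero_closed: "(\<lambda>f. 0) \<in> tangent_space \<A> p"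
  by (rule tangentI) auto

lemma tangent_minus_closed: "v \<in> tangent_space \<A> p \<Longrightarrow> (\<lambda>f. - v f) \<in> tangent_space \<A> p"
  using tangent_scale_closed[of v \<A> p "- 1"] by simp

lemma tangent_sum_closed:
  "(\<And>i. i \<in> I \<Longrightarrow> v i \<in> tangent_space \<A> p) \<Longrightarrow> (\<lambda>f. \<Sum>i\<in>I. v i f) \<in> tangent_space \<A> p"
  by (induction I rule: infinite_finite_induct)
    (auto intro: tangent_zero_closed tangent_add_closed)

lemma chart_deriv_tangent:
  assumes A: "smooth_atlas \<A>" and U: "(U, \<phi>) \<in> \<A>" and q: "q \<in> U"
  shows "(\<lambda>f. if f \<in> Cinf \<A> then chart_deriv U \<phi> f q w else 0) \<in> tangent_space \<A> q"
proof (rule tangentI, goal_cases)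
  case (1 f g)
  note D = chart_deriv_has_derivative[OF A U _ q]
  have "chart_deriv U \<phi> (\<lambda>q. f q + g q) q = (\<lambda>w. chart_deriv U \<phi> f q w + chart_deriv U \<phi> g q w)"
    using has_derivative_add[OF D[OF 1(1)] D[OF 1(2)]] by (intro chart_deriv_eqI) (simp add: o_def)
  then show ?case using 1 A by (simp add: Cinf_add)
next
  case (2 f g)
  note D = chart_deriv_has_derivative[OF A U _ q]
  have "chart_deriv U \<phi> (\<lambda>q. f q * g q) q = (\<lambda>w. f q * chart_deriv U \<phi> g q w + chart_deriv U \<phi> f q w * g q)"
    using has_derivative_mult[OF D[OF 2(1)] D[OF 2(2)]] q smooth_atlasD(1)[OF A U]
    by (intro chart_deriv_eqI) (simp add: o_def)
  then show ?case using 2 A by (simp add: Cinf_mult)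
next
  case (3 c f)
  note D = chart_deriv_has_derivative[OF A U _ q]
  have "chart_deriv U \<phi> (\<lambda>q. c * f q) q = (\<lambda>w. c * chart_deriv U \<phi> f q w)"
    using has_derivative_mult_right[OF D[OF 3]] by (intro chart_deriv_eqI) (simp add: o_def)
  then show ?case using 3 A by (simp add: Cinf_cmult)
qed simp

section \<open>Bump functions and coordinate expansion of derivations\<close>

text \<open>What is needed to extend functions supported near \<open>p\<close> by 0. Unlike the Hausdorff property, it passes
  to total spaces of bundles and to cylinders by a computation in charts.\<close>

definition separated :: "('n, 'e::real_normed_vector) atlas \<Rightarrow> bool" where
  "separated \<A> \<longleftrightarrow> (\<forall>(U, \<phi>)\<in>\<A>. \<forall>p\<in>U. \<exists>V T. openin (atlas_topology \<A>) V \<and> point_set \<A> \<subseteq> U \<union> V \<and>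
     open T \<and> \<phi> p \<in> T \<and> T \<subseteq> \<phi> ` U \<and> (\<forall>q\<in>U. \<phi> q \<in> T \<longrightarrow> q \<notin> V))"

text \<open>V is the complement of the chart preimage of a closed ball around the point. That
  preimage is compact, hence closed by the Hausdorff property.\<close>

lemma Hausdorff_separated:
  fixes \<A> :: "('n, 'e::fin_dim_inner) atlas"
  assumes A: "smooth_atlas \<A>" and H: "Hausdorff_space (atlas_topology \<A>)"
  shows "separated \<A>"
  unfolding separated_def
proof clarify
  fix U \<phi> p assume U: "(U, \<phi>) \<in> \<A>" and p: "p \<in> U"
  note iU = smooth_atlasD(1,2)[OF A U]
  obtain r where r: "r > 0" "cball (\<phi> p) r \<subseteq> \<phi> ` U"
    using iU(2) p open_contains_cball by blast
  let ?K = "inv_into U \<phi> ` cball (\<phi> p) r"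
  have inv: "\<And>y. y \<in> \<phi> ` U \<Longrightarrow> inv_into U \<phi> y \<in> U" by (rule inv_into_into)
  have "continuous_map (top_of_set (\<phi> ` U)) (atlas_topology \<A>) (inv_into U \<phi>)"
    unfolding continuous_map_def
  proof (intro conjI allI impI funcsetI)
    show "inv_into U \<phi> y \<in> topspace (atlas_topology \<A>)" if "y \<in> topspace (top_of_set (\<phi> ` U))" for y
      using that inv point_setI[OF U] by (auto simp: topspace_atlas_topology[OF A])
    fix N assume N: "openin (atlas_topology \<A>) N"
    have "{y \<in> topspace (top_of_set (\<phi> ` U)). inv_into U \<phi> y \<in> N} = \<phi> ` (U \<inter> N)"
    proof (intro equalityI subsetI)
      fix y assume "y \<in> {y \<in> topspace (top_of_set (\<phi> ` U)). inv_into U \<phi> y \<in> N}"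
      then show "y \<in> \<phi> ` (U \<inter> N)"
        using inv[of y] by (intro image_eqI[of _ \<phi> "inv_into U \<phi> y"]) (auto simp: f_inv_into_f)
    qed (use iU(1) in auto)
    then show "openin (top_of_set (\<phi> ` U)) {y \<in> topspace (top_of_set (\<phi> ` U)). inv_into U \<phi> y \<in> N}"
      using openin_chart_image[OF A U N] iU(2) by (auto simp: openin_open_eq)
  qed
  moreover have "compactin (top_of_set (\<phi> ` U)) (cball (\<phi> p) r)"
    using r(2) by (simp add: compactin_subtopology compact_eq_bounded_closed)
  ultimately have "compactin (atlas_topology \<A>) ?K"
    by (rule image_compactin[rotated])
  then have "closedin (atlas_topology \<A>) ?K"
    by (rule compactin_imp_closedin[OF H])
  then have V: "openin (atlas_topology \<A>) (point_set \<A> - ?K)"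
    by (simp add: closedin_def topspace_atlas_topology[OF A])
  show "\<exists>V T. openin (atlas_topology \<A>) V \<and> point_set \<A> \<subseteq> U \<union> V \<and>
     open T \<and> \<phi> p \<in> T \<and> T \<subseteq> \<phi> ` U \<and> (\<forall>q\<in>U. \<phi> q \<in> T \<longrightarrow> q \<notin> V)"
  proof (intro exI conjI ballI impI)
    show "openin (atlas_topology \<A>) (point_set \<A> - ?K)" by (rule V)
    show "point_set \<A> \<subseteq> U \<union> (point_set \<A> - ?K)" using r inv by blast
    show "open (ball (\<phi> p) r)" "\<phi> p \<in> ball (\<phi> p) r" using r by auto
    show "ball (\<phi> p) r \<subseteq> \<phi> ` U" using r(2) by auto
    fix q assume q: "q \<in> U" "\<phi> q \<in> ball (\<phi> p) r"
    then have "q = inv_into U \<phi> (\<phi> q)" using iU(1) by simp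
    then show "q \<notin> point_set \<A> - ?K" using q(2) by (metis DiffD2 ball_subset_cball imageI subsetD)
  qed
qed

text \<open>The open set V is delivered along with \<open>\<theta>\<close> so that a product with
  \<open>\<theta>\<close> can be extended by 0: near each point either the product is 0 or the point
  lies in the chart over S.\<close>

lemma separated_bump:
  fixes \<A> :: "('n, 'e::fin_dim_inner) atlas"
  assumes A: "smooth_atlas \<A>" and sep: "separated \<A>" and U: "(U, \<phi>) \<in> \<A>" and p: "p \<in> U"
    and S: "open S" "\<phi> p \<in> S" "S \<subseteq> \<phi> ` U"
  obtains \<theta> V T where "\<theta> \<in> Cinf \<A>" "openin (atlas_topology \<A>) V"
    "\<And>q. q \<in> point_set \<A> \<Longrightarrow> q \<in> V \<or> q \<in> U \<and> \<phi> q \<in> S" "\<And>q. q \<in> V \<Longrightarrow> \<theta> q = 0"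
    "open T" "\<phi> p \<in> T" "T \<subseteq> S" "\<And>q. q \<in> U \<Longrightarrow> \<phi> q \<in> T \<Longrightarrow> \<theta> q = 1"
proof -
  note iU = smooth_atlasD(1,2)[OF A U]
  obtain V0 T0 where V0: "openin (atlas_topology \<A>) V0" "point_set \<A> \<subseteq> U \<union> V0" "open T0" "\<phi> p \<in> T0"
     "T0 \<subseteq> \<phi> ` U" "\<forall>q\<in>U. \<phi> q \<in> T0 \<longrightarrow> q \<notin> V0"
    using bspec[OF sep[unfolded separated_def] U] p by blast
  have o: "open (S \<inter> T0)" "\<phi> p \<in> S \<inter> T0" using S V0 by auto
  obtain \<beta> :: "'e \<Rightarrow> real" and T K where \<beta>: "smooth_on \<beta> UNIV" "open T" "\<phi> p \<in> T" "compact K" "T \<subseteq> K"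
    "K \<subseteq> S \<inter> T0" "\<And>x. x \<in> T \<Longrightarrow> \<beta> x = 1" "\<And>x. x \<notin> K \<Longrightarrow> \<beta> x = 0"
    by (rule smooth_bump[OF o]) auto
  \<comment> \<open>V joins the part outside the chart to the chart points outside the support K.
    Since K lies in T0 and T0 misses V0, \<open>\<theta>\<close> vanishes on V0 as well.\<close>
  define V where "V = V0 \<union> {q \<in> U. \<phi> q \<in> - K}"
  define \<theta> where "\<theta> q = (if q \<in> U then \<beta> (\<phi> q) else 0)" for q
  have V: "openin (atlas_topology \<A>) V"
    unfolding V_def using \<beta>(4)
    by (intro openin_Un V0(1) openin_chart_preimage[OF A U]) (auto simp: compact_imp_closed open_Compl)
  have \<theta>0: "\<theta> q = 0" if "q \<in> V" for q
    using that V0(6) \<beta>(6,8) by (auto simp: V_def \<theta>_def)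
  have cover: "q \<in> V \<or> q \<in> U \<and> \<phi> q \<in> K" if "q \<in> point_set \<A>" for q
    using that V0(2) by (auto simp: V_def)
  have "\<theta> \<in> Cinf \<A>"
    unfolding Cinf_iff_smooth_at[OF A]
  proof
    fix q assume q: "q \<in> point_set \<A>"
    show "smooth_at \<A> \<theta> q"
    proof (cases "q \<in> V")
      case True
      show ?thesis
        by (rule smooth_at_cong[OF A V True Cinf_smooth_at[OF A Cinf_const[OF A, of 0] q]]) (simp add: \<theta>0)
    next
      case False
      then have q: "q \<in> U" using cover q by blast
      have "smooth_on \<beta> (\<phi> ` U)" using \<beta>(1) smooth_on_subset by blast
      then have "smooth_on (\<theta> \<circ> inv_into U \<phi>) (\<phi> ` U)"
        by (rule smooth_on_cong[OF _ iU(2)]) (use iU(1) in \<open>auto simp: \<theta>_def\<close>)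
      then show ?thesis
        unfolding smooth_at_def using U q iU by blast
    qed
  qed
  then show ?thesis
  proof (rule that[OF _ V])
    show "q \<in> V \<or> q \<in> U \<and> \<phi> q \<in> S" if "q \<in> point_set \<A>" for q
      using cover[OF that] \<beta>(6) by blast
    show "T \<subseteq> S" using \<beta>(5,6) by blast
    show "\<theta> q = 1" if "q \<in> U" "\<phi> q \<in> T" for q
      using that \<beta>(7) by (simp add: \<theta>_def)
  qed (use \<theta>0 \<beta> in auto)
qed

lemma bump_extend:
  fixes \<A> :: "('n, 'e::fin_dim_inner) atlas"
  assumes A: "smooth_atlas \<A>" and U: "(U, \<phi>) \<in> \<A>" and S: "open S" "S \<subseteq> \<phi> ` U"
    and \<theta>: "\<theta> \<in> Cinf \<A>" and V: "openin (atlas_topology \<A>) V"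
    "\<And>q. q \<in> point_set \<A> \<Longrightarrow> q \<in> V \<or> q \<in> U \<and> \<phi> q \<in> S" "\<And>q. q \<in> V \<Longrightarrow> \<theta> q = 0"
    and h: "smooth_on (h \<circ> inv_into U \<phi>) S"
  shows "(\<lambda>q. if q \<in> U \<and> \<phi> q \<in> S then \<theta> q * h q else 0) \<in> Cinf \<A>" (is "?f \<in> _")
  unfolding Cinf_iff_smooth_at[OF A]
proof
  fix q assume q: "q \<in> point_set \<A>"
  note iU = smooth_atlasD(1,2)[OF A U]
  show "smooth_at \<A> ?f q"
  proof (cases "q \<in> V")
    case True
    show ?thesis
      by (rule smooth_at_cong[OF A V(1) True Cinf_smooth_at[OF A Cinf_const[OF A, of 0] q]]) (simp add: V(3))
  next
    case False
    then have q: "q \<in> U" "\<phi> q \<in> S" using V q by auto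
    have "smooth_on (\<lambda>x. (\<theta> \<circ> inv_into U \<phi>) x * (h \<circ> inv_into U \<phi>) x) S"
      using smooth_on_subset[OF CinfD[OF \<theta> U] S(2)] S(1) h by (intro smooth_on_mult)
    then have "smooth_on (?f \<circ> inv_into U \<phi>) S"
      by (rule smooth_on_cong[OF _ S(1)]) (use S(2) iU(1) in \<open>auto simp: f_inv_into_f\<close>)
    then show ?thesis
      unfolding smooth_at_def using U q S by blast
  qed
qed

text \<open>Coordinates live on a chart, while tangent vectors act on global functions; a bump
  function supplies global functions that are coordinates near p.\<close>

lemma coordinate_functions:
  fixes \<A> :: "('n, 'e::fin_dim_inner) atlas"
  assumes A: "smooth_atlas \<A>" and sep: "separated \<A>" and U: "(U, \<phi>) \<in> \<A>" and p: "p \<in> U"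
  obtains \<xi> T where "\<And>w. \<xi> w \<in> Cinf \<A>" "open T" "\<phi> p \<in> T" "T \<subseteq> \<phi> ` U"
    "\<And>w q. q \<in> U \<Longrightarrow> \<phi> q \<in> T \<Longrightarrow> \<xi> w q = w \<bullet> \<phi> q"
proof -
  note iU = smooth_atlasD(1,2)[OF A U]
  obtain \<theta> V T where \<theta>: "\<theta> \<in> Cinf \<A>" "openin (atlas_topology \<A>) V"
    "\<And>q. q \<in> point_set \<A> \<Longrightarrow> q \<in> V \<or> q \<in> U \<and> \<phi> q \<in> \<phi> ` U" "\<And>q. q \<in> V \<Longrightarrow> \<theta> q = 0"
    "open T" "\<phi> p \<in> T" "T \<subseteq> \<phi> ` U" "\<And>q. q \<in> U \<Longrightarrow> \<phi> q \<in> T \<Longrightarrow> \<theta> q = 1"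
    using separated_bump[OF A sep U p iU(2)] p by blast
  define \<xi> where "\<xi> w q = (if q \<in> U \<and> \<phi> q \<in> \<phi> ` U then \<theta> q * (w \<bullet> \<phi> q) else 0)" for w q
  have "\<xi> w \<in> Cinf \<A>" for w
    unfolding \<xi>_def
  proof (rule bump_extend[OF A U iU(2) order_refl \<theta>(1-4)])
    show "smooth_on ((\<lambda>q. w \<bullet> \<phi> q) \<circ> inv_into U \<phi>) (\<phi> ` U)"
      using smooth_on_inner[OF iU(2) smooth_on_const[OF iU(2)] smooth_on_id[OF iU(2)], of w]
      by (rule smooth_on_cong[OF _ iU(2)]) (auto simp: f_inv_into_f)
  qed auto
  then show ?thesis
    using that[of \<xi> T] \<theta> by (auto simp: \<xi>_def)
qed

text \<open>Hadamard's lemma writes f - f q near q as a sum of products of coordinate differences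
  with smooth functions, and a derivation at q sees only the values of the latter at q. The
  coordinate functions are a hypothesis, so that one choice serves all q near a point and the
  coefficients can be studied as functions of q.\<close>

lemma tangent_expand:
  fixes \<A> :: "('n, 'e::fin_dim_inner) atlas"
  assumes A: "smooth_atlas \<A>" and sep: "separated \<A>" and U: "(U, \<phi>) \<in> \<A>" and q: "q \<in> U"
    and \<xi>: "\<And>b. b \<in> onb \<Longrightarrow> \<xi> b \<in> Cinf \<A>" and S: "open S" "\<phi> q \<in> S" "S \<subseteq> \<phi> ` U"
    and \<xi>_eq: "\<And>b x. b \<in> onb \<Longrightarrow> x \<in> U \<Longrightarrow> \<phi> x \<in> S \<Longrightarrow> \<xi> b x = b \<bullet> \<phi> x"
    and v: "v \<in> tangent_space \<A> q" and f: "f \<in> Cinf \<A>"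
  shows "v f = (\<Sum>b\<in>onb. v (\<xi> b) * chart_deriv U \<phi> f q b)"
proof -
  note iU = smooth_atlasD(1,2)[OF A U]
  obtain r where r: "r > 0" "ball (\<phi> q) r \<subseteq> S"
    by (rule openE[OF S(1,2)])
  let ?B = "ball (\<phi> q) r"
  have B: "open ?B" "\<phi> q \<in> ?B" "?B \<subseteq> \<phi> ` U" using r S by auto
  obtain g where g: "\<And>b. smooth_on (g b) ?B"
    "\<And>x. x \<in> ?B \<Longrightarrow> (f \<circ> inv_into U \<phi>) x = (f \<circ> inv_into U \<phi>) (\<phi> q) + (\<Sum>b\<in>onb. ((x - \<phi> q) \<bullet> b) * g b x)"
    "\<And>b. g b (\<phi> q) = frechet_derivative (f \<circ> inv_into U \<phi>) (at (\<phi> q)) b"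
  proof (rule hadamard[OF smooth_on_subset[OF CinfD[OF f U] B(3)] r(1)], goal_cases)
    case (1 g)
    show thesis by (rule that[of g]) (fact 1)+
  qed
  obtain \<theta> V T where \<theta>: "\<theta> \<in> Cinf \<A>" "openin (atlas_topology \<A>) V"
    "\<And>q. q \<in> point_set \<A> \<Longrightarrow> q \<in> V \<or> q \<in> U \<and> \<phi> q \<in> ?B" "\<And>q. q \<in> V \<Longrightarrow> \<theta> q = 0"
    "open T" "\<phi> q \<in> T" "T \<subseteq> ?B" "\<And>q. q \<in> U \<Longrightarrow> \<phi> q \<in> T \<Longrightarrow> \<theta> q = 1"
    using separated_bump[OF A sep U q B] by blast
  have \<theta>q: "\<theta> q = 1" using \<theta> q by blast
  define G where "G b x = (if x \<in> U \<and> \<phi> x \<in> ?B then \<theta> x * g b (\<phi> x) else 0)" for b x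
  have G: "G b \<in> Cinf \<A>" for b
    unfolding G_def
  proof (rule bump_extend[OF A U B(1,3) \<theta>(1-4)])
    show "smooth_on ((\<lambda>x. g b (\<phi> x)) \<circ> inv_into U \<phi>) ?B"
      by (rule smooth_on_cong[OF g(1) B(1)]) (use B(3) in \<open>auto simp: f_inv_into_f\<close>)
  qed auto
  define X where "X b x = \<theta> x * (\<xi> b x - \<xi> b q)" for b x
  have X: "X b \<in> Cinf \<A>" if "b \<in> onb" for b
    unfolding X_def using A \<theta>(1) \<xi>[OF that] by (intro Cinf_intros)
  have X0: "X b q = 0" for b by (simp add: X_def)
  have vX: "v (X b) = v (\<xi> b)" if "b \<in> onb" for b
    unfolding X_def
    using tangentD(2)[OF v \<theta>(1) Cinf_diff[OF A \<xi>[OF that] Cinf_const[OF A, of "\<xi> b q"]]]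
      tangent_diff[OF A v \<xi>[OF that] Cinf_const[OF A]] tangent_const[OF A v] \<theta>q by simp
  have D: "(\<lambda>x. \<theta> x * (f x - f q)) \<in> Cinf \<A>"
    using A \<theta>(1) f by (intro Cinf_intros)
  \<comment> \<open>One factor \<open>\<theta>\<close> is spent on globalising the coordinate
    differences, the other on the functions from Hadamard's lemma. Neither changes the value of v,
    as \<open>\<theta> q\<close> = 1 and f - f q vanishes at q.\<close>
  have "v (\<lambda>x. \<theta> x * (\<theta> x * (f x - f q))) = v (\<lambda>x. \<theta> x * (f x - f q))"
    using tangentD(2)[OF v \<theta>(1) D] \<theta>q by simp
  also have "\<dots> = v f"
    using tangentD(2)[OF v \<theta>(1) Cinf_diff[OF A f Cinf_const[OF A, of "f q"]]] \<theta>q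
      tangent_diff[OF A v f Cinf_const[OF A]] tangent_const[OF A v] by simp
  finally have "v f = v (\<lambda>x. \<theta> x * (\<theta> x * (f x - f q)))" by simp
  also have "\<dots> = v (\<lambda>x. \<Sum>b\<in>onb. X b x * G b x)"
  proof (rule tangent_cong[OF A v point_setI[OF U q]])
    show "(\<lambda>x. \<theta> x * (\<theta> x * (f x - f q))) \<in> Cinf \<A>"
      by (rule Cinf_mult[OF A \<theta>(1) D])
    fix x assume x: "x \<in> point_set \<A>"
    show "\<theta> x * (\<theta> x * (f x - f q)) = (\<Sum>b\<in>onb. X b x * G b x)"
    proof (cases "x \<in> V")
      case True
      then show ?thesis by (simp add: \<theta>(4) X_def)
    next
      case False
      then have x: "x \<in> U" "\<phi> x \<in> ?B" using \<theta>(3) x by auto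
      have "f x - f q = (\<Sum>b\<in>onb. ((\<phi> x - \<phi> q) \<bullet> b) * g b (\<phi> x))"
        using g(2)[OF x(2)] x(1) q iU(1) by simp
      also have "\<dots> = (\<Sum>b\<in>onb. (\<xi> b x - \<xi> b q) * g b (\<phi> x))"
      proof (rule sum.cong[OF refl])
        fix b :: 'e assume b: "b \<in> onb"
        have "\<phi> x \<in> S" using x(2) r(2) by blast
        then show "((\<phi> x - \<phi> q) \<bullet> b) * g b (\<phi> x) = (\<xi> b x - \<xi> b q) * g b (\<phi> x)"
          using \<xi>_eq[OF b] x q S by (simp add: inner_diff_right inner_commute[of _ b])
      qed
      finally show ?thesis
        using x by (simp add: X_def G_def sum_distrib_left mult_ac)
    qed
  qed
  also have "\<dots> = (\<Sum>b\<in>onb. v (\<lambda>x. X b x * G b x))"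
    by (rule tangent_sum[OF A v]) (intro Cinf_mult[OF A] X G)
  also have "\<dots> = (\<Sum>b\<in>onb. v (\<xi> b) * chart_deriv U \<phi> f q b)"
  proof (rule sum.cong[OF refl])
    fix b :: 'e assume b: "b \<in> onb"
    have "G b q = chart_deriv U \<phi> f q b"
      using q \<theta>q B(2) g(3) by (simp add: G_def chart_deriv_def)
    then show "v (\<lambda>x. X b x * G b x) = v (\<xi> b) * chart_deriv U \<phi> f q b"
      using tangentD(2)[OF v X[OF b] G[of b]] X0[of b] vX[OF b] by simp
  qed
  finally show ?thesis .
qed

lemma tangent_chart_vector:
  fixes \<A> :: "('n, 'e::fin_dim_inner) atlas"
  assumes A: "smooth_atlas \<A>" and sep: "separated \<A>" and U: "(U, \<phi>) \<in> \<A>" and q: "q \<in> U"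
    and v: "v \<in> tangent_space \<A> q"
  obtains w where "\<And>f. f \<in> Cinf \<A> \<Longrightarrow> v f = chart_deriv U \<phi> f q w"
proof -
  obtain \<xi> T where \<xi>: "\<And>w. \<xi> w \<in> Cinf \<A>" "open T" "\<phi> q \<in> T" "T \<subseteq> \<phi> ` U"
    "\<And>w x. x \<in> U \<Longrightarrow> \<phi> x \<in> T \<Longrightarrow> \<xi> w x = w \<bullet> \<phi> x"
    using coordinate_functions[OF A sep U q] by metis
  have "v f = chart_deriv U \<phi> f q (\<Sum>b\<in>onb. v (\<xi> b) *\<^sub>R b)" if f: "f \<in> Cinf \<A>" for f
  proof -
    have lin: "linear (chart_deriv U \<phi> f q)"
      using chart_deriv_has_derivative[OF A U f q] has_derivative_linear by blast
    have "v f = (\<Sum>b\<in>onb. v (\<xi> b) * chart_deriv U \<phi> f q b)"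
      by (rule tangent_expand[OF A sep U q _ \<xi>(2-4) _ v f]) (use \<xi> in auto)
    then show ?thesis
      by (simp add: linear_sum[OF lin] linear_cmul[OF lin])
  qed
  then show ?thesis by (rule that)
qed

section \<open>Bivectors and first-order functionals\<close>

lemma bivector_spaceD:
  assumes "B \<in> bivector_space \<A> p"
  shows "B f g = - B g f" and "(\<lambda>f. B f g) \<in> tangent_space \<A> p" and "(\<lambda>g. B f g) \<in> tangent_space \<A> p"
    and "f \<notin> Cinf \<A> \<Longrightarrow> B f g = 0" and "g \<notin> Cinf \<A> \<Longrightarrow> B f g = 0"
proof -
  obtain k :: nat and u v where uv: "\<And>i. i < k \<Longrightarrow> u i \<in> tangent_space \<A> p"
    "\<And>i. i < k \<Longrightarrow> v i \<in> tangent_space \<A> p"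
    and B: "B = (\<lambda>f g. \<Sum>i<k. u i f * v i g - u i g * v i f)"
    using assms unfolding bivector_space_def by blast
  show skew: "B f g = - B g f" for f g
    unfolding B by (simp add: sum_negf[symmetric] mult.commute)
  have "(\<lambda>g. u i f * v i g - u i g * v i f) \<in> tangent_space \<A> p" if "i < k" for i f
  proof -
    have "(\<lambda>g. u i f * v i g + (- v i f) * u i g) \<in> tangent_space \<A> p"
      by (intro tangent_add_closed tangent_scale_closed uv that)
    then show ?thesis by (simp add: mult.commute)
  qed
  then show T: "(\<lambda>g. B f g) \<in> tangent_space \<A> p" for f
    unfolding B by (intro tangent_sum_closed) auto
  show T': "(\<lambda>f. B f g) \<in> tangent_space \<A> p" for g
    by (rule back_subst[of "\<lambda>B. B \<in> tangent_space \<A> p", OF tangent_minus_closed[OF T[of g]]]) (simp add: skew[of _ g])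
  show "f \<notin> Cinf \<A> \<Longrightarrow> B f g = 0" using tangentD(4)[OF T'] .
  show "g \<notin> Cinf \<A> \<Longrightarrow> B f g = 0" using tangentD(4)[OF T] .
qed

text \<open>Coordinate expansion in the second slot writes B as a sum of products of B(-,
  \<open>\<xi> b\<close>) with the partial derivative along b. Antisymmetrising these products
  counts B twice, whence the factor 1/2 in \<open>u\<close>; the enumeration \<open>e\<close> fits
  the sum to the index set demanded by \<open>bivector_space\<close>.\<close>

lemma skew_biderivation_in_bivector_space:
  fixes \<A> :: "('n, 'e::fin_dim_inner) atlas"
  assumes A: "smooth_atlas \<A>" and sep: "separated \<A>" and p: "p \<in> point_set \<A>"
    and skew: "\<And>f g. B f g = - B g f" and T: "\<And>f. f \<in> Cinf \<A> \<Longrightarrow> (\<lambda>g. B f g) \<in> tangent_space \<A> p"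
    and 0: "\<And>f g. f \<notin> Cinf \<A> \<Longrightarrow> B f g = 0"
  shows "B \<in> bivector_space \<A> p"
proof -
  have T': "(\<lambda>f. B f g) \<in> tangent_space \<A> p" if "g \<in> Cinf \<A>" for g
    by (rule back_subst[of "\<lambda>B. B \<in> tangent_space \<A> p", OF tangent_minus_closed[OF T[OF that]]]) (simp add: skew[of _ g])
  obtain U \<phi> where U: "(U, \<phi>) \<in> \<A>" "p \<in> U" using p by (rule point_setE)
  obtain \<xi> T where \<xi>: "\<And>w. \<xi> w \<in> Cinf \<A>" "open T" "\<phi> p \<in> T" "T \<subseteq> \<phi> ` U"
    "\<And>w x. x \<in> U \<Longrightarrow> \<phi> x \<in> T \<Longrightarrow> \<xi> w x = w \<bullet> \<phi> x"
    using coordinate_functions[OF A sep U] by metis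
  define u where "u b f = (1/2) * B f (\<xi> b)" for b f
  define v where "v b g = (if g \<in> Cinf \<A> then chart_deriv U \<phi> g p b else 0)" for b g
  have u: "u b \<in> tangent_space \<A> p" for b
    unfolding u_def[abs_def] by (intro tangent_scale_closed T' \<xi>)
  have v: "v b \<in> tangent_space \<A> p" for b
    unfolding v_def[abs_def] by (rule chart_deriv_tangent[OF A U])
  have half: "(\<Sum>b\<in>onb. u b f * v b g) = (1/2) * B f g" for f g
  proof (cases "f \<in> Cinf \<A> \<and> g \<in> Cinf \<A>")
    case True
    have "B f g = (\<Sum>b\<in>onb. B f (\<xi> b) * chart_deriv U \<phi> g p b)"
      by (rule tangent_expand[OF A sep U _ \<xi>(2-4) _ T]) (use \<xi> True in auto)
    then show ?thesis using True by (simp add: u_def v_def sum_distrib_left)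
  next
    case False
    then have "B f g = 0" using 0 skew by (metis neg_equal_0_iff_equal)
    moreover have "u b f * v b g = 0" for b
      using False 0 by (auto simp: u_def v_def)
    ultimately show ?thesis by (simp only: sum.neutral_const mult_zero_right)
  qed
  obtain e where e: "bij_betw e {0..<card (onb::'e set)} (onb::'e set)"
    using ex_bij_betw_nat_finite[OF finite_onb[where 'a='e]] by blast
  have "B f g = (\<Sum>i<card (onb::'e set). u (e i) f * v (e i) g - u (e i) g * v (e i) f)" for f g
  proof -
    have "B f g = (1/2) * B f g - (1/2) * B g f" using skew[of g f] by simp
    also have "\<dots> = (\<Sum>b\<in>onb. u b f * v b g - u b g * v b f)"
      by (simp only: sum_subtractf half[symmetric])
    also have "\<dots> = (\<Sum>i\<in>{0..<card (onb::'e set)}. u (e i) f * v (e i) g - u (e i) g * v (e i) f)"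
      by (rule sum.reindex_bij_betw[OF e, symmetric])
    finally show ?thesis by (simp add: atLeast0LessThan)
  qed
  then have "B = (\<lambda>f g. \<Sum>i<card (onb::'e set). u (e i) f * v (e i) g - u (e i) g * v (e i) f)"
    by blast
  then show ?thesis unfolding bivector_space_def using u v
    by (intro CollectI exI[of _ "card (onb::'e set)"] exI[of _ "u \<circ> e"] exI[of _ "v \<circ> e"]) simp
qed

lemma vector_fieldD:
  assumes "vector_field \<A> X"
  shows "p \<in> point_set \<A> \<Longrightarrow> X p \<in> tangent_space \<A> p" "p \<notin> point_set \<A> \<Longrightarrow> X p f = 0"
    "f \<in> Cinf \<A> \<Longrightarrow> (\<lambda>p. X p f) \<in> Cinf \<A>" "f \<notin> Cinf \<A> \<Longrightarrow> X p f = 0"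
  using assms tangentD(4)[of "X p" \<A> p f] by (auto simp: vector_field_def, metis)

lemma bivector_fieldD:
  assumes "bivector_field \<A> P"
  shows "p \<in> point_set \<A> \<Longrightarrow> P p \<in> bivector_space \<A> p" "p \<notin> point_set \<A> \<Longrightarrow> P p f g = 0"
    "f \<in> Cinf \<A> \<Longrightarrow> g \<in> Cinf \<A> \<Longrightarrow> (\<lambda>p. P p f g) \<in> Cinf \<A>"
    "P p f g = - P p g f"
    "p \<in> point_set \<A> \<Longrightarrow> P p f \<in> tangent_space \<A> p"
    "p \<in> point_set \<A> \<Longrightarrow> (\<lambda>f. P p f g) \<in> tangent_space \<A> p"
    "f \<notin> Cinf \<A> \<Longrightarrow> P p f g = 0" "g \<notin> Cinf \<A> \<Longrightarrow> P p f g = 0"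
proof -
  show 1: "P p \<in> bivector_space \<A> p" if "p \<in> point_set \<A>" for p
    using assms that by (auto simp: bivector_field_def)
  show 2: "P p f g = 0" if "p \<notin> point_set \<A>" for p f g
    using assms that by (auto simp: bivector_field_def)
  show "(\<lambda>p. P p f g) \<in> Cinf \<A>" if "f \<in> Cinf \<A>" "g \<in> Cinf \<A>"
    using assms that by (auto simp: bivector_field_def)
  show "P p f g = - P p g f"
    using bivector_spaceD(1)[OF 1, of p f g] 2[of p] by (cases "p \<in> point_set \<A>") auto
  show "P p f \<in> tangent_space \<A> p" if "p \<in> point_set \<A>"
    using bivector_spaceD(3)[OF 1[OF that], of f] by simp
  show "(\<lambda>f. P p f g) \<in> tangent_space \<A> p" if "p \<in> point_set \<A>"
    using bivector_spaceD(2)[OF 1[OF that], of g] by simp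
  show "P p f g = 0" if "f \<notin> Cinf \<A>"
    using bivector_spaceD(4)[OF 1 that] 2[of p] by (cases "p \<in> point_set \<A>") auto
  show "P p f g = 0" if "g \<notin> Cinf \<A>"
    using bivector_spaceD(5)[OF 1 that] 2[of p] by (cases "p \<in> point_set \<A>") auto
qed

lemma bivector_fieldI:
  fixes \<A> :: "('n, 'e::fin_dim_inner) atlas"
  assumes A: "smooth_atlas \<A>" and sep: "separated \<A>"
    and "\<And>p f g. P p f g = - P p g f"
    "\<And>p f. p \<in> point_set \<A> \<Longrightarrow> f \<in> Cinf \<A> \<Longrightarrow> P p f \<in> tangent_space \<A> p"
    "\<And>p f g. p \<in> point_set \<A> \<Longrightarrow> f \<notin> Cinf \<A> \<Longrightarrow> P p f g = 0"
    "\<And>p f g. p \<notin> point_set \<A> \<Longrightarrow> P p f g = 0"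
    "\<And>f g. f \<in> Cinf \<A> \<Longrightarrow> g \<in> Cinf \<A> \<Longrightarrow> (\<lambda>p. P p f g) \<in> Cinf \<A>"
  shows "bivector_field \<A> P"
  unfolding bivector_field_def
proof (intro conjI ballI allI impI)
  show "P p \<in> bivector_space \<A> p" if p: "p \<in> point_set \<A>" for p
    by (rule skew_biderivation_in_bivector_space[OF A sep p assms(3) assms(4)[OF p] assms(5)[OF p]])
  show "P p = (\<lambda>_ _. 0)" if "p \<notin> point_set \<A>" for p
    using assms(6)[OF that] by blast
  show "(\<lambda>p. P p f g) \<in> Cinf \<A>" if "f \<in> Cinf \<A>" "g \<in> Cinf \<A>" for f g
    using assms(7)[OF that] .
qed

lemma vector_field_zero: "smooth_atlas \<A> \<Longrightarrow> vector_field \<A> (\<lambda>_ _. 0)"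
  by (auto simp: vector_field_def tangent_zero_closed Cinf_const)

lemma wedge_bivector_field:
  fixes \<A> :: "('n, 'e::fin_dim_inner) atlas"
  assumes A: "smooth_atlas \<A>" and sep: "separated \<A>" and X: "vector_field \<A> X" and Y: "vector_field \<A> Y"
  shows "bivector_field \<A> (wedge X Y)"
proof (rule bivector_fieldI[OF A sep])
  fix p f assume p: "p \<in> point_set \<A>"
  have "(\<lambda>g. X p f * Y p g + (- Y p f) * X p g) \<in> tangent_space \<A> p"
    by (intro tangent_add_closed tangent_scale_closed vector_fieldD(1)[OF X p] vector_fieldD(1)[OF Y p])
  then show "wedge X Y p f \<in> tangent_space \<A> p"
    by (simp add: wedge_def mult.commute)
next
  fix f g assume "f \<in> Cinf \<A>" "g \<in> Cinf \<A>"
  then show "(\<lambda>p. wedge X Y p f g) \<in> Cinf \<A>"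
    unfolding wedge_def by (intro Cinf_intros A vector_fieldD(3)[OF X] vector_fieldD(3)[OF Y])
qed (use vector_fieldD(2,4)[OF X] vector_fieldD(2,4)[OF Y] in \<open>auto simp: wedge_def\<close>)

lemma bivector_field_diff:
  fixes \<A> :: "('n, 'e::fin_dim_inner) atlas"
  assumes A: "smooth_atlas \<A>" and sep: "separated \<A>" and P: "bivector_field \<A> P" and Q: "bivector_field \<A> Q"
  shows "bivector_field \<A> (\<lambda>p f g. P p f g - Q p f g)"
proof (rule bivector_fieldI[OF A sep])
  fix p f assume p: "p \<in> point_set \<A>"
  have "(\<lambda>g. P p f g + - Q p f g) \<in> tangent_space \<A> p"
    by (intro tangent_add_closed tangent_minus_closed bivector_fieldD(5)[OF P p] bivector_fieldD(5)[OF Q p])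
  then show "(\<lambda>g. P p f g - Q p f g) \<in> tangent_space \<A> p" by simp
next
  fix p f g show "P p f g - Q p f g = - (P p g f - Q p g f)"
    using bivector_fieldD(4)[OF P, of p f g] bivector_fieldD(4)[OF Q, of p f g] by simp
next
  fix f g assume "f \<in> Cinf \<A>" "g \<in> Cinf \<A>"
  then show "(\<lambda>p. P p f g - Q p f g) \<in> Cinf \<A>"
    by (intro Cinf_diff A bivector_fieldD(3)[OF P] bivector_fieldD(3)[OF Q])
qed (use bivector_fieldD(2,7)[OF P] bivector_fieldD(2,7)[OF Q] in auto)

section \<open>First-order functionals and the functions that determine them\<close>

definition first_order ::
  "('n, 'e::real_normed_vector) atlas \<Rightarrow> 'n \<Rightarrow> (('n \<Rightarrow> real) \<Rightarrow> real) \<Rightarrow> bool" where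
  "first_order \<A> p L \<longleftrightarrow> (\<exists>v\<in>tangent_space \<A> p. \<exists>c. \<forall>f\<in>Cinf \<A>. L f = v f + c * f p)"

text \<open>Subtracting \<open>L (\<lambda>_. 1)\<close> times evaluation at p turns the product
  rule into the Leibniz rule, so what remains is a tangent vector.\<close>

lemma first_orderI:
  assumes A: "smooth_atlas \<A>"
    and add: "\<And>f g. f \<in> Cinf \<A> \<Longrightarrow> g \<in> Cinf \<A> \<Longrightarrow> L (\<lambda>q. f q + g q) = L f + L g"
    and scale: "\<And>c f. f \<in> Cinf \<A> \<Longrightarrow> L (\<lambda>q. c * f q) = c * L f"
    and mult: "\<And>f g. f \<in> Cinf \<A> \<Longrightarrow> g \<in> Cinf \<A> \<Longrightarrow>
      L (\<lambda>q. f q * g q) = L f * g p + f p * L g - f p * g p * L (\<lambda>_. 1)"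
  shows "first_order \<A> p L"
  unfolding first_order_def
proof (intro bexI exI ballI)
  show "(\<lambda>f. if f \<in> Cinf \<A> then L f - L (\<lambda>_. 1) * f p else 0) \<in> tangent_space \<A> p"
    by (rule tangentI) (auto simp: add scale mult A Cinf_add Cinf_mult Cinf_cmult algebra_simps)
qed auto

lemma tangent_first_order:
  "v \<in> tangent_space \<A> p \<Longrightarrow> first_order \<A> p (\<lambda>f. v f + c * f p)"
  by (auto simp: first_order_def)

lemma first_order_cong:
  "first_order \<A> p L \<Longrightarrow> (\<And>f. f \<in> Cinf \<A> \<Longrightarrow> L f = L' f) \<Longrightarrow> first_order \<A> p L'"
  by (auto simp: first_order_def)

lemma first_order_diff:
  assumes "first_order \<A> p L" "first_order \<A> p L'"
  shows "first_order \<A> p (\<lambda>f. L f - L' f)"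
proof -
  obtain v c v' c' where v: "v \<in> tangent_space \<A> p" "\<And>f. f \<in> Cinf \<A> \<Longrightarrow> L f = v f + c * f p"
    "v' \<in> tangent_space \<A> p" "\<And>f. f \<in> Cinf \<A> \<Longrightarrow> L' f = v' f + c' * f p"
    using assms unfolding first_order_def by metis
  have "first_order \<A> p (\<lambda>f. (v f + - v' f) + (c - c') * f p)"
    by (intro tangent_first_order tangent_add_closed tangent_minus_closed v)
  then show ?thesis
    by (rule first_order_cong) (simp add: v algebra_simps)
qed

definition jet_determining :: "('n, 'e::real_normed_vector) atlas \<Rightarrow> 'n \<Rightarrow> ('n \<Rightarrow> real) set \<Rightarrow> bool" where
  "jet_determining \<A> p S \<longleftrightarrow> S \<subseteq> Cinf \<A> \<and>
     (\<forall>L. first_order \<A> p L \<longrightarrow> (\<forall>s\<in>S. L s = 0) \<longrightarrow> (\<forall>f\<in>Cinf \<A>. L f = 0))"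

text \<open>Tangent vectors kill constants, so the value of a functional on the constant function 1
  is its coefficient of order 0; once this vanishes, only tangent vectors have to be tested.\<close>

lemma jet_determiningI:
  assumes A: "smooth_atlas \<A>" and "S \<subseteq> Cinf \<A>" "(\<lambda>_. 1) \<in> S"
    "\<And>v f. v \<in> tangent_space \<A> p \<Longrightarrow> (\<And>s. s \<in> S \<Longrightarrow> v s = 0) \<Longrightarrow> f \<in> Cinf \<A> \<Longrightarrow> v f = 0"
  shows "jet_determining \<A> p S"
  unfolding jet_determining_def
proof (intro conjI allI impI ballI)
  fix L f assume "first_order \<A> p L" and L0: "\<forall>s\<in>S. L s = 0" and f: "f \<in> Cinf \<A>"
  then obtain v c where v: "v \<in> tangent_space \<A> p" and L: "\<And>f. f \<in> Cinf \<A> \<Longrightarrow> L f = v f + c * f p"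
    by (auto simp: first_order_def)
  have "c = 0"
    using L0 assms(3) L[OF Cinf_const[OF A]] tangent_const[OF A v] by force
  moreover from this have "v s = 0" if "s \<in> S" for s
    using L0 L that assms(2) by force
  ultimately show "L f = 0" using assms(4)[OF v _ f] L[OF f] by simp
qed (rule assms(2))

lemma first_order_eqI:
  assumes "jet_determining \<A> p S" "first_order \<A> p L" "first_order \<A> p L'"
    "\<And>s. s \<in> S \<Longrightarrow> L s = L' s" "f \<in> Cinf \<A>"
  shows "L f = L' f"
proof -
  have "\<forall>s\<in>S. L s - L' s = 0" using assms(4) by simp
  then have "L f - L' f = 0"
    using assms(1,5) first_order_diff[OF assms(2,3)] unfolding jet_determining_def by blast
  then show ?thesis by simp
qed

lemma bifirst_order_eqI:
  assumes S: "jet_determining \<A> p S"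
    and "\<And>g. g \<in> Cinf \<A> \<Longrightarrow> first_order \<A> p (\<lambda>f. B f g)" "\<And>f. f \<in> Cinf \<A> \<Longrightarrow> first_order \<A> p (\<lambda>g. B f g)"
    "\<And>g. g \<in> Cinf \<A> \<Longrightarrow> first_order \<A> p (\<lambda>f. B' f g)" "\<And>f. f \<in> Cinf \<A> \<Longrightarrow> first_order \<A> p (\<lambda>g. B' f g)"
    and eq: "\<And>s t. s \<in> S \<Longrightarrow> t \<in> S \<Longrightarrow> B s t = B' s t" and "f \<in> Cinf \<A>" "g \<in> Cinf \<A>"
  shows "B f g = B' f g"
proof -
  have SC: "S \<subseteq> Cinf \<A>" using S by (auto simp: jet_determining_def)
  have "B f t = B' f t" if "t \<in> S" for t
  proof (rule first_order_eqI[OF S, of "\<lambda>f. B f t" "\<lambda>f. B' f t"])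
    have t: "t \<in> Cinf \<A>" using that SC by blast
    show "first_order \<A> p (\<lambda>f. B f t)" "first_order \<A> p (\<lambda>f. B' f t)"
      using assms(2,4) t by blast+
    show "B s t = B' s t" if "s \<in> S" for s using eq that \<open>t \<in> S\<close> .
  qed fact
  then show ?thesis
    using first_order_eqI[OF S assms(3)[OF \<open>f \<in> Cinf \<A>\<close>] assms(5)[OF \<open>f \<in> Cinf \<A>\<close>]] assms(8) by blast
qed

section \<open>The Jacobi identity on generators\<close>

text \<open>The Jacobi identity is left out of the assumptions: the calculus of the bracket
  developed here is what reduces that identity to generators.\<close>

locale jacobi_fields =
  fixes \<A> :: "('n, 'e::fin_dim_inner) atlas" and \<Lambda> :: "'n bifield" and E :: "'n vfield"
  assumes atlas: "smooth_atlas \<A>" and bivector: "bivector_field \<A> \<Lambda>" and vector: "vector_field \<A> E"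
begin

abbreviation "br \<equiv> jacobi_bracket \<Lambda> E"

lemma br_skew: "br f g p = - br g f p"
  using bivector_fieldD(4)[OF bivector, of p f g] by (simp add: jacobi_bracket_def)

lemma br_Cinf: "f \<in> Cinf \<A> \<Longrightarrow> g \<in> Cinf \<A> \<Longrightarrow> br f g \<in> Cinf \<A>"
  unfolding jacobi_bracket_def
  by (intro Cinf_intros atlas bivector_fieldD(3)[OF bivector] vector_fieldD(3)[OF vector])

context
  fixes p assumes p: "p \<in> point_set \<A>"
begin

lemmas E_tangent = vector_fieldD(1)[OF vector p]
lemmas \<Lambda>_tangent = bivector_fieldD(6)[OF bivector p]

lemma br_add: "f \<in> Cinf \<A> \<Longrightarrow> f' \<in> Cinf \<A> \<Longrightarrow> br (\<lambda>q. f q + f' q) g p = br f g p + br f' g p"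
  by (simp add: jacobi_bracket_def tangentD(1)[OF \<Lambda>_tangent] tangentD(1)[OF E_tangent] algebra_simps)

lemma br_scale: "f \<in> Cinf \<A> \<Longrightarrow> br (\<lambda>q. c * f q) g p = c * br f g p"
  by (simp add: jacobi_bracket_def tangentD(3)[OF \<Lambda>_tangent] tangentD(3)[OF E_tangent] algebra_simps)

lemma br_mult:
  "f \<in> Cinf \<A> \<Longrightarrow> f' \<in> Cinf \<A> \<Longrightarrow>
    br (\<lambda>q. f q * f' q) g p = br f g p * f' p + f p * br f' g p - f p * f' p * br (\<lambda>_. 1) g p"
  by (simp add: jacobi_bracket_def tangentD(2)[OF \<Lambda>_tangent] tangentD(2)[OF E_tangent]
      tangent_const[OF atlas \<Lambda>_tangent] tangent_const[OF atlas E_tangent] algebra_simps)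

lemma br_cong:
  assumes "f \<in> Cinf \<A>" "\<And>q. q \<in> point_set \<A> \<Longrightarrow> f q = f' q"
  shows "br f g p = br f' g p" and "br g f p = br g f' p"
proof -
  show 1: "br f g p = br f' g p"
    using tangent_cong[OF atlas \<Lambda>_tangent p assms] tangent_cong[OF atlas E_tangent p assms] assms(2)[OF p]
    by (simp add: jacobi_bracket_def)
  show "br g f p = br g f' p"
    using 1 by (subst (1 2) br_skew) simp
qed

lemma br_first_order1: "first_order \<A> p (\<lambda>f. br f g p)"
  by (rule first_orderI[OF atlas]) (auto simp: br_add br_scale br_mult)

lemma br_first_order2: "first_order \<A> p (\<lambda>g. br f g p)"
proof (rule first_order_cong)
  show "first_order \<A> p (\<lambda>g. 0 - br g f p)"
    by (intro first_order_diff br_first_order1) (auto simp: first_order_def intro!: bexI[OF _ tangent_zero_closed] exI[of _ 0])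
  show "0 - br g f p = br f g p" for g using br_skew[of g f p] by simp
qed

end

definition jacobiator :: "('n \<Rightarrow> real) \<Rightarrow> ('n \<Rightarrow> real) \<Rightarrow> ('n \<Rightarrow> real) \<Rightarrow> 'n \<Rightarrow> real" where
  "jacobiator f g h p = br f (br g h) p + br g (br h f) p + br h (br f g) p"

text \<open>Skewness moves f into the first slot of the bracket in which it stands, where the
  product rule applies.\<close>

lemma jacobiator_alt:
  assumes "p \<in> point_set \<A>" "f \<in> Cinf \<A>" "g \<in> Cinf \<A>" "h \<in> Cinf \<A>"
  shows "jacobiator f g h p = br f (br g h) p + br (br f h) g p - br (br f g) h p"
proof -
  have "br g (br h f) p = br g (\<lambda>q. - 1 * br f h q) p"
    by (rule br_cong(2)[OF assms(1)]) (use assms br_skew[of h f] in \<open>auto intro: br_Cinf\<close>)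
  also have "\<dots> = br (br f h) g p"
    using br_scale[OF assms(1) br_Cinf[OF assms(2,4)], of "- 1" g] by (subst br_skew) simp
  finally show ?thesis
    using br_skew[of h "br f g" p] by (simp add: jacobiator_def)
qed

lemma br_br_mult:
  assumes p: "p \<in> point_set \<A>" and f: "f \<in> Cinf \<A>" "f' \<in> Cinf \<A>" and h: "h \<in> Cinf \<A>"
  shows "br (br (\<lambda>q. f q * f' q) h) g p =
    (br (br f h) g p * f' p + br f h p * br f' g p - br f h p * f' p * br (\<lambda>_. 1) g p)
    + (br f g p * br f' h p + f p * br (br f' h) g p - f p * br f' h p * br (\<lambda>_. 1) g p)
    - ((br f g p * f' p + f p * br f' g p - f p * f' p * br (\<lambda>_. 1) g p) * br (\<lambda>_. 1) h p
      + f p * f' p * br (br (\<lambda>_. 1) h) g p - f p * f' p * br (\<lambda>_. 1) h p * br (\<lambda>_. 1) g p)"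
proof -
  note 1 = Cinf_const[OF atlas, of 1]
  note C = br_Cinf[OF f(1) h] br_Cinf[OF f(2) h] br_Cinf[OF 1 h] Cinf_mult[OF atlas f]
  note C2 = Cinf_mult[OF atlas C(1) f(2)] Cinf_mult[OF atlas f(1) C(2)] Cinf_mult[OF atlas C(4,3)]
  have "br (br (\<lambda>q. f q * f' q) h) g p =
     br (\<lambda>q. (br f h q * f' q + f q * br f' h q) + - 1 * ((f q * f' q) * br (\<lambda>_. 1) h q)) g p"
    by (rule br_cong(1)[OF p]) (use br_mult[OF _ f] C br_Cinf[OF C(4) h] in auto)
  also have "\<dots> = br (\<lambda>q. br f h q * f' q) g p + br (\<lambda>q. f q * br f' h q) g p
      - br (\<lambda>q. (f q * f' q) * br (\<lambda>_. 1) h q) g p"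
    using br_add[OF p Cinf_add[OF atlas C2(1,2)] Cinf_cmult[OF atlas C2(3), of "- 1"]]
      br_add[OF p C2(1,2)] br_scale[OF p C2(3), of "- 1"] by simp
  finally show ?thesis
    using br_mult[OF p C(1) f(2)] br_mult[OF p f(1) C(2)] br_mult[OF p C(4,3)] br_mult[OF p f] by simp
qed

lemma br_br_add:
  assumes p: "p \<in> point_set \<A>" and f: "f \<in> Cinf \<A>" "f' \<in> Cinf \<A>" and h: "h \<in> Cinf \<A>"
  shows "br (br (\<lambda>q. f q + f' q) h) g p = br (br f h) g p + br (br f' h) g p"
proof -
  have "br (br (\<lambda>q. f q + f' q) h) g p = br (\<lambda>q. br f h q + br f' h q) g p"
    by (rule br_cong(1)[OF p]) (use br_add[OF _ f] f h in \<open>auto intro: br_Cinf Cinf_add atlas\<close>)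
  then show ?thesis using br_add[OF p br_Cinf[OF f(1) h] br_Cinf[OF f(2) h]] by simp
qed

lemma br_br_scale:
  assumes p: "p \<in> point_set \<A>" and f: "f \<in> Cinf \<A>" and h: "h \<in> Cinf \<A>"
  shows "br (br (\<lambda>q. c * f q) h) g p = c * br (br f h) g p"
proof -
  have "br (br (\<lambda>q. c * f q) h) g p = br (\<lambda>q. c * br f h q) g p"
    by (rule br_cong(1)[OF p]) (use br_scale[OF _ f] f h in \<open>auto intro: br_Cinf Cinf_cmult atlas\<close>)
  then show ?thesis using br_scale[OF p br_Cinf[OF f h]] by simp
qed

text \<open>A priori the Jacobiator is of second order in f. By \<open>br_br_mult\<close>, for a
  product of f and f' every term that does not fit the rule of \<open>first_orderI\<close> is
  symmetric in g and h, such as \<open>br f h p * br f' g p + br f g p * br f' h p\<close>, and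
  cancels in the difference of the two iterated brackets.\<close>

lemma jacobiator_first_order:
  assumes p: "p \<in> point_set \<A>" and g: "g \<in> Cinf \<A>" and h: "h \<in> Cinf \<A>"
  shows "first_order \<A> p (\<lambda>f. jacobiator f g h p)"
proof (rule first_order_cong)
  show "first_order \<A> p (\<lambda>f. br f (br g h) p + br (br f h) g p - br (br f g) h p)"
  proof (rule first_orderI[OF atlas], goal_cases)
    case (1 f f')
    then show ?case using br_br_add[OF p 1] br_add[OF p 1] g h by simp
  next
    case (2 c f)
    then show ?case using br_br_scale[OF p 2] br_scale[OF p 2] g h by (simp add: algebra_simps)
  next
    case (3 f f')
    show ?case
      unfolding br_br_mult[OF p 3 g] br_br_mult[OF p 3 h] br_mult[OF p 3]
      by (simp add: algebra_simps)
  qed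
qed (use jacobiator_alt[OF p _ g h] in simp)

lemma jacobiator_zeroI:
  assumes p: "p \<in> point_set \<A>" and S: "jet_determining \<A> p S"
    and J: "\<And>f g h. f \<in> S \<Longrightarrow> g \<in> S \<Longrightarrow> h \<in> S \<Longrightarrow> jacobiator f g h p = 0"
    and "f \<in> Cinf \<A>" "g \<in> Cinf \<A>" "h \<in> Cinf \<A>"
  shows "jacobiator f g h p = 0"
proof -
  have SC: "S \<subseteq> Cinf \<A>" and det: "\<And>L f. first_order \<A> p L \<Longrightarrow> (\<And>s. s \<in> S \<Longrightarrow> L s = 0) \<Longrightarrow>
      f \<in> Cinf \<A> \<Longrightarrow> L f = 0"
    using S by (auto simp: jet_determining_def)
  \<comment> \<open>Cyclic symmetry carries each slot to the first one, so the slots can be freed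
    from S one after the other.\<close>
  have cyc: "jacobiator f g h p = jacobiator g h f p" for f g h by (simp add: jacobiator_def)
  have 1: "jacobiator f g h p = 0" if f: "f \<in> Cinf \<A>" and S: "g \<in> S" "h \<in> S" for f g h
  proof (rule det[OF _ _ f])
    show "first_order \<A> p (\<lambda>f. jacobiator f g h p)"
      using jacobiator_first_order[OF p] S SC by blast
  qed (use J S in blast)
  have 2: "jacobiator f g h p = 0" if f: "f \<in> Cinf \<A>" and g: "g \<in> Cinf \<A>" and S: "h \<in> S" for f g h
    unfolding cyc[of f g h]
  proof (rule det[OF _ _ g])
    show "first_order \<A> p (\<lambda>g. jacobiator g h f p)"
      using jacobiator_first_order[OF p] f S SC by blast
    show "jacobiator s h f p = 0" if "s \<in> S" for s
      using 1[OF f that S] cyc[of f s h] by simp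
  qed
  show ?thesis
    unfolding cyc[of f g h] cyc[of g h f]
  proof (rule det[OF _ _ assms(6)])
    show "first_order \<A> p (\<lambda>h. jacobiator h f g p)"
      using jacobiator_first_order[OF p] assms(4,5) by blast
    show "jacobiator s f g p = 0" if "s \<in> S" for s
      using 2[OF assms(4,5) that] cyc[of s f g] by simp
  qed
qed

lemma jacobi_identity_iff:
  "jacobi_identity \<A> br \<longleftrightarrow> (\<forall>f\<in>Cinf \<A>. \<forall>g\<in>Cinf \<A>. \<forall>h\<in>Cinf \<A>. \<forall>p\<in>point_set \<A>. jacobiator f g h p = 0)"
  by (simp add: jacobi_identity_def jacobiator_def)

lemma jacobiator_Cinf:
  "f \<in> Cinf \<A> \<Longrightarrow> g \<in> Cinf \<A> \<Longrightarrow> h \<in> Cinf \<A> \<Longrightarrow> jacobiator f g h \<in> Cinf \<A>"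
  unfolding jacobiator_def[abs_def] by (intro Cinf_add br_Cinf atlas)

end

lemma poisson_bracket_eq_jacobi: "poisson_bracket P = jacobi_bracket P (\<lambda>_ _. 0)"
  by (simp add: poisson_bracket_def jacobi_bracket_def fun_eq_iff)

lemma poisson_jacobi_fields:
  fixes \<A> :: "('n, 'e::fin_dim_inner) atlas"
  shows "smooth_atlas \<A> \<Longrightarrow> bivector_field \<A> P \<Longrightarrow> jacobi_fields \<A> P (\<lambda>_ _. 0)"
  by unfold_locales (auto intro: vector_field_zero)

section \<open>Fibre bundles\<close>

lemma smooth_on_compose_fst:
  fixes g :: "'a::fin_dim_inner \<Rightarrow> 'c::real_normed_vector"
  assumes "open S" "smooth_on g S"
  shows "smooth_on (\<lambda>z. g (fst z)) (S \<times> (UNIV :: 'b::real_normed_vector set))"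
proof -
  have o: "open (S \<times> (UNIV :: 'b set))" using assms(1) by (simp add: open_Times)
  show ?thesis
    by (rule smooth_on_compose[OF o assms(1) _ smooth_on_fst[OF o smooth_on_id[OF o]] assms(2)]) auto
qed

lemma smooth_atlasI:
  assumes "\<And>U \<phi>. (U, \<phi>) \<in> \<A> \<Longrightarrow> inj_on \<phi> U" "\<And>U \<phi>. (U, \<phi>) \<in> \<A> \<Longrightarrow> open (\<phi> ` U)"
    "\<And>U \<phi> V \<psi>. (U, \<phi>) \<in> \<A> \<Longrightarrow> (V, \<psi>) \<in> \<A> \<Longrightarrow>
      open (\<phi> ` (U \<inter> V)) \<and> smooth_on (\<psi> \<circ> inv_into U \<phi>) (\<phi> ` (U \<inter> V))"
  shows "smooth_atlas \<A>"
  using assms unfolding smooth_atlas_def by blast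

text \<open>Common ground of \<open>A\<close> and its hull \<open>hat A\<close>. Smoothness of the
  transition maps is not assumed, since for \<open>hat A\<close> it has to be derived on the basis
  of these data.\<close>

locale fibre_bundle_data =
  fixes M :: "('m, 'e::fin_dim_inner) atlas" and T :: "'v set" and \<pi> :: "'v \<Rightarrow> 'm"
    and Y :: "('m set \<times> ('v \<Rightarrow> 'f::fin_dim_inner)) set"
  assumes base_atlas: "smooth_atlas M" and base_separated: "separated M"
    and proj: "v \<in> T \<Longrightarrow> \<pi> v \<in> point_set M"
    and triv_cover: "(\<Union>(U, y)\<in>Y. U) = point_set M"
    and triv_open: "(U, y) \<in> Y \<Longrightarrow> openin (atlas_topology M) U"
    and triv_bij: "(U, y) \<in> Y \<Longrightarrow> p \<in> U \<Longrightarrow> bij_betw y {v \<in> T. \<pi> v = p} UNIV"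
begin

definition pt :: "('v \<Rightarrow> 'f) \<Rightarrow> 'm \<Rightarrow> 'f \<Rightarrow> 'v" where
  "pt y p s = inv_into {v \<in> T. \<pi> v = p} y s"

definition dom :: "'m set \<Rightarrow> 'm set \<Rightarrow> 'v set" where
  "dom W U = {v \<in> T. \<pi> v \<in> W \<inter> U}"

definition chart :: "('m \<Rightarrow> 'e) \<Rightarrow> ('v \<Rightarrow> 'f) \<Rightarrow> 'v \<Rightarrow> 'e \<times> 'f" where
  "chart \<phi> y v = (\<phi> (\<pi> v), y v)"

abbreviation "tatlas \<equiv> bundle_atlas M T \<pi> Y"

lemma total_eq: "tatlas = {(dom W U, chart \<phi> y) | W \<phi> U y. (W, \<phi>) \<in> M \<and> (U, y) \<in> Y}"
  by (simp add: bundle_atlas_def dom_def chart_def[abs_def])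

lemma chart_in_total: "(W, \<phi>) \<in> M \<Longrightarrow> (U, y) \<in> Y \<Longrightarrow> (dom W U, chart \<phi> y) \<in> tatlas"
  unfolding total_eq by blast

lemma totalE:
  assumes "(D, \<kappa>) \<in> tatlas"
  obtains W \<phi> U y where "(W, \<phi>) \<in> M" "(U, y) \<in> Y" "D = dom W U" "\<kappa> = chart \<phi> y"
  using assms unfolding total_eq by blast

lemma pt:
  assumes "(U, y) \<in> Y" "p \<in> U"
  shows "pt y p s \<in> T" "\<pi> (pt y p s) = p" "y (pt y p s) = s"
  using triv_bij[OF assms] bij_betw_inv_into_right[OF triv_bij[OF assms], of s]
    inv_into_into[of s y "{v \<in> T. \<pi> v = p}"]
  by (auto simp: pt_def bij_betw_def)

lemma pt_triv:
  assumes "(U, y) \<in> Y" "\<pi> v \<in> U" "v \<in> T"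
  shows "pt y (\<pi> v) (y v) = v"
  using bij_betw_inv_into_left[OF triv_bij[OF assms(1,2)], of v] assms(3) by (simp add: pt_def)

lemma trivE:
  assumes "p \<in> point_set M"
  obtains U y where "(U, y) \<in> Y" "p \<in> U"
  using assms triv_cover by blast

lemma point_set_total [simp]: "point_set tatlas = T"
proof (intro equalityI subsetI)
  fix v assume v: "v \<in> T"
  obtain W \<phi> where "(W, \<phi>) \<in> M" "\<pi> v \<in> W" using proj[OF v] by (rule point_setE)
  moreover obtain U y where "(U, y) \<in> Y" "\<pi> v \<in> U" using proj[OF v] by (rule trivE)
  ultimately show "v \<in> point_set tatlas"
    using v point_setI[OF chart_in_total[of W \<phi> U y], of v] by (auto simp: dom_def)
qed (auto simp: point_set_def total_eq dom_def)

lemma chartE: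
  assumes "v \<in> T"
  obtains W \<phi> U y where "(W, \<phi>) \<in> M" "(U, y) \<in> Y" "v \<in> dom W U"
proof -
  obtain W \<phi> where "(W, \<phi>) \<in> M" "\<pi> v \<in> W" using proj[OF assms] by (rule point_setE)
  moreover obtain U y where "(U, y) \<in> Y" "\<pi> v \<in> U" using proj[OF assms] by (rule trivE)
  ultimately show thesis using assms that[of W \<phi> U y] by (auto simp: dom_def)
qed

context
  fixes W \<phi> U y assumes W: "(W, \<phi>) \<in> M" and U: "(U, y) \<in> Y"
begin

lemma chart_inj: "inj_on (chart \<phi> y) (dom W U)"
proof (rule inj_onI)
  fix u v assume u: "u \<in> dom W U" and v: "v \<in> dom W U" and eq: "chart \<phi> y u = chart \<phi> y v"
  then have \<pi>: "\<pi> u = \<pi> v"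
    using smooth_atlasD(1)[OF base_atlas W] by (auto simp: chart_def dom_def inj_on_def)
  have "u = pt y (\<pi> u) (y u)"
    using pt_triv[OF U, of u] u by (auto simp: dom_def)
  also have "\<dots> = pt y (\<pi> v) (y v)" using \<pi> eq by (simp add: chart_def)
  also have "\<dots> = v" using pt_triv[OF U, of v] v by (auto simp: dom_def)
  finally show "u = v" .
qed

lemma chart_image:
  assumes "N \<subseteq> W \<inter> U"
  shows "chart \<phi> y ` {v \<in> T. \<pi> v \<in> N} = \<phi> ` N \<times> UNIV"
proof (intro equalityI subsetI)
  fix z assume "z \<in> \<phi> ` N \<times> (UNIV :: 'f set)"
  then obtain p s where p: "p \<in> N" "z = (\<phi> p, s)" by auto
  then have "p \<in> U" using assms by auto
  then show "z \<in> chart \<phi> y ` {v \<in> T. \<pi> v \<in> N}"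
    using p by (intro image_eqI[of _ _ "pt y p s"]) (auto simp: chart_def pt[OF U])
qed (auto simp: chart_def)

lemma chart_image_dom: "chart \<phi> y ` dom W U = \<phi> ` (W \<inter> U) \<times> UNIV"
  unfolding dom_def by (rule chart_image) simp

lemma chart_inverse:
  assumes "p \<in> W \<inter> U"
  shows "inv_into (dom W U) (chart \<phi> y) (\<phi> p, s) = pt y p s"
  by (rule inv_into_f_eq[OF chart_inj]) (use assms in \<open>auto simp: dom_def chart_def pt[OF U]\<close>)

lemma chart_inverse':
  assumes "x \<in> \<phi> ` (W \<inter> U)"
  shows "inv_into (dom W U) (chart \<phi> y) (x, s) = pt y (inv_into W \<phi> x) s"
  using assms chart_inverse smooth_atlasD(1)[OF base_atlas W] by auto

lemma open_base_image: "openin (atlas_topology M) N \<Longrightarrow> open (\<phi> ` (W \<inter> U \<inter> N))"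
  using openin_chart_image[OF base_atlas W, of "U \<inter> N"] triv_open[OF U] by (simp add: openin_Int Int_assoc)

lemma open_base_image_dom: "open (\<phi> ` (W \<inter> U))"
  using openin_chart_image[OF base_atlas W triv_open[OF U]] .

end

text \<open>The base component of a transition map comes from the base atlas, so only the fibre
  component has to be checked.\<close>

lemma smooth_atlas_totalI:
  assumes tr: "\<And>W \<phi> U y W' \<phi>' U' y'. (W, \<phi>) \<in> M \<Longrightarrow> (U, y) \<in> Y \<Longrightarrow> (W', \<phi>') \<in> M \<Longrightarrow> (U', y') \<in> Y \<Longrightarrow>
    smooth_on (\<lambda>(x, s). y' (pt y (inv_into W \<phi> x) s)) (\<phi> ` (W \<inter> U \<inter> (W' \<inter> U')) \<times> UNIV)"
  shows "smooth_atlas tatlas"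
proof (rule smooth_atlasI)
  fix D \<kappa> assume "(D, \<kappa>) \<in> tatlas"
  then obtain W \<phi> U y where W: "(W, \<phi>) \<in> M" and U: "(U, y) \<in> Y" and D: "D = dom W U" "\<kappa> = chart \<phi> y"
    by (rule totalE)
  show "inj_on \<kappa> D" unfolding D by (rule chart_inj[OF W U])
  show "open (\<kappa> ` D)"
    unfolding D using open_base_image_dom[OF W U] by (simp add: chart_image_dom[OF W U] open_Times)
next
  fix D \<kappa> D' \<kappa>' assume "(D, \<kappa>) \<in> tatlas" "(D', \<kappa>') \<in> tatlas"
  then obtain W \<phi> U y W' \<phi>' U' y' where W: "(W, \<phi>) \<in> M" and U: "(U, y) \<in> Y"
    and W': "(W', \<phi>') \<in> M" and U': "(U', y') \<in> Y"
    and D: "D = dom W U" "\<kappa> = chart \<phi> y" "D' = dom W' U'" "\<kappa>' = chart \<phi>' y'"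
    by (elim totalE)
  let ?N = "W \<inter> U \<inter> (W' \<inter> U')"
  have im: "chart \<phi> y ` (dom W U \<inter> dom W' U') = \<phi> ` ?N \<times> UNIV"
  proof -
    have "dom W U \<inter> dom W' U' = {v \<in> T. \<pi> v \<in> ?N}" by (auto simp: dom_def)
    moreover have "chart \<phi> y ` {v \<in> T. \<pi> v \<in> ?N} = \<phi> ` ?N \<times> UNIV"
      by (rule chart_image[OF W U]) auto
    ultimately show ?thesis by (simp only:)
  qed
  have "openin (atlas_topology M) (W' \<inter> U')"
    using openin_chart[OF base_atlas W'] triv_open[OF U'] by (rule openin_Int)
  then have o: "open (\<phi> ` ?N)" by (rule open_base_image[OF W U])
  then have o2: "open (\<phi> ` ?N \<times> (UNIV::'f set))" by (simp add: open_Times)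
  have "smooth_on (\<phi>' \<circ> inv_into W \<phi>) (\<phi> ` ?N)"
    by (rule smooth_on_subset[OF smooth_atlasD(4)[OF base_atlas W W']]) auto
  then have "smooth_on (\<lambda>z. (\<phi>' \<circ> inv_into W \<phi>) (fst z)) (\<phi> ` ?N \<times> (UNIV::'f set))"
    by (rule smooth_on_compose_fst[OF o])
  then have "smooth_on (\<lambda>z. ((\<phi>' \<circ> inv_into W \<phi>) (fst z), (\<lambda>(x, s). y' (pt y (inv_into W \<phi> x) s)) z))
      (\<phi> ` ?N \<times> UNIV)"
    using tr[OF W U W' U'] by (rule smooth_on_Pair[OF o2])
  then have "smooth_on (chart \<phi>' y' \<circ> inv_into (dom W U) (chart \<phi> y)) (\<phi> ` ?N \<times> UNIV)"
  proof (rule smooth_on_cong[OF _ o2])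
    fix z assume "z \<in> \<phi> ` ?N \<times> (UNIV::'f set)"
    then obtain p s where p: "z = (\<phi> p, s)" "p \<in> ?N" by auto
    then show "((\<phi>' \<circ> inv_into W \<phi>) (fst z), (\<lambda>(x, s). y' (pt y (inv_into W \<phi> x) s)) z) =
        (chart \<phi>' y' \<circ> inv_into (dom W U) (chart \<phi> y)) z"
      using smooth_atlasD(1)[OF base_atlas W] pt(2)[OF U]
      by (simp add: chart_inverse[OF W U] chart_def)
  qed
  then show "open (\<kappa> ` (D \<inter> D')) \<and> smooth_on (\<kappa>' \<circ> inv_into D \<kappa>) (\<kappa> ` (D \<inter> D'))"
    unfolding D im using o2 by simp
qed

end

locale smooth_bundle = fibre_bundle_data M T \<pi> Y
  for M :: "('m, 'e::fin_dim_inner) atlas" and T :: "'v set" and \<pi> :: "'v \<Rightarrow> 'm"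
    and Y :: "('m set \<times> ('v \<Rightarrow> 'f::fin_dim_inner)) set" +
  assumes total_atlas: "smooth_atlas (bundle_atlas M T \<pi> Y)"
begin

lemma openin_preimage:
  assumes "openin (atlas_topology M) N"
  shows "openin (atlas_topology tatlas) {v \<in> T. \<pi> v \<in> N}"
  unfolding openin_atlas_topology[OF total_atlas]
proof (intro conjI, force, clarify elim!: totalE)
  fix W \<phi> U y assume W: "(W, \<phi>) \<in> M" and U: "(U, y) \<in> Y"
  have "dom W U \<inter> {v \<in> T. \<pi> v \<in> N} = {v \<in> T. \<pi> v \<in> W \<inter> U \<inter> N}"
    by (auto simp: dom_def)
  moreover have "chart \<phi> y ` {v \<in> T. \<pi> v \<in> W \<inter> U \<inter> N} = \<phi> ` (W \<inter> U \<inter> N) \<times> UNIV"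
    by (rule chart_image[OF W U]) auto
  ultimately have "chart \<phi> y ` (dom W U \<inter> {v \<in> T. \<pi> v \<in> N}) = \<phi> ` (W \<inter> U \<inter> N) \<times> UNIV"
    by (simp only:)
  then show "open (chart \<phi> y ` (dom W U \<inter> {v \<in> T. \<pi> v \<in> N}))"
    using open_base_image[OF W U assms] by (simp add: open_Times)
qed

lemma smooth_along_triv:
  assumes W: "(W, \<phi>) \<in> M" and U: "(U, y) \<in> Y" and F: "F \<in> Cinf tatlas"
  shows "smooth_on (\<lambda>(x, s). F (pt y (inv_into W \<phi> x) s)) (\<phi> ` (W \<inter> U) \<times> UNIV)"
proof -
  have "smooth_on (F \<circ> inv_into (dom W U) (chart \<phi> y)) (\<phi> ` (W \<inter> U) \<times> UNIV)"
    using CinfD[OF F chart_in_total[OF W U]] by (simp add: chart_image_dom[OF W U])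
  then show ?thesis
    by (rule smooth_on_cong) (auto simp: chart_inverse'[OF W U] open_Times open_base_image_dom[OF W U])
qed

lemma total_smooth_atI:
  assumes W: "(W, \<phi>) \<in> M" and U: "(U, y) \<in> Y" and S: "open S" "S \<subseteq> \<phi> ` (W \<inter> U) \<times> UNIV"
    and v: "v \<in> dom W U" "chart \<phi> y v \<in> S"
    and F: "smooth_on (\<lambda>(x, s). F (pt y (inv_into W \<phi> x) s)) S"
  shows "smooth_at tatlas F v"
  unfolding smooth_at_def
proof (intro exI conjI)
  show "(dom W U, chart \<phi> y) \<in> tatlas" by (rule chart_in_total[OF W U])
  show "S \<subseteq> chart \<phi> y ` dom W U" using S(2) by (simp add: chart_image_dom[OF W U])
  show "smooth_on (F \<circ> inv_into (dom W U) (chart \<phi> y)) S"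
    by (rule smooth_on_cong[OF F S(1)]) (use S(2) in \<open>auto simp: chart_inverse'[OF W U]\<close>)
qed (use S v in auto)

lemma Cinf_pullback:
  assumes f: "f \<in> Cinf M"
  shows "(\<lambda>v. f (\<pi> v)) \<in> Cinf tatlas"
proof (rule CinfI, elim totalE, clarify)
  fix W \<phi> U y assume W: "(W, \<phi>) \<in> M" and U: "(U, y) \<in> Y"
  note o = open_base_image_dom[OF W U]
  have o2: "open (\<phi> ` (W \<inter> U) \<times> (UNIV::'f set))" using o by (simp add: open_Times)
  have "smooth_on (f \<circ> inv_into W \<phi>) (\<phi> ` (W \<inter> U))"
    by (rule smooth_on_subset[OF CinfD[OF f W]]) auto
  then have "smooth_on (\<lambda>z. (f \<circ> inv_into W \<phi>) (fst z)) (\<phi> ` (W \<inter> U) \<times> (UNIV::'f set))"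
    by (rule smooth_on_compose_fst[OF o])
  then show "smooth_on ((\<lambda>v. f (\<pi> v)) \<circ> inv_into (dom W U) (chart \<phi> y)) (chart \<phi> y ` dom W U)"
    unfolding chart_image_dom[OF W U]
    by (rule smooth_on_cong[OF _ o2])
      (use smooth_atlasD(1)[OF base_atlas W] in \<open>auto simp: chart_inverse[OF W U] pt(2)[OF U]\<close>)
qed

lemma smooth_on_section:
  assumes W: "(W, \<phi>) \<in> M" and U: "(U, y) \<in> Y" and F: "F \<in> Cinf tatlas"
  shows "smooth_on (\<lambda>x. F (pt y (inv_into W \<phi> x) s)) (\<phi> ` (W \<inter> U))"
proof -
  note o = open_base_image_dom[OF W U]
  have o2: "open (\<phi> ` (W \<inter> U) \<times> (UNIV::'f set))" using o by (simp add: open_Times)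
  have "smooth_on (\<lambda>x. (\<lambda>(x, s). F (pt y (inv_into W \<phi> x) s)) (x, s)) (\<phi> ` (W \<inter> U))"
    by (rule smooth_on_compose[OF o o2 _ _ smooth_along_triv[OF W U F]])
      (auto intro!: smooth_on_Pair smooth_on_id smooth_on_const o)
  then show ?thesis by simp
qed

text \<open>Smoothness descends along the local section with fibre coordinate 0.\<close>

lemma Cinf_baseI:
  assumes F: "F \<in> Cinf tatlas" and eq: "\<And>v. v \<in> T \<Longrightarrow> F v = f (\<pi> v)"
  shows "f \<in> Cinf M"
  unfolding Cinf_iff_smooth_at[OF base_atlas]
proof
  fix p assume p: "p \<in> point_set M"
  obtain W \<phi> where W: "(W, \<phi>) \<in> M" "p \<in> W" using p by (rule point_setE)
  obtain U y where U: "(U, y) \<in> Y" "p \<in> U" using p by (rule trivE)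
  note o = open_base_image_dom[OF W(1) U(1)]
  have "smooth_on (f \<circ> inv_into W \<phi>) (\<phi> ` (W \<inter> U))"
    by (rule smooth_on_cong[OF smooth_on_section[OF W(1) U(1) F, of 0] o])
      (use smooth_atlasD(1)[OF base_atlas W(1)] in \<open>auto simp: eq pt[OF U(1)]\<close>)
  then show "smooth_at M f p"
    unfolding smooth_at_def using W U o by blast
qed

text \<open>The separating open set is the preimage of one on the base, taken from a bump function
  there whose support lies in \<open>W \<inter> U\<close>.\<close>

lemma total_separated: "separated tatlas"
  unfolding separated_def
proof (clarify elim!: totalE)
  fix W \<phi> U y v assume W: "(W, \<phi>) \<in> M" and U: "(U, y) \<in> Y" and v: "v \<in> dom W U"
  have p: "\<pi> v \<in> W" "\<pi> v \<in> U" using v by (auto simp: dom_def)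
  let ?S = "\<phi> ` (W \<inter> U)"
  obtain \<theta> V S where \<theta>: "\<theta> \<in> Cinf M" "openin (atlas_topology M) V"
    "\<And>q. q \<in> point_set M \<Longrightarrow> q \<in> V \<or> q \<in> W \<and> \<phi> q \<in> ?S" "\<And>q. q \<in> V \<Longrightarrow> \<theta> q = 0"
    "open S" "\<phi> (\<pi> v) \<in> S" "S \<subseteq> ?S" "\<And>q. q \<in> W \<Longrightarrow> \<phi> q \<in> S \<Longrightarrow> \<theta> q = 1"
    using separated_bump[OF base_atlas base_separated W p(1) open_base_image_dom[OF W U]] p by blast
  show "\<exists>V S. openin (atlas_topology tatlas) V \<and> point_set tatlas \<subseteq> dom W U \<union> V \<and>
     open S \<and> chart \<phi> y v \<in> S \<and> S \<subseteq> chart \<phi> y ` dom W U \<and> (\<forall>q\<in>dom W U. chart \<phi> y q \<in> S \<longrightarrow> q \<notin> V)"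
  proof (intro exI conjI)
    show "openin (atlas_topology tatlas) {v \<in> T. \<pi> v \<in> V}" by (rule openin_preimage[OF \<theta>(2)])
    show "point_set tatlas \<subseteq> dom W U \<union> {v \<in> T. \<pi> v \<in> V}"
    proof
      fix u assume "u \<in> point_set tatlas"
      then have u: "u \<in> T" by simp
      show "u \<in> dom W U \<union> {v \<in> T. \<pi> v \<in> V}"
        using \<theta>(3)[OF proj[OF u]] u smooth_atlasD(1)[OF base_atlas W]
        by (auto simp: dom_def inj_on_def)
    qed
    show "open (S \<times> (UNIV::'f set))" using \<theta>(5) by (simp add: open_Times)
    show "chart \<phi> y v \<in> S \<times> UNIV" using \<theta>(6) by (simp add: chart_def)
    show "S \<times> UNIV \<subseteq> chart \<phi> y ` dom W U" using \<theta>(7) by (auto simp: chart_image_dom[OF W U])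
    show "\<forall>q\<in>dom W U. chart \<phi> y q \<in> S \<times> UNIV \<longrightarrow> q \<notin> {v \<in> T. \<pi> v \<in> V}"
      using \<theta>(4,8) by (force simp: chart_def dom_def)
  qed
qed

lemma chart_deriv_pullback:
  assumes W: "(W, \<phi>) \<in> M" and U: "(U, y) \<in> Y" and v: "v \<in> dom W U" and f: "f \<in> Cinf M"
  shows "chart_deriv (dom W U) (chart \<phi> y) (\<lambda>v. f (\<pi> v)) v w = chart_deriv W \<phi> f (\<pi> v) (fst w)"
proof -
  have p: "\<pi> v \<in> W" "\<pi> v \<in> U" using v by (auto simp: dom_def)
  have o2: "open (\<phi> ` (W \<inter> U) \<times> (UNIV::'f set))"
    using open_base_image_dom[OF W U] by (simp add: open_Times)
  have "((\<lambda>z. (f \<circ> inv_into W \<phi>) (fst z)) has_derivative (\<lambda>w. chart_deriv W \<phi> f (\<pi> v) (fst w)))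
      (at (chart \<phi> y v))"
    using has_derivative_compose[of fst fst "chart \<phi> y v" UNIV "f \<circ> inv_into W \<phi>" "chart_deriv W \<phi> f (\<pi> v)"]
      chart_deriv_has_derivative[OF base_atlas W f p(1)]
    by (simp add: chart_def bounded_linear_imp_has_derivative bounded_linear_fst)
  then have "(((\<lambda>v. f (\<pi> v)) \<circ> inv_into (dom W U) (chart \<phi> y)) has_derivative
      (\<lambda>w. chart_deriv W \<phi> f (\<pi> v) (fst w))) (at (chart \<phi> y v))"
    by (rule has_derivative_transform_within_open[OF _ o2])
      (use p smooth_atlasD(1)[OF base_atlas W] in \<open>auto simp: chart_def chart_inverse[OF W U] pt(2)[OF U]\<close>)
  from chart_deriv_eqI[OF this] show ?thesis by simp
qed

end

lemma (in smooth_bundle) smooth_transition: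
  assumes W: "(W, \<phi>) \<in> M" and U: "(U, y) \<in> Y" and W': "(W', \<phi>') \<in> M" and U': "(U', y') \<in> Y"
  shows "smooth_on (\<lambda>(x, s). y' (pt y (inv_into W \<phi> x) s)) (\<phi> ` (W \<inter> U \<inter> (W' \<inter> U')) \<times> UNIV)"
proof -
  let ?N = "W \<inter> U \<inter> (W' \<inter> U')"
  have "dom W U \<inter> dom W' U' = {v \<in> T. \<pi> v \<in> ?N}" by (auto simp: dom_def)
  moreover have "chart \<phi> y ` {v \<in> T. \<pi> v \<in> ?N} = \<phi> ` ?N \<times> UNIV"
    by (rule chart_image[OF W U]) auto
  ultimately have im: "chart \<phi> y ` (dom W U \<inter> dom W' U') = \<phi> ` ?N \<times> UNIV"
    by (simp only:)
  note D = smooth_atlasD(3,4)[OF total_atlas chart_in_total[OF W U] chart_in_total[OF W' U'], unfolded im]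
  show ?thesis
    using smooth_on_snd[OF D]
    by (rule smooth_on_cong[OF _ D(1)]) (auto simp: chart_inverse'[OF W U] chart_def)
qed

section \<open>Affine bundles and their special vector bundle hulls\<close>

locale affine_bundle_ctx =
  fixes A :: "('m, 'e::fin_dim_inner, 'a, 'v, 'f::fin_dim_inner) abundle"
  assumes affine_bundle: "affine_bundle A"
begin

lemma model_bundle: "vector_bundle (amodel A)"
  using affine_bundle by (simp add: affine_bundle_def)

lemma base_manifold: "smooth_manifold (abase A)"
  using model_bundle by (simp add: vector_bundle_def abase_def)

lemma base_atlas: "smooth_atlas (abase A)"
  and base_separated: "separated (abase A)"
  using base_manifold Hausdorff_separated by (auto simp: smooth_manifold_def)

lemma aatlas_eq: "aatlas A = bundle_atlas (abase A) (atotal A) (aproj A) (atriv A)"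
  by (simp add: aatlas_def)

lemma atrivD:
  assumes "(U, y) \<in> atriv A"
  shows "openin (atlas_topology (abase A)) U" "p \<in> U \<Longrightarrow> bij_betw y (afibre A p) UNIV" "U \<subseteq> point_set (abase A)"
proof -
  show 1: "openin (atlas_topology (abase A)) U" "p \<in> U \<Longrightarrow> bij_betw y (afibre A p) UNIV"
    using affine_bundle assms unfolding affine_bundle_def by blast+
  show "U \<subseteq> point_set (abase A)"
    using openin_subset[OF 1(1)] by (simp add: topspace_atlas_topology[OF base_atlas])
qed

end

sublocale affine_bundle_ctx \<subseteq> AB: smooth_bundle "abase A" "atotal A" "aproj A" "atriv A"
proof unfold_locales
  show "smooth_atlas (abase A)" "separated (abase A)" by (rule base_atlas base_separated)+
  show "aproj A v \<in> point_set (abase A)" if "v \<in> atotal A" for v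
    using affine_bundle that by (auto simp: affine_bundle_def)
  show "(\<Union>(U, y)\<in>atriv A. U) = point_set (abase A)"
    using affine_bundle by (simp add: affine_bundle_def)
  show "openin (atlas_topology (abase A)) U" if "(U, y) \<in> atriv A" for U y
    using atrivD(1)[OF that] .
  show "bij_betw y {v \<in> atotal A. aproj A v = p} UNIV" if "(U, y) \<in> atriv A" "p \<in> U" for U y p
    using atrivD(2)[OF that] by (simp add: afibre_def)
  show "smooth_atlas (bundle_atlas (abase A) (atotal A) (aproj A) (atriv A))"
    using affine_bundle by (simp add: affine_bundle_def aatlas_def)
qed

context affine_bundle_ctx
begin

lemma point_set_aatlas [simp]: "point_set (aatlas A) = atotal A"
  by (simp add: aatlas_eq)

lemma afibre_iff: "x \<in> afibre A p \<longleftrightarrow> x \<in> atotal A \<and> aproj A x = p"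
  by (auto simp: afibre_def)

lemma apt_fibre: "(U, y) \<in> atriv A \<Longrightarrow> p \<in> U \<Longrightarrow> AB.pt y p s \<in> afibre A p"
  by (simp add: afibre_iff AB.pt)

text \<open>Through the trivialisation \<open>\<eta>\<close> of the model bundle, translations of
  the fibre become vectors of the typical fibre, and the linear part of an affine function becomes a
  linear functional, hence an inner product with some w. The constant is the value at the point with
  coordinate 0.\<close>

lemma affine_on_fibre_iff:
  assumes U: "(U, y) \<in> atriv A" and p: "p \<in> U"
  shows "affine_on_fibre A p a \<longleftrightarrow> (\<exists>w d. \<forall>x\<in>afibre A p. a x = w \<bullet> y x + d)"
proof -
  obtain \<eta> where vb: "vector_bundle ((amodel A)\<lparr>vtriv := insert (U, \<eta>) (vtriv (amodel A))\<rparr>)"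
    and y: "\<And>x v. x \<in> afibre A p \<Longrightarrow> v \<in> vfibre (amodel A) p \<Longrightarrow> y (atrans A x v) = y x + \<eta> v"
    using bspec[OF affine_bundle[unfolded affine_bundle_def, THEN conjunct2, THEN conjunct2, THEN conjunct2,
          THEN conjunct2, THEN conjunct1] U] p by auto
  have pM: "p \<in> point_set (vbase (amodel A))" using atrivD(3)[OF U] p by (auto simp: abase_def)
  have \<eta>: "bij_betw \<eta> (vfibre (amodel A) p) UNIV"
    "\<And>u v. u \<in> vfibre (amodel A) p \<Longrightarrow> v \<in> vfibre (amodel A) p \<Longrightarrow> \<eta> (vadd (amodel A) u v) = \<eta> u + \<eta> v"
    "\<And>u c. u \<in> vfibre (amodel A) p \<Longrightarrow> \<eta> (vscale (amodel A) c u) = c *\<^sub>R \<eta> u"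
    using vb p unfolding vector_bundle_def by (simp_all add: vfibre_def)
  have cl: "\<And>u v. u \<in> vfibre (amodel A) p \<Longrightarrow> v \<in> vfibre (amodel A) p \<Longrightarrow> vadd (amodel A) u v \<in> vfibre (amodel A) p"
    "\<And>u c. u \<in> vfibre (amodel A) p \<Longrightarrow> vscale (amodel A) c u \<in> vfibre (amodel A) p"
    using model_bundle pM unfolding vector_bundle_def by blast+
  have tr: "atrans A x v \<in> afibre A p" if "x \<in> afibre A p" "v \<in> vfibre (amodel A) p" for x v
    using affine_bundle that pM unfolding affine_bundle_def abase_def by blast
  have bijy: "bij_betw y (afibre A p) UNIV" using atrivD(2)[OF U p] .
  define i where "i = inv_into (vfibre (amodel A) p) \<eta>"
  have i: "i s \<in> vfibre (amodel A) p" "\<eta> (i s) = s" for s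
    using \<eta>(1) by (auto simp: i_def bij_betw_def f_inv_into_f intro: inv_into_into)
  have i_unique: "i s = v" if "v \<in> vfibre (amodel A) p" "\<eta> v = s" for v s
    using that \<eta>(1) by (auto simp: i_def bij_betw_def)
  show ?thesis
  proof
    assume "affine_on_fibre A p a"
    then obtain l where l: "linear_form (amodel A) p l"
      and a: "\<And>x v. x \<in> afibre A p \<Longrightarrow> v \<in> vfibre (amodel A) p \<Longrightarrow> a (atrans A x v) = a x + l v"
      unfolding affine_on_fibre_def by blast
    have "linear (\<lambda>s. l (i s))"
    proof (rule linearI)
      fix s t c
      have "i (s + t) = vadd (amodel A) (i s) (i t)"
        by (rule i_unique) (simp_all add: cl \<eta> i)
      then show "l (i (s + t)) = l (i s) + l (i t)"
        using l i by (simp add: linear_form_def)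
      have "i (c *\<^sub>R s) = vscale (amodel A) c (i s)"
        by (rule i_unique) (simp_all add: cl \<eta> i)
      then show "l (i (c *\<^sub>R s)) = c *\<^sub>R l (i s)"
        using l i by (simp add: linear_form_def)
    qed
    then obtain w where w: "\<And>s. l (i s) = w \<bullet> s" using linear_riesz by blast
    define x0 where "x0 = AB.pt y p 0"
    have x0: "x0 \<in> afibre A p" "y x0 = 0"
      using AB.pt[OF U p] by (auto simp: x0_def afibre_iff)
    have "a x = w \<bullet> y x + a x0" if x: "x \<in> afibre A p" for x
    proof -
      have "y (atrans A x0 (i (y x))) = y x" by (simp add: y x0 i)
      then have "atrans A x0 (i (y x)) = x"
        using bijy tr[OF x0(1) i(1)] x by (auto simp: bij_betw_def inj_on_def)
      then show ?thesis using a[OF x0(1) i(1)[of "y x"]] w by simp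
    qed
    then show "\<exists>w d. \<forall>x\<in>afibre A p. a x = w \<bullet> y x + d" by blast
  next
    assume "\<exists>w d. \<forall>x\<in>afibre A p. a x = w \<bullet> y x + d"
    then obtain w d where a: "\<And>x. x \<in> afibre A p \<Longrightarrow> a x = w \<bullet> y x + d" by blast
    show "affine_on_fibre A p a"
      unfolding affine_on_fibre_def
    proof (intro exI conjI ballI)
      show "linear_form (amodel A) p (\<lambda>v. w \<bullet> \<eta> v)"
        by (simp add: linear_form_def \<eta> inner_add_right)
      show "a (atrans A x v) = a x + w \<bullet> \<eta> v" if "x \<in> afibre A p" "v \<in> vfibre (amodel A) p" for x v
        using that by (simp add: a tr y inner_add_right)
    qed
  qed
qed

section \<open>Coordinates on the bundle of affine functions and on its dual\<close>

definition aff :: "('a \<Rightarrow> 'f) \<Rightarrow> 'm \<Rightarrow> 'f \<times> real \<Rightarrow> 'a \<Rightarrow> real" where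
  "aff y p wd = (\<lambda>x. if x \<in> afibre A p then fst wd \<bullet> y x + snd wd else 0)"

text \<open>\<open>aff_coord\<close> and \<open>hcoord\<close> are the trivialisations inside the
  records \<open>aff_bundle A\<close> and \<open>hat A\<close> that belong to a trivialisation y of
  \<open>A\<close>. The last component of \<open>hcoord\<close> is the value on the constant
  function 1.\<close>

definition aff_coord :: "('a \<Rightarrow> 'f) \<Rightarrow> 'm \<times> ('a \<Rightarrow> real) \<Rightarrow> 'f \<times> real" where
  "aff_coord y = (\<lambda>(p, a). THE wd. \<forall>x\<in>afibre A p. a x = fst wd \<bullet> y x + snd wd)"

definition hcoord :: "('a \<Rightarrow> 'f) \<Rightarrow> 'm \<times> ('m \<times> ('a \<Rightarrow> real) \<Rightarrow> real) \<Rightarrow> 'f \<times> real" where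
  "hcoord y = (\<lambda>(p, \<psi>). THE z. \<forall>v\<in>vfibre (aff_bundle A) p. \<psi> v = z \<bullet> aff_coord y v)"

abbreviation "H \<equiv> vtotal (hat A)"

lemma hat_simps: "vbase (hat A) = abase A" "vproj (hat A) = fst"
  "vadd (hat A) = (\<lambda>(p, \<psi>) (q, \<theta>). (p, \<lambda>v. \<psi> v + \<theta> v))"
  "vscale (hat A) = (\<lambda>c (p, \<psi>). (p, \<lambda>v. c * \<psi> v))"
  by (simp_all add: hat_def dual_bundle_def aff_bundle_def)

lemma vtriv_hat: "vtriv (hat A) = {(U, hcoord y) | U y. (U, y) \<in> atriv A}"
  unfolding hat_def dual_bundle_def hcoord_def aff_coord_def aff_bundle_def by auto

lemma vatlas_eq: "vatlas (hat A) = bundle_atlas (abase A) H fst (vtriv (hat A))"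
  by (simp add: vatlas_def hat_simps)

lemma hat_total_iff: "(p, \<psi>) \<in> H \<longleftrightarrow> p \<in> point_set (abase A) \<and> linear_form (aff_bundle A) p \<psi> \<and>
    (\<forall>v. v \<notin> vfibre (aff_bundle A) p \<longrightarrow> \<psi> v = 0)"
  by (simp add: hat_def dual_bundle_def aff_bundle_def)

lemma vfibre_aff_iff: "(q, a) \<in> vfibre (aff_bundle A) p \<longleftrightarrow> q = p \<and> p \<in> point_set (abase A) \<and>
    affine_on_fibre A p a \<and> (\<forall>x. x \<notin> afibre A p \<longrightarrow> a x = 0)"
  by (auto simp: vfibre_def aff_bundle_def)

context
  fixes U y p assumes U: "(U, y) \<in> atriv A" and p: "p \<in> U"
begin

lemma aff_fibre: "(p, aff y p wd) \<in> vfibre (aff_bundle A) p"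
  using atrivD(3)[OF U] p by (auto simp: vfibre_aff_iff affine_on_fibre_iff[OF U p] aff_def)

lemma aff_fibreE:
  assumes "s \<in> vfibre (aff_bundle A) p"
  obtains wd where "s = (p, aff y p wd)"
proof -
  obtain q a where s: "s = (q, a)" by fastforce
  then obtain w d where "\<forall>x\<in>afibre A p. a x = w \<bullet> y x + d"
    using assms by (auto simp: vfibre_aff_iff affine_on_fibre_iff[OF U p])
  then have "s = (p, aff y p (w, d))"
    using assms s by (auto simp: vfibre_aff_iff aff_def)
  then show thesis by (rule that)
qed

lemma aff_pt: "aff y p wd (AB.pt y p s) = fst wd \<bullet> s + snd wd"
  by (simp add: aff_def apt_fibre[OF U p] AB.pt[OF U p])

lemma affine_coeffs_unique:
  assumes "\<forall>x\<in>afibre A p. fst wd \<bullet> y x + snd wd = fst wd' \<bullet> y x + snd wd'"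
  shows "wd = wd'"
proof -
  have eq: "fst wd \<bullet> s + snd wd = fst wd' \<bullet> s + snd wd'" for s
    using bspec[OF assms apt_fibre[OF U p, of s]] by (simp add: AB.pt[OF U p])
  have "snd wd = snd wd'" using eq[of 0] by simp
  moreover from this have "fst wd = fst wd'" using eq by (intro vector_eq_rdot[THEN iffD1]) simp
  ultimately show ?thesis by (simp add: prod_eq_iff)
qed

lemma aff_coord_aff: "aff_coord y (p, aff y p wd) = wd"
  unfolding aff_coord_def prod.case
proof (rule the_equality)
  show "\<forall>x\<in>afibre A p. aff y p wd x = fst wd \<bullet> y x + snd wd" by (simp add: aff_def)
  show "wd' = wd" if "\<forall>x\<in>afibre A p. aff y p wd x = fst wd' \<bullet> y x + snd wd'" for wd'
    using that by (intro affine_coeffs_unique) (simp add: aff_def)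
qed

lemma hcoord_eqI:
  assumes "\<And>wd. \<psi> (p, aff y p wd) = z \<bullet> wd"
  shows "hcoord y (p, \<psi>) = z"
  unfolding hcoord_def prod.case
proof (rule the_equality)
  show "\<forall>v\<in>vfibre (aff_bundle A) p. \<psi> v = z \<bullet> aff_coord y v"
    using assms by (auto elim!: aff_fibreE simp: aff_coord_aff)
  fix z' assume z': "\<forall>v\<in>vfibre (aff_bundle A) p. \<psi> v = z' \<bullet> aff_coord y v"
  have "z' \<bullet> wd = z \<bullet> wd" for wd
    using bspec[OF z' aff_fibre[of wd]] assms[of wd] by (simp add: aff_coord_aff)
  then show "z' = z" by (intro vector_eq_rdot[THEN iffD1]) simp
qed

lemma hcoord:
  assumes "(p, \<psi>) \<in> H"
  shows "\<psi> (p, aff y p wd) = hcoord y (p, \<psi>) \<bullet> wd"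
proof -
  have l: "linear_form (aff_bundle A) p \<psi>" using assms by (simp add: hat_total_iff)
  have "linear (\<lambda>wd. \<psi> (p, aff y p wd))"
  proof (rule linearI)
    fix u v :: "'f \<times> real" and c :: real
    have "(p, aff y p (u + v)) = vadd (aff_bundle A) (p, aff y p u) (p, aff y p v)"
      by (auto simp: aff_bundle_def aff_def inner_add_left)
    then show "\<psi> (p, aff y p (u + v)) = \<psi> (p, aff y p u) + \<psi> (p, aff y p v)"
      using l aff_fibre by (simp add: linear_form_def)
    have "(p, aff y p (c *\<^sub>R u)) = vscale (aff_bundle A) c (p, aff y p u)"
      by (auto simp: aff_bundle_def aff_def algebra_simps)
    then show "\<psi> (p, aff y p (c *\<^sub>R u)) = c *\<^sub>R \<psi> (p, aff y p u)"
      using l aff_fibre by (simp add: linear_form_def)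
  qed
  then obtain z where z: "\<And>wd. \<psi> (p, aff y p wd) = z \<bullet> wd" using linear_riesz by metis
  then show ?thesis using hcoord_eqI by simp
qed

text \<open>The element with coordinates \<open>(\<zeta>, \<tau>)\<close> is \<open>ev x\<^sub>1 + (\<tau> - 1) ev x\<^sub>0\<close>, where \<open>x\<^sub>1\<close> and \<open>x\<^sub>0\<close> have the
  coordinates \<open>\<zeta>\<close> and \<open>0\<close>.\<close>

definition hpt :: "'f \<times> real \<Rightarrow> 'm \<times> ('m \<times> ('a \<Rightarrow> real) \<Rightarrow> real)" where
  "hpt z = (p, \<lambda>s. if s \<in> vfibre (aff_bundle A) p
     then snd s (AB.pt y p (fst z)) + (snd z - 1) * snd s (AB.pt y p 0) else 0)"

lemma hpt_total: "hpt z \<in> H"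
proof -
  have "vadd (aff_bundle A) u v \<in> vfibre (aff_bundle A) p \<and> vscale (aff_bundle A) c u \<in> vfibre (aff_bundle A) p"
    if h: "u \<in> vfibre (aff_bundle A) p" "v \<in> vfibre (aff_bundle A) p" for u v c
  proof -
    obtain wd wd' where uv: "u = (p, aff y p wd)" "v = (p, aff y p wd')"
      using aff_fibreE[OF h(1)] aff_fibreE[OF h(2)] by metis
    have "vadd (aff_bundle A) u v = (p, aff y p (wd + wd'))"
      "vscale (aff_bundle A) c u = (p, aff y p (c *\<^sub>R wd))"
      unfolding uv by (auto simp: aff_bundle_def aff_def inner_add_left algebra_simps)
    then show ?thesis using aff_fibre by simp
  qed
  then show ?thesis
    using atrivD(3)[OF U] p
    by (auto simp: hpt_def hat_total_iff linear_form_def aff_bundle_def algebra_simps)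
qed

lemma hcoord_hpt: "hcoord y (hpt z) = z"
  unfolding hpt_def by (rule hcoord_eqI) (simp add: aff_fibre aff_pt inner_prod_def inner_commute algebra_simps)

lemma fst_hpt: "fst (hpt z) = p"
  by (simp add: hpt_def)

lemma hcoord_bij: "bij_betw (hcoord y) {v \<in> H. fst v = p} UNIV"
  unfolding bij_betw_def
proof
  show "inj_on (hcoord y) {v \<in> H. fst v = p}"
  proof (rule inj_onI)
    fix u v assume "u \<in> {v \<in> H. fst v = p}" "v \<in> {v \<in> H. fst v = p}" and eq: "hcoord y u = hcoord y v"
    then obtain \<psi> \<theta> where uv: "u = (p, \<psi>)" "v = (p, \<theta>)" "(p, \<psi>) \<in> H" "(p, \<theta>) \<in> H"
      by (cases u; cases v) auto
    have "\<psi> s = \<theta> s" for s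
    proof (cases "s \<in> vfibre (aff_bundle A) p")
      case True
      then show ?thesis
        using hcoord[OF uv(3)] hcoord[OF uv(4)] eq uv(1,2) by (auto elim!: aff_fibreE)
    next
      case False
      then have "\<psi> s = 0" "\<theta> s = 0" using uv(3,4) unfolding hat_total_iff by blast+
      then show ?thesis by simp
    qed
    then show "u = v" using uv by auto
  qed
  show "hcoord y ` {v \<in> H. fst v = p} = UNIV"
    using hpt_total fst_hpt hcoord_hpt by (metis (mono_tags, lifting) UNIV_eq_I image_eqI mem_Collect_eq)
qed

end

lemma hat_fibre_bundle_data: "fibre_bundle_data (abase A) H fst (vtriv (hat A))"
proof
  show "smooth_atlas (abase A)" "separated (abase A)" by (rule base_atlas base_separated)+
  show "fst v \<in> point_set (abase A)" if "v \<in> H" for v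
    using that by (cases v) (simp add: hat_total_iff)
  show "(\<Union>(U, y)\<in>vtriv (hat A). U) = point_set (abase A)"
  proof -
    have "(\<Union>(U, y)\<in>vtriv (hat A). U) = (\<Union>(U, y)\<in>atriv A. U)"
      unfolding vtriv_hat by auto
    then show ?thesis using AB.triv_cover by simp
  qed
  show "openin (atlas_topology (abase A)) U" if "(U, y) \<in> vtriv (hat A)" for U y
    using that atrivD(1) by (auto simp: vtriv_hat)
  show "bij_betw y {v \<in> H. fst v = p} UNIV" if "(U, y) \<in> vtriv (hat A)" "p \<in> U" for U y p
    using that hcoord_bij by (auto simp: vtriv_hat)
qed

end

sublocale affine_bundle_ctx \<subseteq> H0: fibre_bundle_data "abase A" H fst "vtriv (hat A)"
  by (rule hat_fibre_bundle_data)

context affine_bundle_ctx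
begin

lemma hat_trivI: "(U, y) \<in> atriv A \<Longrightarrow> (U, hcoord y) \<in> vtriv (hat A)"
  by (auto simp: vtriv_hat)

lemma hpt_eq:
  assumes "(U, y) \<in> atriv A" "p \<in> U"
  shows "H0.pt (hcoord y) p z = hpt y p z"
  using H0.pt_triv[OF hat_trivI[OF assms(1)], of "hpt y p z"] assms
  by (simp add: hpt_total hcoord_hpt fst_hpt)

text \<open>The homogenisation of the affine transition map from y to y', keeping the last
  coordinate. The first component is written through values of the transition map of
  \<open>A\<close> itself, so smoothness carries over to \<open>hat A\<close>.\<close>

lemma hcoord_transition:
  assumes U: "(U, y) \<in> atriv A" "p \<in> U" and U': "(U', y') \<in> atriv A" "p \<in> U'"
  shows "hcoord y' (hpt y p z) = (y' (AB.pt y p (fst z)) + (snd z - 1) *\<^sub>R y' (AB.pt y p 0), snd z)"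
  unfolding hpt_def[OF U]
proof (rule hcoord_eqI[OF U'], goal_cases)
  case (1 wd)
  show ?case
    using aff_fibre[OF U'] apt_fibre[OF U]
    by (simp add: aff_def inner_prod_def inner_add_left inner_commute algebra_simps)
qed

lemma hat_atlas: "smooth_atlas (bundle_atlas (abase A) H fst (vtriv (hat A)))"
proof (rule H0.smooth_atlas_totalI)
  fix W \<phi> U Y W' \<phi>' U' Y'
  assume W: "(W, \<phi>) \<in> abase A" and "(U, Y) \<in> vtriv (hat A)" and W': "(W', \<phi>') \<in> abase A"
    and "(U', Y') \<in> vtriv (hat A)"
  then obtain y y' where U: "(U, y) \<in> atriv A" "Y = hcoord y" and U': "(U', y') \<in> atriv A" "Y' = hcoord y'"
    by (auto simp: vtriv_hat)
  let ?N = "\<phi> ` (W \<inter> U \<inter> (W' \<inter> U'))"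
  have o: "open ?N"
    using AB.open_base_image[OF W U(1) openin_Int[OF openin_chart[OF base_atlas W'] atrivD(1)[OF U'(1)]]] .
  have o2: "open (?N \<times> (UNIV :: ('f \<times> real) set))" "open (?N \<times> (UNIV :: 'f set))"
    using o by (simp_all add: open_Times)
  let ?t = "\<lambda>(x, s). y' (AB.pt y (inv_into W \<phi> x) s)"
  have t: "smooth_on ?t (?N \<times> UNIV)" by (rule AB.smooth_transition[OF W U(1) W' U'(1)])
  have 1: "smooth_on (\<lambda>z. ?t (fst z, fst (snd z))) (?N \<times> (UNIV :: ('f \<times> real) set))"
    by (rule smooth_on_compose[OF o2 _ _ t]) (auto intro!: smooth_intros o2)
  have 2: "smooth_on (\<lambda>z. ?t (fst z, 0)) (?N \<times> (UNIV :: ('f \<times> real) set))"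
    by (rule smooth_on_compose[OF o2 _ _ t]) (auto intro!: smooth_intros o2)
  have "smooth_on (\<lambda>z. (?t (fst z, fst (snd z)) + (snd (snd z) - 1) *\<^sub>R ?t (fst z, 0), snd (snd z)))
      (?N \<times> (UNIV :: ('f \<times> real) set))"
    by (intro smooth_intros 1 2 o2)
  then show "smooth_on (\<lambda>(x, s). Y' (H0.pt Y (inv_into W \<phi> x) s)) (?N \<times> UNIV)"
  proof (rule smooth_on_cong[OF _ o2(1)])
    fix z assume "z \<in> ?N \<times> (UNIV :: ('f \<times> real) set)"
    then obtain p s where p: "z = (\<phi> p, s)" "p \<in> W \<inter> U \<inter> (W' \<inter> U')" by auto
    then show "(?t (fst z, fst (snd z)) + (snd (snd z) - 1) *\<^sub>R ?t (fst z, 0), snd (snd z)) =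
        (case z of (x, s) \<Rightarrow> Y' (H0.pt Y (inv_into W \<phi> x) s))"
      using smooth_atlasD(1)[OF base_atlas W]
      by (simp add: U(2) U'(2) hpt_eq[OF U(1)] hcoord_transition[OF U(1) _ U'(1)])
  qed
qed

end

sublocale affine_bundle_ctx \<subseteq> HB: smooth_bundle "abase A" H fst "vtriv (hat A)"
  by unfold_locales (rule hat_atlas)

context affine_bundle_ctx
begin

lemma point_set_vatlas [simp]: "point_set (vatlas (hat A)) = H"
  by (simp add: vatlas_eq)

lemmas aatlas_smooth = AB.total_atlas[folded aatlas_eq]
lemmas aatlas_separated = AB.total_separated[folded aatlas_eq]
lemmas vatlas_smooth = HB.total_atlas[folded vatlas_eq]
lemmas vatlas_separated = HB.total_separated[folded vatlas_eq]
lemmas A_pullback = AB.Cinf_pullback[folded aatlas_eq]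
lemmas H_pullback = HB.Cinf_pullback[folded vatlas_eq]

subsection \<open>Affine functions\<close>

lemma affine_functions_iff:
  "a \<in> affine_functions A \<longleftrightarrow> a \<in> Cinf (aatlas A) \<and>
    (\<forall>(U, y)\<in>atriv A. \<forall>p\<in>U. \<exists>wd. \<forall>x\<in>afibre A p. a x = fst wd \<bullet> y x + snd wd)"
proof -
  have "(\<forall>p\<in>point_set (abase A). affine_on_fibre A p a) \<longleftrightarrow>
    (\<forall>(U, y)\<in>atriv A. \<forall>p\<in>U. \<exists>wd. \<forall>x\<in>afibre A p. a x = fst wd \<bullet> y x + snd wd)"
  proof
    assume *: "\<forall>p\<in>point_set (abase A). affine_on_fibre A p a"
    show "\<forall>(U, y)\<in>atriv A. \<forall>p\<in>U. \<exists>wd. \<forall>x\<in>afibre A p. a x = fst wd \<bullet> y x + snd wd"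
    proof clarify
      fix U y p assume U: "(U, y) \<in> atriv A" "p \<in> U"
      then have "affine_on_fibre A p a" using * atrivD(3)[OF U(1)] by blast
      then show "\<exists>wd. \<forall>x\<in>afibre A p. a x = fst wd \<bullet> y x + snd wd"
        by (simp add: affine_on_fibre_iff[OF U] split_paired_Ex)
    qed
  next
    assume *: "\<forall>(U, y)\<in>atriv A. \<forall>p\<in>U. \<exists>wd. \<forall>x\<in>afibre A p. a x = fst wd \<bullet> y x + snd wd"
    show "\<forall>p\<in>point_set (abase A). affine_on_fibre A p a"
    proof
      fix p assume "p \<in> point_set (abase A)"
      then obtain U y where U: "(U, y) \<in> atriv A" "p \<in> U" by (rule AB.trivE)
      then have "\<exists>wd. \<forall>x\<in>afibre A p. a x = fst wd \<bullet> y x + snd wd" using * by blast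
      then show "affine_on_fibre A p a"
        by (auto simp add: affine_on_fibre_iff[OF U])
    qed
  qed
  then show ?thesis by (simp add: affine_functions_def)
qed

lemma affine_Cinf: "a \<in> affine_functions A \<Longrightarrow> a \<in> Cinf (aatlas A)"
  by (simp add: affine_functions_iff)

lemma affineE:
  assumes "a \<in> affine_functions A" "(U, y) \<in> atriv A" "p \<in> U"
  obtains wd where "\<And>x. x \<in> afibre A p \<Longrightarrow> a x = fst wd \<bullet> y x + snd wd"
  using bspec[OF conjunct2[OF assms(1)[unfolded affine_functions_iff]] assms(2)] assms(3) by auto

lemma affine_functionsI:
  assumes "a \<in> Cinf (aatlas A)"
    "\<And>U y p. (U, y) \<in> atriv A \<Longrightarrow> p \<in> U \<Longrightarrow> \<exists>w d. \<forall>x\<in>afibre A p. a x = w \<bullet> y x + d"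
  shows "a \<in> affine_functions A"
  unfolding affine_functions_iff
proof (intro conjI assms(1), clarify)
  fix U y p assume "(U, y) \<in> atriv A" "p \<in> U"
  then obtain w d where "\<forall>x\<in>afibre A p. a x = w \<bullet> y x + d" using assms(2) by blast
  then show "\<exists>wd. \<forall>x\<in>afibre A p. a x = fst wd \<bullet> y x + snd wd"
    by (intro exI[of _ "(w, d)"]) simp
qed

lemma affine_pullback:
  assumes "f \<in> Cinf (abase A)" shows "(\<lambda>x. f (aproj A x)) \<in> affine_functions A"
proof (rule affine_functionsI[OF A_pullback[OF assms]])
  fix y :: "'a \<Rightarrow> 'f" and p
  show "\<exists>w d. \<forall>x\<in>afibre A p. f (aproj A x) = w \<bullet> y x + d"
    by (intro exI[of _ 0] exI[of _ "f p"]) (simp add: afibre_iff)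
qed

lemma affine_const: "(\<lambda>_. c) \<in> affine_functions A"
  using affine_pullback[OF Cinf_const[OF base_atlas]] .

lemma affine_add:
  assumes "a \<in> affine_functions A" "b \<in> affine_functions A"
  shows "(\<lambda>x. a x + b x) \<in> affine_functions A"
proof (rule affine_functionsI[OF Cinf_add[OF aatlas_smooth assms[THEN affine_Cinf]]])
  fix U y p assume U: "(U, y) \<in> atriv A" "p \<in> U"
  obtain wd where "\<And>x. x \<in> afibre A p \<Longrightarrow> a x = fst wd \<bullet> y x + snd wd" using affineE[OF assms(1) U] by blast
  moreover obtain wd' where "\<And>x. x \<in> afibre A p \<Longrightarrow> b x = fst wd' \<bullet> y x + snd wd'" using affineE[OF assms(2) U] by blast
  ultimately show "\<exists>w d. \<forall>x\<in>afibre A p. a x + b x = w \<bullet> y x + d"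
    by (intro exI[of _ "fst wd + fst wd'"] exI[of _ "snd wd + snd wd'"]) (simp add: inner_add_left)
qed

lemma affine_module:
  assumes f: "f \<in> Cinf (abase A)" and a: "a \<in> affine_functions A"
  shows "(\<lambda>x. f (aproj A x) * a x) \<in> affine_functions A"
proof (rule affine_functionsI[OF Cinf_mult[OF aatlas_smooth A_pullback[OF f] affine_Cinf[OF a]]])
  fix U y p assume U: "(U, y) \<in> atriv A" "p \<in> U"
  obtain wd where "\<And>x. x \<in> afibre A p \<Longrightarrow> a x = fst wd \<bullet> y x + snd wd" using affineE[OF a U] by blast
  then show "\<exists>w d. \<forall>x\<in>afibre A p. f (aproj A x) * a x = w \<bullet> y x + d"
    by (intro exI[of _ "f p *\<^sub>R fst wd"] exI[of _ "f p * snd wd"]) (simp add: afibre_iff algebra_simps)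
qed

lemma affine_scale: "a \<in> affine_functions A \<Longrightarrow> (\<lambda>x. c * a x) \<in> affine_functions A"
  using affine_module[OF Cinf_const[OF base_atlas]] .

lemma affine_sum:
  "(\<And>i. i \<in> I \<Longrightarrow> a i \<in> affine_functions A) \<Longrightarrow> (\<lambda>x. \<Sum>i\<in>I. a i x) \<in> affine_functions A"
  by (induction I rule: infinite_finite_induct) (auto intro: affine_const affine_add)

text \<open>Multiplying by a basic cutoff function keeps functions affine on the fibres, so the
  fibre coordinates over N extend to global affine functions.\<close>

lemma affine_coordinates:
  assumes W: "(W, \<phi>) \<in> abase A" and U: "(U, y) \<in> atriv A" and p: "p \<in> W" "p \<in> U"
  obtains N \<alpha> \<xi> where "openin (atlas_topology (abase A)) N" "p \<in> N" "N \<subseteq> W \<inter> U"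
    "\<And>wd. \<alpha> wd \<in> affine_functions A" "\<And>w. \<xi> w \<in> Cinf (abase A)"
    "\<And>wd x. x \<in> atotal A \<Longrightarrow> aproj A x \<in> N \<Longrightarrow> \<alpha> wd x = fst wd \<bullet> y x + snd wd"
    "\<And>w q. q \<in> N \<Longrightarrow> \<xi> w q = w \<bullet> \<phi> q"
proof -
  let ?S = "\<phi> ` (W \<inter> U)"
  have oS: "open ?S" by (rule AB.open_base_image_dom[OF W U])
  have pS: "\<phi> p \<in> ?S" and SW: "?S \<subseteq> \<phi> ` W" using p by auto
  have inj: "q \<in> U" if "q \<in> W" "\<phi> q \<in> ?S" for q
    using that smooth_atlasD(1)[OF base_atlas W] by (auto simp: inj_on_def)
  obtain \<theta> V T where \<theta>: "\<theta> \<in> Cinf (abase A)" "openin (atlas_topology (abase A)) V"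
    "\<And>q. q \<in> point_set (abase A) \<Longrightarrow> q \<in> V \<or> q \<in> W \<and> \<phi> q \<in> ?S" "\<And>q. q \<in> V \<Longrightarrow> \<theta> q = 0"
    "open T" "\<phi> p \<in> T" "T \<subseteq> ?S" "\<And>q. q \<in> W \<Longrightarrow> \<phi> q \<in> T \<Longrightarrow> \<theta> q = 1"
    using separated_bump[OF base_atlas base_separated W p(1) oS pS SW] by blast
  define N where "N = {q \<in> W. \<phi> q \<in> T}"
  have N: "openin (atlas_topology (abase A)) N"
    unfolding N_def by (rule openin_chart_preimage[OF base_atlas W \<theta>(5)])
  have NWU: "N \<subseteq> W \<inter> U" using inj \<theta>(7) by (auto simp: N_def)
  define \<xi> where "\<xi> w q = (if q \<in> W \<and> \<phi> q \<in> ?S then \<theta> q * (w \<bullet> \<phi> q) else 0)" for w q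
  have \<xi>: "\<xi> w \<in> Cinf (abase A)" for w
    unfolding \<xi>_def
  proof (rule bump_extend[OF base_atlas W oS SW \<theta>(1-4)])
    show "smooth_on ((\<lambda>q. w \<bullet> \<phi> q) \<circ> inv_into W \<phi>) ?S"
      by (rule smooth_on_cong[OF smooth_on_inner[OF oS smooth_on_const[OF oS] smooth_on_id[OF oS], of w] oS])
        (use SW in \<open>auto simp: f_inv_into_f\<close>)
  qed auto
  let ?D = "AB.dom W U" and ?\<kappa> = "AB.chart \<phi> y"
  note D = AB.chart_in_total[OF W U, folded aatlas_eq]
  have oD: "open (?\<kappa> ` ?D)" by (rule smooth_atlasD(2)[OF aatlas_smooth D])
  define \<alpha> where "\<alpha> wd x = (if x \<in> ?D \<and> ?\<kappa> x \<in> ?\<kappa> ` ?D then \<theta> (aproj A x) * (fst wd \<bullet> y x + snd wd) else 0)" for wd x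
  have \<alpha>C: "\<alpha> wd \<in> Cinf (aatlas A)" for wd
    unfolding \<alpha>_def
  proof (rule bump_extend[OF aatlas_smooth D oD order_refl A_pullback[OF \<theta>(1)]
        AB.openin_preimage[OF \<theta>(2), folded aatlas_eq]])
    show "x \<in> {v \<in> atotal A. aproj A v \<in> V} \<or> x \<in> ?D \<and> ?\<kappa> x \<in> ?\<kappa> ` ?D"
      if "x \<in> point_set (aatlas A)" for x
      using \<theta>(3)[OF AB.proj, of x] that inj by (auto simp: AB.dom_def)
    show "\<theta> (aproj A x) = 0" if "x \<in> {v \<in> atotal A. aproj A v \<in> V}" for x
      using that \<theta>(4) by auto
    have "smooth_on (\<lambda>z. fst wd \<bullet> snd z + snd wd) (?\<kappa> ` ?D)"
      by (intro smooth_intros oD)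
    then show "smooth_on ((\<lambda>x. fst wd \<bullet> y x + snd wd) \<circ> inv_into ?D ?\<kappa>) (?\<kappa> ` ?D)"
      by (rule smooth_on_cong[OF _ oD])
        (clarsimp simp: smooth_atlasD(1)[OF aatlas_smooth D], simp add: AB.chart_def)
  qed
  have \<alpha>: "\<alpha> wd \<in> affine_functions A" for wd
    unfolding affine_functions_def
  proof (intro CollectI conjI \<alpha>C ballI)
    fix q assume q: "q \<in> point_set (abase A)"
    show "affine_on_fibre A q (\<alpha> wd)"
    proof (cases "q \<in> W \<inter> U")
      case True
      then show ?thesis
        by (subst affine_on_fibre_iff[OF U])
          (auto simp: \<alpha>_def AB.dom_def afibre_iff algebra_simps
            intro!: exI[of _ "\<theta> q *\<^sub>R fst wd"] exI[of _ "\<theta> q * snd wd"])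
    next
      case False
      obtain U' y' where U': "(U', y') \<in> atriv A" "q \<in> U'" using q by (rule AB.trivE)
      show ?thesis
        using False by (subst affine_on_fibre_iff[OF U'])
          (auto simp: \<alpha>_def AB.dom_def afibre_iff intro!: exI[of _ 0] exI[of _ "0::real"])
    qed
  qed
  show ?thesis
  proof (rule that[OF N _ NWU \<alpha> \<xi>])
    show "p \<in> N" using p \<theta>(6) by (simp add: N_def)
    show "\<alpha> wd x = fst wd \<bullet> y x + snd wd" if "x \<in> atotal A" "aproj A x \<in> N" for wd x
    proof -
      have "x \<in> ?D" using that NWU by (auto simp: AB.dom_def)
      moreover have "\<theta> (aproj A x) = 1" using that(2) \<theta>(8) by (auto simp: N_def)
      ultimately show ?thesis by (auto simp: \<alpha>_def)
    qed
    show "\<xi> w q = w \<bullet> \<phi> q" if "q \<in> N" for w q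
    proof -
      have "q \<in> W" "\<phi> q \<in> T" using that by (auto simp: N_def)
      then show ?thesis using \<theta>(7) \<theta>(8)[of q] by (auto simp: \<xi>_def)
    qed
  qed
qed

text \<open>The coordinates of a bundle chart are sums of a base coordinate and a fibre coordinate,
  and near x both are given by global affine functions.\<close>

lemma affine_jet_determining:
  assumes x: "x \<in> atotal A"
  shows "jet_determining (aatlas A) x (affine_functions A)"
proof (rule jet_determiningI[OF aatlas_smooth])
  show "affine_functions A \<subseteq> Cinf (aatlas A)" using affine_Cinf by blast
  show "(\<lambda>_. 1) \<in> affine_functions A" by (rule affine_const)
  fix v f assume v: "v \<in> tangent_space (aatlas A) x" and v0: "\<And>s. s \<in> affine_functions A \<Longrightarrow> v s = 0"
    and f: "f \<in> Cinf (aatlas A)"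
  obtain W \<phi> U y where W: "(W, \<phi>) \<in> abase A" and U: "(U, y) \<in> atriv A" and D: "x \<in> AB.dom W U"
    using x by (rule AB.chartE)
  have p: "aproj A x \<in> W" "aproj A x \<in> U" using D by (auto simp: AB.dom_def)
  obtain N \<alpha> \<xi> where N: "openin (atlas_topology (abase A)) N" "aproj A x \<in> N" "N \<subseteq> W \<inter> U"
    "\<And>wd. \<alpha> wd \<in> affine_functions A" "\<And>w. \<xi> w \<in> Cinf (abase A)"
    "\<And>wd x. x \<in> atotal A \<Longrightarrow> aproj A x \<in> N \<Longrightarrow> \<alpha> wd x = fst wd \<bullet> y x + snd wd"
    "\<And>w q. q \<in> N \<Longrightarrow> \<xi> w q = w \<bullet> \<phi> q"
    using affine_coordinates[OF W U p] by metis
  define X where "X b = (\<lambda>x. \<xi> (fst b) (aproj A x) + \<alpha> (snd b, 0) x)" for b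
  have X: "X b \<in> affine_functions A" for b
    unfolding X_def by (intro affine_add affine_pullback N)
  let ?S = "AB.chart \<phi> y ` (AB.dom W U \<inter> {v \<in> atotal A. aproj A v \<in> N})"
  note DT = AB.chart_in_total[OF W U, folded aatlas_eq]
  have "v f = (\<Sum>b\<in>onb. v (X b) * chart_deriv (AB.dom W U) (AB.chart \<phi> y) f x b)"
  proof (rule tangent_expand[OF aatlas_smooth aatlas_separated DT D _ _ _ _ _ v f])
    show "X b \<in> Cinf (aatlas A)" for b using X affine_Cinf by blast
    show "open ?S"
      using openin_chart_image[OF aatlas_smooth DT AB.openin_preimage[OF N(1), folded aatlas_eq]] .
    show "AB.chart \<phi> y x \<in> ?S" "?S \<subseteq> AB.chart \<phi> y ` AB.dom W U" using D x N(2) by auto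
    fix b x' assume x': "x' \<in> AB.dom W U" "AB.chart \<phi> y x' \<in> ?S"
    then have "x' \<in> atotal A" "aproj A x' \<in> N"
      using smooth_atlasD(1)[OF aatlas_smooth DT] by (auto simp: inj_on_def)
    then show "X b x' = b \<bullet> AB.chart \<phi> y x'"
      by (simp add: X_def N AB.chart_def inner_prod_def)
  qed
  then show "v f = 0" using v0[OF X] by simp
qed

subsection \<open>Fibrewise linear functions\<close>

lemma bar_eq:
  assumes U: "(U, y) \<in> atriv A" and z: "z \<in> H" "fst z \<in> U"
    and a: "\<And>x. x \<in> afibre A (fst z) \<Longrightarrow> a x = fst wd \<bullet> y x + snd wd"
  shows "bar A a z = hcoord y z \<bullet> wd"
proof -
  obtain p \<psi> where p: "z = (p, \<psi>)" by fastforce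
  have "fibre_section A a p = (p, aff y p wd)"
    using a by (auto simp: fibre_section_def aff_def p)
  then show ?thesis using hcoord[OF U, of p \<psi> wd] z by (simp add: bar_def iota_def p)
qed

text \<open>\<open>bar A a\<close> is the homogenisation of a. It is expressed by two values of a on
  the fibre of \<open>A\<close>, so that its smoothness and its derivatives can be read off those of
  a.\<close>

lemma bar_hpt:
  assumes U: "(U, y) \<in> atriv A" and p: "p \<in> U" and a: "a \<in> affine_functions A"
  shows "bar A a (hpt y p z) = a (AB.pt y p (fst z)) + (snd z - 1) * a (AB.pt y p 0)"
proof -
  obtain wd where wd: "\<And>x. x \<in> afibre A p \<Longrightarrow> a x = fst wd \<bullet> y x + snd wd" using affineE[OF a U p] by blast
  have "bar A a (hpt y p z) = hcoord y (hpt y p z) \<bullet> wd"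
    by (rule bar_eq[OF U hpt_total[OF U p]]) (use p wd in \<open>simp_all add: fst_hpt[OF U]\<close>)
  then show ?thesis
    by (simp add: hcoord_hpt[OF U p] wd apt_fibre[OF U p] AB.pt[OF U p] inner_prod_def inner_commute algebra_simps)
qed

lemma hpt_hcoord:
  assumes "(U, y) \<in> atriv A" "z \<in> H" "fst z \<in> U"
  shows "hpt y (fst z) (hcoord y z) = z"
  using H0.pt_triv[OF hat_trivI[OF assms(1)] assms(3,2)] hpt_eq[OF assms(1,3)] by simp

lemma H_trivE:
  assumes "z \<in> H"
  obtains U y where "(U, y) \<in> atriv A" "fst z \<in> U"
  using AB.trivE[OF H0.proj[OF assms]] by blast

lemma H_chartE:
  assumes "z \<in> H"
  obtains W \<phi> U y where "(W, \<phi>) \<in> abase A" "(U, y) \<in> atriv A" "fst z \<in> W" "fst z \<in> U" "z \<in> H0.dom W U"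
proof -
  obtain W \<phi> where "(W, \<phi>) \<in> abase A" "fst z \<in> W" using H0.proj[OF assms] by (rule point_setE)
  moreover obtain U y where "(U, y) \<in> atriv A" "fst z \<in> U" using assms by (rule H_trivE)
  ultimately show thesis using that[of W \<phi> U y] assms by (simp add: H0.dom_def)
qed

lemma bar_cong:
  assumes "\<And>x. x \<in> atotal A \<Longrightarrow> aproj A x = fst z \<Longrightarrow> a x = b x"
  shows "bar A a z = bar A b z"
proof -
  have "fibre_section A a (fst z) = fibre_section A b (fst z)"
    using assms by (auto simp: fibre_section_def afibre_iff)
  then show ?thesis by (cases z) (simp add: bar_def iota_def)
qed

lemma bar_add:
  assumes a: "a \<in> affine_functions A" and b: "b \<in> affine_functions A" and z: "z \<in> H"
  shows "bar A (\<lambda>x. a x + b x) z = bar A a z + bar A b z"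
proof -
  obtain U y where U: "(U, y) \<in> atriv A" "fst z \<in> U" using z by (rule H_trivE)
  show ?thesis
    using bar_hpt[OF U a, of "hcoord y z"] bar_hpt[OF U b, of "hcoord y z"]
      bar_hpt[OF U affine_add[OF a b], of "hcoord y z"] hpt_hcoord[OF U(1) z U(2)]
    by (simp add: algebra_simps)
qed

lemma bar_module:
  assumes f: "f \<in> Cinf (abase A)" and a: "a \<in> affine_functions A" and z: "z \<in> H"
  shows "bar A (\<lambda>x. f (aproj A x) * a x) z = f (fst z) * bar A a z"
proof -
  obtain U y where U: "(U, y) \<in> atriv A" "fst z \<in> U" using z by (rule H_trivE)
  show ?thesis
    using bar_hpt[OF U a, of "hcoord y z"]
      bar_hpt[OF U affine_module[OF f a], of "hcoord y z"] hpt_hcoord[OF U(1) z U(2)]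
    by (simp add: AB.pt[OF U] distrib_left mult.left_commute)
qed

lemma bar_scale: "a \<in> affine_functions A \<Longrightarrow> z \<in> H \<Longrightarrow> bar A (\<lambda>x. c * a x) z = c * bar A a z"
  using bar_module[OF Cinf_const[OF base_atlas]] .

lemma bar_sum:
  assumes z: "z \<in> H"
  shows "finite I \<Longrightarrow> (\<And>i. i \<in> I \<Longrightarrow> a i \<in> affine_functions A) \<Longrightarrow>
    bar A (\<lambda>x. \<Sum>i\<in>I. a i x) z = (\<Sum>i\<in>I. bar A (a i) z)"
proof (induction I rule: finite_induct)
  case empty
  then show ?case using bar_scale[OF affine_const z, of 0] by simp
next
  case (insert i I)
  then show ?case using bar_add[OF _ _ z, of "a i" "\<lambda>x. \<Sum>i\<in>I. a i x"] by (simp add: affine_sum)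
qed

lemma bar_Cinf:
  assumes a: "a \<in> affine_functions A"
  shows "bar A a \<in> Cinf (vatlas (hat A))"
  unfolding Cinf_iff_smooth_at[OF vatlas_smooth]
proof
  fix z assume "z \<in> point_set (vatlas (hat A))"
  then have z: "z \<in> H" by simp
  obtain W \<phi> U y where W: "(W, \<phi>) \<in> abase A" and U: "(U, y) \<in> atriv A" and D: "z \<in> H0.dom W U"
    "fst z \<in> W" "fst z \<in> U"
    using z by (rule H_chartE) blast
  let ?N = "\<phi> ` (W \<inter> U)"
  have o: "open ?N" by (rule AB.open_base_image_dom[OF W U])
  have o2: "open (?N \<times> (UNIV :: ('f \<times> real) set))" "open (?N \<times> (UNIV :: 'f set))"
    using o by (simp_all add: open_Times)
  let ?t = "\<lambda>(x, s). a (AB.pt y (inv_into W \<phi> x) s)"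
  have t: "smooth_on ?t (?N \<times> UNIV)" using AB.smooth_along_triv[OF W U affine_Cinf[OF a, unfolded aatlas_eq]] .
  have 1: "smooth_on (\<lambda>z. ?t (fst z, fst (snd z))) (?N \<times> (UNIV :: ('f \<times> real) set))"
    by (rule smooth_on_compose[OF o2 _ _ t]) (auto intro!: smooth_intros o2)
  have 2: "smooth_on (\<lambda>z. ?t (fst z, 0)) (?N \<times> (UNIV :: ('f \<times> real) set))"
    by (rule smooth_on_compose[OF o2 _ _ t]) (auto intro!: smooth_intros o2)
  have 3: "smooth_on (\<lambda>z. ?t (fst z, fst (snd z)) + (snd (snd z) - 1) * ?t (fst z, 0))
      (?N \<times> (UNIV :: ('f \<times> real) set))"
    by (intro smooth_intros 1 2 o2)
  show "smooth_at (vatlas (hat A)) (bar A a) z"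
    unfolding vatlas_eq
  proof (rule HB.total_smooth_atI[OF W hat_trivI[OF U] o2(1) order_refl D(1)])
    show "H0.chart \<phi> (hcoord y) z \<in> ?N \<times> UNIV" using D by (auto simp: H0.chart_def)
    show "smooth_on (\<lambda>(x, s). bar A a (H0.pt (hcoord y) (inv_into W \<phi> x) s)) (?N \<times> UNIV)"
      by (rule smooth_on_cong[OF 3 o2(1)])
        (use smooth_atlasD(1)[OF base_atlas W] in \<open>auto simp: hpt_eq[OF U] bar_hpt[OF U _ a]\<close>)
  qed
qed

lemma evaluation_eq_hpt:
  assumes U: "(U, y) \<in> atriv A" and x: "x \<in> atotal A" "aproj A x \<in> U"
  shows "evaluation A x = hpt y (aproj A x) (y x, 1)"
  using AB.pt_triv[OF U x(2,1)] by (auto simp: evaluation_def hpt_def[OF U x(2)])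

lemma evaluation:
  assumes x: "x \<in> atotal A"
  shows "evaluation A x \<in> H" "fst (evaluation A x) = aproj A x"
    "(U, y) \<in> atriv A \<Longrightarrow> aproj A x \<in> U \<Longrightarrow> hcoord y (evaluation A x) = (y x, 1)"
    "a \<in> affine_functions A \<Longrightarrow> bar A a (evaluation A x) = a x"
proof -
  obtain U' y' where U': "(U', y') \<in> atriv A" "aproj A x \<in> U'" using AB.proj[OF x] by (rule AB.trivE)
  note ev = evaluation_eq_hpt[OF _ x]
  show "evaluation A x \<in> H" "fst (evaluation A x) = aproj A x"
    by (simp_all add: ev[OF U'] hpt_total[OF U'] fst_hpt[OF U'])
  show "hcoord y (evaluation A x) = (y x, 1)" if "(U, y) \<in> atriv A" "aproj A x \<in> U"
    by (simp add: ev[OF that] hcoord_hpt[OF that])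
  show "bar A a (evaluation A x) = a x" if "a \<in> affine_functions A"
    by (simp add: ev[OF U'] bar_hpt[OF U' that] AB.pt_triv[OF U' x])
qed

lemma evaluation_Cinf:
  assumes F: "F \<in> Cinf (vatlas (hat A))"
  shows "(\<lambda>x. F (evaluation A x)) \<in> Cinf (aatlas A)"
  unfolding Cinf_iff_smooth_at[OF aatlas_smooth]
proof
  fix x assume "x \<in> point_set (aatlas A)"
  then have x: "x \<in> atotal A" by simp
  obtain W \<phi> U y where W: "(W, \<phi>) \<in> abase A" and U: "(U, y) \<in> atriv A" and D: "x \<in> AB.dom W U"
    using x by (rule AB.chartE)
  let ?N = "\<phi> ` (W \<inter> U)"
  have o: "open ?N" by (rule AB.open_base_image_dom[OF W U])
  have o2: "open (?N \<times> (UNIV :: ('f \<times> real) set))" "open (?N \<times> (UNIV :: 'f set))"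
    using o by (simp_all add: open_Times)
  have "smooth_on (\<lambda>z. (\<lambda>(x, s). F (H0.pt (hcoord y) (inv_into W \<phi> x) s)) (fst z, snd z, 1)) (?N \<times> (UNIV::'f set))"
    by (rule smooth_on_compose[OF o2(2,1) _ _ HB.smooth_along_triv[OF W hat_trivI[OF U] F[unfolded vatlas_eq]]])
      (auto intro!: smooth_intros o2)
  then have "smooth_on (\<lambda>(x, s). F (evaluation A (AB.pt y (inv_into W \<phi> x) s))) (?N \<times> (UNIV::'f set))"
    by (rule smooth_on_cong[OF _ o2(2)])
      (use smooth_atlasD(1)[OF base_atlas W] in \<open>auto simp: hpt_eq[OF U] evaluation_eq_hpt[OF U] AB.pt[OF U]\<close>)
  then show "smooth_at (aatlas A) (\<lambda>x. F (evaluation A x)) x"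
    unfolding aatlas_eq
    by (rule AB.total_smooth_atI[OF W U o2(2) order_refl D, rotated])
      (use D in \<open>auto simp: AB.chart_def AB.dom_def\<close>)
qed

end

context affine_bundle_ctx
begin

section \<open>Frames and 1-jets on the hull\<close>

definition affine_frame :: "'m set \<Rightarrow> ('m \<Rightarrow> 'e) \<Rightarrow> 'm set \<Rightarrow> ('a \<Rightarrow> 'f) \<Rightarrow> 'm set \<Rightarrow>
    ('f \<times> real \<Rightarrow> 'a \<Rightarrow> real) \<Rightarrow> ('e \<Rightarrow> 'm \<Rightarrow> real) \<Rightarrow> bool" where
  "affine_frame W \<phi> U y N \<alpha> \<xi> \<longleftrightarrow> (W, \<phi>) \<in> abase A \<and> (U, y) \<in> atriv A \<and>
     openin (atlas_topology (abase A)) N \<and> N \<subseteq> W \<inter> U \<and>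
     (\<forall>wd. \<alpha> wd \<in> affine_functions A) \<and> (\<forall>w. \<xi> w \<in> Cinf (abase A)) \<and>
     (\<forall>wd x. x \<in> atotal A \<longrightarrow> aproj A x \<in> N \<longrightarrow> \<alpha> wd x = fst wd \<bullet> y x + snd wd) \<and>
     (\<forall>w q. q \<in> N \<longrightarrow> \<xi> w q = w \<bullet> \<phi> q)"

lemma affine_frameD:
  assumes "affine_frame W \<phi> U y N \<alpha> \<xi>"
  shows "(W, \<phi>) \<in> abase A" "(U, y) \<in> atriv A" "openin (atlas_topology (abase A)) N" "N \<subseteq> W \<inter> U"
    "\<alpha> wd \<in> affine_functions A" "\<xi> w \<in> Cinf (abase A)"
    "x \<in> atotal A \<Longrightarrow> aproj A x \<in> N \<Longrightarrow> \<alpha> wd x = fst wd \<bullet> y x + snd wd"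
    "q \<in> N \<Longrightarrow> \<xi> w q = w \<bullet> \<phi> q"
  using assms unfolding affine_frame_def by (auto simp del: split_paired_All)

lemma affine_frame_exists:
  assumes p: "p \<in> point_set (abase A)"
  obtains W \<phi> U y N \<alpha> \<xi> where "affine_frame W \<phi> U y N \<alpha> \<xi>" "p \<in> N"
proof -
  obtain W \<phi> where W: "(W, \<phi>) \<in> abase A" "p \<in> W" using p by (rule point_setE)
  obtain U y where U: "(U, y) \<in> atriv A" "p \<in> U" using p by (rule AB.trivE)
  obtain N \<alpha> \<xi> where N: "openin (atlas_topology (abase A)) N" "p \<in> N" "N \<subseteq> W \<inter> U"
    "\<And>wd. \<alpha> wd \<in> affine_functions A" "\<And>w. \<xi> w \<in> Cinf (abase A)"
    "\<And>wd x. x \<in> atotal A \<Longrightarrow> aproj A x \<in> N \<Longrightarrow> \<alpha> wd x = fst wd \<bullet> y x + snd wd"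
    "\<And>w q. q \<in> N \<Longrightarrow> \<xi> w q = w \<bullet> \<phi> q"
    using affine_coordinates[OF W(1) U(1) W(2) U(2)] by metis
  then have "affine_frame W \<phi> U y N \<alpha> \<xi>"
    using W U unfolding affine_frame_def by blast
  then show thesis using N(2) by (rule that)
qed

text \<open>Global functions that over N are the linear coordinates of the bundle chart of
  \<open>hat A\<close>: base coordinates are basic, fibre coordinates are fibrewise linear.\<close>

definition hat_frame :: "('f \<times> real \<Rightarrow> 'a \<Rightarrow> real) \<Rightarrow> ('e \<Rightarrow> 'm \<Rightarrow> real) \<Rightarrow> 'e \<times> 'f \<times> real \<Rightarrow>
    'm \<times> ('m \<times> ('a \<Rightarrow> real) \<Rightarrow> real) \<Rightarrow> real" where
  "hat_frame \<alpha> \<xi> b = (\<lambda>z. \<xi> (fst b) (fst z) + bar A (\<alpha> (snd b)) z)"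

abbreviation "hdom W U \<equiv> H0.dom W U"
abbreviation "hchart \<phi> y \<equiv> H0.chart \<phi> (hcoord y)"

lemma hchart_in_atlas: "(W, \<phi>) \<in> abase A \<Longrightarrow> (U, y) \<in> atriv A \<Longrightarrow> (hdom W U, hchart \<phi> y) \<in> vatlas (hat A)"
  using H0.chart_in_total[OF _ hat_trivI] by (simp add: vatlas_eq)

lemma hdom_iff: "z \<in> hdom W U \<longleftrightarrow> z \<in> H \<and> fst z \<in> W \<and> fst z \<in> U"
  by (auto simp: H0.dom_def)

context
  fixes W \<phi> U y N \<alpha> \<xi> assumes frame: "affine_frame W \<phi> U y N \<alpha> \<xi>"
begin

lemmas frameD = affine_frameD[OF frame]

lemma frame_bar:
  assumes z: "z \<in> H" "fst z \<in> N"
  shows "bar A (\<alpha> wd) z = hcoord y z \<bullet> wd"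
  by (rule bar_eq[OF frameD(2) z(1)]) (use z frameD(4,7) in \<open>auto simp: afibre_iff\<close>)

lemma hat_frame_Cinf: "hat_frame \<alpha> \<xi> b \<in> Cinf (vatlas (hat A))"
  unfolding hat_frame_def by (intro Cinf_add vatlas_smooth H_pullback bar_Cinf frameD)

lemma hat_frame_eq:
  assumes z: "z \<in> H" "fst z \<in> N"
  shows "hat_frame \<alpha> \<xi> b z = b \<bullet> hchart \<phi> y z"
  using z by (simp add: hat_frame_def frame_bar frameD H0.chart_def inner_prod_def inner_commute)

lemma openin_over_N: "openin (atlas_topology (vatlas (hat A))) {z \<in> H. fst z \<in> N}"
  using HB.openin_preimage[OF frameD(3)] by (simp add: vatlas_eq)

lemma hat_expand:
  assumes z: "z \<in> H" "fst z \<in> N" and v: "v \<in> tangent_space (vatlas (hat A)) z" and F: "F \<in> Cinf (vatlas (hat A))"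
  shows "v F = (\<Sum>b\<in>onb. v (hat_frame \<alpha> \<xi> b) * chart_deriv (hdom W U) (hchart \<phi> y) F z b)"
proof -
  note DT = hchart_in_atlas[OF frameD(1,2)]
  have D: "z \<in> hdom W U" using z frameD(4) by (auto simp: hdom_iff)
  let ?S = "hchart \<phi> y ` (hdom W U \<inter> {z \<in> H. fst z \<in> N})"
  show ?thesis
  proof (rule tangent_expand[OF vatlas_smooth vatlas_separated DT D _ _ _ _ _ v F])
    show "hat_frame \<alpha> \<xi> b \<in> Cinf (vatlas (hat A))" for b by (rule hat_frame_Cinf)
    show "open ?S" using openin_chart_image[OF vatlas_smooth DT openin_over_N] .
    show "hchart \<phi> y z \<in> ?S" "?S \<subseteq> hchart \<phi> y ` hdom W U" using D z by auto
    fix b z' assume z': "z' \<in> hdom W U" "hchart \<phi> y z' \<in> ?S"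
    then have "z' \<in> H" "fst z' \<in> N"
      using smooth_atlasD(1)[OF vatlas_smooth DT] by (auto simp: inj_on_def)
    then show "hat_frame \<alpha> \<xi> b z' = b \<bullet> hchart \<phi> y z'" by (rule hat_frame_eq)
  qed
qed

end

definition nonzero :: "'m \<times> ('m \<times> ('a \<Rightarrow> real) \<Rightarrow> real) \<Rightarrow> bool" where
  "nonzero z \<longleftrightarrow> snd z \<noteq> (\<lambda>_. 0)"

lemma nonzero_iff:
  assumes U: "(U, y) \<in> atriv A" "fst z \<in> U" and z: "z \<in> H"
  shows "nonzero z \<longleftrightarrow> hcoord y z \<noteq> 0"
proof -
  obtain p \<psi> where p: "z = (p, \<psi>)" by fastforce
  have "hcoord y z = 0" if "\<psi> = (\<lambda>_. 0)"
    unfolding p by (rule hcoord_eqI[OF U(1)]) (use that U p in auto)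
  moreover have "\<psi> = (\<lambda>_. 0)" if "hcoord y z = 0"
  proof
    fix s show "\<psi> s = 0"
    proof (cases "s \<in> vfibre (aff_bundle A) p")
      case True
      then obtain wd where "s = (p, aff y p wd)" using aff_fibreE[OF U(1)] U(2) p by (metis fst_conv)
      then show ?thesis using hcoord[OF U(1), of p \<psi> wd] U z that p by simp
    next
      case False
      then show ?thesis using z p by (simp add: hat_total_iff del: split_paired_All)
    qed
  qed
  ultimately show ?thesis by (auto simp: nonzero_def p)
qed

text \<open>If v kills all linear functions and m is one with m z not 0, then v kills m and f m,
  hence by the Leibniz rule f, for every basic f. Basic and linear functions together make up the
  coordinates.\<close>

lemma hat_jet_determining:
  assumes z: "z \<in> H" and nz: "nonzero z"
  shows "jet_determining (vatlas (hat A)) z (insert (\<lambda>_. 1) (bar A ` affine_functions A))"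
proof (rule jet_determiningI[OF vatlas_smooth])
  show "insert (\<lambda>_. 1) (bar A ` affine_functions A) \<subseteq> Cinf (vatlas (hat A))"
    using bar_Cinf Cinf_const[OF vatlas_smooth] by blast
  show "(\<lambda>_. 1) \<in> insert (\<lambda>_. 1) (bar A ` affine_functions A)" by blast
  fix v F assume v: "v \<in> tangent_space (vatlas (hat A)) z"
    and v0: "\<And>s. s \<in> insert (\<lambda>_. 1) (bar A ` affine_functions A) \<Longrightarrow> v s = 0"
    and F: "F \<in> Cinf (vatlas (hat A))"
  obtain W \<phi> U y N \<alpha> \<xi> where fr: "affine_frame W \<phi> U y N \<alpha> \<xi>" "fst z \<in> N"
    using H0.proj[OF z] by (rule affine_frame_exists)
  note frD = affine_frameD[OF fr(1)]
  have zU: "fst z \<in> U" using fr(2) frD(4) by auto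
  \<comment> \<open>Taking the coordinates of z as coefficients makes the value at z equal to
    \<open>hcoord y z \<bullet> hcoord y z\<close>.\<close>
  let ?m = "bar A (\<alpha> (hcoord y z))"
  have m: "?m z \<noteq> 0"
    using nz by (simp add: frame_bar[OF fr(1) z fr(2)] nonzero_iff[OF frD(2) zU z])
  have vf: "v (\<lambda>z. f (fst z)) = 0" if f: "f \<in> Cinf (abase A)" for f
  proof -
    have "0 = v (bar A (\<lambda>x. f (aproj A x) * \<alpha> (hcoord y z) x))"
      using v0 affine_module[OF f frD(5)] by simp
    also have "\<dots> = v (\<lambda>z'. f (fst z') * ?m z')"
      by (rule tangent_cong[OF vatlas_smooth v])
        (use z bar_Cinf[OF affine_module[OF f frD(5)]] bar_module[OF f frD(5)] in auto)
    also have "\<dots> = v (\<lambda>z. f (fst z)) * ?m z + f (fst z) * v ?m"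
      by (rule tangentD(2)[OF v H_pullback[OF f] bar_Cinf[OF frD(5)]])
    also have "v ?m = 0" using v0 frD(5) by simp
    finally show ?thesis using m by simp
  qed
  have "v (hat_frame \<alpha> \<xi> b) = 0" for b
    unfolding hat_frame_def
    using tangentD(1)[OF v H_pullback[OF frD(6)] bar_Cinf[OF frD(5)]] vf[OF frD(6)] v0 frD(5) by simp
  then show "v F = 0" using hat_expand[OF fr(1) z fr(2) v F] by simp
qed

text \<open>Continuity along the line of elements with coordinates (0, t). The last coordinate is
  present in every rank, so even in rank 0 the zero section is approached by other elements.\<close>

lemma zero_on_nonzero_imp_zero:
  assumes G: "G \<in> Cinf (vatlas (hat A))" and 0: "\<And>z. z \<in> H \<Longrightarrow> nonzero z \<Longrightarrow> G z = 0" and z: "z \<in> H"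
  shows "G z = 0"
proof (cases "nonzero z")
  case True
  then show ?thesis using 0 z by blast
next
  case False
  obtain W \<phi> U y where W: "(W, \<phi>) \<in> abase A" and U: "(U, y) \<in> atriv A" and D: "fst z \<in> W" "fst z \<in> U"
    using z by (rule H_chartE) blast
  let ?N = "\<phi> ` (W \<inter> U)" and ?p = "fst z"
  have o: "open (?N \<times> (UNIV :: ('f \<times> real) set))"
    using AB.open_base_image_dom[OF W U] by (simp add: open_Times)
  have "smooth_on (\<lambda>t::real. (\<lambda>(x, s). G (H0.pt (hcoord y) (inv_into W \<phi> x) s)) (\<phi> ?p, 0, t)) UNIV"
    by (rule smooth_on_compose[OF open_UNIV o _ _ HB.smooth_along_triv[OF W hat_trivI[OF U] G[unfolded vatlas_eq]]])
      (use D in \<open>auto intro!: smooth_intros\<close>)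
  then have c: "continuous_on UNIV (\<lambda>t::real. G (hpt y ?p (0, t)))"
    using smooth_atlasD(1)[OF base_atlas W] D
    by (simp add: hpt_eq[OF U] smooth_on_imp_continuous)
  have "G (hpt y ?p (0, t)) = 0" if "t \<noteq> 0" for t
    using that hpt_total[OF U D(2)] fst_hpt[OF U D(2)] hcoord_hpt[OF U D(2)] D(2)
    by (intro 0) (simp_all add: nonzero_iff[OF U] prod_eq_iff)
  then have "((\<lambda>t. G (hpt y ?p (0, t))) \<longlongrightarrow> 0) (at 0)"
    by (intro tendsto_eventually) (simp add: eventually_at_filter)
  moreover have "((\<lambda>t. G (hpt y ?p (0, t))) \<longlongrightarrow> G (hpt y ?p (0, 0))) (at 0)"
    using c by (simp add: continuous_on_def)
  ultimately have "G (hpt y ?p (0, 0)) = 0"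
    using tendsto_unique[OF trivial_limit_at] by blast
  moreover have "hpt y ?p (0, 0) = z"
    using False hpt_hcoord[OF U z D(2)] nonzero_iff[OF U D(2) z] by (simp add: zero_prod_def)
  ultimately show ?thesis by simp
qed

subsection \<open>The Liouville vector field\<close>

lemma vscale_total:
  assumes z: "z \<in> H"
  shows "vscale (hat A) t z \<in> H" "fst (vscale (hat A) t z) = fst z"
    "(U, y) \<in> atriv A \<Longrightarrow> fst z \<in> U \<Longrightarrow> hcoord y (vscale (hat A) t z) = t *\<^sub>R hcoord y z"
proof -
  obtain p \<psi> where p: "z = (p, \<psi>)" by fastforce
  show 1: "fst (vscale (hat A) t z) = fst z" by (simp add: hat_simps p)
  show "vscale (hat A) t z \<in> H"
    using z by (auto simp: hat_simps p hat_total_iff linear_form_def algebra_simps)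
  show "hcoord y (vscale (hat A) t z) = t *\<^sub>R hcoord y z" if U: "(U, y) \<in> atriv A" "fst z \<in> U"
  proof -
    have "hcoord y (p, \<lambda>v. t * \<psi> v) = t *\<^sub>R hcoord y (p, \<psi>)"
      by (rule hcoord_eqI[OF U(1)]) (use U hcoord[OF U(1), of p \<psi>] z in \<open>simp_all add: p\<close>)
    then show ?thesis by (simp add: hat_simps p)
  qed
qed

lemma bar_vscale:
  assumes a: "a \<in> affine_functions A" and z: "z \<in> H"
  shows "bar A a (vscale (hat A) t z) = t * bar A a z"
  by (cases z) (simp add: bar_def iota_def hat_simps)

lemma hchart_deriv_radial:
  assumes W: "(W, \<phi>) \<in> abase A" and U: "(U, y) \<in> atriv A" and z: "z \<in> hdom W U"
    and F: "F \<in> Cinf (vatlas (hat A))"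
  shows "((\<lambda>t. F (vscale (hat A) t z)) has_real_derivative
      chart_deriv (hdom W U) (hchart \<phi> y) F (vscale (hat A) s z) (0, hcoord y z)) (at s)"
proof -
  have zH: "z \<in> H" "fst z \<in> W" "fst z \<in> U" using z by (auto simp: hdom_iff)
  let ?u = "vscale (hat A) s z"
  have u: "?u \<in> hdom W U" using vscale_total[OF zH(1)] zH by (simp add: hdom_iff)
  have \<kappa>: "hchart \<phi> y (vscale (hat A) t z) = (\<phi> (fst z), t *\<^sub>R hcoord y z)" for t
    using vscale_total[OF zH(1)] U zH by (simp add: H0.chart_def)
  note D = chart_deriv_has_derivative[OF vatlas_smooth hchart_in_atlas[OF W U] F u]
  have lin: "linear (chart_deriv (hdom W U) (hchart \<phi> y) F ?u)"
    using D has_derivative_linear by blast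
  have "((\<lambda>t. (F \<circ> inv_into (hdom W U) (hchart \<phi> y)) (\<phi> (fst z), t *\<^sub>R hcoord y z)) has_derivative
      (\<lambda>t. chart_deriv (hdom W U) (hchart \<phi> y) F ?u (0, t *\<^sub>R hcoord y z))) (at s)"
    by (rule has_derivative_compose[of "\<lambda>t. (\<phi> (fst z), t *\<^sub>R hcoord y z)"])
      (use D in \<open>auto intro!: derivative_eq_intros simp: \<kappa> simp del: o_apply\<close>)
  moreover have "chart_deriv (hdom W U) (hchart \<phi> y) F ?u (0, t *\<^sub>R hcoord y z) =
      chart_deriv (hdom W U) (hchart \<phi> y) F ?u (0, hcoord y z) * t" for t
    using linear_cmul[OF lin, of t "(0, hcoord y z)"] by simp
  moreover have "(F \<circ> inv_into (hdom W U) (hchart \<phi> y)) (\<phi> (fst z), t *\<^sub>R hcoord y z) = F (vscale (hat A) t z)" for t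
  proof -
    have "vscale (hat A) t z \<in> hdom W U" using vscale_total[OF zH(1)] zH by (simp add: hdom_iff)
    then show ?thesis
      using inv_into_f_f[OF smooth_atlasD(1)[OF vatlas_smooth hchart_in_atlas[OF W U]], of "vscale (hat A) t z"] \<kappa>
      by simp
  qed
  ultimately show ?thesis by (simp add: has_field_derivative_def)
qed

lemma vscale_one: "z \<in> H \<Longrightarrow> vscale (hat A) 1 z = z"
  by (cases z) (simp add: hat_simps)

text \<open>The chart picked by \<open>SOME\<close> and the given one both compute the derivative of
  t -> F(t z) at t = 1, which refers to no chart.\<close>

lemma liouville_chart:
  assumes W: "(W, \<phi>) \<in> abase A" and U: "(U, y) \<in> atriv A" and z: "z \<in> hdom W U"
    and F: "F \<in> Cinf (vatlas (hat A))"
  shows "liouville (hat A) z F = chart_deriv (hdom W U) (hchart \<phi> y) F z (0, hcoord y z)"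
proof -
  have zH: "z \<in> H" using z by (simp add: hdom_iff)
  define c where "c = (SOME c. c \<in> vatlas (hat A) \<and> z \<in> fst c)"
  have "c \<in> vatlas (hat A) \<and> z \<in> fst c"
    unfolding c_def by (rule someI[of _ "(hdom W U, hchart \<phi> y)"]) (use hchart_in_atlas[OF W U] z in simp)
  then obtain W' \<phi>' U' Y' where c: "(W', \<phi>') \<in> abase A" "(U', Y') \<in> vtriv (hat A)"
    "c = (H0.dom W' U', H0.chart \<phi>' Y')" "z \<in> H0.dom W' U'"
    unfolding vatlas_eq by (cases c) (auto elim!: H0.totalE)
  then obtain y' where y': "(U', y') \<in> atriv A" "Y' = hcoord y'" by (auto simp: vtriv_hat)
  have "liouville (hat A) z F = chart_deriv (hdom W' U') (hchart \<phi>' y') F z (0, hcoord y' z)"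
    unfolding liouville_def c_def[symmetric] c(3) using zH F
    by (simp add: chart_deriv_def H0.chart_def y'(2))
  moreover have "chart_deriv (hdom W' U') (hchart \<phi>' y') F z (0, hcoord y' z) =
      chart_deriv (hdom W U) (hchart \<phi> y) F z (0, hcoord y z)"
    using DERIV_unique[OF hchart_deriv_radial[OF c(1) y'(1) c(4) F, of 1] hchart_deriv_radial[OF W U z F, of 1]]
    by (simp add: vscale_one[OF zH])
  ultimately show ?thesis by simp
qed

lemma liouville_radial:
  assumes z: "z \<in> H" and F: "F \<in> Cinf (vatlas (hat A))"
  shows "((\<lambda>t. F (vscale (hat A) t z)) has_real_derivative liouville (hat A) z F) (at 1)"
proof -
  obtain W \<phi> U y where W: "(W, \<phi>) \<in> abase A" and U: "(U, y) \<in> atriv A" and D: "z \<in> hdom W U"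
    using z by (rule H_chartE) blast
  show ?thesis
    using hchart_deriv_radial[OF W U D F, of 1] liouville_chart[OF W U D F] by (simp add: vscale_one[OF z])
qed

lemma liouville_bar:
  assumes a: "a \<in> affine_functions A" and z: "z \<in> H"
  shows "liouville (hat A) z (bar A a) = bar A a z"
proof -
  have "((\<lambda>t. bar A a (vscale (hat A) t z)) has_real_derivative bar A a z) (at 1)"
    unfolding bar_vscale[OF a z] by (auto intro!: derivative_eq_intros)
  then show ?thesis by (rule DERIV_unique[OF liouville_radial[OF z bar_Cinf[OF a]]])
qed

lemma liouville_vector_field: "vector_field (vatlas (hat A)) (liouville (hat A))"
  unfolding vector_field_def
proof (intro conjI ballI allI impI)
  fix z assume "z \<in> point_set (vatlas (hat A))"
  then have z: "z \<in> H" by simp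
  obtain W \<phi> U y where W: "(W, \<phi>) \<in> abase A" and U: "(U, y) \<in> atriv A" and D: "z \<in> hdom W U"
    using z by (rule H_chartE) blast
  have "liouville (hat A) z = (\<lambda>F. if F \<in> Cinf (vatlas (hat A)) then
      chart_deriv (hdom W U) (hchart \<phi> y) F z (0, hcoord y z) else 0)"
    using liouville_chart[OF W U D] by (auto simp: liouville_def)
  then show "liouville (hat A) z \<in> tangent_space (vatlas (hat A)) z"
    using chart_deriv_tangent[OF vatlas_smooth hchart_in_atlas[OF W U] D] by simp
next
  show "liouville (hat A) z = (\<lambda>_. 0)" if "z \<notin> point_set (vatlas (hat A))" for z
    using that by (simp add: liouville_def)
next
  fix F assume F: "F \<in> Cinf (vatlas (hat A))"
  show "(\<lambda>z. liouville (hat A) z F) \<in> Cinf (vatlas (hat A))"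
    unfolding Cinf_iff_smooth_at[OF vatlas_smooth]
  proof
    fix z assume "z \<in> point_set (vatlas (hat A))"
    then have z: "z \<in> H" by simp
    obtain W \<phi> U y where W: "(W, \<phi>) \<in> abase A" and U: "(U, y) \<in> atriv A" and D: "z \<in> hdom W U"
      using z by (rule H_chartE) blast
    note DT = hchart_in_atlas[OF W U]
    note iD = smooth_atlasD(1,2)[OF vatlas_smooth DT]
    let ?cd = "\<lambda>b. (\<lambda>z. chart_deriv (hdom W U) (hchart \<phi> y) F z b)"
    let ?I = "hchart \<phi> y ` hdom W U"
    \<comment> \<open>The radial direction varies with the point, so the derivative is split into
      derivatives along fixed directions.\<close>
    have "smooth_on (\<lambda>x. \<Sum>b\<in>onb. ((0, snd x) \<bullet> b) * (?cd b \<circ> inv_into (hdom W U) (hchart \<phi> y)) x) ?I"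
      by (intro smooth_on_sum smooth_on_mult smooth_on_inner smooth_on_Pair smooth_on_const smooth_on_snd smooth_on_id
          smooth_on_chart_deriv[OF vatlas_smooth DT F] iD)
    then have "smooth_on ((\<lambda>z. liouville (hat A) z F) \<circ> inv_into (hdom W U) (hchart \<phi> y)) ?I"
    proof (rule smooth_on_cong[OF _ iD(2)])
      fix x assume "x \<in> ?I"
      then obtain z' where z': "x = hchart \<phi> y z'" "z' \<in> hdom W U" by blast
      have lin: "linear (chart_deriv (hdom W U) (hchart \<phi> y) F z')"
        using chart_deriv_has_derivative[OF vatlas_smooth DT F z'(2)] has_derivative_linear by blast
      have "liouville (hat A) z' F = chart_deriv (hdom W U) (hchart \<phi> y) F z' (0, hcoord y z')"
        by (rule liouville_chart[OF W U z'(2) F])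
      also have "\<dots> = (\<Sum>b\<in>onb. ((0, hcoord y z') \<bullet> b) * ?cd b z')"
        by (subst linear_onb[OF lin]) simp
      finally show "(\<Sum>b\<in>onb. ((0, snd x) \<bullet> b) * (?cd b \<circ> inv_into (hdom W U) (hchart \<phi> y)) x) =
          ((\<lambda>z. liouville (hat A) z F) \<circ> inv_into (hdom W U) (hchart \<phi> y)) x"
        using z' iD(1) by (simp add: inv_into_f_f[OF iD(1) z'(2)]) (simp add: H0.chart_def)
    qed
    then show "smooth_at (vatlas (hat A)) (\<lambda>z. liouville (hat A) z F) z"
      unfolding smooth_at_def using DT D iD(2) by blast
  qed
qed

text \<open>Along each fibre, \<open>G\<close> is homogeneous of degree 1 and hence equal to its derivative at the zero section.\<close>

lemma euler_imp_bar:
  assumes G: "G \<in> Cinf (vatlas (hat A))" and eu: "\<And>z. z \<in> H \<Longrightarrow> liouville (hat A) z G = G z"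
  shows "(\<lambda>x. G (evaluation A x)) \<in> affine_functions A"
    and "\<And>z. z \<in> H \<Longrightarrow> G z = bar A (\<lambda>x. G (evaluation A x)) z"
proof -
  have hom: "G (vscale (hat A) t z) = t * G z" if z: "z \<in> H" and t: "t > 0" for t z
  proof -
    have d: "((\<lambda>t. G (vscale (hat A) t z)) has_real_derivative G (vscale (hat A) s z) / s) (at s)" if "s > 0" for s
    proof -
      obtain W \<phi> U y where W: "(W, \<phi>) \<in> abase A" and U: "(U, y) \<in> atriv A" and D: "z \<in> hdom W U"
        using z by (rule H_chartE) blast
      let ?u = "vscale (hat A) s z"
      have u: "?u \<in> hdom W U" "?u \<in> H" using vscale_total[OF z] D by (simp_all add: hdom_iff)
      have hu: "hcoord y ?u = s *\<^sub>R hcoord y z" using vscale_total(3)[OF z U] D by (simp add: hdom_iff)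
      have lin: "linear (chart_deriv (hdom W U) (hchart \<phi> y) G ?u)"
        using chart_deriv_has_derivative[OF vatlas_smooth hchart_in_atlas[OF W U] G u(1)] has_derivative_linear by blast
      have "G ?u = chart_deriv (hdom W U) (hchart \<phi> y) G ?u (0, s *\<^sub>R hcoord y z)"
        using liouville_chart[OF W U u(1) G] eu[OF u(2)] hu by simp
      also have "\<dots> = s * chart_deriv (hdom W U) (hchart \<phi> y) G ?u (0, hcoord y z)"
        using linear_cmul[OF lin, of s "(0, hcoord y z)"] by simp
      finally show ?thesis
        using hchart_deriv_radial[OF W U D G, of s] that by simp
    qed
    have "((\<lambda>t. G (vscale (hat A) t z) / t) has_real_derivative 0) (at s)" if "s > 0" for s
      using d[OF that] that by (auto intro!: derivative_eq_intros)
    \<comment> \<open>The quotient is constant on the interval (0, t + 2), which contains both 1 and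
      t.\<close>
    then have "G (vscale (hat A) t z) / t = G (vscale (hat A) 1 z) / 1"
      using t by (intro DERIV_isconst3[of 0 "t + 2"]) auto
    then show ?thesis using t by (simp add: vscale_one[OF z] field_simps)
  qed
  have lin: "\<exists>l. linear l \<and> (\<forall>z\<in>H. fst z = p \<longrightarrow> G z = l (hcoord y z))"
    if W: "(W, \<phi>) \<in> abase A" and U: "(U, y) \<in> atriv A" and p: "p \<in> W" "p \<in> U" for W \<phi> U y p
  proof -
    let ?o = "hpt y p 0"
    have o: "?o \<in> hdom W U" "?o \<in> H" "hcoord y ?o = 0" "fst ?o = p"
      using hpt_total[OF U p(2)] fst_hpt[OF U p(2)] hcoord_hpt[OF U p(2)] p by (simp_all add: hdom_iff)
    note lin = has_derivative_linear[OF chart_deriv_has_derivative[OF vatlas_smooth hchart_in_atlas[OF W U] G o(1)]]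
    let ?l = "\<lambda>s. chart_deriv (hdom W U) (hchart \<phi> y) G ?o (0, s)"
    have "linear ?l"
      using linear_add[OF lin, of "(0, s)" "(0, t)" for s t] linear_cmul[OF lin, of c "(0, s)" for c s]
      by (intro linearI) simp_all
    moreover have "G z = ?l (hcoord y z)" if z: "z \<in> H" "fst z = p" for z
    proof -
      have "vscale (hat A) 0 z \<in> H" "fst (vscale (hat A) 0 z) = p" "hcoord y (vscale (hat A) 0 z) = 0"
        using vscale_total[OF z(1), where t=0] U p(2) z(2) by simp_all
      then have zo: "vscale (hat A) 0 z = ?o"
        using hpt_hcoord[OF U, of "vscale (hat A) 0 z"] p(2) by simp
      have zD: "z \<in> hdom W U" using z p by (simp add: hdom_iff)
      \<comment> \<open>Euler's relation at the zero section, where the radial direction is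
        0.\<close>
      have G0: "G ?o = 0"
        using liouville_chart[OF W U o(1) G] eu[OF o(2)] o(3) linear_0[OF lin] by (simp add: zero_prod_def)
      have "((\<lambda>t. (G (vscale (hat A) t z) - G (vscale (hat A) 0 z)) / (t - 0)) \<longlongrightarrow> ?l (hcoord y z)) (at 0)"
        using hchart_deriv_radial[OF W U zD G, of 0] zo by (simp add: has_field_derivative_iff)
      then have lim: "((\<lambda>t. G (vscale (hat A) t z) / t) \<longlongrightarrow> ?l (hcoord y z)) (at_right 0)"
        using zo G0 by (simp add: filterlim_at_split)
      have "((\<lambda>t. G (vscale (hat A) t z) / t) \<longlongrightarrow> G z) (at_right 0)"
        by (rule tendsto_eventually) (auto simp: eventually_at_filter hom[OF z(1)])
      then show ?thesis
        using tendsto_unique[OF _ _ lim] by simp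
    qed
    ultimately show ?thesis by blast
  qed
  show aff: "(\<lambda>x. G (evaluation A x)) \<in> affine_functions A"
  proof (rule affine_functionsI[OF evaluation_Cinf[OF G]])
    fix U y p assume U: "(U, y) \<in> atriv A" "p \<in> U"
    then obtain W \<phi> where W: "(W, \<phi>) \<in> abase A" "p \<in> W"
      using atrivD(3) by (meson point_setE subsetD)
    obtain l where l: "linear l" "\<And>z. z \<in> H \<Longrightarrow> fst z = p \<Longrightarrow> G z = l (hcoord y z)"
      using lin[OF W(1) U(1) W(2) U(2)] by blast
    obtain w where w: "\<And>s. l s = w \<bullet> s" using linear_riesz[OF l(1)] by blast
    show "\<exists>w d. \<forall>x\<in>afibre A p. G (evaluation A x) = w \<bullet> y x + d"
    proof (intro exI ballI)
      fix x assume x: "x \<in> afibre A p"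
      then have "G (evaluation A x) = w \<bullet> (y x, 1)"
        using l(2)[of "evaluation A x"] evaluation[of x] U by (simp add: afibre_iff w)
      then show "G (evaluation A x) = fst w \<bullet> y x + snd w" by (simp add: inner_prod_def)
    qed
  qed
  show "G z = bar A (\<lambda>x. G (evaluation A x)) z" if z: "z \<in> H" for z
  proof -
    obtain W \<phi> U y where W: "(W, \<phi>) \<in> abase A" and U: "(U, y) \<in> atriv A" and D: "fst z \<in> W" "fst z \<in> U"
      using z by (rule H_chartE) blast
    obtain l where l: "linear l" "\<And>u. u \<in> H \<Longrightarrow> fst u = fst z \<Longrightarrow> G u = l (hcoord y u)"
      using lin[OF W U D] by blast
    obtain w where w: "\<And>s. l s = w \<bullet> s" using linear_riesz[OF l(1)] by blast
    have "bar A (\<lambda>x. G (evaluation A x)) z = hcoord y z \<bullet> w"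
    proof (rule bar_eq[OF U z D(2)])
      fix x assume x: "x \<in> afibre A (fst z)"
      then have "G (evaluation A x) = w \<bullet> (y x, 1)"
        using l(2)[of "evaluation A x"] evaluation[of x] U D by (simp add: afibre_iff w)
      then show "G (evaluation A x) = fst w \<bullet> y x + snd w" by (simp add: inner_prod_def)
    qed
    then show ?thesis using l(2)[OF z refl] w by (simp add: inner_commute)
  qed
qed

end

context affine_bundle_ctx
begin

subsection \<open>Brackets of affine and of fibrewise linear functions\<close>

definition linked :: "'a bifield \<Rightarrow> 'a vfield \<Rightarrow> ('m \<times> ('m \<times> ('a \<Rightarrow> real) \<Rightarrow> real)) bifield \<Rightarrow> bool" where
  "linked \<Lambda> E P \<longleftrightarrow> (\<forall>a\<in>affine_functions A. \<forall>b\<in>affine_functions A. \<forall>x\<in>atotal A.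
     jacobi_bracket \<Lambda> E a b x = poisson_bracket P (bar A a) (bar A b) (evaluation A x))"

abbreviation "\<tau> \<equiv> bar A (\<lambda>_. 1)"

lemma tau_Cinf: "\<tau> \<in> Cinf (vatlas (hat A))"
  by (rule bar_Cinf[OF affine_const])

lemma affine_cong:
  assumes a: "a \<in> affine_functions A" and eq: "\<And>x. x \<in> atotal A \<Longrightarrow> a x = b x"
  shows "b \<in> affine_functions A"
proof (rule affine_functionsI)
  show "b \<in> Cinf (aatlas A)" by (rule Cinf_cong[OF aatlas_smooth affine_Cinf[OF a]]) (simp add: eq)
  fix U y p assume U: "(U, y) \<in> atriv A" "p \<in> U"
  obtain wd where wd: "\<And>x. x \<in> afibre A p \<Longrightarrow> a x = fst wd \<bullet> y x + snd wd" using affineE[OF a U] by blast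
  then show "\<exists>w d. \<forall>x\<in>afibre A p. b x = w \<bullet> y x + d"
    using eq by (intro exI[of _ "fst wd"] exI[of _ "snd wd"]) (simp add: afibre_iff)
qed

text \<open>Apply homogeneity to two linear functions, which the Liouville field fixes: that field
  then sends their bracket G to -G + G + G = G, and Euler's relation makes G linear.\<close>

lemma linear_bracket:
  assumes P: "bivector_field (vatlas (hat A)) P"
    and L: "lie_derivative (liouville (hat A)) P = (\<lambda>v f g. - P v f g)"
    and a: "a \<in> affine_functions A" and b: "b \<in> affine_functions A"
  shows "(\<lambda>x. P (evaluation A x) (bar A a) (bar A b)) \<in> affine_functions A"
    and "\<And>z. z \<in> H \<Longrightarrow> P z (bar A a) (bar A b) = bar A (\<lambda>x. P (evaluation A x) (bar A a) (bar A b)) z"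
proof -
  let ?G = "\<lambda>z. P z (bar A a) (bar A b)"
  have G: "?G \<in> Cinf (vatlas (hat A))" by (intro bivector_fieldD(3)[OF P] bar_Cinf a b)
  have "liouville (hat A) z ?G = ?G z" if z: "z \<in> H" for z
  proof -
    have zp: "z \<in> point_set (vatlas (hat A))" using z by simp
    note T = bivector_fieldD(5,6)[OF P zp]
    have 1: "P z (bar A a) (bar A b) = P z (\<lambda>q. liouville (hat A) q (bar A a)) (bar A b)"
      by (rule tangent_cong[OF vatlas_smooth T(2) zp bar_Cinf[OF a]]) (simp add: liouville_bar[OF a])
    have 2: "P z (bar A a) (bar A b) = P z (bar A a) (\<lambda>q. liouville (hat A) q (bar A b))"
      by (rule tangent_cong[OF vatlas_smooth T(1) zp bar_Cinf[OF b]]) (simp add: liouville_bar[OF b])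
    show ?thesis
      using fun_cong[OF fun_cong[OF fun_cong[OF L, of z], of "bar A a"], of "bar A b"] 1 2
      by (simp add: lie_derivative_def)
  qed
  from euler_imp_bar[OF G this]
  show "(\<lambda>x. ?G (evaluation A x)) \<in> affine_functions A"
    "\<And>z. z \<in> H \<Longrightarrow> ?G z = bar A (\<lambda>x. ?G (evaluation A x)) z" by blast+
qed

lemma bivector_first_order:
  assumes P: "bivector_field \<A> P" and p: "p \<in> point_set \<A>"
  shows "first_order \<A> p (\<lambda>f. P p f g)" "first_order \<A> p (\<lambda>g. P p f g)"
  using tangent_first_order[OF bivector_fieldD(6)[OF P p], of g 0]
    tangent_first_order[OF bivector_fieldD(5)[OF P p], of f 0] by simp_all

lemma bivector_eqI:
  assumes P: "bivector_field (vatlas (hat A)) P" and Q: "bivector_field (vatlas (hat A)) Q"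
    and eq: "\<And>a b z. a \<in> affine_functions A \<Longrightarrow> b \<in> affine_functions A \<Longrightarrow> z \<in> H \<Longrightarrow>
      P z (bar A a) (bar A b) = Q z (bar A a) (bar A b)"
  shows "P = Q"
proof (intro ext)
  fix z F G
  show "P z F G = Q z F G"
  proof (cases "z \<in> H \<and> F \<in> Cinf (vatlas (hat A)) \<and> G \<in> Cinf (vatlas (hat A))")
    case False
    then consider "z \<notin> H" | "F \<notin> Cinf (vatlas (hat A))" | "G \<notin> Cinf (vatlas (hat A))" by blast
    then show ?thesis
      by cases (simp_all add: bivector_fieldD(2,7,8)[OF P] bivector_fieldD(2,7,8)[OF Q])
  next
    case True
    then have F: "F \<in> Cinf (vatlas (hat A))" and G: "G \<in> Cinf (vatlas (hat A))" and z: "z \<in> H" by auto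
    have nz: "P z F G = Q z F G" if z: "z \<in> H" and "nonzero z" for z
    proof (rule bifirst_order_eqI[OF hat_jet_determining[OF that], of "P z" "Q z"])
      have zp: "z \<in> point_set (vatlas (hat A))" using z by simp
      show "first_order (vatlas (hat A)) z (\<lambda>f. P z f g)" "first_order (vatlas (hat A)) z (\<lambda>g. P z f g)"
        "first_order (vatlas (hat A)) z (\<lambda>f. Q z f g)" "first_order (vatlas (hat A)) z (\<lambda>g. Q z f g)" for f g
        by (intro bivector_first_order P Q zp)+
      have 1: "P z (\<lambda>_. 1) g = 0" "Q z (\<lambda>_. 1) g = 0" "P z g (\<lambda>_. 1) = 0" "Q z g (\<lambda>_. 1) = 0" for g
        using tangent_const[OF vatlas_smooth bivector_fieldD(6)[OF P zp]] tangent_const[OF vatlas_smooth bivector_fieldD(5)[OF P zp]]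
          tangent_const[OF vatlas_smooth bivector_fieldD(6)[OF Q zp]] tangent_const[OF vatlas_smooth bivector_fieldD(5)[OF Q zp]]
        by simp_all
      show "P z s t = Q z s t" if "s \<in> insert (\<lambda>_. 1) (bar A ` affine_functions A)"
        "t \<in> insert (\<lambda>_. 1) (bar A ` affine_functions A)" for s t
        using that eq[OF _ _ z] by (auto simp: 1)
    qed (rule F G)+
    have "P z F G - Q z F G = 0"
      by (rule zero_on_nonzero_imp_zero[OF Cinf_diff[OF vatlas_smooth bivector_fieldD(3)[OF P F G] bivector_fieldD(3)[OF Q F G]] _ z])
        (simp add: nz)
    then show ?thesis by simp
  qed
qed

text \<open>Both brackets of two linear functions are linear, and a linear function on
  \<open>hat A\<close> is known from its restriction to \<open>A\<close>, which
  \<open>linked\<close> prescribes.\<close>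

lemma linked_unique_P:
  assumes P: "homogeneous_poisson (hat A) P" "linked \<Lambda> E P" and Q: "homogeneous_poisson (hat A) Q" "linked \<Lambda> E Q"
  shows "P = Q"
proof -
  have B: "bivector_field (vatlas (hat A)) P" "bivector_field (vatlas (hat A)) Q"
    and L: "lie_derivative (liouville (hat A)) P = (\<lambda>v f g. - P v f g)"
      "lie_derivative (liouville (hat A)) Q = (\<lambda>v f g. - Q v f g)"
    using P(1) Q(1) by (simp_all add: homogeneous_poisson_def poisson_structure_def)
  show ?thesis
  proof (rule bivector_eqI[OF B])
    fix a b z assume a: "a \<in> affine_functions A" and b: "b \<in> affine_functions A" and z: "z \<in> H"
    have "P z (bar A a) (bar A b) = bar A (\<lambda>x. P (evaluation A x) (bar A a) (bar A b)) z"
      by (rule linear_bracket(2)[OF B(1) L(1) a b z])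
    also have "\<dots> = bar A (\<lambda>x. Q (evaluation A x) (bar A a) (bar A b)) z"
      by (rule bar_cong) (use P(2) Q(2) a b in \<open>auto simp: linked_def poisson_bracket_def\<close>)
    also have "\<dots> = Q z (bar A a) (bar A b)"
      by (rule linear_bracket(2)[OF B(2) L(2) a b z, symmetric])
    finally show "P z (bar A a) (bar A b) = Q z (bar A a) (bar A b)" .
  qed
qed

text \<open>Recovers the vector field from the bracket; once \<open>E\<close> is known, the bracket
  also gives the bivector.\<close>

lemma jacobi_bracket_one:
  assumes "jacobi_fields \<A> \<Lambda> E" "p \<in> point_set \<A>"
  shows "jacobi_bracket \<Lambda> E (\<lambda>_. 1) g p = E p g"
proof -
  interpret jacobi_fields \<A> \<Lambda> E by fact
  show ?thesis
    by (simp add: jacobi_bracket_def tangent_const[OF atlas \<Lambda>_tangent[OF assms(2)]] tangent_const[OF atlas E_tangent[OF assms(2)]])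
qed

lemma jacobi_fields_eqI:
  assumes 1: "jacobi_fields (aatlas A) \<Lambda> E" and 2: "jacobi_fields (aatlas A) \<Lambda>' E'"
    and eq: "\<And>a b x. a \<in> affine_functions A \<Longrightarrow> b \<in> affine_functions A \<Longrightarrow> x \<in> atotal A \<Longrightarrow>
      jacobi_bracket \<Lambda> E a b x = jacobi_bracket \<Lambda>' E' a b x"
  shows "\<Lambda> = \<Lambda>' \<and> E = E'"
proof -
  interpret j: jacobi_fields "aatlas A" \<Lambda> E by (rule 1)
  interpret j': jacobi_fields "aatlas A" \<Lambda>' E' by (rule 2)
  have br: "jacobi_bracket \<Lambda> E f g x = jacobi_bracket \<Lambda>' E' f g x"
    if x: "x \<in> atotal A" and f: "f \<in> Cinf (aatlas A)" and g: "g \<in> Cinf (aatlas A)" for f g x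
  proof (rule bifirst_order_eqI[OF affine_jet_determining[OF x],
        of "\<lambda>f g. jacobi_bracket \<Lambda> E f g x" "\<lambda>f g. jacobi_bracket \<Lambda>' E' f g x"])
    have x: "x \<in> point_set (aatlas A)" using x by simp
    show "first_order (aatlas A) x (\<lambda>f. jacobi_bracket \<Lambda> E f g x)"
      "first_order (aatlas A) x (\<lambda>g. jacobi_bracket \<Lambda> E f g x)"
      "first_order (aatlas A) x (\<lambda>f. jacobi_bracket \<Lambda>' E' f g x)"
      "first_order (aatlas A) x (\<lambda>g. jacobi_bracket \<Lambda>' E' f g x)" for f g
      by (intro j.br_first_order1 j.br_first_order2 j'.br_first_order1 j'.br_first_order2 x)+
  qed (use eq x f g in auto)
  have E: "E x f = E' x f" for x f
  proof (cases "x \<in> atotal A \<and> f \<in> Cinf (aatlas A)")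
    case True
    then show ?thesis
      using br[of x "\<lambda>_. 1" f] jacobi_bracket_one[OF 1] jacobi_bracket_one[OF 2] Cinf_const[OF aatlas_smooth] by simp
  next
    case False
    then show ?thesis
      using vector_fieldD(2,4)[OF j.vector] vector_fieldD(2,4)[OF j'.vector] by fastforce
  qed
  have "\<Lambda> x f g = \<Lambda>' x f g" for x f g
  proof (cases "x \<in> atotal A \<and> f \<in> Cinf (aatlas A) \<and> g \<in> Cinf (aatlas A)")
    case True
    then show ?thesis using br[of x f g] E by (simp add: jacobi_bracket_def)
  next
    case False
    then consider "x \<notin> atotal A" | "f \<notin> Cinf (aatlas A)" | "g \<notin> Cinf (aatlas A)" by blast
    then show ?thesis
      by cases (simp_all add: bivector_fieldD(2,7,8)[OF j.bivector] bivector_fieldD(2,7,8)[OF j'.bivector])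
  qed
  with E show ?thesis by blast
qed

lemma jacobi_structure_fields: "jacobi_structure (aatlas A) \<Lambda> E \<Longrightarrow> jacobi_fields (aatlas A) \<Lambda> E"
  by unfold_locales (auto simp: jacobi_structure_def aatlas_smooth)

lemma linked_unique_jacobi:
  assumes "affine_jacobi A \<Lambda> E" "linked \<Lambda> E P" "affine_jacobi A \<Lambda>' E'" "linked \<Lambda>' E' P"
  shows "\<Lambda> = \<Lambda>' \<and> E = E'"
  using assms
  by (intro jacobi_fields_eqI jacobi_structure_fields) (auto simp: affine_jacobi_def linked_def)

subsection \<open>Restricting a homogeneous Poisson structure\<close>

text \<open>\<open>cutoff\<close> is 1 near \<open>\<tau> = 1\<close> and 0 near \<open>\<tau> \<le> 0\<close>; \<open>extension f\<close> is homogeneous of degree 0 near \<open>A\<close>.\<close>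

definition cutoff :: "real \<Rightarrow> real" where
  "cutoff t = smooth_step (4 * t - 2)"

text \<open>The radial projection onto \<open>A\<close>, meaningful where \<open>\<tau>\<close> is
  not 0.\<close>

definition retract :: "'m \<times> ('m \<times> ('a \<Rightarrow> real) \<Rightarrow> real) \<Rightarrow> 'a" where
  "retract z = (SOME x. x \<in> atotal A \<and> evaluation A x = vscale (hat A) (1 / \<tau> z) z)"

definition extension :: "('a \<Rightarrow> real) \<Rightarrow> 'm \<times> ('m \<times> ('a \<Rightarrow> real) \<Rightarrow> real) \<Rightarrow> real" where
  "extension f z = cutoff (\<tau> z) * f (retract z)"

lemma cutoff_0: "t \<le> 1/2 \<Longrightarrow> cutoff t = 0" and cutoff_1: "3/4 \<le> t \<Longrightarrow> cutoff t = 1"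
  by (simp_all add: cutoff_def smooth_step_0 smooth_step_1)

lemma smooth_on_cutoff: "smooth_on cutoff UNIV"
  unfolding cutoff_def
  by (rule smooth_on_compose[of UNIV UNIV "\<lambda>t. 4 * t - 2"]) (auto intro!: smooth_intros smooth_on_smooth_step)

lemma evaluation_inj:
  assumes x: "x \<in> atotal A" and x': "x' \<in> atotal A" and eq: "evaluation A x = evaluation A x'"
  shows "x = x'"
proof -
  obtain U y where U: "(U, y) \<in> atriv A" "aproj A x \<in> U" using AB.proj[OF x] by (rule AB.trivE)
  have p: "aproj A x = aproj A x'" using evaluation(2)[OF x] evaluation(2)[OF x'] eq by simp
  have "(y x, 1) = (y x', 1 :: real)"
    using evaluation(3)[OF x U] evaluation(3)[OF x' U(1)] U(2) eq p by simp
  then show ?thesis using AB.pt_triv[OF U x] AB.pt_triv[OF U(1) _ x'] U(2) p by simp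
qed

lemma tau_hpt: "(U, y) \<in> atriv A \<Longrightarrow> p \<in> U \<Longrightarrow> \<tau> (hpt y p s) = snd s"
  by (simp add: bar_hpt[OF _ _ affine_const])

lemma retract_hpt:
  assumes U: "(U, y) \<in> atriv A" "p \<in> U" and s: "snd s \<noteq> 0"
  shows "retract (hpt y p s) = AB.pt y p ((1 / snd s) *\<^sub>R fst s)"
proof -
  let ?z = "hpt y p s" and ?x = "AB.pt y p ((1 / snd s) *\<^sub>R fst s)"
  have z: "?z \<in> H" "fst ?z = p" using hpt_total[OF U] fst_hpt[OF U] by simp_all
  have x: "?x \<in> atotal A" "aproj A ?x = p" "y ?x = (1 / snd s) *\<^sub>R fst s" using AB.pt[OF U] by simp_all
  have "hcoord y (vscale (hat A) (1 / snd s) ?z) = ((1 / snd s) *\<^sub>R fst s, 1)"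
    using vscale_total(3)[OF z(1) U(1)] U(2) z(2) hcoord_hpt[OF U] s by (simp add: prod_eq_iff)
  moreover have "hpt y p (hcoord y (vscale (hat A) (1 / snd s) ?z)) = vscale (hat A) (1 / snd s) ?z"
    using hpt_hcoord[OF U(1) vscale_total(1)[OF z(1)]] vscale_total(2)[OF z(1)] z(2) U(2) by simp
  ultimately have ev: "evaluation A ?x = vscale (hat A) (1 / \<tau> ?z) ?z"
    using evaluation_eq_hpt[OF U(1) x(1)] x U(2) by (simp add: tau_hpt[OF U])
  show ?thesis
    unfolding retract_def
  proof (rule some_equality)
    show "?x \<in> atotal A \<and> evaluation A ?x = vscale (hat A) (1 / \<tau> ?z) ?z" using x(1) ev by blast
    show "x' = ?x" if "x' \<in> atotal A \<and> evaluation A x' = vscale (hat A) (1 / \<tau> ?z) ?z" for x'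
      using that x(1) ev evaluation_inj by metis
  qed
qed

lemma retract:
  assumes z: "z \<in> H" and t: "\<tau> z \<noteq> 0"
  shows "retract z \<in> atotal A" "a \<in> affine_functions A \<Longrightarrow> bar A a z = \<tau> z * a (retract z)"
proof -
  obtain U y where U: "(U, y) \<in> atriv A" "fst z \<in> U" using z by (rule H_trivE)
  define s where "s = hcoord y z"
  have zs: "z = hpt y (fst z) s" using hpt_hcoord[OF U(1) z U(2)] by (simp add: s_def)
  have s: "\<tau> z = snd s" by (subst zs) (rule tau_hpt[OF U])
  have r: "retract z = AB.pt y (fst z) ((1 / snd s) *\<^sub>R fst s)"
    by (subst zs) (rule retract_hpt[OF U], use t s in simp)
  show "retract z \<in> atotal A" by (simp add: r AB.pt[OF U])
  show "bar A a z = \<tau> z * a (retract z)" if a: "a \<in> affine_functions A"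
  proof -
    obtain wd where wd: "\<And>x. x \<in> afibre A (fst z) \<Longrightarrow> a x = fst wd \<bullet> y x + snd wd" using affineE[OF a U] by blast
    have "bar A a z = s \<bullet> wd" unfolding s_def by (rule bar_eq[OF U(1) z U(2) wd])
    moreover have "a (retract z) = fst wd \<bullet> ((1 / snd s) *\<^sub>R fst s) + snd wd"
      unfolding r by (simp add: wd apt_fibre[OF U] AB.pt[OF U])
    ultimately show ?thesis
      using t s by (simp add: inner_prod_def inner_commute field_simps)
  qed
qed

lemma retract_evaluation:
  assumes x: "x \<in> atotal A"
  shows "retract (evaluation A x) = x" "\<tau> (evaluation A x) = 1"
proof -
  obtain U y where U: "(U, y) \<in> atriv A" "aproj A x \<in> U" using AB.proj[OF x] by (rule AB.trivE)
  show "retract (evaluation A x) = x"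
    using retract_hpt[OF U, of "(y x, 1)"] AB.pt_triv[OF U x] by (simp add: evaluation_eq_hpt[OF U(1) x U(2)])
  show "\<tau> (evaluation A x) = 1" using evaluation(4)[OF x affine_const] .
qed

text \<open>Two overlapping regions: where \<open>\<tau>\<close> < 1/2 the function is 0, and where
  \<open>\<tau>\<close> > 1/4 division by \<open>\<tau>\<close> is smooth.\<close>

lemma extension_Cinf:
  assumes f: "f \<in> Cinf (aatlas A)"
  shows "extension f \<in> Cinf (vatlas (hat A))"
  unfolding Cinf_iff_smooth_at[OF vatlas_smooth]
proof
  fix z assume "z \<in> point_set (vatlas (hat A))"
  then have z: "z \<in> H" by simp
  obtain W \<phi> U y where W: "(W, \<phi>) \<in> abase A" and U: "(U, y) \<in> atriv A" and D: "z \<in> hdom W U"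
    "fst z \<in> W" "fst z \<in> U"
    using z by (rule H_chartE) blast
  let ?N = "\<phi> ` (W \<inter> U)"
  let ?S1 = "?N \<times> (UNIV :: 'f set) \<times> {1/4::real<..}" and ?S2 = "?N \<times> (UNIV :: 'f set) \<times> {..<1/2::real}"
  have o: "open ?N" by (rule AB.open_base_image_dom[OF W U])
  have o2: "open ?S1" "open ?S2" "open (?N \<times> (UNIV :: 'f set))"
    using o by (simp_all add: open_Times)
  have inv: "inv_into W \<phi> x \<in> U" if "x \<in> ?N" for x
    using that smooth_atlasD(1)[OF base_atlas W] by auto
  have sub: "?S1 \<subseteq> ?N \<times> UNIV" "?S2 \<subseteq> ?N \<times> UNIV" by auto
  have \<kappa>z: "hchart \<phi> y z = (\<phi> (fst z), hcoord y z)" by (simp add: H0.chart_def)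
  show "smooth_at (vatlas (hat A)) (extension f) z"
    unfolding vatlas_eq
  proof (cases "snd (hcoord y z) < 1/2")
    case True
    have "smooth_on (\<lambda>_. 0) ?S2" using o2(2) by (rule smooth_on_const)
    then have "smooth_on (\<lambda>(x, s). extension f (H0.pt (hcoord y) (inv_into W \<phi> x) s)) ?S2"
      by (rule smooth_on_cong[OF _ o2(2)])
        (use inv in \<open>auto simp: hpt_eq[OF U] extension_def tau_hpt[OF U] cutoff_0\<close>)
    then show "smooth_at (bundle_atlas (abase A) H fst (vtriv (hat A))) (extension f) z"
      by (rule HB.total_smooth_atI[OF W hat_trivI[OF U] o2(2) sub(2) D(1), rotated])
        (use D True in \<open>auto simp: \<kappa>z mem_Times_iff\<close>)
  next
    case False
    let ?t = "\<lambda>(x, s). f (AB.pt y (inv_into W \<phi> x) s)"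
    have t: "smooth_on ?t (?N \<times> UNIV)" using AB.smooth_along_triv[OF W U f[unfolded aatlas_eq]] .
    have i: "smooth_on (\<lambda>z. 1 / snd (snd z)) ?S1"
      by (rule smooth_on_divide) (auto intro!: smooth_intros o2)
    have 1: "smooth_on (\<lambda>z. ?t (fst z, (1 / snd (snd z)) *\<^sub>R fst (snd z))) ?S1"
      by (rule smooth_on_compose[OF o2(1,3) _ _ t])
        (auto intro!: smooth_on_Pair smooth_on_scaleR i smooth_intros o2)
    have 2: "smooth_on (\<lambda>z. cutoff (snd (snd z))) ?S1"
      by (rule smooth_on_compose[OF o2(1) open_UNIV _ _ smooth_on_cutoff]) (auto intro!: smooth_intros o2)
    have "smooth_on (\<lambda>z. cutoff (snd (snd z)) * ?t (fst z, (1 / snd (snd z)) *\<^sub>R fst (snd z))) ?S1"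
      by (rule smooth_on_mult[OF o2(1) 2 1])
    then have "smooth_on (\<lambda>(x, s). extension f (H0.pt (hcoord y) (inv_into W \<phi> x) s)) ?S1"
      by (rule smooth_on_cong[OF _ o2(1)])
        (use inv in \<open>auto simp: hpt_eq[OF U] extension_def tau_hpt[OF U] retract_hpt[OF U]\<close>)
    then show "smooth_at (bundle_atlas (abase A) H fst (vtriv (hat A))) (extension f) z"
      by (rule HB.total_smooth_atI[OF W hat_trivI[OF U] o2(1) sub(1) D(1), rotated])
        (use D False in \<open>auto simp: \<kappa>z mem_Times_iff\<close>)
  qed
qed

text \<open>A product of two extensions carries the square of the cutoff, so multiplicativity holds
  only after one further cutoff factor; tangent vectors at points of \<open>A\<close> do not notice
  it.\<close>

lemma extension_add: "extension (\<lambda>x. f x + g x) = (\<lambda>z. extension f z + extension g z)"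
  and extension_scale: "extension (\<lambda>x. c * f x) = (\<lambda>z. c * extension f z)"
  and extension_mult: "(\<lambda>z. cutoff (\<tau> z) * extension (\<lambda>x. f x * g x) z) = (\<lambda>z. extension f z * extension g z)"
  by (auto simp: extension_def algebra_simps)

lemma extension_evaluation: "x \<in> atotal A \<Longrightarrow> extension f (evaluation A x) = f x"
  by (simp add: extension_def retract_evaluation cutoff_1)

lemma cutoff_tau_Cinf: "(\<lambda>z. cutoff (\<tau> z)) \<in> Cinf (vatlas (hat A))"
  by (rule Cinf_compose[OF vatlas_smooth tau_Cinf open_UNIV _ smooth_on_cutoff]) simp

text \<open>\<open>cutoff \<circ> \<tau>\<close> is 1 wherever a second cutoff function that is 1 at \<open>A\<close> does not vanish.\<close>

lemma tangent_cutoff: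
  assumes x: "x \<in> atotal A" and u: "u \<in> tangent_space (vatlas (hat A)) (evaluation A x)"
    and F: "F \<in> Cinf (vatlas (hat A))"
  shows "u (\<lambda>z. cutoff (\<tau> z) * F z) = u F"
proof -
  define \<sigma> where "\<sigma> t = smooth_step (4 * t - 3)" for t
  have s: "smooth_on \<sigma> UNIV"
    unfolding \<sigma>_def
    by (rule smooth_on_compose[of UNIV UNIV "\<lambda>t. 4 * t - 3"]) (auto intro!: smooth_intros smooth_on_smooth_step)
  have C: "(\<lambda>z. \<sigma> (\<tau> z)) \<in> Cinf (vatlas (hat A))"
    by (rule Cinf_compose[OF vatlas_smooth tau_Cinf open_UNIV _ s]) simp
  have "cutoff t * \<sigma> t = \<sigma> t" for t
    by (cases "3/4 \<le> t") (simp_all add: cutoff_1 \<sigma>_def smooth_step_0)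
  \<comment> \<open>At \<open>\<tau>\<close> = 1 both factors have the value 1, so the Leibniz rule
    turns this equation into the vanishing of u on the cutoff.\<close>
  then have "u (\<lambda>z. cutoff (\<tau> z) * \<sigma> (\<tau> z)) = u (\<lambda>z. \<sigma> (\<tau> z))" by (simp only:)
  then have "u (\<lambda>z. cutoff (\<tau> z)) = 0"
    using tangentD(2)[OF u cutoff_tau_Cinf C] retract_evaluation(2)[OF x]
    by (simp add: cutoff_1 \<sigma>_def smooth_step_1)
  then show ?thesis
    using tangentD(2)[OF u cutoff_tau_Cinf F] retract_evaluation(2)[OF x] by (simp add: cutoff_1)
qed

text \<open>This is the image of u under the radial projection onto \<open>A\<close>; in the Leibniz
  rule the surplus cutoff factor is removed by \<open>tangent_cutoff\<close>.\<close>

lemma tangent_extension: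
  assumes x: "x \<in> atotal A" and u: "u \<in> tangent_space (vatlas (hat A)) (evaluation A x)"
  shows "(\<lambda>f. if f \<in> Cinf (aatlas A) then u (extension f) else 0) \<in> tangent_space (aatlas A) x"
proof (rule tangentI, goal_cases)
  case (1 f g)
  then show ?case
    by (simp add: Cinf_add[OF aatlas_smooth] extension_add tangentD(1)[OF u] extension_Cinf)
next
  case (2 f g)
  have "u (extension (\<lambda>x. f x * g x)) = u (\<lambda>z. extension f z * extension g z)"
    using tangent_cutoff[OF x u extension_Cinf[OF Cinf_mult[OF aatlas_smooth 2]]] by (simp add: extension_mult)
  then show ?case
    using 2 by (simp add: Cinf_mult[OF aatlas_smooth] tangentD(2)[OF u] extension_Cinf extension_evaluation[OF x])
next
  case (3 c f)
  then show ?case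
    by (simp add: Cinf_cmult[OF aatlas_smooth] extension_scale tangentD(3)[OF u] extension_Cinf)
qed simp

text \<open>Near \<open>A\<close>, where the cutoff is 1, \<open>bar A a\<close> is
  \<open>\<tau>\<close> times \<open>extension a\<close>; the rest is the Leibniz rule at
  \<open>\<tau>\<close> = 1.\<close>

lemma tangent_bar:
  assumes x: "x \<in> atotal A" and u: "u \<in> tangent_space (vatlas (hat A)) (evaluation A x)"
    and a: "a \<in> affine_functions A"
  shows "u (bar A a) = u \<tau> * a x + u (extension a)"
proof -
  have e: "extension a \<in> Cinf (vatlas (hat A))" by (rule extension_Cinf[OF affine_Cinf[OF a]])
  have "u (bar A a) = u (\<lambda>z. cutoff (\<tau> z) * bar A a z)"
    using tangent_cutoff[OF x u bar_Cinf[OF a]] by simp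
  also have "\<dots> = u (\<lambda>z. \<tau> z * extension a z)"
  proof (rule tangent_cong[OF vatlas_smooth u])
    show "evaluation A x \<in> point_set (vatlas (hat A))" using evaluation(1)[OF x] by simp
    show "(\<lambda>z. cutoff (\<tau> z) * bar A a z) \<in> Cinf (vatlas (hat A))"
      by (intro Cinf_mult vatlas_smooth cutoff_tau_Cinf bar_Cinf a)
    fix z assume "z \<in> point_set (vatlas (hat A))"
    then show "cutoff (\<tau> z) * bar A a z = \<tau> z * extension a z"
      using retract(2)[of z, OF _ _ a] by (cases "\<tau> z = 0") (simp_all add: cutoff_0 extension_def)
  qed
  also have "\<dots> = u \<tau> * a x + u (extension a)"
    using tangentD(2)[OF u tau_Cinf e] x by (simp add: retract_evaluation extension_evaluation)
  finally show ?thesis .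
qed

definition restrict_E :: "('m \<times> ('m \<times> ('a \<Rightarrow> real) \<Rightarrow> real)) bifield \<Rightarrow> 'a vfield" where
  "restrict_E P x f = (if x \<in> atotal A \<and> f \<in> Cinf (aatlas A) then P (evaluation A x) \<tau> (extension f) else 0)"

definition restrict_\<Lambda> :: "('m \<times> ('m \<times> ('a \<Rightarrow> real) \<Rightarrow> real)) bifield \<Rightarrow> 'a bifield" where
  "restrict_\<Lambda> P x f g = (if x \<in> atotal A \<and> f \<in> Cinf (aatlas A) \<and> g \<in> Cinf (aatlas A)
     then P (evaluation A x) (extension f) (extension g) else 0)"

lemma restrict_jacobi_fields:
  assumes P: "bivector_field (vatlas (hat A)) P"
  shows "jacobi_fields (aatlas A) (restrict_\<Lambda> P) (restrict_E P)"
proof (unfold_locales, rule aatlas_smooth)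
  have ep: "evaluation A x \<in> point_set (vatlas (hat A))" if "x \<in> atotal A" for x
    using evaluation(1)[OF that] by simp
  show "bivector_field (aatlas A) (restrict_\<Lambda> P)"
  proof (rule bivector_fieldI[OF aatlas_smooth aatlas_separated])
    show "restrict_\<Lambda> P x f g = - restrict_\<Lambda> P x g f" for x f g
      using bivector_fieldD(4)[OF P, of "evaluation A x" "extension f" "extension g"] by (auto simp: restrict_\<Lambda>_def)
    fix x f assume x: "x \<in> point_set (aatlas A)" and f: "f \<in> Cinf (aatlas A)"
    then have "restrict_\<Lambda> P x f = (\<lambda>g. if g \<in> Cinf (aatlas A) then P (evaluation A x) (extension f) (extension g) else 0)"
      by (auto simp: restrict_\<Lambda>_def)
    then show "restrict_\<Lambda> P x f \<in> tangent_space (aatlas A) x"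
      using tangent_extension[OF _ bivector_fieldD(5)[OF P ep]] x by simp
  next
    fix f g assume f: "f \<in> Cinf (aatlas A)" and g: "g \<in> Cinf (aatlas A)"
    show "(\<lambda>x. restrict_\<Lambda> P x f g) \<in> Cinf (aatlas A)"
      by (rule Cinf_cong[OF aatlas_smooth evaluation_Cinf[OF bivector_fieldD(3)[OF P extension_Cinf[OF f] extension_Cinf[OF g]]]])
        (simp add: restrict_\<Lambda>_def f g)
  qed (auto simp: restrict_\<Lambda>_def)
  show "vector_field (aatlas A) (restrict_E P)"
    unfolding vector_field_def
  proof (intro conjI ballI allI impI)
    fix x assume x: "x \<in> point_set (aatlas A)"
    then have "restrict_E P x = (\<lambda>f. if f \<in> Cinf (aatlas A) then P (evaluation A x) \<tau> (extension f) else 0)"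
      by (auto simp: restrict_E_def)
    then show "restrict_E P x \<in> tangent_space (aatlas A) x"
      using tangent_extension[OF _ bivector_fieldD(5)[OF P ep]] x by simp
  next
    fix f assume f: "f \<in> Cinf (aatlas A)"
    show "(\<lambda>x. restrict_E P x f) \<in> Cinf (aatlas A)"
      by (rule Cinf_cong[OF aatlas_smooth evaluation_Cinf[OF bivector_fieldD(3)[OF P tau_Cinf extension_Cinf[OF f]]]])
        (simp add: restrict_E_def f)
  qed (auto simp: restrict_E_def)
qed

lemma restrict_linked:
  assumes P: "bivector_field (vatlas (hat A)) P"
  shows "linked (restrict_\<Lambda> P) (restrict_E P) P"
  unfolding linked_def poisson_bracket_def
proof (intro ballI)
  fix a b x assume a: "a \<in> affine_functions A" and b: "b \<in> affine_functions A" and x: "x \<in> atotal A"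
  have ep: "evaluation A x \<in> point_set (vatlas (hat A))" using evaluation(1)[OF x] by simp
  let ?P = "P (evaluation A x)"
  note T = tangent_bar[OF x bivector_fieldD(6)[OF P ep] a] tangent_bar[OF x bivector_fieldD(5)[OF P ep] b]
  \<comment> \<open>Expanding both slots by \<open>tangent_bar\<close> produces four terms. This one
    drops out, and the other three make up the Jacobi bracket.\<close>
  have "?P \<tau> \<tau> = 0" using bivector_fieldD(4)[OF P, of "evaluation A x" \<tau> \<tau>] by simp
  moreover have "?P (extension a) \<tau> = - ?P \<tau> (extension a)" by (rule bivector_fieldD(4)[OF P])
  ultimately show "jacobi_bracket (restrict_\<Lambda> P) (restrict_E P) a b x = ?P (bar A a) (bar A b)"
    using x affine_Cinf[OF a] affine_Cinf[OF b]
    by (simp add: T jacobi_bracket_def restrict_\<Lambda>_def restrict_E_def)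
qed

text \<open>Iterated Poisson brackets of linear functions restrict to iterated brackets of affine
  functions, so the Jacobi identity holds on affine functions, and these determine 1-jets.\<close>

lemma restrict_affine_jacobi:
  assumes P: "homogeneous_poisson (hat A) P"
  shows "affine_jacobi A (restrict_\<Lambda> P) (restrict_E P)"
proof -
  have B: "bivector_field (vatlas (hat A)) P" and J: "jacobi_identity (vatlas (hat A)) (poisson_bracket P)"
    and L: "lie_derivative (liouville (hat A)) P = (\<lambda>v f g. - P v f g)"
    using P by (simp_all add: homogeneous_poisson_def poisson_structure_def)
  interpret j: jacobi_fields "aatlas A" "restrict_\<Lambda> P" "restrict_E P" by (rule restrict_jacobi_fields[OF B])
  have br: "j.br a b x = P (evaluation A x) (bar A a) (bar A b)"
    if "a \<in> affine_functions A" "b \<in> affine_functions A" "x \<in> atotal A" for a b x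
    using restrict_linked[OF B] that by (simp add: linked_def poisson_bracket_def)
  have aff: "j.br a b \<in> affine_functions A" if "a \<in> affine_functions A" "b \<in> affine_functions A" for a b
    by (rule affine_cong[OF linear_bracket(1)[OF B L that]]) (simp add: br that)
  have bar_br: "bar A (j.br a b) z = P z (bar A a) (bar A b)"
    if "a \<in> affine_functions A" "b \<in> affine_functions A" "z \<in> H" for a b z
    using linear_bracket(2)[OF B L that] bar_cong[of z "j.br a b"] br[OF that(1,2)] by simp
  have br2: "j.br a (j.br b c) x = poisson_bracket P (bar A a) (poisson_bracket P (bar A b) (bar A c)) (evaluation A x)"
    if a: "a \<in> affine_functions A" and b: "b \<in> affine_functions A" and c: "c \<in> affine_functions A" and x: "x \<in> atotal A" for a b c x
  proof -
    have ep: "evaluation A x \<in> point_set (vatlas (hat A))" using evaluation(1)[OF x] by simp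
    have "P (evaluation A x) (bar A a) (bar A (j.br b c)) = P (evaluation A x) (bar A a) (\<lambda>z. P z (bar A b) (bar A c))"
      by (rule tangent_cong[OF vatlas_smooth bivector_fieldD(5)[OF B ep] ep bar_Cinf[OF aff[OF b c]]])
        (simp add: bar_br[OF b c])
    then show ?thesis using br[OF a aff[OF b c] x] by (simp add: poisson_bracket_def)
  qed
  have "jacobi_identity (aatlas A) j.br"
    unfolding j.jacobi_identity_iff
  proof (intro ballI)
    fix f g h x assume fgh: "f \<in> Cinf (aatlas A)" "g \<in> Cinf (aatlas A)" "h \<in> Cinf (aatlas A)" and x: "x \<in> point_set (aatlas A)"
    have xA: "x \<in> atotal A" using x by simp
    show "j.jacobiator f g h x = 0"
    proof (rule j.jacobiator_zeroI[OF x affine_jet_determining[OF xA] _ fgh])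
      fix a b c assume abc: "a \<in> affine_functions A" "b \<in> affine_functions A" "c \<in> affine_functions A"
      have "evaluation A x \<in> point_set (vatlas (hat A))" using evaluation(1) x by simp
      then show "j.jacobiator a b c x = 0"
        using J abc[THEN bar_Cinf] x abc by (simp add: j.jacobiator_def br2 jacobi_identity_def)
    qed
  qed
  then show ?thesis
    using aff j.bivector j.vector by (simp add: affine_jacobi_def jacobi_structure_def)
qed

subsection \<open>The Jacobi structure on the hull\<close>

text \<open>Pushes a functional forward along the embedding, so that the bracket on \<open>A\<close>
  and the one on \<open>hat A\<close> can be compared as functionals at the same point.\<close>

lemma first_order_evaluation:
  assumes x: "x \<in> atotal A" and L: "first_order (aatlas A) x L"
  shows "first_order (vatlas (hat A)) (evaluation A x) (\<lambda>F. L (\<lambda>x. F (evaluation A x)))"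
proof -
  obtain v c where v: "v \<in> tangent_space (aatlas A) x" and L: "\<And>f. f \<in> Cinf (aatlas A) \<Longrightarrow> L f = v f + c * f x"
    using L by (auto simp: first_order_def)
  have "(\<lambda>F. if F \<in> Cinf (vatlas (hat A)) then v (\<lambda>x. F (evaluation A x)) else 0) \<in>
      tangent_space (vatlas (hat A)) (evaluation A x)"
    by (rule tangentI) (auto simp: Cinf_add Cinf_mult Cinf_cmult vatlas_smooth tangentD[OF v] evaluation_Cinf)
  from tangent_first_order[OF this, of c] show ?thesis
    by (rule first_order_cong) (simp add: L evaluation_Cinf)
qed

lemma hamiltonian_vector_field:
  assumes "bivector_field \<A> P" "f \<in> Cinf \<A>"
  shows "vector_field \<A> (hamiltonian P f)"
  unfolding vector_field_def
proof (intro conjI ballI allI impI)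
  show "hamiltonian P f p \<in> tangent_space \<A> p" if "p \<in> point_set \<A>" for p
    using bivector_fieldD(5)[OF assms(1) that, of f] by (simp add: hamiltonian_def)
  show "hamiltonian P f p = (\<lambda>_. 0)" if "p \<notin> point_set \<A>" for p
    using bivector_fieldD(2)[OF assms(1) that] by (auto simp: hamiltonian_def)
  show "(\<lambda>p. hamiltonian P f p g) \<in> Cinf \<A>" if "g \<in> Cinf \<A>" for g
    using bivector_fieldD(3)[OF assms that] by (simp add: hamiltonian_def)
qed

text \<open>The Liouville field fixes linear functions, so on these the wedge term cancels the two
  terms of the bracket that contain E'. The Jacobi bracket on \<open>hat A\<close> is then the
  Poisson bracket of linear functions, which restricts to the bracket on \<open>A\<close> by
  \<open>linked\<close>; both claims become comparisons on generators.\<close>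

lemma hull_jacobi_structure:
  assumes P: "homogeneous_poisson (hat A) P" and aj: "jacobi_structure (aatlas A) \<Lambda> E" and linked: "linked \<Lambda> E P"
    and E': "E' = hamiltonian P \<tau>" and \<Lambda>': "\<Lambda>' = (\<lambda>z f g. P z f g - wedge (liouville (hat A)) E' z f g)"
  shows "jacobi_structure (vatlas (hat A)) \<Lambda>' E'"
    "jacobi_restriction (aatlas A) (vatlas (hat A)) (evaluation A) \<Lambda> E \<Lambda>' E'"
proof -
  have B: "bivector_field (vatlas (hat A)) P" and J: "jacobi_identity (vatlas (hat A)) (poisson_bracket P)"
    and L: "lie_derivative (liouville (hat A)) P = (\<lambda>v f g. - P v f g)"
    using P by (simp_all add: homogeneous_poisson_def poisson_structure_def)
  have vE: "vector_field (vatlas (hat A)) E'" unfolding E' by (rule hamiltonian_vector_field[OF B tau_Cinf])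
  have b\<Lambda>: "bivector_field (vatlas (hat A)) \<Lambda>'"
    unfolding \<Lambda>'
    by (rule bivector_field_diff[OF vatlas_smooth vatlas_separated B
          wedge_bivector_field[OF vatlas_smooth vatlas_separated liouville_vector_field vE]])
  interpret h: jacobi_fields "vatlas (hat A)" \<Lambda>' E' by unfold_locales (rule vatlas_smooth b\<Lambda> vE)+
  interpret j: jacobi_fields "aatlas A" \<Lambda> E by (rule jacobi_structure_fields[OF aj])
  \<comment> \<open>\<open>rep s a\<close>: inside brackets the generator s acts like the linear
    function \<open>bar A a\<close>. The constant 1 acts like \<open>\<tau>\<close>, because the
    bracket with 1 is E' and E' is the hamiltonian field of \<open>\<tau>\<close>.\<close>
  define rep where "rep s a \<longleftrightarrow> a \<in> affine_functions A \<and> (s = bar A a \<or> s = (\<lambda>_. 1) \<and> a = (\<lambda>_. 1))" for s a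
  let ?S = "insert (\<lambda>_. 1) (bar A ` affine_functions A)"
  have repE: "\<exists>a. rep s a" if "s \<in> ?S" for s
    using that affine_const[of 1] by (auto simp: rep_def)
  have rep_Cinf: "s \<in> Cinf (vatlas (hat A))" if "rep s a" for s a
    using that bar_Cinf Cinf_const[OF vatlas_smooth] by (auto simp: rep_def)
  have rep_ev: "s (evaluation A x) = a x" if "rep s a" "x \<in> atotal A" for s a x
    using that evaluation(4) by (auto simp: rep_def)
  have P1: "P z (\<lambda>_. 1) G = 0" "P z G (\<lambda>_. 1) = 0" if "z \<in> H" for z G
    using tangent_const[OF vatlas_smooth bivector_fieldD(6)[OF B]]
      tangent_const[OF vatlas_smooth bivector_fieldD(5)[OF B]] that by simp_all
  have L1: "liouville (hat A) z (\<lambda>_. 1) = 0" if "z \<in> H" for z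
    using tangent_const[OF vatlas_smooth vector_fieldD(1)[OF liouville_vector_field]] that by simp
  have Ptt: "P z F F = 0" for z F using bivector_fieldD(4)[OF B, of z F F] by simp
  have br: "h.br s t z = P z (bar A a) (bar A b)" if s: "rep s a" and t: "rep t b" and z: "z \<in> H" for s a t b z
  proof -
    have "P z (bar A a) \<tau> = - P z \<tau> (bar A a)" by (rule bivector_fieldD(4)[OF B])
    then show ?thesis
      using s t z P1[OF z] L1[OF z] Ptt liouville_bar[OF _ z]
      by (auto simp: rep_def jacobi_bracket_def \<Lambda>' wedge_def E' hamiltonian_def)
  qed
  define c where "c a b = (\<lambda>x. P (evaluation A x) (bar A a) (bar A b))" for a b
  have c: "c a b \<in> affine_functions A" "\<And>z. z \<in> H \<Longrightarrow> P z (bar A a) (bar A b) = bar A (c a b) z"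
    if "a \<in> affine_functions A" "b \<in> affine_functions A" for a b
    unfolding c_def by (rule linear_bracket[OF B L that])+
  have br2: "h.br s (h.br t u) z = poisson_bracket P (bar A a) (poisson_bracket P (bar A b) (bar A d)) z"
    if s: "rep s a" and t: "rep t b" and u: "rep u d" and z: "z \<in> H" for s t u a b d z
  proof -
    have zp: "z \<in> point_set (vatlas (hat A))" using z by simp
    have bd: "b \<in> affine_functions A" "d \<in> affine_functions A" using t u by (auto simp: rep_def)
    have "h.br s (h.br t u) z = h.br s (bar A (c b d)) z"
      by (rule h.br_cong(2)[OF zp h.br_Cinf[OF rep_Cinf[OF t] rep_Cinf[OF u]]]) (simp add: br[OF t u] c(2)[OF bd])
    also have "\<dots> = P z (bar A a) (bar A (c b d))"
      by (rule br[OF s _ z]) (simp add: rep_def c(1)[OF bd])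
    also have "\<dots> = P z (bar A a) (\<lambda>z. P z (bar A b) (bar A d))"
      by (rule tangent_cong[OF vatlas_smooth bivector_fieldD(5)[OF B zp] zp bar_Cinf[OF c(1)[OF bd]]])
        (simp add: c(2)[OF bd])
    finally show ?thesis by (simp add: poisson_bracket_def)
  qed
  have jac: "h.jacobiator f g k z = 0"
    if f: "f \<in> Cinf (vatlas (hat A))" "g \<in> Cinf (vatlas (hat A))" "k \<in> Cinf (vatlas (hat A))" and z: "z \<in> H" for f g k z
  proof (rule zero_on_nonzero_imp_zero[OF h.jacobiator_Cinf[OF f] _ z])
    fix z assume z: "z \<in> H" "nonzero z"
    then have zp: "z \<in> point_set (vatlas (hat A))" by simp
    show "h.jacobiator f g k z = 0"
    proof (rule h.jacobiator_zeroI[OF zp hat_jet_determining[OF z] _ f])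
      fix s t u assume "s \<in> ?S" "t \<in> ?S" "u \<in> ?S"
      then obtain a b d where r: "rep s a" "rep t b" "rep u d" using repE by meson
      then have "bar A a \<in> Cinf (vatlas (hat A))" "bar A b \<in> Cinf (vatlas (hat A))" "bar A d \<in> Cinf (vatlas (hat A))"
        by (auto simp: rep_def bar_Cinf)
      then show "h.jacobiator s t u z = 0"
        using J zp by (simp add: h.jacobiator_def br2[OF r(1,2,3) z(1)] br2[OF r(2,3,1) z(1)] br2[OF r(3,1,2) z(1)]
            jacobi_identity_def)
    qed
  qed
  show "jacobi_structure (vatlas (hat A)) \<Lambda>' E'"
    using jac b\<Lambda> vE by (simp add: jacobi_structure_def h.jacobi_identity_iff)
  show "jacobi_restriction (aatlas A) (vatlas (hat A)) (evaluation A) \<Lambda> E \<Lambda>' E'"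
    unfolding jacobi_restriction_def o_def
  proof (intro ballI)
    fix x F G assume "x \<in> point_set (aatlas A)" and F: "F \<in> Cinf (vatlas (hat A))" and G: "G \<in> Cinf (vatlas (hat A))"
    then have x: "x \<in> atotal A" and xp: "x \<in> point_set (aatlas A)" by auto
    note z = evaluation(1)[OF x]
    have zp: "evaluation A x \<in> point_set (vatlas (hat A))" using z by simp
    obtain U y where U: "(U, y) \<in> atriv A" "aproj A x \<in> U" using AB.proj[OF x] by (rule AB.trivE)
    have nz: "nonzero (evaluation A x)"
      using nonzero_iff[OF U(1) _ z] evaluation(2,3)[OF x] U by (simp add: prod_eq_iff)
    have eq: "j.br (\<lambda>x. F (evaluation A x)) (\<lambda>x. G (evaluation A x)) x = h.br F G (evaluation A x)"
      if F: "F \<in> Cinf (vatlas (hat A))" and G: "G \<in> Cinf (vatlas (hat A))" for F G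
    proof (rule bifirst_order_eqI[OF hat_jet_determining[OF z nz],
          of "\<lambda>F G. j.br (\<lambda>x. F (evaluation A x)) (\<lambda>x. G (evaluation A x)) x" "\<lambda>F G. h.br F G (evaluation A x)"])
      show "first_order (vatlas (hat A)) (evaluation A x) (\<lambda>F. j.br (\<lambda>x. F (evaluation A x)) (\<lambda>x. G (evaluation A x)) x)"
        "first_order (vatlas (hat A)) (evaluation A x) (\<lambda>G. j.br (\<lambda>x. F (evaluation A x)) (\<lambda>x. G (evaluation A x)) x)"
        "first_order (vatlas (hat A)) (evaluation A x) (\<lambda>F. h.br F G (evaluation A x))"
        "first_order (vatlas (hat A)) (evaluation A x) (\<lambda>G. h.br F G (evaluation A x))" for F G
        by (intro first_order_evaluation[OF x] j.br_first_order1[OF xp] j.br_first_order2[OF xp]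
            h.br_first_order1[OF zp] h.br_first_order2[OF zp])+
      fix s t assume "s \<in> ?S" "t \<in> ?S"
      then obtain a b where r: "rep s a" "rep t b" using repE by meson
      then have ab: "a \<in> affine_functions A" "b \<in> affine_functions A" by (auto simp: rep_def)
      have "j.br (\<lambda>x. s (evaluation A x)) (\<lambda>x. t (evaluation A x)) x = j.br a (\<lambda>x. t (evaluation A x)) x"
        by (rule j.br_cong(1)[OF xp evaluation_Cinf[OF rep_Cinf[OF r(1)]]]) (simp add: rep_ev[OF r(1)])
      also have "\<dots> = j.br a b x"
        by (rule j.br_cong(2)[OF xp evaluation_Cinf[OF rep_Cinf[OF r(2)]]]) (simp add: rep_ev[OF r(2)])
      also have "\<dots> = h.br s t (evaluation A x)"
        using linked ab x by (simp add: br[OF r z] linked_def poisson_bracket_def)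
      finally show "j.br (\<lambda>x. s (evaluation A x)) (\<lambda>x. t (evaluation A x)) x = h.br s t (evaluation A x)" .
    qed (rule F G)+
    have E: "E x (\<lambda>x. F (evaluation A x)) = E' (evaluation A x) F" if F: "F \<in> Cinf (vatlas (hat A))" for F
      using eq[OF Cinf_const[OF vatlas_smooth, of 1] F]
        jacobi_bracket_one[OF j.jacobi_fields_axioms xp] jacobi_bracket_one[OF h.jacobi_fields_axioms zp] by simp
    show "\<Lambda> x (\<lambda>x. F (evaluation A x)) (\<lambda>x. G (evaluation A x)) = \<Lambda>' (evaluation A x) F G \<and>
        E x (\<lambda>x. F (evaluation A x)) = E' (evaluation A x) F"
      using eq[OF F G] E[OF F] E[OF G] by (simp add: jacobi_bracket_def)
  qed
qed

end

text \<open>Prepares the comparison of the Lie derivative with -P on generators, which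
  \<open>bivector_eqI\<close> offers for bivector fields. For a product g h the mixed terms X(g)
  P(f, h) and P(f, g) X(h) occur both in X(P(f, g h)) and in P(f, X(g h)), and cancel.\<close>

lemma lie_derivative_bivector_field:
  fixes \<A> :: "('n, 'e::fin_dim_inner) atlas"
  assumes A: "smooth_atlas \<A>" and sep: "separated \<A>" and X: "vector_field \<A> X" and P: "bivector_field \<A> P"
  shows "bivector_field \<A> (lie_derivative X P)"
proof (rule bivector_fieldI[OF A sep])
  note XC = vector_fieldD(3)[OF X] and PC = bivector_fieldD(3)[OF P]
  have X0: "X p (\<lambda>_. 0) = 0" for p
    using tangent_const[OF A vector_fieldD(1)[OF X]] vector_fieldD(2)[OF X] by (cases "p \<in> point_set \<A>") auto
  have P0: "P p (\<lambda>_. 0) g = 0" "P p g (\<lambda>_. 0) = 0" for p g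
    using tangent_const[OF A bivector_fieldD(5)[OF P]] tangent_const[OF A bivector_fieldD(6)[OF P]] bivector_fieldD(2)[OF P]
    by (cases "p \<in> point_set \<A>"; auto)+
  have Xminus: "X p (\<lambda>q. - F q) = - X p F" for p F
  proof (cases "F \<in> Cinf \<A> \<and> p \<in> point_set \<A>")
    case True
    then show ?thesis using tangent_minus[OF vector_fieldD(1)[OF X]] by blast
  next
    case False
    moreover have "(\<lambda>q. - F q) \<in> Cinf \<A> \<Longrightarrow> F \<in> Cinf \<A>" using Cinf_minus[OF A, of "\<lambda>q. - F q"] by simp
    ultimately show ?thesis using vector_fieldD(2,4)[OF X] by (metis neg_equal_0_iff_equal)
  qed
  show "lie_derivative X P p f g = - lie_derivative X P p g f" for p f g
  proof -
    have "(\<lambda>q. P q f g) = (\<lambda>q. - P q g f)" using bivector_fieldD(4)[OF P, of _ f g] by blast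
    then have "X p (\<lambda>q. P q f g) = - X p (\<lambda>q. P q g f)" using Xminus by simp
    then show ?thesis
      using bivector_fieldD(4)[OF P, of p "\<lambda>q. X q f" g] bivector_fieldD(4)[OF P, of p f "\<lambda>q. X q g"]
      by (simp add: lie_derivative_def)
  qed
  show "lie_derivative X P p f g = 0" if "f \<notin> Cinf \<A>" for p f g
    using vector_fieldD(4)[OF X that] bivector_fieldD(7)[OF P that] X0 P0 by (simp add: lie_derivative_def)
  show "lie_derivative X P p f g = 0" if "p \<notin> point_set \<A>" for p f g
    using vector_fieldD(2)[OF X that] bivector_fieldD(2)[OF P that] by (simp add: lie_derivative_def)
  show "(\<lambda>p. lie_derivative X P p f g) \<in> Cinf \<A>" if "f \<in> Cinf \<A>" "g \<in> Cinf \<A>" for f g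
    unfolding lie_derivative_def using that by (intro Cinf_diff A XC PC)
  fix p f assume p: "p \<in> point_set \<A>" and f: "f \<in> Cinf \<A>"
  note Xp = vector_fieldD(1)[OF X p] and P1 = bivector_fieldD(5)[OF P]
  note Xq = vector_fieldD(1)[OF X]
  show "lie_derivative X P p f \<in> tangent_space \<A> p"
  proof (rule tangentI, goal_cases)
    case (1 g h)
    have "X p (\<lambda>q. P q f (\<lambda>q. g q + h q)) = X p (\<lambda>q. P q f g + P q f h)"
      by (rule tangent_cong[OF A Xp p PC[OF f Cinf_add[OF A 1]]]) (use tangentD(1)[OF P1 1] in auto)
    moreover have "P p f (\<lambda>q. X q (\<lambda>q. g q + h q)) = P p f (\<lambda>q. X q g + X q h)"
      by (rule tangent_cong[OF A P1[OF p] p XC[OF Cinf_add[OF A 1]]]) (use tangentD(1)[OF Xq _ ] 1 in auto)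
    ultimately show ?case
      using tangentD(1)[OF Xp PC[OF f 1(1)] PC[OF f 1(2)]] tangentD(1)[OF P1[OF p] 1]
        tangentD(1)[OF P1[OF p] XC[OF 1(1)] XC[OF 1(2)]]
      by (simp add: lie_derivative_def)
  next
    case (2 g h)
    note C = PC[OF f 2(1)] PC[OF f 2(2)]
    have "X p (\<lambda>q. P q f (\<lambda>q. g q * h q)) = X p (\<lambda>q. P q f g * h q + g q * P q f h)"
      by (rule tangent_cong[OF A Xp p PC[OF f Cinf_mult[OF A 2]]]) (use tangentD(2)[OF P1 2] in auto)
    also have "\<dots> = X p (\<lambda>q. P q f g) * h p + P p f g * X p h + (X p g * P p f h + g p * X p (\<lambda>q. P q f h))"
      using tangentD(1)[OF Xp Cinf_mult[OF A C(1) 2(2)] Cinf_mult[OF A 2(1) C(2)]]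
        tangentD(2)[OF Xp C(1) 2(2)] tangentD(2)[OF Xp 2(1) C(2)] by simp
    finally have E1: "X p (\<lambda>q. P q f (\<lambda>q. g q * h q)) =
        X p (\<lambda>q. P q f g) * h p + P p f g * X p h + (X p g * P p f h + g p * X p (\<lambda>q. P q f h))" .
    have "P p f (\<lambda>q. X q (\<lambda>q. g q * h q)) = P p f (\<lambda>q. X q g * h q + g q * X q h)"
      by (rule tangent_cong[OF A P1[OF p] p XC[OF Cinf_mult[OF A 2]]]) (use tangentD(2)[OF Xq] 2 in auto)
    also have "\<dots> = P p f (\<lambda>q. X q g) * h p + X p g * P p f h + (P p f g * X p h + g p * P p f (\<lambda>q. X q h))"
      using tangentD(1)[OF P1[OF p] Cinf_mult[OF A XC[OF 2(1)] 2(2)] Cinf_mult[OF A 2(1) XC[OF 2(2)]]]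
        tangentD(2)[OF P1[OF p] XC[OF 2(1)] 2(2)] tangentD(2)[OF P1[OF p] 2(1) XC[OF 2(2)]] by simp
    finally have E2: "P p f (\<lambda>q. X q (\<lambda>q. g q * h q)) =
        P p f (\<lambda>q. X q g) * h p + X p g * P p f h + (P p f g * X p h + g p * P p f (\<lambda>q. X q h))" .
    show ?case
      using E1 E2 tangentD(2)[OF P1[OF p] 2] by (simp add: lie_derivative_def algebra_simps)
  next
    case (3 c g)
    have "X p (\<lambda>q. P q f (\<lambda>q. c * g q)) = X p (\<lambda>q. c * P q f g)"
      by (rule tangent_cong[OF A Xp p PC[OF f Cinf_cmult[OF A 3]]]) (use tangentD(3)[OF P1 3] in auto)
    moreover have "P p f (\<lambda>q. X q (\<lambda>q. c * g q)) = P p f (\<lambda>q. c * X q g)"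
      by (rule tangent_cong[OF A P1[OF p] p XC[OF Cinf_cmult[OF A 3]]]) (use tangentD(3)[OF Xq] 3 in auto)
    ultimately show ?case
      using tangentD(3)[OF Xp PC[OF f 3]] tangentD(3)[OF P1[OF p] 3] tangentD(3)[OF P1[OF p] XC[OF 3]]
      by (simp add: lie_derivative_def algebra_simps)
  next
    case (4 g)
    then show ?case
      using vector_fieldD(4)[OF X 4] bivector_fieldD(8)[OF P 4] X0 P0 by (simp add: lie_derivative_def)
  qed
qed

lemma chart_deriv_coordinate:
  assumes A: "smooth_atlas \<A>" and U: "(U, \<phi>) \<in> \<A>" and N: "openin (atlas_topology \<A>) N" "N \<subseteq> U" and q: "q \<in> N"
    and \<xi>: "\<And>x. x \<in> N \<Longrightarrow> \<xi> x = w \<bullet> \<phi> x"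
  shows "chart_deriv U \<phi> \<xi> q u = w \<bullet> u"
proof -
  have "((\<xi> \<circ> inv_into U \<phi>) has_derivative (\<lambda>u. w \<bullet> u)) (at (\<phi> q))"
    by (rule has_derivative_transform_within_open[of "\<lambda>x. w \<bullet> x" _ _ _ "\<phi> ` (U \<inter> N)"])
      (use N q \<xi> openin_chart_image[OF A U N(1)] smooth_atlasD(1)[OF A U] in
        \<open>auto intro!: derivative_eq_intros\<close>)
  then show ?thesis using chart_deriv_eqI by metis
qed

section \<open>The homogeneous Poisson structure of an affine Jacobi structure\<close>

locale affine_jacobi_ctx = affine_bundle_ctx A
  for A :: "('m, 'e::fin_dim_inner, 'a, 'v, 'f::fin_dim_inner) abundle" +
  fixes \<Lambda> :: "'a bifield" and E :: "'a vfield"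
  assumes affine_jacobi: "affine_jacobi A \<Lambda> E" and rank_pos: "\<exists>u::'f. u \<noteq> 0"

sublocale affine_jacobi_ctx \<subseteq> j: jacobi_fields "aatlas A" \<Lambda> E
  using affine_jacobi jacobi_structure_fields by (simp add: affine_jacobi_def)

context affine_jacobi_ctx
begin

lemma br_affine: "a \<in> affine_functions A \<Longrightarrow> b \<in> affine_functions A \<Longrightarrow> j.br a b \<in> affine_functions A"
  using affine_jacobi by (simp add: affine_jacobi_def)

lemma frame_at:
  assumes x: "x \<in> atotal A"
  obtains W \<phi> U y N \<alpha> \<xi> where "affine_frame W \<phi> U y N \<alpha> \<xi>" "aproj A x \<in> N"
  using AB.proj[OF x] by (rule affine_frame_exists)

text \<open>The product of \<open>c\<close> with its own linear part is affine, so the linear part vanishes.\<close>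

lemma affine_multiplier_constant:
  assumes c: "\<And>a. a \<in> affine_functions A \<Longrightarrow> (\<lambda>x. a x * c x) \<in> affine_functions A"
    and x: "x \<in> atotal A" "x' \<in> atotal A" "aproj A x = aproj A x'"
  shows "c x = c x'"
proof -
  obtain W \<phi> U y N \<alpha> \<xi> where fr: "affine_frame W \<phi> U y N \<alpha> \<xi>" "aproj A x \<in> N" using frame_at[OF x(1)] .
  note D = affine_frameD[OF fr(1)]
  let ?p = "aproj A x"
  have U: "(U, y) \<in> atriv A" "?p \<in> U" using D(2,4) fr(2) by auto
  have "(\<lambda>x. 1 * c x) \<in> affine_functions A" by (rule c[OF affine_const])
  then obtain wd where wd: "\<And>x. x \<in> afibre A ?p \<Longrightarrow> c x = fst wd \<bullet> y x + snd wd"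
    using affineE[OF _ U, of "\<lambda>x. 1 * c x"] by (simp, metis)
  obtain wd' where wd': "\<And>x. x \<in> afibre A ?p \<Longrightarrow> \<alpha> (fst wd, 0) x * c x = fst wd' \<bullet> y x + snd wd'"
    using affineE[OF c[OF D(5)[of "(fst wd, 0)"]] U] by blast
  have eq: "(fst wd \<bullet> s) * (fst wd \<bullet> s + snd wd) = fst wd' \<bullet> s + snd wd'" for s
    using wd'[OF apt_fibre[OF U, of s]] wd[OF apt_fibre[OF U, of s]] D(7)[of "AB.pt y ?p s" "(fst wd, 0)"] fr(2)
    by (simp add: AB.pt[OF U])
  define m where "m = fst wd \<bullet> fst wd"
  \<comment> \<open>The relation \<open>eq\<close> at w = \<open>fst wd\<close>, at -w and at 0.
    Once the constant is known to be 0, adding the first two cancels the odd terms and leaves m m =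
    0, with m the squared norm of w.\<close>
  have "m * (m + snd wd) = fst wd' \<bullet> fst wd + snd wd'" "- m * (- m + snd wd) = - (fst wd' \<bullet> fst wd) + snd wd'"
    "0 = snd wd'"
    using eq[of "fst wd"] eq[of "- fst wd"] eq[of 0] by (simp_all add: m_def)
  then have "m * m + m * snd wd = fst wd' \<bullet> fst wd" "m * m - m * snd wd = - (fst wd' \<bullet> fst wd)"
    by (simp_all add: algebra_simps)
  then have "m * m = 0" by linarith
  then have "fst wd = 0" by (simp add: m_def)
  then show ?thesis using wd[of x] wd[of x'] x by (simp add: afibre_iff)
qed

text \<open>Determined by \<open>{f a, b} = f {a, b} + a (symbol_at b f)\<close>.\<close>

definition symbol_at :: "('a \<Rightarrow> real) \<Rightarrow> ('m \<Rightarrow> real) \<Rightarrow> 'a \<Rightarrow> real" where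
  "symbol_at b f x = \<Lambda> x (\<lambda>x. f (aproj A x)) b - b x * E x (\<lambda>x. f (aproj A x))"

lemma symbol_at_multiplier:
  assumes b: "b \<in> affine_functions A" and f: "f \<in> Cinf (abase A)" and a: "a \<in> affine_functions A"
  shows "(\<lambda>x. a x * symbol_at b f x) \<in> affine_functions A"
proof (rule affine_cong)
  let ?f = "\<lambda>x. f (aproj A x)"
  show "(\<lambda>x. j.br (\<lambda>x. ?f x * a x) b x + - 1 * (?f x * j.br a b x)) \<in> affine_functions A"
    by (intro affine_add affine_scale affine_module[OF f] br_affine a b)
  fix x assume x: "x \<in> atotal A"
  then have xp: "x \<in> point_set (aatlas A)" by simp
  show "j.br (\<lambda>x. ?f x * a x) b x + - 1 * (?f x * j.br a b x) = a x * symbol_at b f x"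
    using j.br_mult[OF xp A_pullback[OF f] affine_Cinf[OF a], of b] jacobi_bracket_one[OF j.jacobi_fields_axioms xp, of b]
    by (simp add: jacobi_bracket_def symbol_at_def algebra_simps)
qed

lemma symbol_at_basic:
  assumes "b \<in> affine_functions A" "f \<in> Cinf (abase A)" "x \<in> atotal A" "x' \<in> atotal A" "aproj A x = aproj A x'"
  shows "symbol_at b f x = symbol_at b f x'"
  by (rule affine_multiplier_constant[OF symbol_at_multiplier[OF assms(1,2)] assms(3-5)])

text \<open>Replacing b by h b in the symbol shows that b \<Lambda>(f, h) is basic for every affine
  b. For b = 1 this makes \<Lambda>(f, h) itself basic, and an affine b that is not constant on the
  fibre then forces it to be 0; positive rank provides such a b.\<close>

lemma \<Lambda>_basic_zero:
  assumes f: "f \<in> Cinf (abase A)" and h: "h \<in> Cinf (abase A)" and x: "x \<in> atotal A"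
  shows "\<Lambda> x (\<lambda>x. f (aproj A x)) (\<lambda>x. h (aproj A x)) = 0"
proof -
  let ?f = "\<lambda>x. f (aproj A x)" and ?h = "\<lambda>x. h (aproj A x)"
  let ?G = "\<lambda>x. \<Lambda> x ?f ?h"
  have bas: "b x * ?G x = b x' * ?G x'"
    if b: "b \<in> affine_functions A" and x: "x \<in> atotal A" "x' \<in> atotal A" "aproj A x = aproj A x'" for b x x'
  proof -
    have "symbol_at (\<lambda>x. ?h x * b x) f u = ?h u * symbol_at b f u + b u * ?G u" if "u \<in> atotal A" for u
    proof -
      have up: "u \<in> point_set (aatlas A)" using that by simp
      show ?thesis
        using tangentD(2)[OF bivector_fieldD(5)[OF j.bivector up] A_pullback[OF h] affine_Cinf[OF b], of ?f]
        by (simp add: symbol_at_def algebra_simps)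
    qed
    then show ?thesis
      using symbol_at_basic[OF affine_module[OF h b] f x] symbol_at_basic[OF b f x] x by simp
  qed
  obtain W \<phi> U y N \<alpha> \<xi> where fr: "affine_frame W \<phi> U y N \<alpha> \<xi>" "aproj A x \<in> N" using frame_at[OF x] .
  note D = affine_frameD[OF fr(1)]
  have U: "(U, y) \<in> atriv A" "aproj A x \<in> U" using D(2,4) fr(2) by auto
  obtain u :: 'f where u: "u \<noteq> 0" using rank_pos by blast
  let ?x = "\<lambda>s. AB.pt y (aproj A x) s"
  have px: "?x s \<in> atotal A" "aproj A (?x s) = aproj A x" "\<alpha> (u, 0) (?x s) = u \<bullet> s" for s
    using AB.pt[OF U] D(7)[of "?x s" "(u, 0)"] fr(2) by simp_all
  \<comment> \<open>The affine function with linear part u has the values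
    \<open>u \<bullet> u\<close> and 0 at the points with coordinates u and 0.\<close>
  have "(u \<bullet> u) * ?G (?x u) = (u \<bullet> 0) * ?G (?x 0)"
    using bas[OF D(5)[of "(u, 0)"], of "?x u" "?x 0"] px by simp
  then have "?G (?x u) = 0" using u by simp
  then show ?thesis using bas[OF affine_const[of 1] x px(1)[of u]] px(2) by simp
qed

definition symbol_of :: "('a \<Rightarrow> real) \<Rightarrow> ('m \<Rightarrow> real) \<Rightarrow> 'm \<Rightarrow> real" where
  "symbol_of b f p = symbol_at b f (SOME x. x \<in> afibre A p)"

lemma symbol_of:
  assumes "b \<in> affine_functions A" "f \<in> Cinf (abase A)" "x \<in> atotal A"
  shows "symbol_at b f x = symbol_of b f (aproj A x)"
proof -
  have "x \<in> afibre A (aproj A x)" using assms(3) by (simp add: afibre_iff)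
  then have "(SOME x'. x' \<in> afibre A (aproj A x)) \<in> afibre A (aproj A x)" by (rule someI)
  then show ?thesis
    unfolding symbol_of_def using assms by (intro symbol_at_basic) (simp_all add: afibre_iff)
qed

lemma symbol_of_Cinf:
  assumes b: "b \<in> affine_functions A" and f: "f \<in> Cinf (abase A)"
  shows "symbol_of b f \<in> Cinf (abase A)"
proof (rule AB.Cinf_baseI[folded aatlas_eq])
  show "symbol_at b f \<in> Cinf (aatlas A)"
    unfolding symbol_at_def using A_pullback[OF f] affine_Cinf[OF b]
    by (intro Cinf_diff Cinf_mult aatlas_smooth bivector_fieldD(3)[OF j.bivector] vector_fieldD(3)[OF j.vector])
  show "symbol_at b f x = symbol_of b f (aproj A x)" if "x \<in> atotal A" for x by (rule symbol_of[OF b f that])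
qed

text \<open>The bracket of \<open>bar a + f\<close> and \<open>bar b + g\<close> forced by bilinearity: basic functions commute, and
  \<open>symbol_of b f\<close> is the bracket of \<open>f\<close> with \<open>bar b\<close>.\<close>

definition jet_bracket where
  "jet_bracket z a f b g = bar A (j.br a b) z + symbol_of b f (fst z) - symbol_of a g (fst z)"

lemma fibre_point:
  assumes z: "z \<in> H"
  obtains x where "x \<in> atotal A" "aproj A x = fst z"
proof -
  obtain U y where U: "(U, y) \<in> atriv A" "fst z \<in> U" using z by (rule H_trivE)
  show thesis using that[of "AB.pt y (fst z) 0"] AB.pt[OF U] by simp
qed

lemma jet_bracket_skew:
  assumes "a \<in> affine_functions A" "b \<in> affine_functions A" "z \<in> H"
  shows "jet_bracket z a f b g = - jet_bracket z b g a f"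
proof -
  have "bar A (j.br a b) z = bar A (\<lambda>x. - 1 * j.br b a x) z"
    by (rule bar_cong) (use j.br_skew[of a b] in simp)
  then show ?thesis
    using bar_scale[OF br_affine[OF assms(2,1)] assms(3), of "- 1"] by (simp add: jet_bracket_def)
qed

lemma jet_bracket_add:
  assumes a: "a \<in> affine_functions A" "a' \<in> affine_functions A" and f: "f \<in> Cinf (abase A)" "f' \<in> Cinf (abase A)"
    and b: "b \<in> affine_functions A" and g: "g \<in> Cinf (abase A)" and z: "z \<in> H"
  shows "jet_bracket z (\<lambda>x. a x + a' x) (\<lambda>q. f q + f' q) b g = jet_bracket z a f b g + jet_bracket z a' f' b g"
proof -
  have "bar A (j.br (\<lambda>x. a x + a' x) b) z = bar A (\<lambda>x. j.br a b x + j.br a' b x) z"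
    by (rule bar_cong) (use j.br_add a affine_Cinf in simp)
  then have 1: "bar A (j.br (\<lambda>x. a x + a' x) b) z = bar A (j.br a b) z + bar A (j.br a' b) z"
    using bar_add[OF br_affine[OF a(1) b] br_affine[OF a(2) b] z] by simp
  obtain x where x: "x \<in> atotal A" "aproj A x = fst z" using fibre_point[OF z] .
  then have xp: "x \<in> point_set (aatlas A)" by simp
  have "symbol_at b (\<lambda>q. f q + f' q) x = symbol_at b f x + symbol_at b f' x"
    using tangentD(1)[OF bivector_fieldD(6)[OF j.bivector xp] A_pullback[OF f(1)] A_pullback[OF f(2)]]
      tangentD(1)[OF vector_fieldD(1)[OF j.vector xp] A_pullback[OF f(1)] A_pullback[OF f(2)]]
    by (simp add: symbol_at_def algebra_simps)
  moreover have "symbol_at (\<lambda>x. a x + a' x) g x = symbol_at a g x + symbol_at a' g x"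
    using tangentD(1)[OF bivector_fieldD(5)[OF j.bivector xp] affine_Cinf[OF a(1)] affine_Cinf[OF a(2)]]
    by (simp add: symbol_at_def algebra_simps)
  ultimately show ?thesis
    using 1 symbol_of[OF b Cinf_add[OF base_atlas f] x(1)] symbol_of[OF b f(1) x(1)] symbol_of[OF b f(2) x(1)]
      symbol_of[OF affine_add[OF a] g x(1)] symbol_of[OF a(1) g x(1)] symbol_of[OF a(2) g x(1)] x(2)
    by (simp add: jet_bracket_def)
qed

lemma jet_bracket_scale:
  assumes a: "a \<in> affine_functions A" and f: "f \<in> Cinf (abase A)"
    and b: "b \<in> affine_functions A" and g: "g \<in> Cinf (abase A)" and z: "z \<in> H"
  shows "jet_bracket z (\<lambda>x. c * a x) (\<lambda>q. c * f q) b g = c * jet_bracket z a f b g"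
proof -
  have "bar A (j.br (\<lambda>x. c * a x) b) z = bar A (\<lambda>x. c * j.br a b x) z"
    by (rule bar_cong) (use j.br_scale a affine_Cinf in simp)
  then have 1: "bar A (j.br (\<lambda>x. c * a x) b) z = c * bar A (j.br a b) z"
    using bar_scale[OF br_affine[OF a b] z] by simp
  obtain x where x: "x \<in> atotal A" "aproj A x = fst z" using fibre_point[OF z] .
  then have xp: "x \<in> point_set (aatlas A)" by simp
  have "symbol_at b (\<lambda>q. c * f q) x = c * symbol_at b f x"
    using tangentD(3)[OF bivector_fieldD(6)[OF j.bivector xp] A_pullback[OF f]]
      tangentD(3)[OF vector_fieldD(1)[OF j.vector xp] A_pullback[OF f]]
    by (simp add: symbol_at_def algebra_simps)
  moreover have "symbol_at (\<lambda>x. c * a x) g x = c * symbol_at a g x"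
    using tangentD(3)[OF bivector_fieldD(5)[OF j.bivector xp] affine_Cinf[OF a]]
    by (simp add: symbol_at_def algebra_simps)
  ultimately show ?thesis
    using 1 symbol_of[OF b Cinf_cmult[OF base_atlas f] x(1)] symbol_of[OF b f x(1)]
      symbol_of[OF affine_scale[OF a] g x(1)] symbol_of[OF a g x(1)] x(2)
    by (simp add: jet_bracket_def algebra_simps)
qed

subsection \<open>Well-definedness\<close>

abbreviation "acd W \<phi> U y \<equiv> chart_deriv (AB.dom W U) (AB.chart \<phi> y)"
abbreviation "hcd W \<phi> U y \<equiv> chart_deriv (hdom W U) (hchart \<phi> y)"

lemma acd_linear:
  assumes "(W, \<phi>) \<in> abase A" "(U, y) \<in> atriv A" "x \<in> AB.dom W U" "F \<in> Cinf (aatlas A)"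
  shows "linear (acd W \<phi> U y F x)"
  using chart_deriv_has_derivative[OF aatlas_smooth AB.chart_in_total[folded aatlas_eq] assms(4,3)] assms(1,2)
    has_derivative_linear by blast

lemma acd_vertical:
  assumes W: "(W, \<phi>) \<in> abase A" and U: "(U, y) \<in> atriv A" and p: "p \<in> W" "p \<in> U"
    and a: "a \<in> affine_functions A" "\<And>x. x \<in> afibre A p \<Longrightarrow> a x = w \<bullet> y x + d"
  shows "acd W \<phi> U y a (AB.pt y p s) (0, \<omega>) = w \<bullet> \<omega>"
proof -
  let ?x = "AB.pt y p s"
  have x: "?x \<in> AB.dom W U" using AB.pt[OF U p(2)] p by (simp add: AB.dom_def)
  have \<kappa>: "AB.chart \<phi> y ?x = (\<phi> p, s)" using AB.pt[OF U p(2)] by (simp add: AB.chart_def)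
  note D = chart_deriv_has_derivative[OF aatlas_smooth AB.chart_in_total[OF W U, folded aatlas_eq] affine_Cinf[OF a(1)] x]
  have "((\<lambda>t. (a \<circ> inv_into (AB.dom W U) (AB.chart \<phi> y)) (\<phi> p, s + t *\<^sub>R \<omega>)) has_derivative
      (\<lambda>t. acd W \<phi> U y a ?x (0, t *\<^sub>R \<omega>))) (at 0)"
    by (rule has_derivative_compose[of "\<lambda>t. (\<phi> p, s + t *\<^sub>R \<omega>)"])
      (use D in \<open>auto intro!: derivative_eq_intros simp: \<kappa> simp del: o_apply\<close>)
  moreover have "(a \<circ> inv_into (AB.dom W U) (AB.chart \<phi> y)) (\<phi> p, s + t *\<^sub>R \<omega>) = w \<bullet> (s + t *\<^sub>R \<omega>) + d" for t
    using p by (simp add: AB.chart_inverse[OF W U] a(2)[OF apt_fibre[OF U p(2)]] AB.pt[OF U p(2)])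
  ultimately have "((\<lambda>t. w \<bullet> (s + t *\<^sub>R \<omega>) + d) has_derivative (\<lambda>t. acd W \<phi> U y a ?x (0, t *\<^sub>R \<omega>))) (at 0)"
    by simp
  moreover have "((\<lambda>t. w \<bullet> (s + t *\<^sub>R \<omega>) + d) has_derivative (\<lambda>t. w \<bullet> (t *\<^sub>R \<omega>))) (at 0)"
    by (auto intro!: derivative_eq_intros)
  ultimately have "acd W \<phi> U y a ?x (0, 1 *\<^sub>R \<omega>) = w \<bullet> (1 *\<^sub>R \<omega>)"
    using has_derivative_unique by metis
  then show ?thesis by simp
qed

text \<open>The chain rule applied to \<open>bar_hpt\<close>; the term with \<open>\<delta>\<close>
  comes from differentiating the factor \<open>snd z - 1\<close>.\<close>

lemma hcd_bar:
  assumes W: "(W, \<phi>) \<in> abase A" and U: "(U, y) \<in> atriv A" and p: "p \<in> W" "p \<in> U"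
    and a: "a \<in> affine_functions A"
  shows "hcd W \<phi> U y (bar A a) (hpt y p (\<zeta>, t)) (u, \<omega>, \<delta>) =
    acd W \<phi> U y a (AB.pt y p \<zeta>) (u, \<omega>) + (t - 1) * acd W \<phi> U y a (AB.pt y p 0) (u, 0) + \<delta> * a (AB.pt y p 0)"
proof -
  let ?z = "hpt y p (\<zeta>, t)" and ?t = "a \<circ> inv_into (AB.dom W U) (AB.chart \<phi> y)"
  let ?B = "bar A a \<circ> inv_into (hdom W U) (hchart \<phi> y)"
  have x: "AB.pt y p s \<in> AB.dom W U" for s using AB.pt[OF U p(2)] p by (simp add: AB.dom_def)
  have \<kappa>: "AB.chart \<phi> y (AB.pt y p s) = (\<phi> p, s)" for s using AB.pt[OF U p(2)] by (simp add: AB.chart_def)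
  have h\<kappa>: "hchart \<phi> y ?z = (\<phi> p, \<zeta>, t)" using fst_hpt[OF U p(2)] hcoord_hpt[OF U p(2)] by (simp add: H0.chart_def)
  have D: "(?t has_derivative acd W \<phi> U y a (AB.pt y p s)) (at (\<phi> p, s))" for s
    using chart_deriv_has_derivative[OF aatlas_smooth AB.chart_in_total[OF W U, folded aatlas_eq] affine_Cinf[OF a] x]
    by (simp add: \<kappa>)
  have 1: "((\<lambda>v. ?t (fst v, fst (snd v))) has_derivative
      (\<lambda>v. acd W \<phi> U y a (AB.pt y p \<zeta>) (fst v, fst (snd v)))) (at (\<phi> p, \<zeta>, t))"
    by (rule has_derivative_compose[of "\<lambda>v. (fst v, fst (snd v))"])
      (use D in \<open>auto intro!: derivative_eq_intros simp del: o_apply\<close>)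
  have 2: "((\<lambda>v. ?t (fst v, 0)) has_derivative
      (\<lambda>v. acd W \<phi> U y a (AB.pt y p 0) (fst v, 0))) (at (\<phi> p, \<zeta>, t))"
    by (rule has_derivative_compose[of "\<lambda>v. (fst v, 0)"])
      (use D in \<open>auto intro!: derivative_eq_intros simp del: o_apply\<close>)
  have t0: "?t (\<phi> p, 0) = a (AB.pt y p 0)" using AB.chart_inverse[OF W U, of p 0] p by simp
  have 3: "((\<lambda>v. ?t (fst v, fst (snd v)) + (snd (snd v) - 1) * ?t (fst v, 0)) has_derivative
      (\<lambda>v. acd W \<phi> U y a (AB.pt y p \<zeta>) (fst v, fst (snd v)) +
        ((t - 1) * acd W \<phi> U y a (AB.pt y p 0) (fst v, 0) + snd (snd v) * a (AB.pt y p 0)))) (at (\<phi> p, \<zeta>, t))"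
    by (intro has_derivative_add 1 has_derivative_eq_rhs[OF has_derivative_mult[OF _ 2]])
      (auto intro!: derivative_eq_intros simp: t0 simp del: o_apply)
  have o: "open (\<phi> ` (W \<inter> U) \<times> (UNIV :: ('f \<times> real) set))"
    using AB.open_base_image_dom[OF W U] by (simp add: open_Times)
  have "(?B has_derivative (\<lambda>v. acd W \<phi> U y a (AB.pt y p \<zeta>) (fst v, fst (snd v)) +
        ((t - 1) * acd W \<phi> U y a (AB.pt y p 0) (fst v, 0) + snd (snd v) * a (AB.pt y p 0)))) (at (\<phi> p, \<zeta>, t))"
  proof (rule has_derivative_transform_within_open[OF 3 o])
    show "(\<phi> p, \<zeta>, t) \<in> \<phi> ` (W \<inter> U) \<times> UNIV" using p by auto
    fix v assume "v \<in> \<phi> ` (W \<inter> U) \<times> (UNIV :: ('f \<times> real) set)"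
    then obtain q s where v: "v = (\<phi> q, s)" "q \<in> W \<inter> U" by auto
    then show "?t (fst v, fst (snd v)) + (snd (snd v) - 1) * ?t (fst v, 0) = ?B v"
      by (simp add: AB.chart_inverse[OF W U] H0.chart_inverse[OF W hat_trivI[OF U]] hpt_eq[OF U] bar_hpt[OF U _ a])
  qed
  then have "hcd W \<phi> U y (bar A a) ?z = (\<lambda>v. acd W \<phi> U y a (AB.pt y p \<zeta>) (fst v, fst (snd v)) +
        ((t - 1) * acd W \<phi> U y a (AB.pt y p 0) (fst v, 0) + snd (snd v) * a (AB.pt y p 0)))"
    by (intro chart_deriv_eqI) (simp add: h\<kappa>)
  then show ?thesis by simp
qed

text \<open>The hypothesis says that \<open>bar A a\<close> + f has zero differential at z. Vertical
  vectors show that a vanishes on the whole fibre of \<open>A\<close>. Hence {a, b} at a point of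
  the fibre is a tangent vector applied to a, and the base component u of this vector is the same
  all along the fibre. So the value of {a, b} extended linearly to z, plus the symbol of f, is the
  differential of \<open>bar A a\<close> + f in the direction (u, 0, 0), which is 0.\<close>

lemma jet_bracket_vanishes:
  assumes a: "a \<in> affine_functions A" and f: "f \<in> Cinf (abase A)"
    and b: "b \<in> affine_functions A" and g: "g \<in> Cinf (abase A)" and z: "z \<in> H"
    and 0: "\<And>v. v \<in> tangent_space (vatlas (hat A)) z \<Longrightarrow> v (bar A a) + v (\<lambda>z. f (fst z)) = 0"
  shows "jet_bracket z a f b g = 0"
proof -
  obtain W \<phi> U y N \<alpha> \<xi> where fr: "affine_frame W \<phi> U y N \<alpha> \<xi>" "fst z \<in> N"
    using H0.proj[OF z] by (rule affine_frame_exists)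
  note frD = affine_frameD[OF fr(1)]
  let ?p = "fst z"
  have W: "(W, \<phi>) \<in> abase A" and U: "(U, y) \<in> atriv A" and p: "?p \<in> W" "?p \<in> U" using frD fr(2) by auto
  have D: "z \<in> hdom W U" using z p by (simp add: hdom_iff)
  obtain \<zeta> t where s: "hcoord y z = (\<zeta>, t)" by fastforce
  have zs: "z = hpt y ?p (\<zeta>, t)" using hpt_hcoord[OF U z p(2)] s by simp
  let ?x = "\<lambda>s. AB.pt y ?p s"
  have x: "?x s \<in> atotal A" "aproj A (?x s) = ?p" "?x s \<in> AB.dom W U" "?x s \<in> point_set (aatlas A)" for s
    using AB.pt[OF U p(2)] p by (simp_all add: AB.dom_def)
  note DA = AB.chart_in_total[OF W U, folded aatlas_eq]
  have 0: "hcd W \<phi> U y (bar A a) z w + chart_deriv W \<phi> f ?p (fst w) = 0" for w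
    using 0[OF chart_deriv_tangent[OF vatlas_smooth hchart_in_atlas[OF W U] D, of w]] bar_Cinf[OF a] H_pullback[OF f]
      HB.chart_deriv_pullback[OF W hat_trivI[OF U] D f] by simp
  have f0: "chart_deriv W \<phi> f ?p 0 = 0"
    using linear_0[OF has_derivative_linear[OF chart_deriv_has_derivative[OF base_atlas W f p(1)]]] .
  obtain wd where wd: "\<And>x. x \<in> afibre A ?p \<Longrightarrow> a x = fst wd \<bullet> y x + snd wd" using affineE[OF a U p(2)] by blast
  note lin = acd_linear[OF W U x(3) affine_Cinf[OF a]]
  have bar: "hcd W \<phi> U y (bar A a) z (u, \<omega>, \<delta>) =
    acd W \<phi> U y a (?x \<zeta>) (u, \<omega>) + (t - 1) * acd W \<phi> U y a (?x 0) (u, 0) + \<delta> * a (?x 0)" for u \<omega> \<delta>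
    using hcd_bar[OF W U p a, of \<zeta> t u \<omega> \<delta>] by (simp add: zs[symmetric])
  \<comment> \<open>Vertical vectors do not see f, so the fibre derivatives of
    \<open>bar A a\<close> vanish. Varying \<open>\<omega>\<close> kills the linear part of a,
    varying \<open>\<delta>\<close> its value at the origin of the fibre.\<close>
  have v0: "acd W \<phi> U y a (?x \<zeta>) (0, \<omega>) + \<delta> * a (?x 0) = 0" for \<omega> \<delta>
    using 0[of "(0, \<omega>, \<delta>)"] bar[of 0 \<omega> \<delta>] f0 linear_0[OF lin, of 0] by (simp add: zero_prod_def)
  have v: "fst wd \<bullet> \<omega> + \<delta> * a (?x 0) = 0" for \<omega> \<delta>
    using v0[of \<omega> \<delta>] acd_vertical[OF W U p a wd, of \<zeta> \<omega>] by simp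
  have w0: "fst wd = 0" using v[of "fst wd" 0] by simp
  have a0: "a (?x s) = 0" for s
    using v[of 0 1] wd[OF apt_fibre[OF U p(2)], of 0] wd[OF apt_fibre[OF U p(2)], of s] w0 by simp
  have vert: "acd W \<phi> U y a (?x s) (u, \<omega>) = acd W \<phi> U y a (?x s) (u, 0)" for s u \<omega>
    using linear_add[OF lin[of s], of "(u, 0)" "(0, \<omega>)"] acd_vertical[OF W U p a wd, of s \<omega>] w0 by simp
  have coord: "chart_deriv W \<phi> (\<xi> w) ?p u = w \<bullet> u" for w u
    by (rule chart_deriv_coordinate[OF base_atlas W frD(3) _ fr(2)]) (use frD(4,8) in auto)
  \<comment> \<open>The vector part of the first-order functional F -> {F, b} at the point with
    coordinate s. On a basic function it is the symbol, and on a, which is 0 at this point, it is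
    the full bracket.\<close>
  define V where "V s F = \<Lambda> (?x s) F b + (- b (?x s)) * E (?x s) F" for s F
  have VT: "V s \<in> tangent_space (aatlas A) (?x s)" for s
    unfolding V_def[abs_def] using bivector_fieldD(6)[OF j.bivector x(4)] vector_fieldD(1)[OF j.vector x(4)]
    by (intro tangent_add_closed tangent_scale_closed)
  have ex: "\<exists>\<omega>. \<forall>F\<in>Cinf (aatlas A). V s F = acd W \<phi> U y F (?x s) \<omega>" for s
    by (rule tangent_chart_vector[OF aatlas_smooth aatlas_separated DA x(3) VT]) blast
  define \<omega> where "\<omega> s = (SOME \<omega>. \<forall>F\<in>Cinf (aatlas A). V s F = acd W \<phi> U y F (?x s) \<omega>)" for s
  have \<omega>: "V s F = acd W \<phi> U y F (?x s) (\<omega> s)" if "F \<in> Cinf (aatlas A)" for s F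
    using someI_ex[OF ex[of s]] that unfolding \<omega>_def by blast
  have Vf: "chart_deriv W \<phi> h ?p (fst (\<omega> s)) = symbol_of b h ?p" if h: "h \<in> Cinf (abase A)" for h s
    using \<omega>[OF A_pullback[OF h], of s] AB.chart_deriv_pullback[OF W U x(3) h] symbol_of[OF b h x(1), of s] x(2)
    by (simp add: V_def symbol_at_def)
  define u where "u = fst (\<omega> 0)"
  \<comment> \<open>The symbol is basic, so the vectors \<open>V s\<close> along the fibre all
    project to one vector on the base; testing with base coordinates shows this.\<close>
  have u: "fst (\<omega> s) = u" for s
  proof -
    have "w \<bullet> fst (\<omega> s) = w \<bullet> u" for w
      using Vf[OF frD(6)[of w], of s] Vf[OF frD(6)[of w], of 0] by (simp add: coord u_def)
    then show ?thesis by (intro vector_eq_ldot[THEN iffD1]) simp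
  qed
  have Va: "V s a = j.br a b (?x s)" for s
    by (simp add: V_def jacobi_bracket_def a0)
  have Va2: "j.br a b (?x s) = acd W \<phi> U y a (?x s) (u, 0)" for s
    using \<omega>[OF affine_Cinf[OF a], of s] Va[of s] u[of s] vert[of s u "snd (\<omega> s)"] by (metis prod.collapse)
  have "bar A (j.br a b) z = j.br a b (?x \<zeta>) + (t - 1) * j.br a b (?x 0)"
    by (subst (1) zs) (simp add: bar_hpt[OF U p(2) br_affine[OF a b]])
  then have "bar A (j.br a b) z + symbol_of b f ?p = 0"
    using 0[of "(u, 0, 0)"] bar[of u 0 0] Va2 Vf[OF f, of 0] by (simp add: u_def)
  \<comment> \<open>Basic functions commute, so the vector \<Lambda>(g, -) is vertical, and a has no
    vertical derivative.\<close>
  moreover have "symbol_of a g ?p = 0"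
  proof -
    obtain \<eta> where \<eta>: "\<And>F. F \<in> Cinf (aatlas A) \<Longrightarrow> \<Lambda> (?x 0) (\<lambda>x. g (aproj A x)) F = acd W \<phi> U y F (?x 0) \<eta>"
      using tangent_chart_vector[OF aatlas_smooth aatlas_separated DA x(3) bivector_fieldD(5)[OF j.bivector x(4)]] by metis
    have "w \<bullet> fst \<eta> = 0" for w
      using \<eta>[OF A_pullback[OF frD(6)[of w]]] \<Lambda>_basic_zero[OF g frD(6)[of w] x(1)]
        AB.chart_deriv_pullback[OF W U x(3) frD(6)[of w]] x(2) by (simp add: coord)
    then have "fst \<eta> = 0" using inner_eq_zero_iff by blast
    then have "\<Lambda> (?x 0) (\<lambda>x. g (aproj A x)) a = 0"
      using \<eta>[OF affine_Cinf[OF a]] acd_vertical[OF W U p a wd, of 0 "snd \<eta>"] w0 by (cases \<eta>) simp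
    then show ?thesis using symbol_of[OF a g x(1), of 0] x(2) a0 by (simp add: symbol_at_def)
  qed
  ultimately show ?thesis by (simp add: jet_bracket_def)
qed

end

text \<open>A Poisson bracket with a constant vanishes, so the constant function 1, needed to
  determine jets, can be left out of the check.\<close>

lemma poisson_jacobiator_zeroI:
  fixes \<A> :: "('n, 'e::fin_dim_inner) atlas"
  assumes A: "smooth_atlas \<A>" and P: "bivector_field \<A> P" and p: "p \<in> point_set \<A>"
    and S: "jet_determining \<A> p (insert (\<lambda>_. 1) S)"
    and J: "\<And>f g h. f \<in> S \<Longrightarrow> g \<in> S \<Longrightarrow> h \<in> S \<Longrightarrow> jacobi_fields.jacobiator P (\<lambda>_ _. 0) f g h p = 0"
    and C: "f \<in> Cinf \<A>" "g \<in> Cinf \<A>" "h \<in> Cinf \<A>"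
  shows "jacobi_fields.jacobiator P (\<lambda>_ _. 0) f g h p = 0"
proof -
  interpret j: jacobi_fields \<A> P "\<lambda>_ _. 0" by (rule poisson_jacobi_fields[OF A P])
  have const: "j.br (\<lambda>_. c) g q = 0" if "q \<in> point_set \<A>" for c g q
    using tangent_const[OF A bivector_fieldD(6)[OF P that]] by (simp add: jacobi_bracket_def)
  have one: "j.jacobiator (\<lambda>_. 1) g h p = 0" if g: "g \<in> Cinf \<A>" and h: "h \<in> Cinf \<A>" for g h
  proof -
    note 1 = Cinf_const[OF A, of 1]
    have "j.br (j.br (\<lambda>_. 1) h) g p = j.br (\<lambda>_. 0) g p" "j.br (j.br (\<lambda>_. 1) g) h p = j.br (\<lambda>_. 0) h p"
      by (rule j.br_cong(1)[OF p j.br_Cinf[OF 1]]; use g h const in simp)+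
    then show ?thesis using j.jacobiator_alt[OF p 1 g h] const[OF p] by simp
  qed
  have cyc: "j.jacobiator f g h p = j.jacobiator g h f p" for f g h by (simp add: j.jacobiator_def)
  show ?thesis
  proof (rule j.jacobiator_zeroI[OF p S _ C])
    fix s t u assume stu: "s \<in> insert (\<lambda>_. 1) S" "t \<in> insert (\<lambda>_. 1) S" "u \<in> insert (\<lambda>_. 1) S"
    then have c: "s \<in> Cinf \<A>" "t \<in> Cinf \<A>" "u \<in> Cinf \<A>"
      using S by (auto simp: jet_determining_def)
    consider "s = (\<lambda>_. 1)" | "t = (\<lambda>_. 1)" | "u = (\<lambda>_. 1)" | "s \<in> S" "t \<in> S" "u \<in> S"
      using stu by blast
    then show "j.jacobiator s t u p = 0"
    proof cases
      case 1 then show ?thesis using one c by simp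
    next
      case 2 then show ?thesis using one[OF c(3,1)] cyc[of s t u] by simp
    next
      case 3 then show ?thesis using one[OF c(1,2)] cyc[of u s t] by simp
    next
      case 4 then show ?thesis by (rule J)
    qed
  qed
qed

context affine_jacobi_ctx
begin

section \<open>The bivector of the hull\<close>

definition jet_rep where
  "jet_rep z F a f \<longleftrightarrow> a \<in> affine_functions A \<and> f \<in> Cinf (abase A) \<and>
     (\<forall>v\<in>tangent_space (vatlas (hat A)) z. v F = v (bar A a) + v (\<lambda>z. f (fst z)))"

lemma jet_repD: "jet_rep z F a f \<Longrightarrow> v \<in> tangent_space (vatlas (hat A)) z \<Longrightarrow> v F = v (bar A a) + v (\<lambda>z. f (fst z))"
  by (simp add: jet_rep_def)

lemma jet_rep_add:
  assumes z: "z \<in> H" and F: "F \<in> Cinf (vatlas (hat A))" "G \<in> Cinf (vatlas (hat A))"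
    and r: "jet_rep z F a f" "jet_rep z G b g"
  shows "jet_rep z (\<lambda>u. F u + G u) (\<lambda>x. a x + b x) (\<lambda>q. f q + g q)"
proof -
  have a: "a \<in> affine_functions A" "b \<in> affine_functions A" "f \<in> Cinf (abase A)" "g \<in> Cinf (abase A)"
    using r by (auto simp: jet_rep_def)
  have ab: "v (bar A (\<lambda>x. a x + b x)) = v (bar A a) + v (bar A b)" if v: "v \<in> tangent_space (vatlas (hat A)) z" for v
    using tangent_cong[OF vatlas_smooth v _ bar_Cinf[OF affine_add[OF a(1,2)]], of "\<lambda>u. bar A a u + bar A b u"]
      tangentD(1)[OF v bar_Cinf[OF a(1)] bar_Cinf[OF a(2)]] z bar_add[OF a(1,2)] by simp
  have "v (\<lambda>u. F u + G u) = v (bar A (\<lambda>x. a x + b x)) + v (\<lambda>z. f (fst z) + g (fst z))"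
    if v: "v \<in> tangent_space (vatlas (hat A)) z" for v
    using jet_repD[OF r(1) v] jet_repD[OF r(2) v] ab[OF v] tangentD(1)[OF v F] tangentD(1)[OF v H_pullback[OF a(3)] H_pullback[OF a(4)]] by simp
  then show ?thesis
    using a by (simp add: jet_rep_def affine_add Cinf_add[OF base_atlas])
qed

lemma jet_rep_scale:
  assumes z: "z \<in> H" and F: "F \<in> Cinf (vatlas (hat A))" and r: "jet_rep z F a f"
  shows "jet_rep z (\<lambda>u. c * F u) (\<lambda>x. c * a x) (\<lambda>q. c * f q)"
proof -
  have a: "a \<in> affine_functions A" "f \<in> Cinf (abase A)" using r by (auto simp: jet_rep_def)
  have ca: "v (bar A (\<lambda>x. c * a x)) = c * v (bar A a)" if v: "v \<in> tangent_space (vatlas (hat A)) z" for v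
    using tangent_cong[OF vatlas_smooth v _ bar_Cinf[OF affine_scale[OF a(1)]], of c "\<lambda>u. c * bar A a u"]
      tangentD(3)[OF v bar_Cinf[OF a(1)], of c] z bar_scale[OF a(1)] by simp
  have "v (\<lambda>u. c * F u) = v (bar A (\<lambda>x. c * a x)) + v (\<lambda>z. c * f (fst z))"
    if v: "v \<in> tangent_space (vatlas (hat A)) z" for v
    using jet_repD[OF r v] ca[OF v] tangentD(3)[OF v F, of c] tangentD(3)[OF v H_pullback[OF a(2)], of c]
    by (simp add: distrib_left)
  then show ?thesis
    using a by (simp add: jet_rep_def affine_scale Cinf_cmult[OF base_atlas])
qed

text \<open>The coefficients are the numbers \<open>F z\<close> and \<open>G z\<close>, not
  functions: only the differential at z is represented, not the product near z.\<close>

lemma jet_rep_mult: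
  assumes z: "z \<in> H" and F: "F \<in> Cinf (vatlas (hat A))" "G \<in> Cinf (vatlas (hat A))"
    and r: "jet_rep z F a f" "jet_rep z G b g"
  shows "jet_rep z (\<lambda>u. F u * G u) (\<lambda>x. G z * a x + F z * b x) (\<lambda>q. G z * f q + F z * g q)"
proof -
  have "jet_rep z (\<lambda>u. G z * F u + F z * G u) (\<lambda>x. G z * a x + F z * b x) (\<lambda>q. G z * f q + F z * g q)"
    by (intro jet_rep_add jet_rep_scale z F r Cinf_cmult vatlas_smooth)
  moreover have "v (\<lambda>u. F u * G u) = v (\<lambda>u. G z * F u + F z * G u)" if v: "v \<in> tangent_space (vatlas (hat A)) z" for v
    using tangentD(1)[OF v Cinf_cmult[OF vatlas_smooth F(1)] Cinf_cmult[OF vatlas_smooth F(2)]]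
      tangentD(2)[OF v F] tangentD(3)[OF v F(1)] tangentD(3)[OF v F(2)] by simp
  ultimately show ?thesis unfolding jet_rep_def by simp
qed

lemma jet_rep_bar: "a \<in> affine_functions A \<Longrightarrow> jet_rep z (bar A a) a (\<lambda>_. 0)"
  using tangent_const[OF vatlas_smooth] by (auto simp: jet_rep_def Cinf_const[OF base_atlas])

lemma jet_rep_expand:
  assumes fr: "affine_frame W \<phi> U y N \<alpha> \<xi>" and z: "z \<in> H" "fst z \<in> N" and F: "F \<in> Cinf (vatlas (hat A))"
  shows "jet_rep z F (\<lambda>x. \<Sum>b\<in>onb. hcd W \<phi> U y F z b * \<alpha> (snd b) x) (\<lambda>q. \<Sum>b\<in>onb. hcd W \<phi> U y F z b * \<xi> (fst b) q)"
proof -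
  note frD = affine_frameD[OF fr]
  let ?c = "hcd W \<phi> U y F z"
  have a: "(\<lambda>x. ?c b * \<alpha> (snd b) x) \<in> affine_functions A" for b
    by (rule affine_scale[OF frD(5)])
  have f: "(\<lambda>q. ?c b * \<xi> (fst b) q) \<in> Cinf (abase A)" for b
    by (rule Cinf_cmult[OF base_atlas frD(6)])
  have "v F = v (bar A (\<lambda>x. \<Sum>b\<in>onb. ?c b * \<alpha> (snd b) x)) + v (\<lambda>z. \<Sum>b\<in>onb. ?c b * \<xi> (fst b) (fst z))"
    if v: "v \<in> tangent_space (vatlas (hat A)) z" for v
  proof -
    have 1: "v (bar A (\<lambda>x. \<Sum>b\<in>onb. ?c b * \<alpha> (snd b) x)) = v (\<lambda>u. \<Sum>b\<in>onb. ?c b * bar A (\<alpha> (snd b)) u)"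
      by (rule tangent_cong[OF vatlas_smooth v _ bar_Cinf[OF affine_sum[OF a]]])
        (use z in \<open>simp_all add: bar_sum a bar_scale frD(5)\<close>)
    have 2: "v (\<lambda>u. \<Sum>b\<in>onb. ?c b * bar A (\<alpha> (snd b)) u) = (\<Sum>b\<in>onb. ?c b * v (bar A (\<alpha> (snd b))))"
      by (subst tangent_sum[OF vatlas_smooth v])
        (simp_all add: Cinf_cmult[OF vatlas_smooth] bar_Cinf frD(5) tangentD(3)[OF v])
    have 3: "v (\<lambda>z. \<Sum>b\<in>onb. ?c b * \<xi> (fst b) (fst z)) = (\<Sum>b\<in>onb. ?c b * v (\<lambda>z. \<xi> (fst b) (fst z)))"
      by (subst tangent_sum[OF vatlas_smooth v])
        (simp_all add: Cinf_cmult[OF vatlas_smooth] H_pullback frD(6) tangentD(3)[OF v])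
    have "v (hat_frame \<alpha> \<xi> b) = v (\<lambda>z. \<xi> (fst b) (fst z)) + v (bar A (\<alpha> (snd b)))" for b
      unfolding hat_frame_def by (rule tangentD(1)[OF v H_pullback[OF frD(6)] bar_Cinf[OF frD(5)]])
    then show ?thesis
      unfolding 1 2 3 hat_expand[OF fr z v F] by (simp add: sum.distrib[symmetric] algebra_simps)
  qed
  then show ?thesis
    unfolding jet_rep_def by (intro conjI affine_sum a Cinf_sum base_atlas f ballI)
qed

lemma jet_rep_exists:
  assumes z: "z \<in> H" and F: "F \<in> Cinf (vatlas (hat A))"
  obtains a f where "jet_rep z F a f"
proof -
  obtain W \<phi> U y N \<alpha> \<xi> where fr: "affine_frame W \<phi> U y N \<alpha> \<xi>" "fst z \<in> N"
    using H0.proj[OF z] by (rule affine_frame_exists)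
  show thesis using jet_rep_expand[OF fr(1) z fr(2) F] by (rule that)
qed

text \<open>The difference of two representations of F represents the zero function, to which
  \<open>jet_bracket_vanishes\<close> applies; skewness transfers this to the second slot.\<close>

lemma jet_bracket_unique:
  assumes z: "z \<in> H" and F: "F \<in> Cinf (vatlas (hat A))" "G \<in> Cinf (vatlas (hat A))"
    and r: "jet_rep z F a f" "jet_rep z F a' f'" "jet_rep z G b g" "jet_rep z G b' g'"
  shows "jet_bracket z a f b g = jet_bracket z a' f' b' g'"
proof -
  have *: "jet_bracket z a f b g = jet_bracket z a' f' b g"
    if F: "F \<in> Cinf (vatlas (hat A))" and r: "jet_rep z F a f" "jet_rep z F a' f'"
      and b: "b \<in> affine_functions A" and g: "g \<in> Cinf (abase A)" for F a f a' f' b g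
  proof -
    have a: "a \<in> affine_functions A" "f \<in> Cinf (abase A)" "a' \<in> affine_functions A" "f' \<in> Cinf (abase A)"
      using r by (auto simp: jet_rep_def)
    let ?a = "\<lambda>x. a x + - 1 * a' x" and ?f = "\<lambda>q. f q + - 1 * f' q"
    have "jet_rep z (\<lambda>u. F u + - 1 * F u) ?a ?f"
      by (intro jet_rep_add jet_rep_scale z F r Cinf_cmult vatlas_smooth)
    then have rr: "jet_rep z (\<lambda>_. 0) ?a ?f" by simp
    have "jet_bracket z ?a ?f b g = 0"
    proof (rule jet_bracket_vanishes[OF _ _ b g z])
      show "?a \<in> affine_functions A" "?f \<in> Cinf (abase A)" using rr by (auto simp: jet_rep_def)
      show "v (bar A ?a) + v (\<lambda>z. ?f (fst z)) = 0" if v: "v \<in> tangent_space (vatlas (hat A)) z" for v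
        using rr v tangent_const[OF vatlas_smooth v, of 0] by (simp add: jet_rep_def)
    qed
    then show ?thesis
      using jet_bracket_add[OF a(1) affine_scale[OF a(3)] a(2) Cinf_cmult[OF base_atlas a(4)] b g z, of "- 1" "- 1"]
        jet_bracket_scale[OF a(3,4) b g z, of "- 1"] by simp
  qed
  have m: "a' \<in> affine_functions A" "f' \<in> Cinf (abase A)" "b \<in> affine_functions A" "g \<in> Cinf (abase A)"
    "b' \<in> affine_functions A" using r by (auto simp: jet_rep_def)
  have "jet_bracket z a f b g = jet_bracket z a' f' b g" by (rule *[OF F(1) r(1,2) m(3,4)])
  also have "\<dots> = - jet_bracket z b g a' f'" by (rule jet_bracket_skew[OF m(1,3) z])
  also have "jet_bracket z b g a' f' = jet_bracket z b' g' a' f'" by (rule *[OF F(2) r(3,4) m(1,2)])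
  also have "- jet_bracket z b' g' a' f' = jet_bracket z a' f' b' g'" by (rule jet_bracket_skew[OF m(1,5) z, symmetric])
  finally show ?thesis .
qed

text \<open>The description by \<open>THE\<close> is legitimate by \<open>jet_rep_exists\<close> and
  \<open>jet_bracket_unique\<close>.\<close>

definition hull_bivector :: "('m \<times> ('m \<times> ('a \<Rightarrow> real) \<Rightarrow> real)) bifield" where
  "hull_bivector z F G = (if z \<in> H \<and> F \<in> Cinf (vatlas (hat A)) \<and> G \<in> Cinf (vatlas (hat A))
     then (THE r. \<exists>a f b g. jet_rep z F a f \<and> jet_rep z G b g \<and> r = jet_bracket z a f b g) else 0)"

lemma hull_bivector_eq:
  assumes z: "z \<in> H" and F: "F \<in> Cinf (vatlas (hat A))" "G \<in> Cinf (vatlas (hat A))"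
    and r: "jet_rep z F a f" "jet_rep z G b g"
  shows "hull_bivector z F G = jet_bracket z a f b g"
proof -
  have "(THE r. \<exists>a f b g. jet_rep z F a f \<and> jet_rep z G b g \<and> r = jet_bracket z a f b g) = jet_bracket z a f b g"
  proof (rule the_equality)
    show "\<exists>a' f' b' g'. jet_rep z F a' f' \<and> jet_rep z G b' g' \<and> jet_bracket z a f b g = jet_bracket z a' f' b' g'" using r by blast
    show "r = jet_bracket z a f b g" if "\<exists>a f b g. jet_rep z F a f \<and> jet_rep z G b g \<and> r = jet_bracket z a f b g" for r
      using that jet_bracket_unique[OF z F _ r(1) _ r(2)] by blast
  qed
  then show ?thesis using z F by (simp add: hull_bivector_def)
qed

lemma jet_bracket_sum:
  assumes "finite I" "\<And>i. i \<in> I \<Longrightarrow> a i \<in> affine_functions A" "\<And>i. i \<in> I \<Longrightarrow> f i \<in> Cinf (abase A)"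
    and b: "b \<in> affine_functions A" and g: "g \<in> Cinf (abase A)" and z: "z \<in> H"
  shows "jet_bracket z (\<lambda>x. \<Sum>i\<in>I. c i * a i x) (\<lambda>q. \<Sum>i\<in>I. c i * f i q) b g = (\<Sum>i\<in>I. c i * jet_bracket z (a i) (f i) b g)"
  using assms(1-3)
proof (induction I rule: finite_induct)
  case empty
  then show ?case using jet_bracket_scale[OF affine_const Cinf_const[OF base_atlas] b g z, of 0] by simp
next
  case (insert i I)
  have "jet_bracket z (\<lambda>x. c i * a i x + (\<Sum>i\<in>I. c i * a i x)) (\<lambda>q. c i * f i q + (\<Sum>i\<in>I. c i * f i q)) b g =
      jet_bracket z (\<lambda>x. c i * a i x) (\<lambda>q. c i * f i q) b g + jet_bracket z (\<lambda>x. \<Sum>i\<in>I. c i * a i x) (\<lambda>q. \<Sum>i\<in>I. c i * f i q) b g"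
    using insert.prems by (intro jet_bracket_add b g z affine_scale affine_sum Cinf_cmult Cinf_sum base_atlas) auto
  then show ?case
    using insert jet_bracket_scale[OF _ _ b g z, of "a i" "f i" "c i"] by simp
qed

text \<open>A representation has its coefficients frozen at one point. With a frame fixed over N,
  the dependence on z is carried by chart derivatives of F and G and by jet brackets of frame
  members, all of them smooth in z; this is how smoothness of the bivector is obtained.\<close>

lemma hull_bivector_frame:
  assumes fr: "affine_frame W \<phi> U y N \<alpha> \<xi>" and z: "z \<in> H" "fst z \<in> N"
    and F: "F \<in> Cinf (vatlas (hat A))" "G \<in> Cinf (vatlas (hat A))"
  shows "hull_bivector z F G = (\<Sum>b\<in>onb. hcd W \<phi> U y F z b *
    (\<Sum>c\<in>onb. hcd W \<phi> U y G z c * jet_bracket z (\<alpha> (snd b)) (\<xi> (fst b)) (\<alpha> (snd c)) (\<xi> (fst c))))"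
proof -
  note frD = affine_frameD[OF fr]
  note r = jet_rep_expand[OF fr z F(1)] jet_rep_expand[OF fr z F(2)]
  let ?a = "\<lambda>x. \<Sum>b\<in>onb. hcd W \<phi> U y F z b * \<alpha> (snd b) x" and ?f = "\<lambda>q. \<Sum>b\<in>onb. hcd W \<phi> U y F z b * \<xi> (fst b) q"
  let ?b = "\<lambda>x. \<Sum>b\<in>onb. hcd W \<phi> U y G z b * \<alpha> (snd b) x" and ?g = "\<lambda>q. \<Sum>b\<in>onb. hcd W \<phi> U y G z b * \<xi> (fst b) q"
  have b: "?b \<in> affine_functions A" "?g \<in> Cinf (abase A)" using r(2) by (auto simp: jet_rep_def)
  have "hull_bivector z F G = jet_bracket z ?a ?f ?b ?g"
    by (rule hull_bivector_eq[OF z(1) F r])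
  also have "\<dots> = (\<Sum>b\<in>onb. hcd W \<phi> U y F z b * jet_bracket z (\<alpha> (snd b)) (\<xi> (fst b)) ?b ?g)"
    by (rule jet_bracket_sum[OF finite_onb _ _ b z(1)]) (rule frD)+
  also have "\<dots> = (\<Sum>b\<in>onb. hcd W \<phi> U y F z b *
    (\<Sum>c\<in>onb. hcd W \<phi> U y G z c * jet_bracket z (\<alpha> (snd b)) (\<xi> (fst b)) (\<alpha> (snd c)) (\<xi> (fst c))))"
  proof (intro sum.cong refl arg_cong2[of _ _ _ _ "(*)"])
    fix e :: "'e \<times> 'f \<times> real"
    have "jet_bracket z (\<alpha> (snd e)) (\<xi> (fst e)) ?b ?g = - jet_bracket z ?b ?g (\<alpha> (snd e)) (\<xi> (fst e))"
      by (rule jet_bracket_skew[OF frD(5) b(1) z(1)])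
    also have "jet_bracket z ?b ?g (\<alpha> (snd e)) (\<xi> (fst e)) =
        (\<Sum>c\<in>onb. hcd W \<phi> U y G z c * jet_bracket z (\<alpha> (snd c)) (\<xi> (fst c)) (\<alpha> (snd e)) (\<xi> (fst e)))"
      by (rule jet_bracket_sum[OF finite_onb _ _ frD(5) frD(6) z(1)]) (rule frD)+
    finally have 1: "jet_bracket z (\<alpha> (snd e)) (\<xi> (fst e)) ?b ?g =
        - (\<Sum>c\<in>onb. hcd W \<phi> U y G z c * jet_bracket z (\<alpha> (snd c)) (\<xi> (fst c)) (\<alpha> (snd e)) (\<xi> (fst e)))" .
    have sk: "jet_bracket z (\<alpha> (snd e)) (\<xi> (fst e)) (\<alpha> (snd c)) (\<xi> (fst c)) =
        - jet_bracket z (\<alpha> (snd c)) (\<xi> (fst c)) (\<alpha> (snd e)) (\<xi> (fst e))" for c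
      by (rule jet_bracket_skew[OF frD(5) frD(5) z(1)])
    show "jet_bracket z (\<alpha> (snd e)) (\<xi> (fst e)) ?b ?g =
        (\<Sum>c\<in>onb. hcd W \<phi> U y G z c * jet_bracket z (\<alpha> (snd e)) (\<xi> (fst e)) (\<alpha> (snd c)) (\<xi> (fst c)))"
      by (simp only: 1 sk mult_minus_right sum_negf)
  qed
  finally show ?thesis .
qed

lemma hull_bivector_field: "bivector_field (vatlas (hat A)) hull_bivector"
proof (rule bivector_fieldI[OF vatlas_smooth vatlas_separated])
  fix z F G
  show "hull_bivector z F G = - hull_bivector z G F"
  proof (cases "z \<in> H \<and> F \<in> Cinf (vatlas (hat A)) \<and> G \<in> Cinf (vatlas (hat A))")
    case True
    then have z: "z \<in> H" and F: "F \<in> Cinf (vatlas (hat A))" "G \<in> Cinf (vatlas (hat A))" by auto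
    obtain a f where r1: "jet_rep z F a f" using jet_rep_exists[OF z F(1)] .
    obtain b g where r2: "jet_rep z G b g" using jet_rep_exists[OF z F(2)] .
    show ?thesis
      using hull_bivector_eq[OF z F r1 r2] hull_bivector_eq[OF z F(2,1) r2 r1] jet_bracket_skew[OF _ _ z, of a b f g] r1 r2
      by (auto simp: jet_rep_def)
  qed (auto simp: hull_bivector_def)
next
  fix z F assume zp: "z \<in> point_set (vatlas (hat A))" and F: "F \<in> Cinf (vatlas (hat A))"
  from zp have z: "z \<in> H" by simp
  obtain a f where r: "jet_rep z F a f" using jet_rep_exists[OF z F] .
  then have a: "a \<in> affine_functions A" "f \<in> Cinf (abase A)" by (auto simp: jet_rep_def)
  have eq: "hull_bivector z F G = - jet_bracket z b g a f" if G: "G \<in> Cinf (vatlas (hat A))" and rG: "jet_rep z G b g" for G b g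
    using hull_bivector_eq[OF z F G r rG] jet_bracket_skew[OF a(1) _ z, of b f g] rG by (simp add: jet_rep_def)
  show "hull_bivector z F \<in> tangent_space (vatlas (hat A)) z"
  proof (rule tangentI, goal_cases)
    case (1 G K)
    obtain b g where r1: "jet_rep z G b g" using jet_rep_exists[OF z 1(1)] .
    obtain c k where r2: "jet_rep z K c k" using jet_rep_exists[OF z 1(2)] .
    show ?case
      using eq[OF 1(1) r1] eq[OF 1(2) r2] eq[OF Cinf_add[OF vatlas_smooth 1] jet_rep_add[OF z 1 r1 r2]]
        jet_bracket_add[OF _ _ _ _ a z, of b c g k] r1 r2 by (simp add: jet_rep_def)
  next
    case (2 G K)
    obtain b g where r1: "jet_rep z G b g" using jet_rep_exists[OF z 2(1)] .
    obtain c k where r2: "jet_rep z K c k" using jet_rep_exists[OF z 2(2)] .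
    have m: "b \<in> affine_functions A" "c \<in> affine_functions A" "g \<in> Cinf (abase A)" "k \<in> Cinf (abase A)"
      using r1 r2 by (auto simp: jet_rep_def)
    show ?case
      using eq[OF 2(1) r1] eq[OF 2(2) r2] eq[OF Cinf_mult[OF vatlas_smooth 2] jet_rep_mult[OF z 2 r1 r2]]
        jet_bracket_add[OF affine_scale[OF m(1)] affine_scale[OF m(2)] Cinf_cmult[OF base_atlas m(3)]
          Cinf_cmult[OF base_atlas m(4)] a z, of "K z" "G z" "K z" "G z"]
        jet_bracket_scale[OF m(1,3) a z, of "K z"] jet_bracket_scale[OF m(2,4) a z, of "G z"] by simp
  next
    case (3 c G)
    obtain b g where r1: "jet_rep z G b g" using jet_rep_exists[OF z 3] .
    show ?case
      using eq[OF 3 r1] eq[OF Cinf_cmult[OF vatlas_smooth 3] jet_rep_scale[OF z 3 r1]]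
        jet_bracket_scale[OF _ _ a z, of b g c] r1 by (simp add: jet_rep_def)
  next
    case (4 G)
    then show ?case by (simp add: hull_bivector_def)
  qed
next
  fix F G assume F: "F \<in> Cinf (vatlas (hat A))" and G: "G \<in> Cinf (vatlas (hat A))"
  show "(\<lambda>z. hull_bivector z F G) \<in> Cinf (vatlas (hat A))"
    unfolding Cinf_iff_smooth_at[OF vatlas_smooth]
  proof
    fix z assume zp: "z \<in> point_set (vatlas (hat A))"
    then have z: "z \<in> H" by simp
    obtain W \<phi> U y N \<alpha> \<xi> where fr: "affine_frame W \<phi> U y N \<alpha> \<xi>" "fst z \<in> N"
      using H0.proj[OF z] by (rule affine_frame_exists)
    note frD = affine_frameD[OF fr(1)]
    note DT = hchart_in_atlas[OF frD(1,2)]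
    note iD = smooth_atlasD(1,2)[OF vatlas_smooth DT]
    have D: "z \<in> hdom W U" using z fr(2) frD(4) by (auto simp: hdom_iff)
    let ?I = "inv_into (hdom W U) (hchart \<phi> y)" and ?S = "hchart \<phi> y ` hdom W U"
    let ?q = "\<lambda>b c z. jet_bracket z (\<alpha> (snd b)) (\<xi> (fst b)) (\<alpha> (snd c)) (\<xi> (fst c))"
    have q: "?q b c \<in> Cinf (vatlas (hat A))" for b c
      unfolding jet_bracket_def
      by (intro Cinf_diff Cinf_add vatlas_smooth bar_Cinf br_affine H_pullback symbol_of_Cinf frD(5,6))
    have "smooth_on (\<lambda>x. \<Sum>b\<in>onb. ((\<lambda>z. hcd W \<phi> U y F z b) \<circ> ?I) x *
        (\<Sum>c\<in>onb. ((\<lambda>z. hcd W \<phi> U y G z c) \<circ> ?I) x * (?q b c \<circ> ?I) x)) ?S"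
      by (rule smooth_on_sum[OF iD(2) smooth_on_mult[OF iD(2) smooth_on_chart_deriv[OF vatlas_smooth DT F]
          smooth_on_sum[OF iD(2) smooth_on_mult[OF iD(2) smooth_on_chart_deriv[OF vatlas_smooth DT G] CinfD[OF q DT]]]]])
    then have "smooth_at (vatlas (hat A)) (\<lambda>z. \<Sum>b\<in>onb. hcd W \<phi> U y F z b * (\<Sum>c\<in>onb. hcd W \<phi> U y G z c * ?q b c z)) z"
      unfolding smooth_at_def using DT D iD(2)
      by (intro exI[of _ "hdom W U"] exI[of _ "hchart \<phi> y"] exI[of _ ?S]) (auto simp: o_def)
    then show "smooth_at (vatlas (hat A)) (\<lambda>z. hull_bivector z F G) z"
      by (rule smooth_at_cong[OF vatlas_smooth openin_over_N[OF fr(1)], rotated])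
        (use z fr hull_bivector_frame[OF fr(1) _ _ F G] in auto)
  qed
qed (auto simp: hull_bivector_def)

lemma hull_bivector_bar:
  assumes a: "a \<in> affine_functions A" and b: "b \<in> affine_functions A" and z: "z \<in> H"
  shows "hull_bivector z (bar A a) (bar A b) = bar A (j.br a b) z"
proof -
  have "symbol_of c (\<lambda>_. 0) (fst z) = 0" if c: "c \<in> affine_functions A" for c
  proof -
    obtain x where x: "x \<in> atotal A" "aproj A x = fst z" using fibre_point[OF z] .
    then have xp: "x \<in> point_set (aatlas A)" by simp
    show ?thesis
      using symbol_of[OF c Cinf_const[OF base_atlas, of 0] x(1)] x(2)
        tangent_const[OF aatlas_smooth bivector_fieldD(6)[OF j.bivector xp]]
        tangent_const[OF aatlas_smooth vector_fieldD(1)[OF j.vector xp]]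
      by (simp add: symbol_at_def)
  qed
  then show ?thesis
    using hull_bivector_eq[OF z bar_Cinf[OF a] bar_Cinf[OF b] jet_rep_bar[OF a] jet_rep_bar[OF b]] a b by (simp add: jet_bracket_def)
qed

lemma hull_linked: "linked \<Lambda> E hull_bivector"
  unfolding linked_def poisson_bracket_def
  using hull_bivector_bar evaluation(1,4) br_affine by simp

text \<open>Both properties are tested on linear functions. Their Jacobiator is \<open>bar A\<close>
  of the Jacobiator of the affine functions. Their bracket G is linear again, and the Liouville
  field fixes linear functions, so the Lie derivative has the value G - G - G = -G.\<close>

lemma hull_homogeneous: "homogeneous_poisson (hat A) hull_bivector"
proof -
  let ?P = hull_bivector and ?V = "vatlas (hat A)"
  interpret h: jacobi_fields ?V ?P "\<lambda>_ _. 0"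
    by (rule poisson_jacobi_fields[OF vatlas_smooth hull_bivector_field])
  note B = hull_bivector_field
  have h_br: "h.br F G z = ?P z F G" for F G z by (simp add: jacobi_bracket_def)
  have br2: "h.br (bar A a) (h.br (bar A b) (bar A c)) z = bar A (j.br a (j.br b c)) z"
    if a: "a \<in> affine_functions A" and b: "b \<in> affine_functions A" and c: "c \<in> affine_functions A" and z: "z \<in> H" for a b c z
  proof -
    have zp: "z \<in> point_set ?V" using z by simp
    have "h.br (bar A a) (h.br (bar A b) (bar A c)) z = h.br (bar A a) (bar A (j.br b c)) z"
      by (rule h.br_cong(2)[OF zp h.br_Cinf[OF bar_Cinf[OF b] bar_Cinf[OF c]]])
        (simp add: h_br hull_bivector_bar[OF b c])
    then show ?thesis using hull_bivector_bar[OF a br_affine[OF b c] z] by (simp add: h_br)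
  qed
  have "jacobi_identity ?V h.br"
    unfolding h.jacobi_identity_iff
  proof (intro ballI)
    fix F G K z assume F: "F \<in> Cinf ?V" "G \<in> Cinf ?V" "K \<in> Cinf ?V" and "z \<in> point_set ?V"
    then have z: "z \<in> H" by simp
    show "h.jacobiator F G K z = 0"
    proof (rule zero_on_nonzero_imp_zero[OF h.jacobiator_Cinf[OF F] _ z])
      fix z assume z: "z \<in> H" "nonzero z"
      then have zp: "z \<in> point_set ?V" by simp
      show "h.jacobiator F G K z = 0"
      proof (rule poisson_jacobiator_zeroI[OF vatlas_smooth B zp hat_jet_determining[OF z] _ F])
        fix s t u assume "s \<in> bar A ` affine_functions A" "t \<in> bar A ` affine_functions A" "u \<in> bar A ` affine_functions A"
        then obtain a b c where 4: "a \<in> affine_functions A" "b \<in> affine_functions A" "c \<in> affine_functions A"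
            "s = bar A a" "t = bar A b" "u = bar A c" by blast
        show "h.jacobiator s t u z = 0"
        proof -
          let ?abc = "\<lambda>a b c. j.br a (j.br b c)"
          have m: "?abc a b c \<in> affine_functions A" "?abc b c a \<in> affine_functions A" "?abc c a b \<in> affine_functions A"
            using 4 br_affine by blast+
          have "h.jacobiator s t u z = bar A (\<lambda>x. (?abc a b c x + ?abc b c a x) + ?abc c a b x) z"
            using bar_add[OF affine_add[OF m(1,2)] m(3) z(1)] bar_add[OF m(1,2) z(1)]
            by (simp add: h.jacobiator_def 4 br2 z(1))
          also have "\<dots> = bar A (\<lambda>_. 0) z"
          proof (rule bar_cong)
            have "jacobi_identity (aatlas A) j.br"
              using affine_jacobi by (simp add: affine_jacobi_def jacobi_structure_def)
            then show "?abc a b c x + ?abc b c a x + ?abc c a b x = 0" if "x \<in> atotal A" for x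
              using that 4 affine_Cinf by (simp add: jacobi_identity_def)
          qed
          also have "\<dots> = 0" using bar_scale[OF affine_const z(1), of 0] by simp
          finally show ?thesis .
        qed
      qed
    qed
  qed
  then have J: "jacobi_identity ?V (poisson_bracket ?P)"
    by (simp add: poisson_bracket_eq_jacobi)
  \<comment> \<open>Negation is written as a difference from the zero field, so that
    \<open>bivector_field_diff\<close> shows the right side to be a bivector field.\<close>
  have "lie_derivative (liouville (hat A)) ?P = (\<lambda>z F G. 0 - ?P z F G)"
  proof (rule bivector_eqI)
    show "bivector_field ?V (lie_derivative (liouville (hat A)) ?P)"
      by (rule lie_derivative_bivector_field[OF vatlas_smooth vatlas_separated liouville_vector_field B])
    have "bivector_field ?V (\<lambda>_ _ _. 0)"
      by (rule bivector_fieldI[OF vatlas_smooth vatlas_separated])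
        (auto simp: tangent_zero_closed Cinf_const[OF vatlas_smooth])
    from bivector_field_diff[OF vatlas_smooth vatlas_separated this B]
    show "bivector_field ?V (\<lambda>z F G. 0 - ?P z F G)" .
    fix a b z assume a: "a \<in> affine_functions A" and b: "b \<in> affine_functions A" and z: "z \<in> H"
    then have zp: "z \<in> point_set ?V" by simp
    have "liouville (hat A) z (\<lambda>q. ?P q (bar A a) (bar A b)) = liouville (hat A) z (bar A (j.br a b))"
      by (rule tangent_cong[OF vatlas_smooth vector_fieldD(1)[OF liouville_vector_field zp] zp
            bivector_fieldD(3)[OF B bar_Cinf[OF a] bar_Cinf[OF b]]])
        (simp add: hull_bivector_bar[OF a b])
    moreover have "?P z (\<lambda>q. liouville (hat A) q (bar A a)) (bar A b) = ?P z (bar A a) (bar A b)"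
      by (rule tangent_cong[OF vatlas_smooth bivector_fieldD(6)[OF B zp] zp bar_Cinf[OF a], symmetric])
        (simp add: liouville_bar[OF a])
    moreover have "?P z (bar A a) (\<lambda>q. liouville (hat A) q (bar A b)) = ?P z (bar A a) (bar A b)"
      by (rule tangent_cong[OF vatlas_smooth bivector_fieldD(5)[OF B zp] zp bar_Cinf[OF b], symmetric])
        (simp add: liouville_bar[OF b])
    ultimately show "lie_derivative (liouville (hat A)) ?P z (bar A a) (bar A b) = 0 - ?P z (bar A a) (bar A b)"
      using liouville_bar[OF br_affine[OF a b] z] hull_bivector_bar[OF a b z] by (simp add: lie_derivative_def)
  qed
  then show ?thesis
    using B J by (simp add: homogeneous_poisson_def poisson_structure_def)
qed

end

section \<open>Linear Poisson structures on the cylinder\<close>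

locale base_manifold =
  fixes M :: "('m, 'e::fin_dim_inner) atlas"
  assumes M_atlas: "smooth_atlas M" and M_separated: "separated M"
begin

abbreviation "C \<equiv> cylinder M"

lemma cylinder_eq: "C = {(U \<times> (- {0}), map_prod \<phi> id) | U \<phi>. (U, \<phi>) \<in> M}"
  by (auto simp: cylinder_def prod_atlas_def nonzero_reals_def)

lemma cyl_chart: "(U, \<phi>) \<in> M \<Longrightarrow> (U \<times> (- {0}), map_prod \<phi> id) \<in> C"
  by (auto simp: cylinder_eq)

lemma cylE:
  assumes "(D, \<kappa>) \<in> C"
  obtains U \<phi> where "(U, \<phi>) \<in> M" "D = U \<times> (- {0})" "\<kappa> = map_prod \<phi> id"
  using assms by (auto simp: cylinder_eq)

lemma point_set_cylinder: "point_set C = point_set M \<times> (- {0})"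
  by (auto simp: point_set_def cylinder_eq)

lemma cyl_image: "map_prod \<phi> id ` (N \<times> (- {0})) = \<phi> ` N \<times> (- {0::real})"
  by (auto simp: map_prod_def)

lemma cyl_inj: "(U, \<phi>) \<in> M \<Longrightarrow> inj_on (map_prod \<phi> id) (U \<times> (- {0::real}))"
  using smooth_atlasD(1)[OF M_atlas] by (auto simp: inj_on_def)

lemma cyl_inverse:
  assumes "(U, \<phi>) \<in> M" "p \<in> U" "t \<noteq> 0"
  shows "inv_into (U \<times> (- {0})) (map_prod \<phi> id) (\<phi> p, t) = (p, t::real)"
  by (rule inv_into_f_eq[OF cyl_inj[OF assms(1)]]) (use assms in auto)

lemma open_cyl: "open N \<Longrightarrow> open (N \<times> (- {0::real}))"
  by (intro open_Times) auto

lemma smooth_on_cyl_cong: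
  fixes F :: "'e \<times> real \<Rightarrow> 'c::real_normed_vector"
  assumes "smooth_on F (\<phi> ` N \<times> (- {0}))" "open (\<phi> ` N)"
    "\<And>p t. p \<in> N \<Longrightarrow> t \<noteq> 0 \<Longrightarrow> F (\<phi> p, t) = G (\<phi> p, t)"
  shows "smooth_on G (\<phi> ` N \<times> (- {0}))"
  by (rule smooth_on_cong[OF assms(1) open_cyl[OF assms(2)]]) (use assms(3) in auto)

lemma cylinder_atlas: "smooth_atlas C"
proof (rule smooth_atlasI)
  fix D \<kappa> assume "(D, \<kappa>) \<in> C"
  then obtain U \<phi> where U: "(U, \<phi>) \<in> M" and D: "D = U \<times> (- {0})" "\<kappa> = map_prod \<phi> id" by (rule cylE)
  show "inj_on \<kappa> D" unfolding D by (rule cyl_inj[OF U])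
  show "open (\<kappa> ` D)" unfolding D cyl_image by (rule open_cyl[OF smooth_atlasD(2)[OF M_atlas U]])
next
  fix D \<kappa> D' \<kappa>' assume "(D, \<kappa>) \<in> C" "(D', \<kappa>') \<in> C"
  then obtain U \<phi> U' \<phi>' where U: "(U, \<phi>) \<in> M" "(U', \<phi>') \<in> M"
    and D: "D = U \<times> (- {0})" "\<kappa> = map_prod \<phi> id" "D' = U' \<times> (- {0})" "\<kappa>' = map_prod \<phi>' id"
    by (elim cylE)
  have int: "D \<inter> D' = (U \<inter> U') \<times> (- {0})" unfolding D by auto
  note T = smooth_atlasD(3,4)[OF M_atlas U]
  note o = open_cyl[OF T(1)]
  have "smooth_on (\<lambda>z. (\<phi>' \<circ> inv_into U \<phi>) (fst z)) (\<phi> ` (U \<inter> U') \<times> (- {0::real}))"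
    by (rule smooth_on_subset[OF smooth_on_compose_fst[OF T]]) auto
  then have "smooth_on (\<lambda>z. ((\<phi>' \<circ> inv_into U \<phi>) (fst z), snd z)) (\<phi> ` (U \<inter> U') \<times> (- {0::real}))"
    by (intro smooth_on_Pair smooth_on_snd smooth_on_id o)
  then have "smooth_on (\<kappa>' \<circ> inv_into D \<kappa>) (\<phi> ` (U \<inter> U') \<times> (- {0::real}))"
    by (rule smooth_on_cyl_cong[OF _ T(1)])
      (use smooth_atlasD(1)[OF M_atlas U(1)] in \<open>simp add: D cyl_inverse[OF U(1)]\<close>)
  then show "open (\<kappa> ` (D \<inter> D')) \<and> smooth_on (\<kappa>' \<circ> inv_into D \<kappa>) (\<kappa> ` (D \<inter> D'))"
    unfolding int D(2) cyl_image using o by simp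
qed

lemma cylinder_openin:
  assumes N: "openin (atlas_topology M) N"
  shows "openin (atlas_topology C) (N \<times> (- {0}))"
  unfolding openin_atlas_topology[OF cylinder_atlas]
proof (intro conjI ballI)
  show "N \<times> (- {0}) \<subseteq> point_set C"
    using N by (auto simp: point_set_cylinder openin_atlas_topology[OF M_atlas])
  fix c assume c: "c \<in> C"
  obtain D \<kappa> where d: "c = (D, \<kappa>)" by fastforce
  then obtain U \<phi> where U: "(U, \<phi>) \<in> M" and D: "D = U \<times> (- {0})" "\<kappa> = map_prod \<phi> id"
    using c by (metis cylE)
  have "D \<inter> N \<times> (- {0}) = (U \<inter> N) \<times> (- {0})" unfolding D by auto
  then have "open (\<kappa> ` (D \<inter> N \<times> (- {0})))"
    using open_cyl[OF openin_chart_image[OF M_atlas U N]] by (simp add: D cyl_image)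
  then show "case c of (U, \<phi>) \<Rightarrow> open (\<phi> ` (U \<inter> N \<times> (- {0})))" by (simp add: d)
qed

lemma cylinder_separated: "separated C"
  unfolding separated_def
proof (intro ballI)
  fix c assume c: "c \<in> C"
  obtain D \<kappa> where d: "c = (D, \<kappa>)" by fastforce
  then obtain U \<phi> where U: "(U, \<phi>) \<in> M" and D: "D = U \<times> (- {0})" "\<kappa> = map_prod \<phi> id"
    using c by (metis cylE)
  have "\<exists>V T. openin (atlas_topology C) V \<and> point_set C \<subseteq> D \<union> V \<and>
     open T \<and> \<kappa> z \<in> T \<and> T \<subseteq> \<kappa> ` D \<and> (\<forall>q\<in>D. \<kappa> q \<in> T \<longrightarrow> q \<notin> V)" if "z \<in> D" for z
  proof -
    obtain p t where z: "z = (p, t)" by fastforce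
    have p: "p \<in> U" and t: "t \<noteq> 0" using that by (auto simp: D z)
    obtain V T where V: "openin (atlas_topology M) V" "point_set M \<subseteq> U \<union> V" "open T" "\<phi> p \<in> T"
       "T \<subseteq> \<phi> ` U" "\<forall>q\<in>U. \<phi> q \<in> T \<longrightarrow> q \<notin> V"
      using bspec[OF M_separated[unfolded separated_def] U] p by auto
    show ?thesis
      unfolding D cyl_image point_set_cylinder
      using cylinder_openin[OF V(1)] open_cyl[OF V(3)] V t
      by (intro exI[of _ "V \<times> (- {0})"] exI[of _ "T \<times> (- {0})"]) (auto simp: z)
  qed
  then show "case c of (U, \<phi>) \<Rightarrow> \<forall>p\<in>U. \<exists>V T. openin (atlas_topology C) V \<and> point_set C \<subseteq> U \<union> V \<and>
     open T \<and> \<phi> p \<in> T \<and> T \<subseteq> \<phi> ` U \<and> (\<forall>q\<in>U. \<phi> q \<in> T \<longrightarrow> q \<notin> V)"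
    by (simp add: d)
qed

lemma cyl_pullback:
  assumes f: "f \<in> Cinf M"
  shows "(\<lambda>z. f (fst z)) \<in> Cinf C"
proof (rule CinfI, elim cylE, clarify)
  fix U \<phi> assume U: "(U, \<phi>) \<in> M"
  note o = smooth_atlasD(2)[OF M_atlas U]
  have "smooth_on (\<lambda>z. (f \<circ> inv_into U \<phi>) (fst z)) (\<phi> ` U \<times> (- {0::real}))"
    by (rule smooth_on_subset[OF smooth_on_compose_fst[OF o CinfD[OF f U]]]) auto
  then show "smooth_on ((\<lambda>z. f (fst z)) \<circ> inv_into (U \<times> (- {0})) (map_prod \<phi> id)) (map_prod \<phi> id ` (U \<times> (- {0::real})))"
    unfolding cyl_image
    by (rule smooth_on_cyl_cong[OF _ o])
      (use smooth_atlasD(1)[OF M_atlas U] in \<open>simp add: cyl_inverse[OF U]\<close>)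
qed

lemma cyl_height:
  assumes h: "smooth_on h (- {0::real})"
  shows "(\<lambda>z. h (snd z)) \<in> Cinf C"
proof (rule CinfI, elim cylE, clarify)
  fix U \<phi> assume U: "(U, \<phi>) \<in> M"
  note o = open_cyl[OF smooth_atlasD(2)[OF M_atlas U]]
  have "smooth_on (\<lambda>z. h (snd z)) (\<phi> ` U \<times> (- {0::real}))"
    by (rule smooth_on_compose[OF o _ _ smooth_on_snd[OF o smooth_on_id[OF o]] h]) auto
  then show "smooth_on ((\<lambda>z. h (snd z)) \<circ> inv_into (U \<times> (- {0})) (map_prod \<phi> id)) (map_prod \<phi> id ` (U \<times> (- {0::real})))"
    unfolding cyl_image
    by (rule smooth_on_cyl_cong[OF _ smooth_atlasD(2)[OF M_atlas U]]) (simp add: cyl_inverse[OF U])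
qed

lemma snd_Cinf: "snd \<in> Cinf C"
proof -
  have "smooth_on (\<lambda>x. x) (- {0::real})" by (rule smooth_on_id) auto
  from cyl_height[OF this] show ?thesis by simp
qed

lemma t_times_eq: "t_times f = (\<lambda>z. snd z * f (fst z))"
  by (auto simp: t_times_def)

lemma t_times_Cinf: "f \<in> Cinf M \<Longrightarrow> t_times f \<in> Cinf C"
  unfolding t_times_eq by (rule Cinf_mult[OF cylinder_atlas snd_Cinf cyl_pullback])

lemma cyl_slice:
  assumes F: "F \<in> Cinf C" and t: "t \<noteq> 0"
  shows "(\<lambda>y. F (y, t)) \<in> Cinf M"
proof (rule CinfI)
  fix U \<phi> assume U: "(U, \<phi>) \<in> M"
  note o = smooth_atlasD(2)[OF M_atlas U]
  have "smooth_on (F \<circ> inv_into (U \<times> (- {0})) (map_prod \<phi> id)) (\<phi> ` U \<times> (- {0}))"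
    using CinfD[OF F cyl_chart[OF U]] by (simp add: cyl_image)
  then have "smooth_on (\<lambda>x. (F \<circ> inv_into (U \<times> (- {0})) (map_prod \<phi> id)) (x, t)) (\<phi> ` U)"
    by (rule smooth_on_compose[OF o open_cyl[OF o], rotated 2])
      (use t o in \<open>auto intro!: smooth_on_Pair smooth_on_id smooth_on_const\<close>)
  then show "smooth_on ((\<lambda>y. F (y, t)) \<circ> inv_into U \<phi>) (\<phi> ` U)"
    by (rule smooth_on_cong[OF _ o])
      (use t smooth_atlasD(1)[OF M_atlas U] in \<open>auto simp: cyl_inverse[OF U]\<close>)
qed

abbreviation "ccd U \<phi> \<equiv> chart_deriv (U \<times> (- {0::real})) (map_prod \<phi> id)"

lemma ccd_slice:
  assumes U: "(U, \<phi>) \<in> M" and F: "F \<in> Cinf C" and p: "p \<in> U" and t: "t \<noteq> 0"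
  shows "chart_deriv U \<phi> (\<lambda>y. F (y, t)) p w = ccd U \<phi> F (p, t) (w, 0)"
proof -
  note o = smooth_atlasD(1,2)[OF M_atlas U]
  have "(F \<circ> inv_into (U \<times> (- {0})) (map_prod \<phi> id) has_derivative ccd U \<phi> F (p, t)) (at (\<phi> p, t))"
    using chart_deriv_has_derivative[OF cylinder_atlas cyl_chart[OF U] F, of "(p, t)"] p t by simp
  then have "((\<lambda>x. (F \<circ> inv_into (U \<times> (- {0})) (map_prod \<phi> id)) (x, t)) has_derivative
      (\<lambda>w. ccd U \<phi> F (p, t) (w, 0))) (at (\<phi> p))"
    by (rule has_derivative_compose[OF has_derivative_Pair[OF has_derivative_ident has_derivative_const]])
  then have "(((\<lambda>y. F (y, t)) \<circ> inv_into U \<phi>) has_derivative (\<lambda>w. ccd U \<phi> F (p, t) (w, 0))) (at (\<phi> p))"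
    by (rule has_derivative_transform_within_open[OF _ o(2)])
      (use p t o(1) in \<open>auto simp: cyl_inverse[OF U]\<close>)
  from chart_deriv_eqI[OF this] show ?thesis by simp
qed

lemma d_dt_chart:
  assumes U: "(U, \<phi>) \<in> M" and F: "F \<in> Cinf C" and z: "z \<in> U \<times> (- {0})"
  shows "d_dt M z F = ccd U \<phi> F z (0, 1)"
    and "((\<lambda>s. F (fst z, s)) has_real_derivative d_dt M z F) (at (snd z))"
proof -
  obtain p t where zz: "z = (p, t)" by fastforce
  with z have p: "p \<in> U" "t \<noteq> 0" by auto
  let ?G = "F \<circ> inv_into (U \<times> (- {0})) (map_prod \<phi> id)"
  have D: "(?G has_derivative ccd U \<phi> F (p, t)) (at (\<phi> p, t))"
    using chart_deriv_has_derivative[OF cylinder_atlas cyl_chart[OF U] F, of "(p, t)"] p by simp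
  have "((\<lambda>s. ?G (\<phi> p, s)) has_derivative (\<lambda>s. ccd U \<phi> F (p, t) (0, s))) (at t)"
    using D by (rule has_derivative_compose[OF has_derivative_Pair[OF has_derivative_const has_derivative_ident]])
  then have "((\<lambda>s. F (p, s)) has_derivative (\<lambda>s. ccd U \<phi> F (p, t) (0, s))) (at t)"
    by (rule has_derivative_transform_within_open[of _ _ _ _ "- {0}"])
      (use p in \<open>auto simp: cyl_inverse[OF U]\<close>)
  moreover have "ccd U \<phi> F (p, t) (0, s) = ccd U \<phi> F (p, t) (0, 1) * s" for s
    using linear_cmul[OF has_derivative_linear[OF D], of s "(0, 1)"] by simp
  then have "(\<lambda>s. ccd U \<phi> F (p, t) (0, s)) = (*) (ccd U \<phi> F (p, t) (0, 1))" by blast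
  ultimately have d: "((\<lambda>s. F (p, s)) has_real_derivative ccd U \<phi> F (p, t) (0, 1)) (at t)"
    unfolding has_field_derivative_def by argo
  have "(p, t) \<in> point_set C" using p point_setI[OF U] by (auto simp: point_set_cylinder)
  then show 1: "d_dt M z F = ccd U \<phi> F z (0, 1)"
    using F DERIV_imp_deriv[OF d] by (simp add: d_dt_def zz)
  show "((\<lambda>s. F (fst z, s)) has_real_derivative d_dt M z F) (at (snd z))"
    using d by (simp add: 1) (simp add: zz)
qed

lemma cyl_point:
  assumes "z \<in> point_set C"
  obtains U \<phi> where "(U, \<phi>) \<in> M" "z \<in> U \<times> (- {0})"
proof -
  have z: "fst z \<in> point_set M" "snd z \<noteq> 0" using assms by (auto simp: point_set_cylinder)
  obtain U \<phi> where "(U, \<phi>) \<in> M" "fst z \<in> U" using z(1) by (rule point_setE)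
  then show thesis using that z(2) by (simp add: mem_Times_iff)
qed

lemma d_dt_vector_field: "vector_field C (d_dt M)"
  unfolding vector_field_def
proof (intro conjI ballI allI impI)
  fix z assume "z \<in> point_set C"
  then obtain U \<phi> where U: "(U, \<phi>) \<in> M" and z: "z \<in> U \<times> (- {0})" by (rule cyl_point)
  have "d_dt M z = (\<lambda>F. if F \<in> Cinf C then ccd U \<phi> F z (0, 1) else 0)"
    using d_dt_chart(1)[OF U _ z] by (cases z) (auto simp: d_dt_def)
  then show "d_dt M z \<in> tangent_space C z"
    using chart_deriv_tangent[OF cylinder_atlas cyl_chart[OF U] z] by simp
next
  show "d_dt M z = (\<lambda>_. 0)" if "z \<notin> point_set C" for z
    using that by (cases z) (simp add: d_dt_def)
next
  fix F assume F: "F \<in> Cinf C"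
  show "(\<lambda>z. d_dt M z F) \<in> Cinf C"
  proof (rule CinfI)
    fix D \<kappa> assume D: "(D, \<kappa>) \<in> C"
    then obtain U \<phi> where U: "(U, \<phi>) \<in> M" and eq: "D = U \<times> (- {0})" "\<kappa> = map_prod \<phi> id" by (rule cylE)
    show "smooth_on ((\<lambda>z. d_dt M z F) \<circ> inv_into D \<kappa>) (\<kappa> ` D)"
    proof (rule smooth_on_cong[OF smooth_on_chart_deriv[OF cylinder_atlas D F, of "(0, 1)"]
            smooth_atlasD(2)[OF cylinder_atlas D]])
      fix x assume "x \<in> \<kappa> ` D"
      then have "inv_into D \<kappa> x \<in> U \<times> (- {0})" by (metis eq(1) inv_into_into)
      then show "((\<lambda>z. chart_deriv D \<kappa> F z (0, 1)) \<circ> inv_into D \<kappa>) x = ((\<lambda>z. d_dt M z F) \<circ> inv_into D \<kappa>) x"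
        using d_dt_chart(1)[OF U F] by (simp add: eq)
    qed
  qed
qed

lemma frame_M:
  assumes p: "p \<in> point_set M"
  obtains U \<phi> N \<xi> where "(U, \<phi>) \<in> M" "openin (atlas_topology M) N" "p \<in> N" "N \<subseteq> U"
    "\<And>w. \<xi> w \<in> Cinf M" "\<And>w q. q \<in> N \<Longrightarrow> \<xi> w q = w \<bullet> \<phi> q"
proof -
  obtain U \<phi> where U: "(U, \<phi>) \<in> M" "p \<in> U" using p by (rule point_setE)
  obtain \<xi> T where \<xi>: "\<And>w. \<xi> w \<in> Cinf M" "open T" "\<phi> p \<in> T" "T \<subseteq> \<phi> ` U"
    "\<And>w q. q \<in> U \<Longrightarrow> \<phi> q \<in> T \<Longrightarrow> \<xi> w q = w \<bullet> \<phi> q"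
    using coordinate_functions[OF M_atlas M_separated U] by metis
  show thesis
    by (rule that[OF U(1) openin_chart_preimage[OF M_atlas U(1) \<xi>(2)], of \<xi>]) (use U \<xi> in auto)
qed

lemma expand_M:
  assumes U: "(U, \<phi>) \<in> M" and N: "openin (atlas_topology M) N" "N \<subseteq> U" and q: "q \<in> N"
    and \<xi>: "\<And>w. \<xi> w \<in> Cinf M" "\<And>w q. q \<in> N \<Longrightarrow> \<xi> w q = w \<bullet> \<phi> q"
    and v: "v \<in> tangent_space M q" and f: "f \<in> Cinf M"
  shows "v f = (\<Sum>b\<in>onb. v (\<xi> b) * chart_deriv U \<phi> f q b)"
proof (rule tangent_expand[OF M_atlas M_separated U _ \<xi>(1) _ _ _ _ v f])
  show "open (\<phi> ` (U \<inter> N))" by (rule openin_chart_image[OF M_atlas U N(1)])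
  show "\<xi> b x = b \<bullet> \<phi> x" if "x \<in> U" "\<phi> x \<in> \<phi> ` (U \<inter> N)" for b x
    using that smooth_atlasD(1)[OF M_atlas U] \<xi>(2) by (auto simp: inj_on_def)
qed (use q N in auto)

lemma cyl_smooth_atI:
  assumes N: "openin (atlas_topology M) N" and z: "fst z \<in> N" "snd z \<noteq> 0" and U: "(U, \<phi>) \<in> M" "N \<subseteq> U"
    and G: "smooth_on (G \<circ> inv_into (U \<times> (- {0})) (map_prod \<phi> id)) (\<phi> ` U \<times> (- {0}))"
    and eq: "\<And>q t. q \<in> N \<Longrightarrow> t \<noteq> 0 \<Longrightarrow> G (q, t) = F (q, t)"
  shows "smooth_at C F z"
proof (rule smooth_at_cong[OF cylinder_atlas cylinder_openin[OF N]])
  show "z \<in> N \<times> (- {0})" using z by (simp add: mem_Times_iff)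
  then have "z \<in> U \<times> (- {0})" using U(2) by auto
  moreover have "open (\<phi> ` U \<times> (- {0::real}))" by (rule open_cyl[OF smooth_atlasD(2)[OF M_atlas U(1)]])
  ultimately show "smooth_at C G z"
    unfolding smooth_at_def using cyl_chart[OF U(1)] G
    by (intro exI[of _ "U \<times> (- {0})"] exI[of _ "map_prod \<phi> id"] exI[of _ "\<phi> ` U \<times> (- {0})"])
      (auto simp: cyl_image)
qed (use eq in auto)

lemma smooth_on_cyl_of_Cinf:
  assumes U: "(U, \<phi>) \<in> M" and F: "F \<in> Cinf C"
  shows "smooth_on (F \<circ> inv_into (U \<times> (- {0})) (map_prod \<phi> id)) (\<phi> ` U \<times> (- {0}))"
  using CinfD[OF F cyl_chart[OF U]] by (simp add: cyl_image)

lemma smooth_on_ccd: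
  assumes U: "(U, \<phi>) \<in> M" and F: "F \<in> Cinf C"
  shows "smooth_on ((\<lambda>z. ccd U \<phi> F z w) \<circ> inv_into (U \<times> (- {0})) (map_prod \<phi> id)) (\<phi> ` U \<times> (- {0}))"
  using smooth_on_chart_deriv[OF cylinder_atlas cyl_chart[OF U] F, of w] by (simp add: cyl_image)

text \<open>Slices give smoothness in the base point only. Expanding E in a coordinate frame
  separates coefficients pulled back from the base from chart derivatives of F on the cylinder, and
  both are jointly smooth in (x, t).\<close>

lemma lift_vector_field:
  assumes E: "vector_field M E"
  shows "vector_field C (lift_vfield M E)"
  unfolding vector_field_def
proof (intro conjI ballI allI impI)
  fix z assume z: "z \<in> point_set C"
  obtain p t where zz: "z = (p, t)" by fastforce
  with z have p: "p \<in> point_set M" "t \<noteq> 0" by (auto simp: point_set_cylinder)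
  note T = vector_fieldD(1)[OF E p(1)]
  have "lift_vfield M E z = (\<lambda>F. if F \<in> Cinf C then E p (\<lambda>y. F (y, t)) else 0)"
    using z by (auto simp: lift_vfield_def zz)
  moreover have "\<dots> \<in> tangent_space C z"
    by (rule tangentI) (auto simp: zz Cinf_add Cinf_mult Cinf_cmult cylinder_atlas tangentD[OF T] cyl_slice p)
  ultimately show "lift_vfield M E z \<in> tangent_space C z" by simp
next
  show "lift_vfield M E z = (\<lambda>_. 0)" if "z \<notin> point_set C" for z
    using that by (cases z) (simp add: lift_vfield_def)
next
  fix F assume F: "F \<in> Cinf C"
  show "(\<lambda>z. lift_vfield M E z F) \<in> Cinf C"
    unfolding Cinf_iff_smooth_at[OF cylinder_atlas]
  proof
    fix z assume "z \<in> point_set C"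
    then have z: "fst z \<in> point_set M" "snd z \<noteq> 0" by (auto simp: point_set_cylinder)
    obtain U \<phi> N \<xi> where U: "(U, \<phi>) \<in> M" and N: "openin (atlas_topology M) N" "fst z \<in> N" "N \<subseteq> U"
      and \<xi>: "\<And>w. \<xi> w \<in> Cinf M" "\<And>w q. q \<in> N \<Longrightarrow> \<xi> w q = w \<bullet> \<phi> q"
      using frame_M[OF z(1)] by metis
    note o = open_cyl[OF smooth_atlasD(2)[OF M_atlas U]]
    have "smooth_on (\<lambda>x. \<Sum>b\<in>onb. ((\<lambda>z. E (fst z) (\<xi> b)) \<circ> inv_into (U \<times> (- {0})) (map_prod \<phi> id)) x *
        ((\<lambda>z. ccd U \<phi> F z (b, 0)) \<circ> inv_into (U \<times> (- {0})) (map_prod \<phi> id)) x) (\<phi> ` U \<times> (- {0}))"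
      by (rule smooth_on_sum[OF o smooth_on_mult[OF o smooth_on_cyl_of_Cinf[OF U cyl_pullback[OF vector_fieldD(3)[OF E \<xi>(1)]]]
              smooth_on_ccd[OF U F]]])
    then have "smooth_on ((\<lambda>z. \<Sum>b\<in>onb. E (fst z) (\<xi> b) * ccd U \<phi> F z (b, 0)) \<circ> inv_into (U \<times> (- {0})) (map_prod \<phi> id))
        (\<phi> ` U \<times> (- {0}))"
      by (simp add: o_def)
    then show "smooth_at C (\<lambda>z. lift_vfield M E z F) z"
    proof (rule cyl_smooth_atI[OF N(1,2) z(2) U N(3)])
      fix q and t :: real assume q: "q \<in> N" and t: "t \<noteq> 0"
      have qp: "q \<in> point_set M" using q N(3) point_setI[OF U] by blast
      have "E q (\<lambda>y. F (y, t)) = (\<Sum>b\<in>onb. E q (\<xi> b) * chart_deriv U \<phi> (\<lambda>y. F (y, t)) q b)"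
        by (rule expand_M[OF U N(1,3) q \<xi> vector_fieldD(1)[OF E qp] cyl_slice[OF F t]])
      then show "(\<Sum>b\<in>onb. E (fst (q, t)) (\<xi> b) * ccd U \<phi> F (q, t) (b, 0)) = lift_vfield M E (q, t) F"
        using ccd_slice[OF U F _ t, of q] q N(3) qp t F by (auto simp: lift_vfield_def point_set_cylinder)
    qed
  qed
qed

lemma lift_bivector_field:
  assumes \<Lambda>: "bivector_field M \<Lambda>"
  shows "bivector_field C (lift_bifield M \<Lambda>)"
proof (rule bivector_fieldI[OF cylinder_atlas cylinder_separated])
  show "lift_bifield M \<Lambda> z F G = - lift_bifield M \<Lambda> z G F" for z F G
    using bivector_fieldD(4)[OF \<Lambda>, of "fst z" "\<lambda>y. F (y, snd z)" "\<lambda>y. G (y, snd z)"]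
    by (auto simp: lift_bifield_def split: prod.splits)
  show "lift_bifield M \<Lambda> z F G = 0" if "F \<notin> Cinf C" for z F G
    using that by (cases z) (simp add: lift_bifield_def)
  show "lift_bifield M \<Lambda> z F G = 0" if "z \<notin> point_set C" for z F G
    using that by (cases z) (simp add: lift_bifield_def)
next
  fix z F assume z: "z \<in> point_set C" and F: "F \<in> Cinf C"
  obtain p t where zz: "z = (p, t)" by fastforce
  with z have p: "p \<in> point_set M" "t \<noteq> 0" by (auto simp: point_set_cylinder)
  note T = bivector_fieldD(5)[OF \<Lambda> p(1), of "\<lambda>y. F (y, t)"]
  have "lift_bifield M \<Lambda> z F = (\<lambda>G. if G \<in> Cinf C then \<Lambda> p (\<lambda>y. F (y, t)) (\<lambda>y. G (y, t)) else 0)"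
    using z F by (auto simp: lift_bifield_def zz)
  moreover have "\<dots> \<in> tangent_space C z"
    by (rule tangentI) (auto simp: zz Cinf_add Cinf_mult Cinf_cmult cylinder_atlas tangentD[OF T] cyl_slice p)
  ultimately show "lift_bifield M \<Lambda> z F \<in> tangent_space C z" by simp
next
  fix F G assume F: "F \<in> Cinf C" and G: "G \<in> Cinf C"
  show "(\<lambda>z. lift_bifield M \<Lambda> z F G) \<in> Cinf C"
    unfolding Cinf_iff_smooth_at[OF cylinder_atlas]
  proof
    fix z assume "z \<in> point_set C"
    then have z: "fst z \<in> point_set M" "snd z \<noteq> 0" by (auto simp: point_set_cylinder)
    obtain U \<phi> N \<xi> where U: "(U, \<phi>) \<in> M" and N: "openin (atlas_topology M) N" "fst z \<in> N" "N \<subseteq> U"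
      and \<xi>: "\<And>w. \<xi> w \<in> Cinf M" "\<And>w q. q \<in> N \<Longrightarrow> \<xi> w q = w \<bullet> \<phi> q"
      using frame_M[OF z(1)] by metis
    note o = open_cyl[OF smooth_atlasD(2)[OF M_atlas U]]
    let ?I = "inv_into (U \<times> (- {0::real})) (map_prod \<phi> id)"
    have "smooth_on (\<lambda>x. \<Sum>c\<in>onb. (\<Sum>b\<in>onb. ((\<lambda>z. \<Lambda> (fst z) (\<xi> b) (\<xi> c)) \<circ> ?I) x *
        ((\<lambda>z. ccd U \<phi> F z (b, 0)) \<circ> ?I) x) * ((\<lambda>z. ccd U \<phi> G z (c, 0)) \<circ> ?I) x) (\<phi> ` U \<times> (- {0}))"
      by (rule smooth_on_sum[OF o smooth_on_mult[OF o smooth_on_sum[OF o smooth_on_mult[OF o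
              smooth_on_cyl_of_Cinf[OF U cyl_pullback[OF bivector_fieldD(3)[OF \<Lambda> \<xi>(1) \<xi>(1)]]]
              smooth_on_ccd[OF U F]]] smooth_on_ccd[OF U G]]])
    then have "smooth_on ((\<lambda>z. \<Sum>c\<in>onb. (\<Sum>b\<in>onb. \<Lambda> (fst z) (\<xi> b) (\<xi> c) * ccd U \<phi> F z (b, 0)) * ccd U \<phi> G z (c, 0)) \<circ> ?I)
        (\<phi> ` U \<times> (- {0}))"
      by (simp add: o_def)
    then show "smooth_at C (\<lambda>z. lift_bifield M \<Lambda> z F G) z"
    proof (rule cyl_smooth_atI[OF N(1,2) z(2) U N(3)])
      fix q and t :: real assume q: "q \<in> N" and t: "t \<noteq> 0"
      have qU: "q \<in> U" using q N(3) by blast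
      have qp: "q \<in> point_set M" using qU point_setI[OF U] by blast
      let ?F = "\<lambda>y. F (y, t)" and ?G = "\<lambda>y. G (y, t)"
      have "\<Lambda> q ?F ?G = (\<Sum>c\<in>onb. \<Lambda> q ?F (\<xi> c) * chart_deriv U \<phi> ?G q c)"
        by (rule expand_M[OF U N(1,3) q \<xi> bivector_fieldD(5)[OF \<Lambda> qp] cyl_slice[OF G t]])
      also have "\<dots> = (\<Sum>c\<in>onb. (\<Sum>b\<in>onb. \<Lambda> q (\<xi> b) (\<xi> c) * chart_deriv U \<phi> ?F q b) * chart_deriv U \<phi> ?G q c)"
      proof (intro sum.cong refl arg_cong2[of _ _ _ _ "(*)"])
        fix c :: 'e
        show "\<Lambda> q ?F (\<xi> c) = (\<Sum>b\<in>onb. \<Lambda> q (\<xi> b) (\<xi> c) * chart_deriv U \<phi> ?F q b)"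
          by (rule expand_M[OF U N(1,3) q \<xi> bivector_fieldD(6)[OF \<Lambda> qp] cyl_slice[OF F t]])
      qed
      finally show "(\<Sum>c\<in>onb. (\<Sum>b\<in>onb. \<Lambda> (fst (q, t)) (\<xi> b) (\<xi> c) * ccd U \<phi> F (q, t) (b, 0)) * ccd U \<phi> G (q, t) (c, 0)) =
          lift_bifield M \<Lambda> (q, t) F G"
        using ccd_slice[OF U F qU t] ccd_slice[OF U G qU t] qp t F G by (simp add: lift_bifield_def point_set_cylinder)
    qed
  qed
qed

text \<open>\<open>t_times\<close> of the constant 1 is t, so v kills t; then v(t f) = t v(f) with t
  not 0 at z, so v kills basic functions, and with them all coordinates.\<close>

lemma cyl_jet_determining:
  assumes z: "z \<in> point_set C"
  shows "jet_determining C z (insert (\<lambda>_. 1) (t_times ` Cinf M))"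
proof (rule jet_determiningI[OF cylinder_atlas])
  show "insert (\<lambda>_. 1) (t_times ` Cinf M) \<subseteq> Cinf C"
    using t_times_Cinf Cinf_const[OF cylinder_atlas] by blast
  show "(\<lambda>_. 1) \<in> insert (\<lambda>_. 1) (t_times ` Cinf M)" by simp
  fix v F assume v: "v \<in> tangent_space C z" and v0: "\<And>s. s \<in> insert (\<lambda>_. 1) (t_times ` Cinf M) \<Longrightarrow> v s = 0"
    and F: "F \<in> Cinf C"
  have zM: "fst z \<in> point_set M" "snd z \<noteq> 0" using z by (auto simp: point_set_cylinder)
  have t: "v snd = 0"
  proof -
    have "v (t_times (\<lambda>_. 1)) = 0" by (intro v0 insertI2 imageI Cinf_const M_atlas)
    then show ?thesis by (simp add: t_times_eq)
  qed
  have f: "v (\<lambda>z. f (fst z)) = 0" if "f \<in> Cinf M" for f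
  proof -
    have "v (t_times f) = 0" by (intro v0 insertI2 imageI that)
    then show ?thesis
      using tangentD(2)[OF v snd_Cinf cyl_pullback[OF that]] t zM(2) by (simp add: t_times_eq)
  qed
  obtain U \<phi> N \<xi> where U: "(U, \<phi>) \<in> M" and N: "openin (atlas_topology M) N" "fst z \<in> N" "N \<subseteq> U"
    and \<xi>: "\<And>w. \<xi> w \<in> Cinf M" "\<And>w q. q \<in> N \<Longrightarrow> \<xi> w q = w \<bullet> \<phi> q"
    using frame_M[OF zM(1)] by metis
  define X where "X b z = \<xi> (fst b) (fst z) + snd b * snd z" for b :: "'e \<times> real" and z
  have st: "(\<lambda>z. c * snd z) \<in> Cinf C" for c by (rule Cinf_cmult[OF cylinder_atlas snd_Cinf])
  have "v F = (\<Sum>b\<in>onb. v (X b) * ccd U \<phi> F z b)"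
  proof (rule tangent_expand[OF cylinder_atlas cylinder_separated cyl_chart[OF U] _ _ _ _ _ _ v F])
    show "X b \<in> Cinf C" for b
      unfolding X_def[abs_def] by (intro Cinf_add cylinder_atlas cyl_pullback \<xi> st)
    show "open (\<phi> ` (U \<inter> N) \<times> (- {0::real}))" by (rule open_cyl[OF openin_chart_image[OF M_atlas U N(1)]])
    show "X b z' = b \<bullet> map_prod \<phi> id z'"
      if "z' \<in> U \<times> - {0}" "map_prod \<phi> id z' \<in> \<phi> ` (U \<inter> N) \<times> - {0}" for b z'
      using that smooth_atlasD(1)[OF M_atlas U] \<xi>(2) by (auto simp: X_def inner_prod_def inj_on_def)
  qed (use zM N in \<open>auto simp: mem_Times_iff cyl_image\<close>)
  moreover have "v (X b) = 0" for b
    unfolding X_def[abs_def]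
    using tangentD(1)[OF v cyl_pullback[OF \<xi>(1)] st] tangentD(3)[OF v snd_Cinf] t f[OF \<xi>(1)] by simp
  ultimately show "v F = 0" by simp
qed

lemma cyl_bivector_eqI:
  assumes P: "bivector_field C P" and Q: "bivector_field C Q"
    and eq: "\<And>f g z. f \<in> Cinf M \<Longrightarrow> g \<in> Cinf M \<Longrightarrow> z \<in> point_set C \<Longrightarrow>
      P z (t_times f) (t_times g) = Q z (t_times f) (t_times g)"
  shows "P = Q"
proof (intro ext)
  fix z F G
  show "P z F G = Q z F G"
  proof (cases "z \<in> point_set C \<and> F \<in> Cinf C \<and> G \<in> Cinf C")
    case False
    then consider "z \<notin> point_set C" | "F \<notin> Cinf C" | "G \<notin> Cinf C" by blast
    then show ?thesis
      by cases (simp_all add: bivector_fieldD(2,7,8)[OF P] bivector_fieldD(2,7,8)[OF Q])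
  next
    case True
    then have zp: "z \<in> point_set C" by blast
    have fo: "first_order C z (\<lambda>f. R z f g)" "first_order C z (\<lambda>g. R z f g)"
      and 1: "R z (\<lambda>_. 1) g = 0" "R z g (\<lambda>_. 1) = 0" if R: "bivector_field C R" for R f g
      using tangent_first_order[OF bivector_fieldD(6)[OF R zp], of g 0]
        tangent_first_order[OF bivector_fieldD(5)[OF R zp], of f 0]
        tangent_const[OF cylinder_atlas bivector_fieldD(6)[OF R zp]]
        tangent_const[OF cylinder_atlas bivector_fieldD(5)[OF R zp]] by simp_all
    show ?thesis
    proof (rule bifirst_order_eqI[OF cyl_jet_determining[OF zp], of "P z" "Q z"])
      show "P z s t = Q z s t" if "s \<in> insert (\<lambda>_. 1) (t_times ` Cinf M)"
        "t \<in> insert (\<lambda>_. 1) (t_times ` Cinf M)" for s t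
        using that eq[OF _ _ zp] 1[OF P] 1[OF Q] by auto
    qed (use fo[OF P] fo[OF Q] True in auto)
  qed
qed

section \<open>Poissonization of a Jacobi structure\<close>

lemma poissonization_bivector_field:
  assumes \<Lambda>: "bivector_field M \<Lambda>" and E: "vector_field M E"
  shows "bivector_field C (poissonization M \<Lambda> E)"
proof -
  note L = lift_bivector_field[OF \<Lambda>]
  note W = wedge_bivector_field[OF cylinder_atlas cylinder_separated d_dt_vector_field lift_vector_field[OF E]]
  have r: "(\<lambda>z. 1 / snd z) \<in> Cinf C"
    by (rule cyl_height, rule smooth_on_divide) (auto intro!: smooth_intros)
  show ?thesis
  proof (rule bivector_fieldI[OF cylinder_atlas cylinder_separated])
    show "poissonization M \<Lambda> E z F G = - poissonization M \<Lambda> E z G F" for z F G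
      using bivector_fieldD(4)[OF L, of z F G] bivector_fieldD(4)[OF W, of z F G] by (simp add: poissonization_def)
    show "poissonization M \<Lambda> E z F \<in> tangent_space C z" if z: "z \<in> point_set C" for z F
    proof -
      have "(\<lambda>G. (1 / snd z) * lift_bifield M \<Lambda> z F G + wedge (d_dt M) (lift_vfield M E) z F G) \<in> tangent_space C z"
        by (intro tangent_add_closed tangent_scale_closed bivector_fieldD(5)[OF L z] bivector_fieldD(5)[OF W z])
      then show ?thesis by (simp add: poissonization_def)
    qed
    show "(\<lambda>z. poissonization M \<Lambda> E z F G) \<in> Cinf C" if "F \<in> Cinf C" "G \<in> Cinf C" for F G
      unfolding poissonization_def
      by (intro Cinf_add Cinf_mult cylinder_atlas r bivector_fieldD(3)[OF L] bivector_fieldD(3)[OF W] that)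
  qed (use bivector_fieldD(2,7)[OF L] bivector_fieldD(2,7)[OF W] in \<open>auto simp: poissonization_def\<close>)
qed

text \<open>Differentiating t f in t gives f, and E(t f) = t E(f), so the wedge term contributes t
  (f E(g) - g E(f)). The bivector contributes t^2 \<Lambda>(f, g), which the factor 1/t reduces to
  the same degree.\<close>

lemma poissonization_t_times:
  assumes \<Lambda>: "bivector_field M \<Lambda>" and E: "vector_field M E" and f: "f \<in> Cinf M" and g: "g \<in> Cinf M"
    and x: "x \<in> point_set M" and t: "t \<noteq> 0"
  shows "poissonization M \<Lambda> E (x, t) (t_times f) (t_times g) = t * jacobi_bracket \<Lambda> E f g x"
proof -
  have z: "(x, t) \<in> point_set C" using x t by (simp add: point_set_cylinder)
  have d: "d_dt M (x, t) (t_times h) = h x" if h: "h \<in> Cinf M" for h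
  proof -
    obtain U \<phi> where U: "(U, \<phi>) \<in> M" "(x, t) \<in> U \<times> (- {0})" using z by (rule cyl_point)
    have "((\<lambda>s. t_times h (x, s)) has_real_derivative h x) (at t)"
      unfolding t_times_def by (auto intro!: derivative_eq_intros)
    then show ?thesis using d_dt_chart(2)[OF U(1) t_times_Cinf[OF h] U(2)] DERIV_unique by fastforce
  qed
  have e: "lift_vfield M E (x, t) (t_times h) = t * E x h" if h: "h \<in> Cinf M" for h
    using z t_times_Cinf[OF h] tangentD(3)[OF vector_fieldD(1)[OF E x] h, of t] by (simp add: lift_vfield_def t_times_def)
  have l: "lift_bifield M \<Lambda> (x, t) (t_times f) (t_times g) = t * (t * \<Lambda> x f g)"
    using z t_times_Cinf[OF f] t_times_Cinf[OF g] tangentD(3)[OF bivector_fieldD(5)[OF \<Lambda> x] g, of "\<lambda>y. t * f y" t]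
      tangentD(3)[OF bivector_fieldD(6)[OF \<Lambda> x] f, of t g]
    by (simp add: lift_bifield_def t_times_def)
  show ?thesis
    using t by (simp add: poissonization_def wedge_def d e l f g jacobi_bracket_def algebra_simps)
qed

lemma jacobi_fieldsI: "bivector_field M \<Lambda> \<Longrightarrow> vector_field M E \<Longrightarrow> jacobi_fields M \<Lambda> E"
  by unfold_locales (auto simp: M_atlas)

lemma poissonization_linear_poisson:
  assumes J: "jacobi_structure M \<Lambda> E"
  shows "linear_poisson M (poissonization M \<Lambda> E)"
proof -
  have \<Lambda>: "bivector_field M \<Lambda>" and E: "vector_field M E" using J by (auto simp: jacobi_structure_def)
  let ?P = "poissonization M \<Lambda> E"
  interpret j: jacobi_fields M \<Lambda> E by (rule jacobi_fieldsI[OF \<Lambda> E])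
  note B = poissonization_bivector_field[OF \<Lambda> E]
  interpret h: jacobi_fields C ?P "\<lambda>_ _. 0" by (rule poisson_jacobi_fields[OF cylinder_atlas B])
  have h_br: "h.br F G z = ?P z F G" for F G z by (simp add: jacobi_bracket_def)
  have P: "?P z (t_times f) (t_times g) = t_times (j.br f g) z"
    if "f \<in> Cinf M" "g \<in> Cinf M" "z \<in> point_set C" for f g z
    using poissonization_t_times[OF \<Lambda> E that(1,2), of "fst z" "snd z"] that(3)
    by (cases z) (simp add: t_times_def point_set_cylinder)
  have br2: "h.br (t_times f) (h.br (t_times g) (t_times k)) z = t_times (j.br f (j.br g k)) z"
    if f: "f \<in> Cinf M" "g \<in> Cinf M" "k \<in> Cinf M" and z: "z \<in> point_set C" for f g k z
  proof -
    have "h.br (t_times f) (h.br (t_times g) (t_times k)) z = h.br (t_times f) (t_times (j.br g k)) z"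
      by (rule h.br_cong(2)[OF z h.br_Cinf[OF t_times_Cinf[OF f(2)] t_times_Cinf[OF f(3)]]])
        (simp add: h_br P[OF f(2,3)])
    then show ?thesis using P[OF f(1) j.br_Cinf[OF f(2,3)] z] by (simp add: h_br)
  qed
  have "jacobi_identity C h.br"
    unfolding h.jacobi_identity_iff
  proof (intro ballI)
    fix F G K z assume F: "F \<in> Cinf C" "G \<in> Cinf C" "K \<in> Cinf C" and z: "z \<in> point_set C"
    show "h.jacobiator F G K z = 0"
    proof (rule poisson_jacobiator_zeroI[OF cylinder_atlas B z cyl_jet_determining[OF z] _ F])
      fix s t u assume "s \<in> t_times ` Cinf M" "t \<in> t_times ` Cinf M" "u \<in> t_times ` Cinf M"
      then obtain f g k where f: "f \<in> Cinf M" "g \<in> Cinf M" "k \<in> Cinf M" "s = t_times f" "t = t_times g" "u = t_times k"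
        by blast
      have "fst z \<in> point_set M" using z by (auto simp: point_set_cylinder)
      then have "j.br f (j.br g k) (fst z) + j.br g (j.br k f) (fst z) + j.br k (j.br f g) (fst z) = 0"
        using J f by (simp add: jacobi_structure_def jacobi_identity_def)
      moreover have "h.jacobiator s t u z =
          t_times (j.br f (j.br g k)) z + t_times (j.br g (j.br k f)) z + t_times (j.br k (j.br f g)) z"
        using f(1-3) z by (simp add: h.jacobiator_def f(4-6) br2)
      ultimately show "h.jacobiator s t u z = 0"
        by (simp add: t_times_eq distrib_left[symmetric])
    qed
  qed
  then have "poisson_structure C ?P"
    using B by (simp add: poisson_structure_def poisson_bracket_eq_jacobi)
  moreover have "\<exists>h\<in>Cinf M. \<forall>z\<in>point_set C. ?P z (t_times f) (t_times g) = t_times h z"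
    if "f \<in> Cinf M" "g \<in> Cinf M" for f g
    using P[OF that] j.br_Cinf[OF that] by blast
  ultimately show ?thesis by (simp add: linear_poisson_def)
qed

text \<open>On the slice \<open>t = 1\<close> a linear Poisson tensor \<open>P\<close> gives back \<open>E f = P(dt, df)\<close> and
  \<open>\<Lambda>(df, dg) = P(df, dg)\<close>.\<close>

lemma linear_poisson_slice:
  assumes P: "linear_poisson M P"
  obtains \<Lambda> E where "jacobi_structure M \<Lambda> E"
    "\<And>f g x t. f \<in> Cinf M \<Longrightarrow> g \<in> Cinf M \<Longrightarrow> x \<in> point_set M \<Longrightarrow> t \<noteq> 0 \<Longrightarrow>
      P (x, t) (t_times f) (t_times g) = t * jacobi_bracket \<Lambda> E f g x"
proof -
  have B: "bivector_field C P" and J: "jacobi_identity C (poisson_bracket P)"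
    and lin: "\<And>f g. f \<in> Cinf M \<Longrightarrow> g \<in> Cinf M \<Longrightarrow> \<exists>h\<in>Cinf M. \<forall>z\<in>point_set C. P z (t_times f) (t_times g) = t_times h z"
    using P by (auto simp: linear_poisson_def poisson_structure_def)
  define E where "E x f = (if x \<in> point_set M \<and> f \<in> Cinf M then P (x, 1) snd (\<lambda>z. f (fst z)) else 0)" for x f
  define \<Lambda> where "\<Lambda> x f g = (if x \<in> point_set M \<and> f \<in> Cinf M \<and> g \<in> Cinf M
     then P (x, 1) (\<lambda>z. f (fst z)) (\<lambda>z. g (fst z)) else 0)" for x f g
  have x1: "(x, 1) \<in> point_set C" if "x \<in> point_set M" for x using that by (simp add: point_set_cylinder)
  have T: "(\<lambda>f. if f \<in> Cinf M then v (\<lambda>z. f (fst z)) else 0) \<in> tangent_space M x"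
    if v: "v \<in> tangent_space C (x, 1)" for v x
    by (rule tangentI) (auto simp: Cinf_add Cinf_mult Cinf_cmult M_atlas tangentD[OF v] cyl_pullback)
  have E: "vector_field M E"
    unfolding vector_field_def
  proof (intro conjI ballI allI impI)
    fix x assume x: "x \<in> point_set M"
    then have "E x = (\<lambda>f. if f \<in> Cinf M then P (x, 1) snd (\<lambda>z. f (fst z)) else 0)" by (auto simp: E_def)
    then show "E x \<in> tangent_space M x" using T[OF bivector_fieldD(5)[OF B x1[OF x]]] by simp
  next
    fix f assume f: "f \<in> Cinf M"
    show "(\<lambda>x. E x f) \<in> Cinf M"
      by (rule Cinf_cong[OF M_atlas cyl_slice[OF bivector_fieldD(3)[OF B snd_Cinf cyl_pullback[OF f]], of 1]])
        (simp_all add: E_def f)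
  qed (auto simp: E_def)
  have \<Lambda>: "bivector_field M \<Lambda>"
  proof (rule bivector_fieldI[OF M_atlas M_separated])
    show "\<Lambda> x f g = - \<Lambda> x g f" for x f g
      using bivector_fieldD(4)[OF B, of "(x, 1)" "\<lambda>z. f (fst z)" "\<lambda>z. g (fst z)"] by (auto simp: \<Lambda>_def)
    fix x f assume x: "x \<in> point_set M" and f: "f \<in> Cinf M"
    then have "\<Lambda> x f = (\<lambda>g. if g \<in> Cinf M then P (x, 1) (\<lambda>z. f (fst z)) (\<lambda>z. g (fst z)) else 0)" by (auto simp: \<Lambda>_def)
    then show "\<Lambda> x f \<in> tangent_space M x" using T[OF bivector_fieldD(5)[OF B x1[OF x]]] by simp
  next
    fix f g assume f: "f \<in> Cinf M" and g: "g \<in> Cinf M"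
    show "(\<lambda>x. \<Lambda> x f g) \<in> Cinf M"
      by (rule Cinf_cong[OF M_atlas cyl_slice[OF bivector_fieldD(3)[OF B cyl_pullback[OF f] cyl_pullback[OF g]], of 1]])
        (simp_all add: \<Lambda>_def f g)
  qed (auto simp: \<Lambda>_def)
  interpret j: jacobi_fields M \<Lambda> E by (rule jacobi_fieldsI[OF \<Lambda> E])
  have br: "P (x, 1) (t_times f) (t_times g) = j.br f g x"
    if f: "f \<in> Cinf M" and g: "g \<in> Cinf M" and x: "x \<in> point_set M" for f g x
  proof -
    note T1 = tangentD(2)[OF bivector_fieldD(6)[OF B x1[OF x]] snd_Cinf cyl_pullback[OF f]]
    note T2 = tangentD(2)[OF bivector_fieldD(5)[OF B x1[OF x]] snd_Cinf cyl_pullback[OF g]]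
    have "P (x, 1) snd snd = 0" using bivector_fieldD(4)[OF B, of "(x, 1)" snd snd] by simp
    moreover have "P (x, 1) (\<lambda>z. f (fst z)) snd = - P (x, 1) snd (\<lambda>z. f (fst z))" by (rule bivector_fieldD(4)[OF B])
    ultimately show ?thesis
      using f g x by (simp add: t_times_eq T1 T2 jacobi_bracket_def E_def \<Lambda>_def algebra_simps)
  qed
  \<comment> \<open>Linearity of P provides one function h for all t, and the slice t = 1 identifies
    it.\<close>
  have Pt: "P (x, t) (t_times f) (t_times g) = t * j.br f g x"
    if f: "f \<in> Cinf M" and g: "g \<in> Cinf M" and x: "x \<in> point_set M" and t: "t \<noteq> 0" for f g x t
  proof -
    obtain h where h: "\<And>z. z \<in> point_set C \<Longrightarrow> P z (t_times f) (t_times g) = t_times h z" using lin[OF f g] by blast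
    have "h x = j.br f g x" using h[OF x1[OF x]] br[OF f g x] by (simp add: t_times_def)
    then show ?thesis using h[of "(x, t)"] x t by (simp add: t_times_def point_set_cylinder)
  qed
  have br2: "j.br f (j.br g k) x = poisson_bracket P (t_times f) (poisson_bracket P (t_times g) (t_times k)) (x, 1)"
    if f: "f \<in> Cinf M" "g \<in> Cinf M" "k \<in> Cinf M" and x: "x \<in> point_set M" for f g k x
  proof -
    have "P (x, 1) (t_times f) (t_times (j.br g k)) = P (x, 1) (t_times f) (\<lambda>z. P z (t_times g) (t_times k))"
    proof (rule tangent_cong[OF cylinder_atlas bivector_fieldD(5)[OF B x1[OF x]] x1[OF x] t_times_Cinf[OF j.br_Cinf[OF f(2,3)]]])
      fix z assume "z \<in> point_set C"
      then have "fst z \<in> point_set M" "snd z \<noteq> 0" by (auto simp: point_set_cylinder)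
      then show "t_times (j.br g k) z = P z (t_times g) (t_times k)"
        using Pt[OF f(2,3), of "fst z" "snd z"] by (simp add: t_times_eq[of "j.br g k"])
    qed
    then show ?thesis using br[OF f(1) j.br_Cinf[OF f(2,3)] x] by (simp add: poisson_bracket_def)
  qed
  have "jacobi_identity M j.br"
    unfolding jacobi_identity_def
    using J x1 t_times_Cinf by (simp add: br2 jacobi_identity_def)
  then have "jacobi_structure M \<Lambda> E" using \<Lambda> E by (simp add: jacobi_structure_def)
  with Pt show thesis by (intro that) auto
qed

end

section \<open>Rank zero\<close>

text \<open>Vectors act on smooth functions, so F enters only as a bijection of points that matches
  the smooth functions of the two atlases.\<close>

lemma push_jacobi_structure:
  fixes \<A> :: "('n, 'e::fin_dim_inner) atlas" and \<B> :: "('k, 'g::fin_dim_inner) atlas"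
  assumes A: "smooth_atlas \<A>" and B: "smooth_atlas \<B>" "separated \<B>"
    and F: "bij_betw F (point_set \<A>) (point_set \<B>)"
    and C: "\<And>f. f \<in> Cinf \<B> \<longleftrightarrow> f \<circ> F \<in> Cinf \<A>"
    and J: "jacobi_structure \<A> \<Lambda> E"
  shows "jacobi_structure \<B> (push_bifield (point_set \<A>) F \<Lambda>) (push_vfield (point_set \<A>) F E)"
    (is "jacobi_structure \<B> ?\<Lambda> ?E")
proof -
  let ?i = "inv_into (point_set \<A>) F"
  have \<Lambda>: "bivector_field \<A> \<Lambda>" and E: "vector_field \<A> E" using J by (auto simp: jacobi_structure_def)
  interpret a: jacobi_fields \<A> \<Lambda> E by unfold_locales (rule A \<Lambda> E)+
  have im: "F ` point_set \<A> = point_set \<B>" using F by (simp add: bij_betw_def)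
  have inv: "?i (F x) = x" if "x \<in> point_set \<A>" for x using F that by (simp add: bij_betw_def)
  have i: "?i q \<in> point_set \<A>" "F (?i q) = q" if "q \<in> point_set \<B>" for q
    using inv_into_into[of q F "point_set \<A>"] f_inv_into_f[of q F "point_set \<A>"] that
    unfolding im by blast+
  have E_at: "?E q f = E (?i q) (f \<circ> F)" if "q \<in> point_set \<B>" for q f
    using that im by (simp add: push_vfield_def)
  have \<Lambda>_at: "?\<Lambda> q f g = \<Lambda> (?i q) (f \<circ> F) (g \<circ> F)" if "q \<in> point_set \<B>" for q f g
    using that im by (simp add: push_bifield_def)
  have T: "(\<lambda>f. v (f \<circ> F)) \<in> tangent_space \<B> q" if q: "q \<in> point_set \<B>" and v: "v \<in> tangent_space \<A> (?i q)" for v q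
  proof (rule tangentI)
    fix f g assume fg: "f \<in> Cinf \<B>" "g \<in> Cinf \<B>"
    then show "v ((\<lambda>q. f q + g q) \<circ> F) = v (f \<circ> F) + v (g \<circ> F)"
      using tangentD(1)[OF v, of "f \<circ> F" "g \<circ> F"] C by (simp add: o_def)
    show "v ((\<lambda>q. f q * g q) \<circ> F) = v (f \<circ> F) * g q + f q * v (g \<circ> F)"
      using tangentD(2)[OF v, of "f \<circ> F" "g \<circ> F"] fg C i(2)[OF q] by (simp add: o_def)
  next
    show "v ((\<lambda>q. c * f q) \<circ> F) = c * v (f \<circ> F)" if "f \<in> Cinf \<B>" for c f
      using tangentD(3)[OF v, of "f \<circ> F" c] that C by (simp add: o_def)
    show "v (f \<circ> F) = 0" if "f \<notin> Cinf \<B>" for f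
      using tangentD(4)[OF v] that C by blast
  qed
  have vE: "vector_field \<B> ?E"
    unfolding vector_field_def
  proof (intro conjI ballI allI impI)
    fix q assume q: "q \<in> point_set \<B>"
    have "?E q = (\<lambda>f. E (?i q) (f \<circ> F))" using E_at[OF q] by blast
    then show "?E q \<in> tangent_space \<B> q" using T[OF q vector_fieldD(1)[OF E i(1)[OF q]]] by simp
  next
    show "?E q = (\<lambda>_. 0)" if "q \<notin> point_set \<B>" for q
      using that im by (auto simp: push_vfield_def)
  next
    fix f assume f: "f \<in> Cinf \<B>"
    have "(\<lambda>q. ?E q f) \<circ> F \<in> Cinf \<A>"
      by (rule Cinf_cong[OF A vector_fieldD(3)[OF E iffD1[OF C f]]])
        (auto simp: push_vfield_def inv)
    then show "(\<lambda>q. ?E q f) \<in> Cinf \<B>" using C by blast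
  qed
  have b\<Lambda>: "bivector_field \<B> ?\<Lambda>"
  proof (rule bivector_fieldI[OF B])
    show "?\<Lambda> q f g = - ?\<Lambda> q g f" for q f g
      using bivector_fieldD(4)[OF \<Lambda>, of "?i q" "f \<circ> F" "g \<circ> F"] by (simp add: push_bifield_def)
    fix q f assume q: "q \<in> point_set \<B>" and f: "f \<in> Cinf \<B>"
    have "?\<Lambda> q f = (\<lambda>g. \<Lambda> (?i q) (f \<circ> F) (g \<circ> F))" using \<Lambda>_at[OF q] by blast
    then show "?\<Lambda> q f \<in> tangent_space \<B> q" using T[OF q bivector_fieldD(5)[OF \<Lambda> i(1)[OF q]]] by simp
  next
    fix q f g assume q: "q \<in> point_set \<B>" and f: "f \<notin> Cinf \<B>"
    then show "?\<Lambda> q f g = 0" using bivector_fieldD(7)[OF \<Lambda>] C by (simp add: \<Lambda>_at)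
  next
    show "?\<Lambda> q f g = 0" if "q \<notin> point_set \<B>" for q f g
      using that im by (auto simp: push_bifield_def)
  next
    fix f g assume f: "f \<in> Cinf \<B>" and g: "g \<in> Cinf \<B>"
    have "(\<lambda>q. ?\<Lambda> q f g) \<circ> F \<in> Cinf \<A>"
      by (rule Cinf_cong[OF A bivector_fieldD(3)[OF \<Lambda> iffD1[OF C f] iffD1[OF C g]]])
        (auto simp: push_bifield_def inv)
    then show "(\<lambda>q. ?\<Lambda> q f g) \<in> Cinf \<B>" using C by blast
  qed
  interpret b: jacobi_fields \<B> ?\<Lambda> ?E by unfold_locales (rule B b\<Lambda> vE)+
  have br: "b.br f g (F x) = a.br (f \<circ> F) (g \<circ> F) x" if "x \<in> point_set \<A>" for f g x
  proof -
    have "F x \<in> point_set \<B>" using that im by blast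
    then show ?thesis using that by (simp add: jacobi_bracket_def E_at \<Lambda>_at inv)
  qed
  have br2: "b.br f (b.br g h) (F x) = a.br (f \<circ> F) (a.br (g \<circ> F) (h \<circ> F)) x"
    if "x \<in> point_set \<A>" "g \<in> Cinf \<B>" "h \<in> Cinf \<B>" for f g h x
  proof -
    have "b.br f (b.br g h) (F x) = a.br (f \<circ> F) (b.br g h \<circ> F) x" by (rule br[OF that(1)])
    also have "\<dots> = a.br (f \<circ> F) (a.br (g \<circ> F) (h \<circ> F)) x"
      by (rule a.br_cong(2)[OF that(1) iffD1[OF C b.br_Cinf[OF that(2,3)]]]) (simp add: br)
    finally show ?thesis .
  qed
  have "jacobi_identity \<B> b.br"
    unfolding jacobi_identity_def
  proof (intro ballI)
    fix f g h q assume f: "f \<in> Cinf \<B>" "g \<in> Cinf \<B>" "h \<in> Cinf \<B>" and q: "q \<in> point_set \<B>"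
    define x where "x = ?i q"
    have x: "x \<in> point_set \<A>" "q = F x" using i[OF q] by (simp_all add: x_def)
    have "f \<circ> F \<in> Cinf \<A>" "g \<circ> F \<in> Cinf \<A>" "h \<circ> F \<in> Cinf \<A>" using f C by auto
    then show "b.br f (b.br g h) q + b.br g (b.br h f) q + b.br h (b.br f g) q = 0"
      using J x f by (simp add: br2 jacobi_structure_def jacobi_identity_def)
  qed
  then show ?thesis using b\<Lambda> vE by (simp add: jacobi_structure_def)
qed

text \<open>G inverts F on the point set only, so a function and its round trip may differ
  elsewhere. \<open>tangent_cong\<close> for smooth functions, and the value 0 on all others, still
  make the fields equal as HOL functions.\<close>

lemma push_inverse:
  fixes \<A> :: "('n, 'e::fin_dim_inner) atlas"
  assumes A: "smooth_atlas \<A>" and F: "bij_betw F (point_set \<A>) K" and G: "\<And>x. x \<in> point_set \<A> \<Longrightarrow> G (F x) = x"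
  shows "bivector_field \<A> \<Lambda> \<Longrightarrow> push_bifield K G (push_bifield (point_set \<A>) F \<Lambda>) = \<Lambda>"
    and "vector_field \<A> E \<Longrightarrow> push_vfield K G (push_vfield (point_set \<A>) F E) = E"
proof -
  have K: "K = F ` point_set \<A>" and inj: "inj_on F (point_set \<A>)" using F by (auto simp: bij_betw_def)
  have GK: "G ` K = point_set \<A>" unfolding K using G by (auto simp: image_iff)
  have injG: "inj_on G K" unfolding K using G by (auto simp: inj_on_def)
  have iG: "inv_into K G x = F x" if "x \<in> point_set \<A>" for x
    by (rule inv_into_f_eq[OF injG]) (use that G K in auto)
  have iF: "inv_into (point_set \<A>) F (F x) = x" if "x \<in> point_set \<A>" for x using inj that by simp
  have eq: "(f \<circ> G \<circ> F) x = f x" if "x \<in> point_set \<A>" for f :: "'n \<Rightarrow> real" and x using G that by simp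
  have Cin: "f \<circ> G \<circ> F \<in> Cinf \<A> \<longleftrightarrow> f \<in> Cinf \<A>" for f
    using Cinf_cong[OF A, of "f \<circ> G \<circ> F" f] Cinf_cong[OF A, of f "f \<circ> G \<circ> F"] eq[of _ f] by auto
  show "push_bifield K G (push_bifield (point_set \<A>) F \<Lambda>) = \<Lambda>" if \<Lambda>: "bivector_field \<A> \<Lambda>"
  proof (intro ext)
    fix x f g
    show "push_bifield K G (push_bifield (point_set \<A>) F \<Lambda>) x f g = \<Lambda> x f g"
    proof (cases "x \<in> point_set \<A>")
      case True
      have "\<Lambda> x (f \<circ> G \<circ> F) (g \<circ> G \<circ> F) = \<Lambda> x f g"
      proof (cases "f \<in> Cinf \<A> \<and> g \<in> Cinf \<A>")
        case fg: True
        have "\<Lambda> x (f \<circ> G \<circ> F) (g \<circ> G \<circ> F) = \<Lambda> x f (g \<circ> G \<circ> F)"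
          by (rule tangent_cong[OF A bivector_fieldD(6)[OF \<Lambda> True] True]) (use fg Cin eq in auto)
        also have "\<dots> = \<Lambda> x f g"
          by (rule tangent_cong[OF A bivector_fieldD(5)[OF \<Lambda> True] True]) (use fg Cin eq in auto)
        finally show ?thesis .
      next
        case False
        then consider "f \<notin> Cinf \<A>" | "g \<notin> Cinf \<A>" by blast
        then show ?thesis
          by cases (use bivector_fieldD(7,8)[OF \<Lambda>] Cin in \<open>simp_all\<close>)
      qed
      moreover have "push_bifield K G (push_bifield (point_set \<A>) F \<Lambda>) x f g = \<Lambda> x (f \<circ> G \<circ> F) (g \<circ> G \<circ> F)"
        using True by (simp add: push_bifield_def[of K] GK iG) (simp add: push_bifield_def iF)
      ultimately show ?thesis by simp
    next
      case False
      then show ?thesis using bivector_fieldD(2)[OF \<Lambda>] by (simp add: push_bifield_def[of K] GK)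
    qed
  qed
  show "push_vfield K G (push_vfield (point_set \<A>) F E) = E" if E: "vector_field \<A> E"
  proof (intro ext)
    fix x f
    show "push_vfield K G (push_vfield (point_set \<A>) F E) x f = E x f"
    proof (cases "x \<in> point_set \<A>")
      case True
      have "E x (f \<circ> G \<circ> F) = E x f"
      proof (cases "f \<in> Cinf \<A>")
        case f: True
        show ?thesis
          by (rule tangent_cong[OF A vector_fieldD(1)[OF E True] True]) (use f Cin eq in auto)
      next
        case False
        then show ?thesis using vector_fieldD(4)[OF E] Cin by simp
      qed
      moreover have "push_vfield K G (push_vfield (point_set \<A>) F E) x f = E x (f \<circ> G \<circ> F)"
        using True by (simp add: push_vfield_def[of K] GK iG) (simp add: push_vfield_def iF)
      ultimately show ?thesis by simp
    next
      case False
      then show ?thesis using vector_fieldD(2)[OF E] by (simp add: push_vfield_def[of K] GK)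
    qed
  qed
qed

locale rank_zero_ctx = affine_bundle_ctx A
  for A :: "('m, 'e::fin_dim_inner, 'a, 'v, 'f::fin_dim_inner) abundle" +
  assumes rank_zero: "\<And>u::'f. u = 0"

sublocale rank_zero_ctx \<subseteq> B: base_manifold "abase A"
  by unfold_locales (rule base_atlas base_separated)+

context rank_zero_ctx
begin

abbreviation "sec \<equiv> inv_into (atotal A) (aproj A)"

lemma proj_bij: "bij_betw (aproj A) (atotal A) (point_set (abase A))"
  unfolding bij_betw_def
proof
  show "inj_on (aproj A) (atotal A)"
  proof (rule inj_onI)
    fix x x' assume x: "x \<in> atotal A" "x' \<in> atotal A" "aproj A x = aproj A x'"
    obtain U y where U: "(U, y) \<in> atriv A" "aproj A x \<in> U" using AB.proj[OF x(1)] by (rule AB.trivE)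
    have "y x = y x'" using rank_zero by metis
    then show "x = x'" using AB.pt_triv[OF U x(1)] AB.pt_triv[OF U(1) _ x(2)] U(2) x(3) by simp
  qed
  show "aproj A ` atotal A = point_set (abase A)"
  proof (intro equalityI subsetI)
    fix p assume "p \<in> point_set (abase A)"
    then obtain U y where U: "(U, y) \<in> atriv A" "p \<in> U" by (rule AB.trivE)
    then show "p \<in> aproj A ` atotal A" using AB.pt[OF U, of 0] by force
  qed (use AB.proj in auto)
qed

lemma sec: "p \<in> point_set (abase A) \<Longrightarrow> sec p \<in> atotal A" "p \<in> point_set (abase A) \<Longrightarrow> aproj A (sec p) = p"
  "x \<in> atotal A \<Longrightarrow> sec (aproj A x) = x"
  using proj_bij by (auto simp: bij_betw_def f_inv_into_f inv_into_into)

lemma sec_bij: "bij_betw sec (point_set (abase A)) (atotal A)"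
  by (rule bij_betw_inv_into[OF proj_bij])

lemma Cinf_proj: "f \<in> Cinf (abase A) \<longleftrightarrow> f \<circ> aproj A \<in> Cinf (aatlas A)"
proof
  show "f \<circ> aproj A \<in> Cinf (aatlas A)" if "f \<in> Cinf (abase A)"
    using A_pullback[OF that] by (simp add: o_def)
  show "f \<in> Cinf (abase A)" if "f \<circ> aproj A \<in> Cinf (aatlas A)"
    by (rule AB.Cinf_baseI[folded aatlas_eq, OF that]) simp
qed

lemma Cinf_sec: "g \<in> Cinf (aatlas A) \<longleftrightarrow> g \<circ> sec \<in> Cinf (abase A)"
proof -
  have eq: "(g \<circ> sec \<circ> aproj A) x = g x" if "x \<in> point_set (aatlas A)" for x using that by (simp add: sec)
  show ?thesis
    unfolding Cinf_proj
    using Cinf_cong[OF aatlas_smooth, of "g \<circ> sec \<circ> aproj A" g] Cinf_cong[OF aatlas_smooth, of g "g \<circ> sec \<circ> aproj A"] eq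
    by metis
qed

text \<open>A fibre is a single point, so being affine on it is no condition.\<close>

lemma affine_functions_rank_zero: "affine_functions A = Cinf (aatlas A)"
proof (intro equalityI subsetI)
  fix a assume a: "a \<in> Cinf (aatlas A)"
  show "a \<in> affine_functions A"
  proof (rule affine_functionsI[OF a])
    fix U y p assume U: "(U, y) \<in> atriv A" "p \<in> U"
    show "\<exists>w d. \<forall>x\<in>afibre A p. a x = w \<bullet> y x + d"
    proof (intro exI ballI)
      fix x assume "x \<in> afibre A p"
      then have "x = sec p" using sec(3)[of x] by (simp add: afibre_iff)
      then show "a x = 0 \<bullet> y x + a (sec p)" by simp
    qed
  qed
qed (rule affine_Cinf)

lemma affine_jacobi_rank_zero: "affine_jacobi A \<Lambda> E \<longleftrightarrow> jacobi_structure (aatlas A) \<Lambda> E"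
proof -
  have "jacobi_bracket \<Lambda> E a b \<in> Cinf (aatlas A)"
    if "jacobi_structure (aatlas A) \<Lambda> E" "a \<in> Cinf (aatlas A)" "b \<in> Cinf (aatlas A)" for a b
  proof -
    interpret j: jacobi_fields "aatlas A" \<Lambda> E by (rule jacobi_structure_fields[OF that(1)])
    show ?thesis by (rule j.br_Cinf[OF that(2,3)])
  qed
  then show ?thesis by (auto simp: affine_jacobi_def affine_functions_rank_zero)
qed

abbreviation "pushL \<equiv> push_bifield (atotal A) (aproj A)"
abbreviation "pushE \<equiv> push_vfield (atotal A) (aproj A)"

lemma push_jacobi: "jacobi_structure (aatlas A) \<Lambda> E \<Longrightarrow> jacobi_structure (abase A) (pushL \<Lambda>) (pushE E)"
  using push_jacobi_structure[OF aatlas_smooth base_atlas base_separated _ Cinf_proj] proj_bij by simp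

lemma push_jacobi_surj:
  assumes J: "jacobi_structure (abase A) \<Lambda> E"
  obtains \<Lambda>\<^sub>A E\<^sub>A where "jacobi_structure (aatlas A) \<Lambda>\<^sub>A E\<^sub>A" "pushL \<Lambda>\<^sub>A = \<Lambda>" "pushE E\<^sub>A = E"
proof
  show "jacobi_structure (aatlas A) (push_bifield (point_set (abase A)) sec \<Lambda>) (push_vfield (point_set (abase A)) sec E)"
    using push_jacobi_structure[OF base_atlas aatlas_smooth aatlas_separated _ Cinf_sec J] sec_bij by simp
  show "pushL (push_bifield (point_set (abase A)) sec \<Lambda>) = \<Lambda>"
    by (rule push_inverse(1)[OF base_atlas sec_bij]) (use J in \<open>simp_all add: sec jacobi_structure_def\<close>)
  show "pushE (push_vfield (point_set (abase A)) sec E) = E"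
    by (rule push_inverse(2)[OF base_atlas sec_bij]) (use J in \<open>simp_all add: sec jacobi_structure_def\<close>)
qed

lemma push_jacobi_inj:
  assumes "jacobi_structure (aatlas A) \<Lambda> E" "jacobi_structure (aatlas A) \<Lambda>' E'" "pushL \<Lambda> = pushL \<Lambda>'" "pushE E = pushE E'"
  shows "\<Lambda> = \<Lambda>' \<and> E = E'"
proof -
  have b: "bij_betw (aproj A) (point_set (aatlas A)) (point_set (abase A))" using proj_bij by simp
  have s: "\<And>x. x \<in> point_set (aatlas A) \<Longrightarrow> sec (aproj A x) = x" by (simp add: sec)
  note L = push_inverse[OF aatlas_smooth b s, simplified point_set_aatlas]
  have "bivector_field (aatlas A) \<Lambda>" "bivector_field (aatlas A) \<Lambda>'" "vector_field (aatlas A) E" "vector_field (aatlas A) E'"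
    using assms(1,2) by (simp_all add: jacobi_structure_def)
  then show ?thesis using L assms(3,4) by metis
qed

text \<open>Every Jacobi structure on \<open>A\<close> is affine, \<open>aproj A\<close> carries it
  to the base, and there the correspondence is Poissonization, with the slice t = 1 as its
  inverse.\<close>

lemma rank_zero_correspondence:
  "\<exists>\<Phi>. bij_betw \<Phi> {(\<Lambda>, E). affine_jacobi A \<Lambda> E} {P. linear_poisson (abase A) P} \<and>
    (\<forall>\<Lambda>\<^sub>A E\<^sub>A. affine_jacobi A \<Lambda>\<^sub>A E\<^sub>A \<longrightarrow>
      (let \<Lambda> = pushL \<Lambda>\<^sub>A; E = pushE E\<^sub>A
       in jacobi_structure (abase A) \<Lambda> E \<and>
          (\<forall>P. linear_poisson (abase A) P \<longrightarrow>
            (P = \<Phi> (\<Lambda>\<^sub>A, E\<^sub>A) \<longleftrightarrow>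
              (\<forall>f\<in>Cinf (abase A). \<forall>g\<in>Cinf (abase A). \<forall>x\<in>point_set (abase A). \<forall>t. t \<noteq> 0 \<longrightarrow>
                P (x, t) (t_times f) (t_times g) = t * jacobi_bracket \<Lambda> E f g x))) \<and>
          \<Phi> (\<Lambda>\<^sub>A, E\<^sub>A) = poissonization (abase A) \<Lambda> E))"
proof -
  let ?M = "abase A"
  let ?J = "\<lambda>\<Lambda> E. jacobi_structure ?M \<Lambda> E"
  let ?R = "\<lambda>P \<Lambda> E. \<forall>f\<in>Cinf ?M. \<forall>g\<in>Cinf ?M. \<forall>x\<in>point_set ?M. \<forall>t. t \<noteq> 0 \<longrightarrow>
    P (x, t) (t_times f) (t_times g) = t * jacobi_bracket \<Lambda> E f g x"
  define \<Phi> where "\<Phi> = (\<lambda>(\<Lambda>, E). poissonization ?M (pushL \<Lambda>) (pushE E))"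
  have lp: "linear_poisson ?M (poissonization ?M \<Lambda> E)" if "?J \<Lambda> E" for \<Lambda> E
    by (rule B.poissonization_linear_poisson[OF that])
  have R: "?R (poissonization ?M \<Lambda> E) \<Lambda> E" if "?J \<Lambda> E" for \<Lambda> E
    using that B.poissonization_t_times by (auto simp: jacobi_structure_def)
  have uniq: "P = Q" if P: "linear_poisson ?M P" "?R P \<Lambda> E" and Q: "linear_poisson ?M Q" "?R Q \<Lambda> E" for P Q \<Lambda> E
  proof (rule B.cyl_bivector_eqI)
    show "bivector_field (cylinder ?M) P" "bivector_field (cylinder ?M) Q"
      using P(1) Q(1) by (simp_all add: linear_poisson_def poisson_structure_def)
    show "P z (t_times f) (t_times g) = Q z (t_times f) (t_times g)"
      if "f \<in> Cinf ?M" "g \<in> Cinf ?M" "z \<in> point_set (cylinder ?M)" for f g z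
      using P(2) Q(2) that by (cases z) (auto simp: B.point_set_cylinder)
  qed
  have recover: "\<Lambda> = \<Lambda>' \<and> E = E'" if J: "?J \<Lambda> E" "?J \<Lambda>' E'" and R: "?R P \<Lambda> E" "?R P \<Lambda>' E'" for P \<Lambda> E \<Lambda>' E'
  proof -
    have f: "bivector_field ?M \<Lambda>" "bivector_field ?M \<Lambda>'" "vector_field ?M E" "vector_field ?M E'"
      using J by (simp_all add: jacobi_structure_def)
    note j = B.jacobi_fieldsI[OF f(1,3)] B.jacobi_fieldsI[OF f(2,4)]
    have br: "jacobi_bracket \<Lambda> E f g x = jacobi_bracket \<Lambda>' E' f g x"
      if "f \<in> Cinf ?M" "g \<in> Cinf ?M" "x \<in> point_set ?M" for f g x
      using R[THEN bspec, OF that(1), THEN bspec, OF that(2), THEN bspec, OF that(3), THEN spec, of 1] by simp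
    have E: "E x g = E' x g" for x g
    proof (cases "x \<in> point_set ?M \<and> g \<in> Cinf ?M")
      case True
      then show ?thesis
        using br[OF Cinf_const[OF base_atlas, of 1], of g x] jacobi_bracket_one[OF j(1), of x g]
          jacobi_bracket_one[OF j(2), of x g] by simp
    next
      case False
      then show ?thesis
        using vector_fieldD(2,4)[OF f(3)] vector_fieldD(2,4)[OF f(4)] by fastforce
    qed
    have "\<Lambda> x h g = \<Lambda>' x h g" for x h g
    proof (cases "x \<in> point_set ?M \<and> h \<in> Cinf ?M \<and> g \<in> Cinf ?M")
      case True
      then show ?thesis using br[of h g x] E by (simp add: jacobi_bracket_def)
    next
      case False
      then consider "x \<notin> point_set ?M" | "h \<notin> Cinf ?M" | "g \<notin> Cinf ?M" by blast
      then show ?thesis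
        by cases (simp_all add: bivector_fieldD(2,7,8)[OF f(1)] bivector_fieldD(2,7,8)[OF f(2)])
    qed
    with E show ?thesis by blast
  qed
  have "bij_betw \<Phi> {(\<Lambda>, E). affine_jacobi A \<Lambda> E} {P. linear_poisson ?M P}"
    unfolding bij_betw_def
  proof
    show "inj_on \<Phi> {(\<Lambda>, E). affine_jacobi A \<Lambda> E}"
    proof (rule inj_onI, clarify)
      fix \<Lambda> E \<Lambda>' E' assume "affine_jacobi A \<Lambda> E" "affine_jacobi A \<Lambda>' E'" and eq: "\<Phi> (\<Lambda>, E) = \<Phi> (\<Lambda>', E')"
      then have J: "jacobi_structure (aatlas A) \<Lambda> E" "jacobi_structure (aatlas A) \<Lambda>' E'"
        by (simp_all add: affine_jacobi_rank_zero)
      have "pushL \<Lambda> = pushL \<Lambda>' \<and> pushE E = pushE E'"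
        by (rule recover[OF push_jacobi[OF J(1)] push_jacobi[OF J(2)] R[OF push_jacobi[OF J(1)]]])
          (use R[OF push_jacobi[OF J(2)]] eq in \<open>simp add: \<Phi>_def\<close>)
      then show "\<Lambda> = \<Lambda>' \<and> E = E'" using push_jacobi_inj[OF J] by blast
    qed
    show "\<Phi> ` {(\<Lambda>, E). affine_jacobi A \<Lambda> E} = {P. linear_poisson ?M P}"
    proof (intro equalityI subsetI)
      fix P assume "P \<in> \<Phi> ` {(\<Lambda>, E). affine_jacobi A \<Lambda> E}"
      then show "P \<in> {P. linear_poisson ?M P}"
        using lp push_jacobi by (auto simp: \<Phi>_def affine_jacobi_rank_zero)
    next
      fix P assume "P \<in> {P. linear_poisson ?M P}"
      then have P: "linear_poisson ?M P" by simp
      obtain \<Lambda> E where J: "?J \<Lambda> E" and RP: "?R P \<Lambda> E"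
        using B.linear_poisson_slice[OF P] by metis
      obtain \<Lambda>\<^sub>A E\<^sub>A where JA: "jacobi_structure (aatlas A) \<Lambda>\<^sub>A E\<^sub>A" "pushL \<Lambda>\<^sub>A = \<Lambda>" "pushE E\<^sub>A = E"
        using push_jacobi_surj[OF J] .
      have "P = poissonization ?M \<Lambda> E" by (rule uniq[OF P RP lp[OF J] R[OF J]])
      then show "P \<in> \<Phi> ` {(\<Lambda>, E). affine_jacobi A \<Lambda> E}"
        using JA by (intro image_eqI[of _ _ "(\<Lambda>\<^sub>A, E\<^sub>A)"]) (simp_all add: \<Phi>_def affine_jacobi_rank_zero)
    qed
  qed
  moreover have "?J (pushL \<Lambda>\<^sub>A) (pushE E\<^sub>A) \<and>
      (\<forall>P. linear_poisson ?M P \<longrightarrow> (P = \<Phi> (\<Lambda>\<^sub>A, E\<^sub>A) \<longleftrightarrow> ?R P (pushL \<Lambda>\<^sub>A) (pushE E\<^sub>A))) \<and>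
      \<Phi> (\<Lambda>\<^sub>A, E\<^sub>A) = poissonization ?M (pushL \<Lambda>\<^sub>A) (pushE E\<^sub>A)" if "affine_jacobi A \<Lambda>\<^sub>A E\<^sub>A" for \<Lambda>\<^sub>A E\<^sub>A
  proof (intro conjI allI impI)
    show J: "?J (pushL \<Lambda>\<^sub>A) (pushE E\<^sub>A)"
      using that push_jacobi by (simp add: affine_jacobi_rank_zero)
    show \<Phi>: "\<Phi> (\<Lambda>\<^sub>A, E\<^sub>A) = poissonization ?M (pushL \<Lambda>\<^sub>A) (pushE E\<^sub>A)" by (simp add: \<Phi>_def)
    fix P assume P: "linear_poisson ?M P"
    show "P = \<Phi> (\<Lambda>\<^sub>A, E\<^sub>A) \<longleftrightarrow> ?R P (pushL \<Lambda>\<^sub>A) (pushE E\<^sub>A)"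
    proof
      show "?R P (pushL \<Lambda>\<^sub>A) (pushE E\<^sub>A)" if "P = \<Phi> (\<Lambda>\<^sub>A, E\<^sub>A)" using R[OF J] unfolding that \<Phi> .
      show "P = \<Phi> (\<Lambda>\<^sub>A, E\<^sub>A)" if "?R P (pushL \<Lambda>\<^sub>A) (pushE E\<^sub>A)"
        unfolding \<Phi> by (rule uniq[OF P that lp[OF J] R[OF J]])
    qed
  qed
  ultimately show ?thesis
    unfolding Let_def by (intro exI[of _ \<Phi>] conjI allI impI) blast+
qed

subsection \<open>The identification of the cylinder with the complement of the zero section\<close>

lemma cylinder_map_hpt:
  assumes U: "(U, y) \<in> atriv A" "p \<in> U"
  shows "cylinder_map A (p, t) = hpt y p (0, t)"
proof -
  have p: "p \<in> point_set (abase A)" using atrivD(3)[OF U(1)] U(2) by blast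
  note s = sec(1,2)[OF p]
  note ev = evaluation(1,2)[OF s(1)] and v = vscale_total[OF evaluation(1)[OF s(1)]]
  let ?z = "vscale (hat A) t (evaluation A (sec p))"
  have "hcoord y ?z = t *\<^sub>R (y (sec p), 1)"
    using v(3)[OF U(1), of t] evaluation(3)[OF s(1) U(1)] ev(2) s(2) U(2) by simp
  also have "\<dots> = (0, t)" using rank_zero by (simp add: prod_eq_iff)
  finally have "hcoord y ?z = (0, t)" .
  then show ?thesis
    using hpt_hcoord[OF U(1) v(1)[of t]] v(2)[of t] ev(2) s(2) U(2) by (simp add: cylinder_map_def)
qed

lemma zero_section_iff: "z \<in> zero_section (hat A) \<longleftrightarrow> z \<in> H \<and> \<not> nonzero z"
  by (cases z) (auto simp: zero_section_def hat_simps nonzero_def fun_eq_iff)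

lemma nonzero_rank_zero: "z \<in> H \<Longrightarrow> (U, y) \<in> atriv A \<Longrightarrow> fst z \<in> U \<Longrightarrow> nonzero z \<longleftrightarrow> snd (hcoord y z) \<noteq> 0"
  using nonzero_iff[of U y z] rank_zero by (auto simp: prod_eq_iff)

abbreviation "H\<^sub>0 \<equiv> open_submanifold (vatlas (hat A)) (H - zero_section (hat A))"
abbreviation "cyl \<equiv> cylinder (abase A)"

lemma cyl_map:
  assumes "p \<in> point_set (abase A)" "t \<noteq> 0"
  shows "cylinder_map A (p, t) \<in> H" "nonzero (cylinder_map A (p, t))" "fst (cylinder_map A (p, t)) = p"
    "(U, y) \<in> atriv A \<Longrightarrow> p \<in> U \<Longrightarrow> hcoord y (cylinder_map A (p, t)) = (0, t)"
proof -
  obtain U y where U: "(U, y) \<in> atriv A" "p \<in> U" using assms(1) by (rule AB.trivE)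
  show 1: "cylinder_map A (p, t) \<in> H" "fst (cylinder_map A (p, t)) = p"
    by (simp_all add: cylinder_map_hpt[OF U] hpt_total[OF U] fst_hpt[OF U])
  show h: "hcoord y (cylinder_map A (p, t)) = (0, t)" if "(U, y) \<in> atriv A" "p \<in> U" for U y
    by (simp add: cylinder_map_hpt[OF that] hcoord_hpt[OF that])
  show "nonzero (cylinder_map A (p, t))"
    using nonzero_rank_zero[OF 1(1) U(1)] 1(2) U h[OF U] assms(2) by simp
qed

text \<open>The inverse of the identification is (\<open>fst\<close>, \<open>\<tau>\<close>): in
  rank 0 the value on the function 1 is the only fibre coordinate of the hull.\<close>

lemma cyl_map_height:
  assumes z: "z \<in> H" "nonzero z"
  shows "\<tau> z \<noteq> 0" "cylinder_map A (fst z, \<tau> z) = z"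
    "(U, y) \<in> atriv A \<Longrightarrow> fst z \<in> U \<Longrightarrow> \<tau> z = snd (hcoord y z)"
proof -
  show t: "\<tau> z = snd (hcoord y z)" if "(U, y) \<in> atriv A" "fst z \<in> U" for U y
    using tau_hpt[OF that, of "hcoord y z"] hpt_hcoord[OF that(1) z(1) that(2)] by simp
  obtain U y where U: "(U, y) \<in> atriv A" "fst z \<in> U" using z(1) by (rule H_trivE)
  show "\<tau> z \<noteq> 0" using nonzero_rank_zero[OF z(1) U] z(2) t[OF U] by simp
  have "hcoord y z = (0, \<tau> z)" using t[OF U] rank_zero by (simp add: prod_eq_iff)
  then show "cylinder_map A (fst z, \<tau> z) = z"
    using cylinder_map_hpt[OF U] hpt_hcoord[OF U(1) z(1) U(2)] by simp
qed

lemma point_set_open_submanifold: "point_set (open_submanifold \<A> W) = point_set \<A> \<inter> W"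
  unfolding point_set_def open_submanifold_def by fastforce

lemma point_set_H0: "point_set H\<^sub>0 = {z \<in> H. nonzero z}"
  by (auto simp: point_set_open_submanifold zero_section_iff)

lemma H0E:
  assumes "(D, \<kappa>) \<in> H\<^sub>0"
  obtains W \<phi> U y where "(W, \<phi>) \<in> abase A" "(U, y) \<in> atriv A" "D = {z \<in> hdom W U. nonzero z}" "\<kappa> = hchart \<phi> y"
proof -
  obtain D' where "(D', \<kappa>) \<in> vatlas (hat A)" and D: "D = D' \<inter> (H - zero_section (hat A))"
    using assms by (auto simp: open_submanifold_def)
  then obtain W \<phi> U Y where W: "(W, \<phi>) \<in> abase A" "(U, Y) \<in> vtriv (hat A)" "D' = hdom W U" "\<kappa> = H0.chart \<phi> Y"
    unfolding vatlas_eq by (elim H0.totalE)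
  moreover obtain y where "(U, y) \<in> atriv A" "Y = hcoord y" using W(2) by (auto simp: vtriv_hat)
  moreover have "D = {z \<in> hdom W U. nonzero z}"
    unfolding D W(3) by (auto simp: zero_section_iff hdom_iff)
  ultimately show thesis using that by simp
qed

lemma cyl_map_bij: "bij_betw (cylinder_map A) (point_set cyl) (point_set H\<^sub>0)"
  unfolding bij_betw_def point_set_H0 B.point_set_cylinder
proof
  have tau: "\<tau> (cylinder_map A (p, t)) = t" if pt: "p \<in> point_set (abase A)" "t \<noteq> 0" for p t
  proof -
    obtain U y where U: "(U, y) \<in> atriv A" "p \<in> U" using pt(1) by (rule AB.trivE)
    then show ?thesis using cyl_map_height(3)[OF cyl_map(1,2)[OF pt] U(1)] cyl_map(3,4)[OF pt] by simp
  qed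
  show "inj_on (cylinder_map A) (point_set (abase A) \<times> - {0})"
  proof (rule inj_on_inverseI)
    fix z assume "z \<in> point_set (abase A) \<times> - {0::real}"
    then show "(\<lambda>z. (fst z, \<tau> z)) (cylinder_map A z) = z"
      using cyl_map(3) tau by auto
  qed
  show "cylinder_map A ` (point_set (abase A) \<times> - {0}) = {z \<in> H. nonzero z}"
  proof (intro equalityI subsetI)
    fix z assume "z \<in> {z \<in> H. nonzero z}"
    then have z: "z \<in> H" "nonzero z" by auto
    show "z \<in> cylinder_map A ` (point_set (abase A) \<times> - {0})"
      using cyl_map_height[OF z] H0.proj[OF z(1)] by (intro image_eqI[of _ _ "(fst z, \<tau> z)"]) auto
  qed (use cyl_map(1,2) in auto)
qed

lemma cyl_map_inverse:
  assumes z: "z \<in> H" "nonzero z"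
  shows "inv_into (point_set cyl) (cylinder_map A) z = (fst z, \<tau> z)"
  by (rule inv_into_f_eq) (use cyl_map_bij cyl_map_height[OF z] H0.proj[OF z(1)] in
      \<open>auto simp: bij_betw_def B.point_set_cylinder\<close>)

lemma cylinder_map_smooth: "smooth_map cyl H\<^sub>0 (cylinder_map A)"
  unfolding smooth_map_def
proof (intro conjI ballI)
  show "cylinder_map A ` point_set cyl \<subseteq> point_set H\<^sub>0" using cyl_map_bij by (simp add: bij_betw_def)
  fix c assume c: "c \<in> cyl"
  obtain D \<kappa> where cd: "c = (D, \<kappa>)" by fastforce
  obtain W \<phi> where W: "(W, \<phi>) \<in> abase A" and D: "D = W \<times> (- {0})" "\<kappa> = map_prod \<phi> id"
    using c unfolding cd by (rule B.cylE)
  have "open (\<kappa> ` (D \<inter> cylinder_map A -` D')) \<and>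
      smooth_on (\<kappa>' \<circ> cylinder_map A \<circ> inv_into D \<kappa>) (\<kappa> ` (D \<inter> cylinder_map A -` D'))"
    if d: "(D', \<kappa>') \<in> H\<^sub>0" for D' \<kappa>'
  proof -
    obtain W' \<phi>' U' y' where W': "(W', \<phi>') \<in> abase A" "(U', y') \<in> atriv A"
      and D': "D' = {z \<in> hdom W' U'. nonzero z}" "\<kappa>' = hchart \<phi>' y'"
      using d by (rule H0E)
    let ?N = "W \<inter> (W' \<inter> U')"
    have dom: "D \<inter> cylinder_map A -` D' = ?N \<times> (- {0})"
      using cyl_map(1-3) point_setI[OF W] by (auto simp: D D' hdom_iff)
    have "openin (atlas_topology (abase A)) (W' \<inter> U')"
      by (rule openin_Int[OF openin_chart[OF base_atlas W'(1)] atrivD(1)[OF W'(2)]])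
    then have o: "open (\<phi> ` ?N)" by (rule openin_chart_image[OF base_atlas W])
    note o2 = B.open_cyl[OF o]
    have "smooth_on (\<phi>' \<circ> inv_into W \<phi>) (\<phi> ` ?N)"
      by (rule smooth_on_subset[OF smooth_atlasD(4)[OF base_atlas W W'(1)]]) auto
    then have "smooth_on (\<lambda>z. (\<phi>' \<circ> inv_into W \<phi>) (fst z)) (\<phi> ` ?N \<times> (- {0::real}))"
      by (rule smooth_on_subset[OF smooth_on_compose_fst[OF o]]) auto
    then have "smooth_on (\<lambda>z. ((\<phi>' \<circ> inv_into W \<phi>) (fst z), 0::'f, snd z)) (\<phi> ` ?N \<times> (- {0::real}))"
      by (intro smooth_on_Pair smooth_on_snd smooth_on_id smooth_on_const o2)
    then have "smooth_on (\<kappa>' \<circ> cylinder_map A \<circ> inv_into D \<kappa>) (\<phi> ` ?N \<times> (- {0::real}))"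
    proof (rule B.smooth_on_cyl_cong[OF _ o])
      fix p and t :: real assume p: "p \<in> ?N" and t: "t \<noteq> 0"
      then have pM: "p \<in> point_set (abase A)" using point_setI[OF W] by blast
      show "((\<phi>' \<circ> inv_into W \<phi>) (fst (\<phi> p, t)), 0, snd (\<phi> p, t)) = (\<kappa>' \<circ> cylinder_map A \<circ> inv_into D \<kappa>) (\<phi> p, t)"
        using p t cyl_map(3)[OF pM t] cyl_map(4)[OF pM t W'(2)] smooth_atlasD(1)[OF base_atlas W]
        by (simp add: D D' B.cyl_inverse[OF W] H0.chart_def)
    qed
    then show ?thesis unfolding dom D(2) B.cyl_image using o2 D(2) by simp
  qed
  then show "case c of (U, \<phi>) \<Rightarrow> \<forall>(V, \<psi>)\<in>H\<^sub>0. open (\<phi> ` (U \<inter> cylinder_map A -` V)) \<and>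
      smooth_on (\<psi> \<circ> cylinder_map A \<circ> inv_into U \<phi>) (\<phi> ` (U \<inter> cylinder_map A -` V))"
    by (auto simp: cd)
qed

lemma cylinder_map_inverse_smooth:
  "smooth_map H\<^sub>0 cyl (inv_into (point_set cyl) (cylinder_map A))" (is "smooth_map _ _ ?I")
  unfolding smooth_map_def
proof (intro conjI ballI)
  show "?I ` point_set H\<^sub>0 \<subseteq> point_set cyl"
    using bij_betw_inv_into[OF cyl_map_bij] by (simp add: bij_betw_def)
  fix c assume c: "c \<in> H\<^sub>0"
  obtain D \<kappa> where cd: "c = (D, \<kappa>)" by fastforce
  obtain W \<phi> U y where W: "(W, \<phi>) \<in> abase A" and U: "(U, y) \<in> atriv A"
    and D: "D = {z \<in> hdom W U. nonzero z}" "\<kappa> = hchart \<phi> y"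
    using c unfolding cd by (rule H0E)
  have inj: "inj_on \<kappa> D"
    using smooth_atlasD(1)[OF vatlas_smooth hchart_in_atlas[OF W U]]
    unfolding D by (rule inj_on_subset) auto
  have "open (\<kappa> ` (D \<inter> ?I -` D')) \<and>
      smooth_on (\<kappa>' \<circ> ?I \<circ> inv_into D \<kappa>) (\<kappa> ` (D \<inter> ?I -` D'))"
    if d: "(D', \<kappa>') \<in> cyl" for D' \<kappa>'
  proof -
    obtain W' \<phi>' where W': "(W', \<phi>') \<in> abase A" and D': "D' = W' \<times> (- {0})" "\<kappa>' = map_prod \<phi>' id"
      using d by (rule B.cylE)
    let ?N = "W \<inter> (W' \<inter> U)"
    let ?S = "\<phi> ` ?N \<times> ((UNIV :: 'f set) \<times> (- {0::real}))"
    have dom: "D \<inter> ?I -` D' = {z \<in> H. nonzero z \<and> fst z \<in> ?N}"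
      using cyl_map_inverse cyl_map_height(1) by (auto simp: D D' hdom_iff)
    have image: "\<kappa> ` (D \<inter> ?I -` D') = ?S"
    proof (intro equalityI subsetI)
      fix w assume "w \<in> \<kappa> ` (D \<inter> ?I -` D')"
      then show "w \<in> ?S"
        using nonzero_rank_zero[OF _ U] unfolding dom
        by (auto simp: D H0.chart_def mem_Times_iff)
    next
      fix w assume "w \<in> ?S"
      then obtain p \<zeta> t where w: "w = (\<phi> p, \<zeta>, t)" "p \<in> ?N" "t \<noteq> 0" by auto
      then have p: "p \<in> U" by simp
      show "w \<in> \<kappa> ` (D \<inter> ?I -` D')"
        unfolding dom D(2)
        using w nonzero_rank_zero[OF hpt_total[OF U p] U] fst_hpt[OF U p] hcoord_hpt[OF U p] hpt_total[OF U p] p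
        by (intro image_eqI[of _ _ "hpt y p (\<zeta>, t)"]) (simp_all add: H0.chart_def)
    qed
    have "openin (atlas_topology (abase A)) (W' \<inter> U)"
      by (rule openin_Int[OF openin_chart[OF base_atlas W'] atrivD(1)[OF U]])
    then have o: "open (\<phi> ` ?N)" by (rule openin_chart_image[OF base_atlas W])
    have o2: "open ?S" by (intro open_Times o) auto
    have "smooth_on (\<phi>' \<circ> inv_into W \<phi>) (\<phi> ` ?N)"
      by (rule smooth_on_subset[OF smooth_atlasD(4)[OF base_atlas W W']]) auto
    then have "smooth_on (\<lambda>z. (\<phi>' \<circ> inv_into W \<phi>) (fst z)) ?S"
      by (rule smooth_on_subset[OF smooth_on_compose_fst[OF o]]) auto
    then have "smooth_on (\<lambda>z. ((\<phi>' \<circ> inv_into W \<phi>) (fst z), snd (snd z))) ?S"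
      by (intro smooth_on_Pair smooth_on_snd smooth_on_id o2)
    then have "smooth_on (\<kappa>' \<circ> ?I \<circ> inv_into D \<kappa>) ?S"
    proof (rule smooth_on_cong[OF _ o2])
      fix w assume "w \<in> ?S"
      then obtain z where z: "z \<in> H" "nonzero z" "fst z \<in> ?N" "w = \<kappa> z" "z \<in> D"
        unfolding image[symmetric] using dom by blast
      have "inv_into D \<kappa> w = z" unfolding z(4) by (rule inv_into_f_f[OF inj z(5)])
      then show "((\<phi>' \<circ> inv_into W \<phi>) (fst w), snd (snd w)) = (\<kappa>' \<circ> ?I \<circ> inv_into D \<kappa>) w"
        using z cyl_map_inverse[OF z(1,2)] cyl_map_height(3)[OF z(1,2) U] smooth_atlasD(1)[OF base_atlas W]
        by (simp add: D D' H0.chart_def)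
    qed
    then show ?thesis unfolding image using o2 by simp
  qed
  then show "case c of (U, \<phi>) \<Rightarrow> \<forall>(V, \<psi>)\<in>cyl. open (\<phi> ` (U \<inter> ?I -` V)) \<and>
      smooth_on (\<psi> \<circ> ?I \<circ> inv_into U \<phi>) (\<phi> ` (U \<inter> ?I -` V))"
    by (auto simp: cd)
qed

lemma cylinder_map_diffeomorphism: "diffeomorphism cyl H\<^sub>0 (cylinder_map A)"
  unfolding diffeomorphism_def
  using cyl_map_bij cylinder_map_smooth cylinder_map_inverse_smooth by blast

end

section \<open>The correspondences\<close>

text \<open>\<open>dim\<close> is a cardinality and would be 0 for an infinite basis as well; the
  finite spanning set rules this out.\<close>

lemma dim_UNIV_eq_0: "dim (UNIV :: 'f::fin_dim_inner set) = 0 \<longleftrightarrow> (\<forall>u::'f. u = 0)"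
proof
  assume 0: "dim (UNIV :: 'f set) = 0"
  obtain C :: "'f set" where C: "finite C" "span C = UNIV"
    using finite_spanning_set fin_dim_inner_iff_span by metis
  obtain B :: "'f set" where B: "independent B" "UNIV \<subseteq> span B" "card B = dim (UNIV :: 'f set)"
    using basis_exists[of "UNIV :: 'f set"] by metis
  have "finite B" using independent_span_bound[OF C(1) B(1)] C(2) by auto
  then have "B = {}" using B(3) 0 by simp
  then show "\<forall>u::'f. u = 0" using B(2) by auto
next
  assume "\<forall>u::'f. u = 0"
  then have "(UNIV :: 'f set) = {0}" by auto
  then show "dim (UNIV :: 'f set) = 0" using dim_eq_card[of "{}" "{0 :: 'f}"] independent_empty by simp
qed

text \<open>\<open>hull_bivector\<close> shows that the map is defined, restriction to
  \<open>A\<close> that it is onto. \<open>linked_unique_P\<close> makes it single-valued and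
  \<open>linked_unique_jacobi\<close> injective.\<close>

lemma (in affine_bundle_ctx) positive_rank_correspondence:
  assumes rank_pos: "\<exists>u::'f. u \<noteq> 0"
  shows "\<exists>\<Phi>. bij_betw \<Phi> {(\<Lambda>, E). affine_jacobi A \<Lambda> E} {P. homogeneous_poisson (hat A) P} \<and>
         (\<forall>\<Lambda> E. affine_jacobi A \<Lambda> E \<longrightarrow>
           (\<forall>P. homogeneous_poisson (hat A) P \<longrightarrow> (P = \<Phi> (\<Lambda>, E) \<longleftrightarrow> linked \<Lambda> E P)) \<and>
           (let P = \<Phi> (\<Lambda>, E);
                E' = hamiltonian P (iota (one_section A));
                \<Lambda>' = (\<lambda>z f g. P z f g - wedge (liouville (hat A)) E' z f g)
            in jacobi_structure (vatlas (hat A)) \<Lambda>' E' \<and>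
               jacobi_restriction (aatlas A) (vatlas (hat A)) (evaluation A) \<Lambda> E \<Lambda>' E'))"
proof -
  define \<Phi> where "\<Phi> = (\<lambda>(\<Lambda>, E). THE P. homogeneous_poisson (hat A) P \<and> linked \<Lambda> E P)"
  have ex: "\<exists>P. homogeneous_poisson (hat A) P \<and> linked \<Lambda> E P" if "affine_jacobi A \<Lambda> E" for \<Lambda> E
  proof -
    interpret affine_jacobi_ctx A \<Lambda> E by unfold_locales (use that rank_pos in auto)
    show ?thesis using hull_homogeneous hull_linked by blast
  qed
  have \<Phi>: "homogeneous_poisson (hat A) (\<Phi> (\<Lambda>, E))" "linked \<Lambda> E (\<Phi> (\<Lambda>, E))"
    if aj: "affine_jacobi A \<Lambda> E" for \<Lambda> E
  proof -
    obtain P where P: "homogeneous_poisson (hat A) P" "linked \<Lambda> E P" using ex[OF aj] by blast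
    then have "\<Phi> (\<Lambda>, E) = P"
      unfolding \<Phi>_def prod.case using linked_unique_P by (intro the_equality) blast+
    then show "homogeneous_poisson (hat A) (\<Phi> (\<Lambda>, E))" "linked \<Lambda> E (\<Phi> (\<Lambda>, E))" using P by simp_all
  qed
  have iff: "P = \<Phi> (\<Lambda>, E) \<longleftrightarrow> linked \<Lambda> E P" if "affine_jacobi A \<Lambda> E" "homogeneous_poisson (hat A) P" for \<Lambda> E P
    using \<Phi>[OF that(1)] linked_unique_P[OF that(2)] by blast
  have "bij_betw \<Phi> {(\<Lambda>, E). affine_jacobi A \<Lambda> E} {P. homogeneous_poisson (hat A) P}"
    unfolding bij_betw_def
  proof
    show "inj_on \<Phi> {(\<Lambda>, E). affine_jacobi A \<Lambda> E}"
    proof (rule inj_onI, clarify)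
      fix \<Lambda> E \<Lambda>' E' assume a: "affine_jacobi A \<Lambda> E" "affine_jacobi A \<Lambda>' E'" and eq: "\<Phi> (\<Lambda>, E) = \<Phi> (\<Lambda>', E')"
      show "\<Lambda> = \<Lambda>' \<and> E = E'"
        using linked_unique_jacobi[OF a(1) \<Phi>(2)[OF a(1)] a(2)] \<Phi>(2)[OF a(2)] eq by simp
    qed
    show "\<Phi> ` {(\<Lambda>, E). affine_jacobi A \<Lambda> E} = {P. homogeneous_poisson (hat A) P}"
    proof (intro equalityI subsetI)
      fix P assume "P \<in> {P. homogeneous_poisson (hat A) P}"
      then have P: "homogeneous_poisson (hat A) P" by simp
      note R = restrict_affine_jacobi[OF P]
      have "linked (restrict_\<Lambda> P) (restrict_E P) P"
        using P by (intro restrict_linked) (simp add: homogeneous_poisson_def poisson_structure_def)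
      then have "P = \<Phi> (restrict_\<Lambda> P, restrict_E P)" using iff[OF R P] by simp
      then show "P \<in> \<Phi> ` {(\<Lambda>, E). affine_jacobi A \<Lambda> E}"
        by (rule image_eqI) (use R in simp)
    qed (use \<Phi>(1) in auto)
  qed
  moreover have "jacobi_structure (vatlas (hat A)) \<Lambda>' E' \<and>
      jacobi_restriction (aatlas A) (vatlas (hat A)) (evaluation A) \<Lambda> E \<Lambda>' E'"
    if aj: "affine_jacobi A \<Lambda> E" and E': "E' = hamiltonian (\<Phi> (\<Lambda>, E)) (iota (one_section A))"
      and \<Lambda>': "\<Lambda>' = (\<lambda>z f g. \<Phi> (\<Lambda>, E) z f g - wedge (liouville (hat A)) E' z f g)" for \<Lambda> E \<Lambda>' E'
    using hull_jacobi_structure[OF \<Phi>(1)[OF aj] _ \<Phi>(2)[OF aj] _ \<Lambda>'] aj E'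
    by (simp add: affine_jacobi_def bar_def one_section_def)
  ultimately show ?thesis
    unfolding Let_def using iff by (intro exI[of _ \<Phi>] conjI allI impI) blast+
qed

theorem corollary3p9:
  fixes A :: "('m, 'e::fin_dim_inner, 'a, 'v, 'f::fin_dim_inner) abundle"
    and n :: nat
  assumes "affine_bundle A" and "bundle_rank A = n"
  shows
    "(n > 0 \<longrightarrow>
       (\<exists>\<Phi>. bij_betw \<Phi> {(\<Lambda>, E). affine_jacobi A \<Lambda> E} {P. homogeneous_poisson (hat A) P} \<and>
         (\<forall>\<Lambda> E. affine_jacobi A \<Lambda> E \<longrightarrow>
           (\<forall>P. homogeneous_poisson (hat A) P \<longrightarrow>
             (P = \<Phi> (\<Lambda>, E) \<longleftrightarrow>
               (\<forall>a\<in>affine_functions A. \<forall>b\<in>affine_functions A. \<forall>x\<in>atotal A.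
                 jacobi_bracket \<Lambda> E a b x
                   = poisson_bracket P (bar A a) (bar A b) (evaluation A x)))) \<and>
           (let P = \<Phi> (\<Lambda>, E);
                E' = hamiltonian P (iota (one_section A));
                \<Lambda>' = (\<lambda>z f g. P z f g - wedge (liouville (hat A)) E' z f g)
            in jacobi_structure (vatlas (hat A)) \<Lambda>' E' \<and>
               jacobi_restriction (aatlas A) (vatlas (hat A)) (evaluation A) \<Lambda> E \<Lambda>' E'))))
     \<and>
     (n = 0 \<longrightarrow>
       diffeomorphism (cylinder (abase A))
         (open_submanifold (vatlas (hat A)) (vtotal (hat A) - zero_section (hat A)))
         (cylinder_map A) \<and>
       (\<exists>\<Phi>. bij_betw \<Phi> {(\<Lambda>, E). affine_jacobi A \<Lambda> E} {P. linear_poisson (abase A) P} \<and>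
         (\<forall>\<Lambda>\<^sub>A E\<^sub>A. affine_jacobi A \<Lambda>\<^sub>A E\<^sub>A \<longrightarrow>
           (let \<Lambda> = push_bifield (atotal A) (aproj A) \<Lambda>\<^sub>A;
                E = push_vfield (atotal A) (aproj A) E\<^sub>A
            in jacobi_structure (abase A) \<Lambda> E \<and>
               (\<forall>P. linear_poisson (abase A) P \<longrightarrow>
                 (P = \<Phi> (\<Lambda>\<^sub>A, E\<^sub>A) \<longleftrightarrow>
                   (\<forall>f\<in>Cinf (abase A). \<forall>g\<in>Cinf (abase A). \<forall>x\<in>point_set (abase A). \<forall>t. t \<noteq> 0 \<longrightarrow>
                     P (x, t) (t_times f) (t_times g) = t * jacobi_bracket \<Lambda> E f g x))) \<and>
               \<Phi> (\<Lambda>\<^sub>A, E\<^sub>A) = poissonization (abase A) \<Lambda> E))))"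
proof -
  interpret affine_bundle_ctx A by unfold_locales (rule assms(1))
  have rank: "n = 0 \<longleftrightarrow> (\<forall>u::'f. u = 0)"
    using assms(2) dim_UNIV_eq_0[where 'f = 'f] by (simp add: bundle_rank_def)
  have "\<exists>u::'f. u \<noteq> 0" if "n > 0" using that rank by blast
  note positive = positive_rank_correspondence[unfolded linked_def, OF this]
  show ?thesis (is "(_ \<longrightarrow> ?positive) \<and> (_ \<longrightarrow> ?zero)")
  proof
    show "n > 0 \<longrightarrow> ?positive" using positive by (rule impI)
    show "n = 0 \<longrightarrow> ?zero"
    proof
      assume "n = 0"
      then interpret rank_zero_ctx A by unfold_locales (use rank in blast)
      show ?zero using cylinder_map_diffeomorphism rank_zero_correspondence by (rule conjI)
    qed
  qed
qed

end
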